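(* Suppose that: (a) $E\|F(x,\xi)\|^2<\infty$ for all $x\in O$; (b) for a.e. $\omega\in\Omega$ the map $x\mapsto F(x,\xi(\omega))$ is continuously differentiable on $O$, and $E\|d_xF(x,\xi)\|^2<\infty$ for all $x\in O$; (c) there is a square integrable random variable $C$ such that $\|F(x,\xi(\omega))-F(x',\xi(\omega))\|+\|d_xF(x,\xi(\omega))-d_xF(x',\xi(\omega))\|\le C(\omega)\|x-x'\|$ for all $x,x'\in O$ and a.e. $\omega\in\Omega$. Suppose further that $x_0\in S\cap O$ solves $0\in f_0(x_0)+N_S(x_0)$ and that, with $z_0=x_0-f_0(x_0)$, $L=df_0(x_0)$, $K=T_S(x_0)\cap\{z_0-x_0\}^\perp$, the map $L_K:\mathbb{R}^q\to\mathbb{R}^q$, $L_K(h)=L(\Pi_K(h))+h-\Pi_K(h)$, is a homeomorphism from $\mathbb{R}^q$ to $\mathbb{R}^q$. Let $z_n$ be the solutions of the sample average normal map equations $(f_n)_S(z)=0$ near $z_0$ and $x_n=\Pi_S(z_n)$ (as fixed in the context). Let $\Sigma_0$ be the covariance matrix of $F(x_0,\xi)$, let $\Sigma_n$ be the sample covariance matrix of $\{F(x_n,\xi^i)\}_{i=1}^n$, and let $Y_0$ be a normal random vector with mean zero and covariance matrix $\Sigma_0$. Suppose that $\Sigma_0$ has a positive determinant. Let $P_1,\dots,P_k$ be the $q$-cells in the normal manifold of $S$ that contain $z_0$. For $i=1,\dots,k$ let $K_i=\mathrm{cone}(P_i-z_0)$, let $A_i$ be the matrix representing the linear map $d\Pi_S(z)$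 for $z$ in the interior of $P_i$, and let $M_i=LA_i+I-A_i$ (these matrices are nonsingular). Let $\Gamma=(L_K)^{-1}(Y_0)$, $\Gamma^i=M_i^{-1}Y_0$, and $r^i_j=\sqrt{(M_i^{-1}\Sigma_0M_i^{-T})_{jj}}$ for $i=1,\dots,k$, $j=1,\dots,q$. For each integer $n$ and $j=1,\dots,q$ define $r_{nj}=\sqrt{(d(f_n)_S(z_n)^{-1}\,\Sigma_n\,d(f_n)_S(z_n)^{-T})_{jj}}$ if $d(f_n)_S(z_n)$ is an invertible linear map, and $r_{nj}=0$ otherwise. Then for each $\alpha\in(0,1)$ and each $j=1,\dots,q$, $$\lim_{n\to\infty}\mathrm{Prob}\left(\frac{\sqrt n\,|(z_n-z_0)_j|}{r_{nj}}\le\sqrt{\chi^2_1(\alpha)}\right)=\sum_{i=1}^k\mathrm{Prob}\left(\Big|\frac{\Gamma^i_j}{r^i_j}\Big|\le\sqrt{\chi^2_1(\alpha)}\text{ and }\Gamma^i\in K_i\right)=\sum_{i=1}^k\mathrm{Prob}\left(\Big|\frac{\Gamma_j}{r^i_j}\Big|\le\sqrt{\chi^2_1(\alpha)}\text{ and }\Gamma\in K_i\right).$$ Moreover, for each $j\in\{1,\dots,q\}$ and $\alpha\in(0,1)$ such that $$\mathrm{Prob}\left(\Big|\frac{\Gamma^i_j}{r^i_j}\Big|\le\sqrt{\chi^2_1(\alpha)}\text{ and }\Gamma^i\in K_i\right)=\mathrm{Prob}\left(\Big|\frac{\Gamma^i_j}{r^i_j}\Big|\le\sqrt{\chi^2_1(\alpha)}\right)\mathrm{Prob}(\Gamma^i\in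 K_i)$$ holds for each $i=1,\dots,k$, one has $$\lim_{n\to\infty}\mathrm{Prob}\left\{|(z_n-z_0)_j|\le\frac{\sqrt{\chi^2_1(\alpha)}\,r_{nj}}{\sqrt n}\right\}=1-\alpha.$$
   Context: Setting. $(\Omega,\mathcal{F},P)$ is a probability space; $\xi$ is a random vector on $\Omega$ supported on a closed set $\Xi\subset\mathbb{R}^d$; $O\subset\mathbb{R}^q$ is open; $F:O\times\Xi\to\mathbb{R}^q$ is measurable and $f_0(x)=E[F(x,\xi)]$ is well defined for each $x\in O$; $d_xF$ is the partial derivative in $x$ (a $q\times q$ matrix). $S\subset\mathbb{R}^q$ is a polyhedral convex set. $\xi^1,\xi^2,\dots$ are i.i.d. with the distribution of $\xi$, and $f_n(x)=f_n(x,\omega)=n^{-1}\sum_{i=1}^nF(x,\xi^i(\omega))$. Under (a)-(c), $f_0$ is continuously differentiable on $O$. Convex notions. $N_S(x)=\{v:\langle v,s-x\rangle\le0\ \forall s\in S\}$; $T_S(x)=\{v:\exists t>0,\ x+tv\in S\}$ for $x\in S$; $\Pi_C$ is the Euclidean projection onto a closed convex set $C$; $\mathrm{cone}\,C$ is the smallest cone containing $C$ (a cone being a set closed under multiplication by positive reals). The normal manifold of $S$ is the finite family of $q$-dimensional polyhedral convex sets ($q$-cells) $G+N_G$, where $G$ runs over the nonempty faces of $S$ and $N_G$ is the common normal cone $N_S(x)$ at points $x$ of the relative interior of $G$. The $q$-cells cover $\mathbb{R}^q$, any two distinct ones are disjoint or meet in a common proper face, and $\Pi_S$ coincides with an affine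 function on each. B-derivative. A locally Lipschitz function $g$ is B-differentiable at $x$ if there is a positively homogeneous function $G=dg(x)$ with $g(x+v)=g(x)+G(v)+o(v)$; then $dg(x)(h)$ is the directional derivative of $g$ at $x$ along $h$. $\Pi_S$ is piecewise affine and hence B-differentiable everywhere. Normal maps. For a function $g$ on $O$ with values in $\mathbb{R}^q$, $g_S(z)=g(\Pi_S(z))+z-\Pi_S(z)$ for $z\in\Pi_S^{-1}(O)$. For $g$ differentiable at $\Pi_S(z)$, $dg_S(z)(h)=dg(\Pi_S(z))(d\Pi_S(z)(h))+h-d\Pi_S(z)(h)$. One has $\Pi_S(z_0)=x_0$, $(f_0)_S(z_0)=0$ and $d(f_0)_S(z_0)=L_K$; on $K_i$ this map is represented by the matrix $M_i$. SAA solutions. It is a known result that, under the hypotheses (a)-(c) and the hypotheses on $x_0$ and $L_K$ in the claim, there are neighborhoods $X_0$ of $x_0$ in $O$ and $Z$ of $z_0$ such that for a.e. $\omega$ there is an integer $N_\omega$ such that for each $n\ge N_\omega$ the equation $(f_n)_S(z)=0$ has a unique solution $z_n$ in $Z$, and $x_n=\Pi_S(z_n)$ is the unique solution in $X_0$ of $0\in f_n(x)+N_S(x)$; moreover $z_n\to z_0$ and $x_n\to x_0$ almost surely, $\sqrt n(z_n-z_0)\Rightarrow (L_K)^{-1}(Y_0)$ and $\sqrt n L_K(z_n-z_0)\Rightarrow Y_0$ (weak convergence). Such neighborhoods are fixed; $z_n$ denotes this solution (for $n<N_\omega$, any measurable choice in $\Pi_S^{-1}(O)$), and $x_n=\Pi_S(z_n)$.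 $\chi^2_1(\alpha)$ is the number with $P(\chi^2_1>\chi^2_1(\alpha))=\alpha$, where $\chi^2_1$ is a $\chi^2$ random variable with one degree of freedom. A subscript $j$ on a vector denotes its $j$th component. *)

theory Defs
  imports "HOL-Probability.Probability"
begin

text \<open>The condition \<open>x \<in> S\<close> is not part of the definition and is stated separately where it is needed.\<close>
definition normal_cone :: "'a::real_inner set \<Rightarrow> 'a \<Rightarrow> 'a set" where
  "normal_cone S x = {v. \<forall>s\<in>S. v \<bullet> (s - x) \<le> 0}"

text \<open>For polyhedral \<open>S\<close> and \<open>x \<in> S\<close> the cone of feasible directions is already closed.\<close>
definition tangent_cone :: "'a::real_vector set \<Rightarrow> 'a \<Rightarrow> 'a set" where
  "tangent_cone S x = {v. \<exists>t>0. x + t *\<^sub>R v \<in> S}"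

definition solves_VI :: "('a::real_inner \<Rightarrow> 'a) \<Rightarrow> 'a set \<Rightarrow> 'a \<Rightarrow> bool" where
  "solves_VI g S x \<longleftrightarrow> x \<in> S \<and> 0 \<in> (\<lambda>v. g x + v) ` normal_cone S x"

definition normal_map :: "('a::euclidean_space \<Rightarrow> 'a) \<Rightarrow> 'a set \<Rightarrow> 'a \<Rightarrow> 'a" where
  "normal_map g S z = g (closest_point S z) + z - closest_point S z"

text \<open>The cells \<open>G + N\<^sub>G\<close>, where \<open>N\<^sub>G\<close> is the normal cone at any relative interior point
  of the nonempty face \<open>G\<close>.\<close>
definition normal_manifold :: "'a::euclidean_space set \<Rightarrow> 'a set set" where
  "normal_manifold S =
     {P. \<exists>G x. G face_of S \<and> G \<noteq> {} \<and> x \<in> rel_interior G \<and>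
               P = {g + v | g v. g \<in> G \<and> v \<in> normal_cone S x}}"

definition has_B_derivative ::
  "('a::euclidean_space \<Rightarrow> 'b::euclidean_space) \<Rightarrow> ('a \<Rightarrow> 'b) \<Rightarrow> 'a \<Rightarrow> bool" where
  "has_B_derivative g G x \<longleftrightarrow>
     (\<exists>U C. open U \<and> x \<in> U \<and> C-lipschitz_on U g) \<and>
     (\<forall>t>0. \<forall>v. G (t *\<^sub>R v) = t *\<^sub>R G v) \<and>
     ((\<lambda>v. (g (x + v) - g x - G v) /\<^sub>R norm v) \<longlongrightarrow> 0) (at 0)"

definition B_deriv ::
  "('a::euclidean_space \<Rightarrow> 'b::euclidean_space) \<Rightarrow> 'a \<Rightarrow> 'a \<Rightarrow> 'b" where
  "B_deriv g x = (THE G. has_B_derivative g G x)"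

definition C1_on :: "(real^'n) set \<Rightarrow> (real^'n \<Rightarrow> real^'m) \<Rightarrow> bool" where
  "C1_on U g \<longleftrightarrow> (\<forall>x\<in>U. g differentiable (at x)) \<and> continuous_on U (\<lambda>x. jacobian g (at x))"

definition covariance_matrix :: "'w measure \<Rightarrow> ('w \<Rightarrow> real^'n) \<Rightarrow> real^'n^'n" where
  "covariance_matrix M X =
     (let \<mu> = (\<integral>w. X w \<partial>M) in \<chi> i j. \<integral>w. (X w $ i - \<mu> $ i) * (X w $ j - \<mu> $ j) \<partial>M)"

text \<open>Unbiased normalisation; the sample is indexed by \<open>1, \<dots>, n\<close>.\<close>
definition sample_covariance :: "nat \<Rightarrow> (nat \<Rightarrow> real^'n) \<Rightarrow> real^'n^'n" where
  "sample_covariance n X =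
     (let \<mu> = (\<Sum>l=1..n. X l) /\<^sub>R real n
      in \<chi> i j. (\<Sum>l=1..n. (X l $ i - \<mu> $ i) * (X l $ j - \<mu> $ j)) / (real n - 1))"

text \<open>A random vector is normal if every linear functional of it is (possibly degenerate) normal.\<close>
definition normal_random_vector ::
  "'w measure \<Rightarrow> ('w \<Rightarrow> real^'n) \<Rightarrow> real^'n \<Rightarrow> real^'n^'n \<Rightarrow> bool" where
  "normal_random_vector M Y \<mu> V \<longleftrightarrow>
     Y \<in> borel_measurable M \<and>
     (\<forall>a. distr M borel (\<lambda>w. a \<bullet> Y w) =
        (let \<sigma>2 = a \<bullet> (V *v a) in
         if \<sigma>2 = 0 then return borel (a \<bullet> \<mu>)
         else density lborel (normal_density (a \<bullet> \<mu>) (sqrt \<sigma>2))))"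

definition chi_square_1 :: "real measure" where
  "chi_square_1 = distr (density lborel std_normal_density) borel (\<lambda>x. x\<^sup>2)"

text \<open>The upper quantile; it is unique for \<open>\<alpha>\<close> strictly between 0 and 1.\<close>
definition chi_square_1_quantile :: "real \<Rightarrow> real" where
  "chi_square_1_quantile \<alpha> = (THE c. measure chi_square_1 {c<..} = \<alpha>)"

definition sd_coord :: "real^'n^'n \<Rightarrow> real^'n^'n \<Rightarrow> 'n \<Rightarrow> real" where
  "sd_coord B V j = sqrt ((matrix_inv B ** V ** transpose (matrix_inv B)) $ j $ j)"

text \<open>The same quantity for a map \<open>D\<close> that need not be linear or invertible.\<close>
definition sd_coord_map :: "(real^'n \<Rightarrow> real^'n) \<Rightarrow> real^'n^'n \<Rightarrow> 'n \<Rightarrow> real" where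
  "sd_coord_map D V j = (if linear D \<and> bij D then sd_coord (matrix D) V j else 0)"

definition saa :: "('x \<Rightarrow> 'y \<Rightarrow> real^'n) \<Rightarrow> (nat \<Rightarrow> 'w \<Rightarrow> 'y) \<Rightarrow> nat \<Rightarrow> 'w \<Rightarrow> 'x \<Rightarrow> real^'n" where
  "saa F \<xi>s n w x = (\<Sum>i=1..n. F x (\<xi>s i w)) /\<^sub>R real n"

text \<open>Probability of an event that is only determined up to a null set (such as one that involves
  an almost surely existing derivative), hence the completion; on \<open>sets M\<close> it agrees with \<open>M\<close>.\<close>
definition Prob :: "'w measure \<Rightarrow> ('w \<Rightarrow> bool) \<Rightarrow> real" where
  "Prob M E = measure (completion M) {w \<in> space M. E w}"

end

theory Submission
  imports Defs
begin

text \<open>Brouwer's theorem, applied to the fixed point form of the normal map equation on a ball of radius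
  \<open>O(1/\<surd>n)\<close>, shows that the solution \<open>z\<^sub>n\<close> satisfies \<open>\<surd>n L\<^sub>K(z\<^sub>n - z\<^sub>0) = V\<^sub>n + o(1)\<close>, where \<open>V\<^sub>n\<close> is the normalised
  sum to which the central limit theorem applies. If the limit of \<open>\<surd>n (z\<^sub>n - z\<^sub>0)\<close> is interior to a cone
  \<open>K\<^sub>i\<close>, then \<open>z\<^sub>n\<close> is eventually interior to the cell \<open>P\<^sub>i\<close>, the B-derivative of the sample normal map at \<open>z\<^sub>n\<close>
  is a matrix tending to \<open>M\<^sub>i\<close>, and so \<open>r\<^sub>n\<^sub>j\<close> tends to \<open>r\<^sup>i\<^sub>j\<close>. The remaining limits lie in finitely many
  hyperplanes (the boundaries of the cones, on each of which \<open>L\<^sub>K\<close> is linear and invertible), which are null for a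
  nondegenerate normal vector.

  The exceptional null sets in (b) and (c) concern \<open>\<xi>\<close> only. They carry over to the sample points \<open>\<xi>\<^sup>l\<close>
  because the irregular values of \<open>\<xi>\<close> form the projection of a Borel set, which is universally measurable.\<close>

section \<open>Projections of Borel sets\<close>

text \<open>The probabilistic input is weak: means of finitely many functions of the sample converge
  in probability, the normalised sum converges in law. So the analysis is kept deterministic. If
  along a sequence of samples these means converge and the normalised sums tend to v, where the
  inverse of \<open>LK\<close> maps v into the interior of a cone, then the scaled error and r_nj
  are forced to converge. Compactness makes this uniform: as long as the normalised sum stays in a
  compact set off a closed null set, the event about z_n and r_nj coincides, for large good samples,
  with an event about the normalised sum alone, to which the portmanteau theorem applies.

  The obstacle is the kinks of the projection. At a boundary point of a cell the B-derivative of the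
  sample normal map need not be linear, and r_nj may then be its default value 0; such limits are
  excluded, not estimated.

  Brouwer's theorem asks of the inverse of \<open>LK\<close> only continuity and linear growth.
  Uniqueness in the fixed neighbourhood identifies the zero that it yields with z_n, so consistency
  of z_n comes out as a by-product.\<close>

text \<open>Analytic sets, encoded as projections along the Baire space
  \<open>nat \<Rightarrow> nat\<close> with the product topology; its coordinates can carry discrete
  labels and bounds.\<close>

definition souslin :: "'a::topological_space set \<Rightarrow> bool" where
  "souslin A \<longleftrightarrow> (\<exists>C :: ('a \<times> (nat \<Rightarrow> nat)) set. closed C \<and> A = fst ` C)"

lemma souslin_closed: "closed A \<Longrightarrow> souslin A"
  unfolding souslin_def by (intro exI[of _ "A \<times> UNIV"]) (auto intro: closed_Times)

text \<open>The first coordinate of the parameter names a set and the shifted sequence is its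
  parameter. Since the naturals are discrete, "first coordinate m implies shift in
  \<open>C m\<close>" is a closed condition.\<close>

lemma souslin_UN:
  fixes A :: "nat \<Rightarrow> 'a::topological_space set"
  assumes "\<And>n. souslin (A n)"
  shows "souslin (\<Union>n. A n)"
proof -
  obtain C :: "nat \<Rightarrow> ('a \<times> (nat \<Rightarrow> nat)) set" where C: "\<And>n. closed (C n)" "\<And>n. A n = fst ` C n"
    using assms unfolding souslin_def by metis
  define D where "D = (\<Inter>m. (\<lambda>p::'a \<times> (nat \<Rightarrow> nat). snd p 0) -` (- {m}) \<union> (\<lambda>p. (fst p, \<lambda>k. snd p (Suc k))) -` C m)"
  have coord: "continuous_on UNIV (\<lambda>p::'a \<times> (nat \<Rightarrow> nat). snd p k)" for k
    by (rule continuous_on_product_then_coordinatewise[OF continuous_on_snd[OF continuous_on_id]])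
  have "closed D"
    unfolding D_def
    by (intro closed_INT ballI closed_Un closed_vimage C continuous_intros coord
        continuous_on_coordinatewise_then_product) (auto intro: Topological_Spaces.open_discrete simp: closed_def)
  moreover have "(\<Union>n. A n) = fst ` D"
  proof (intro equalityI subsetI)
    fix x assume "x \<in> (\<Union>n. A n)"
    then obtain n \<sigma> where n: "(x, \<sigma>) \<in> C n" using C by force
    have "(x, case_nat n \<sigma>) \<in> D" using n by (auto simp: D_def)
    then show "x \<in> fst ` D" by force
  next
    fix x assume "x \<in> fst ` D"
    then obtain \<sigma> where \<sigma>: "(x, \<sigma>) \<in> D" by auto
    then have "(x, \<lambda>k. \<sigma> (Suc k)) \<in> C (\<sigma> 0)" by (auto simp: D_def)
    then show "x \<in> (\<Union>n. A n)" using C by force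
  qed
  ultimately show ?thesis unfolding souslin_def by blast
qed

text \<open>The pairing \<open>prod_encode\<close> packs countably many parameters into one
  sequence.\<close>

lemma souslin_INT:
  fixes A :: "nat \<Rightarrow> 'a::topological_space set"
  assumes "\<And>n. souslin (A n)"
  shows "souslin (\<Inter>n. A n)"
proof -
  obtain C :: "nat \<Rightarrow> ('a \<times> (nat \<Rightarrow> nat)) set" where C: "\<And>n. closed (C n)" "\<And>n. A n = fst ` C n"
    using assms unfolding souslin_def by metis
  define D where "D = (\<Inter>m. (\<lambda>p::'a \<times> (nat \<Rightarrow> nat). (fst p, \<lambda>k. snd p (prod_encode (m, k)))) -` C m)"
  have coord: "continuous_on UNIV (\<lambda>p::'a \<times> (nat \<Rightarrow> nat). snd p k)" for k
    by (rule continuous_on_product_then_coordinatewise[OF continuous_on_snd[OF continuous_on_id]])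
  have "closed D"
    unfolding D_def
    by (intro closed_INT ballI closed_vimage C continuous_intros coord
        continuous_on_coordinatewise_then_product)
  moreover have "(\<Inter>n. A n) = fst ` D"
  proof (intro equalityI subsetI)
    fix x assume x: "x \<in> (\<Inter>n. A n)"
    then have "\<exists>\<sigma>. (x, \<sigma>) \<in> C n" for n using C by force
    then obtain \<sigma> where \<sigma>: "\<And>n. (x, \<sigma> n) \<in> C n" by metis
    have "(x, \<lambda>j. case prod_decode j of (n, k) \<Rightarrow> \<sigma> n k) \<in> D" using \<sigma> by (auto simp: D_def)
    then show "x \<in> fst ` D" by force
  next
    fix x assume "x \<in> fst ` D"
    then obtain \<sigma> where \<sigma>: "(x, \<sigma>) \<in> D" by auto
    then have "(x, \<lambda>k. \<sigma> (prod_encode (n, k))) \<in> C n" for n by (auto simp: D_def)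
    then show "x \<in> (\<Inter>n. A n)" using C by force
  qed
  ultimately show ?thesis unfolding souslin_def by blast
qed

lemma souslin_borel:
  fixes A :: "'a::metric_space set"
  assumes "A \<in> sets borel"
  shows "souslin A"
proof -
  \<comment> \<open>An open set is the union of the closed sets of points at distance at least
    1/(n+1) from its complement. The whole space is set apart because \<open>infdist\<close> to the
    empty set is 0.\<close>
  have op: "souslin U" if "open U" for U :: "'a set"
  proof (cases "U = UNIV")
    case False
    define B where "B n = {x. infdist x (- U) \<ge> inverse (real (Suc n))}" for n
    have cl: "closed (B n)" for n
      unfolding B_def by (intro closed_Collect_le continuous_intros)
    have "U = (\<Union>n. B n)"
    proof (intro equalityI subsetI)
      fix x assume "x \<in> U"
      then have "infdist x (- U) > 0"
        using that False infdist_pos_not_in_closed[of "- U" x] by (auto simp: Compl_eq_Diff_UNIV)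
      then obtain n where "inverse (real (Suc n)) < infdist x (- U)"
        using reals_Archimedean by blast
      then show "x \<in> (\<Union>n. B n)" by (auto simp: B_def intro!: exI[of _ n])
    next
      fix x assume "x \<in> (\<Union>n. B n)"
      then obtain n where "infdist x (- U) \<ge> inverse (real (Suc n))" by (auto simp: B_def)
      moreover have "inverse (real (Suc n)) > 0" by simp
      ultimately have "infdist x (- U) \<noteq> 0" by linarith
      then show "x \<in> U" by (metis ComplI infdist_zero)
    qed
    then show ?thesis using souslin_UN[of B] souslin_closed[OF cl] by simp
  qed (auto intro: souslin_closed)
  have "A \<in> sigma_sets UNIV {S::'a set. open S}"
    using assms by (simp add: borel_def)
  \<comment> \<open>Souslin sets are not closed under complement, so the induction carries the
    complement along, using countable unions for one half and countable intersections for the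
    other.\<close>
  then have "souslin A \<and> souslin (- A)"
  proof (induction rule: sigma_sets.induct)
    case (Basic a) then show ?case using op souslin_closed[of "- a"] by auto
  next
    case Empty then show ?case by (auto intro: souslin_closed)
  next
    case (Compl a) then show ?case by (simp add: Compl_eq_Diff_UNIV[symmetric])
  next
    case (Union a) then show ?case using souslin_UN[of a] souslin_INT[of "\<lambda>n. - a n"] by auto
  qed
  then show ?thesis by simp
qed

text \<open>Tychonoff's theorem for finite sets of naturals: bounding each coordinate by its own
  constant cuts a compact piece out of the Baire space.\<close>

lemma compact_Pi_atMost_nat: "compact {\<sigma>::nat \<Rightarrow> nat. \<forall>i. \<sigma> i \<le> s i}"
proof -
  have "compactin (product_topology (\<lambda>_::nat. euclidean) UNIV) (Pi\<^sub>E UNIV (\<lambda>i. {..s i}))"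
    by (subst compactin_PiE) (auto intro: finite_imp_compact)
  moreover have "Pi\<^sub>E UNIV (\<lambda>i. {..s i}) = {\<sigma>::nat \<Rightarrow> nat. \<forall>i. \<sigma> i \<le> s i}"
    by (auto simp: PiE_def Pi_def)
  ultimately show ?thesis
    by (simp add: euclidean_product_topology)
qed

text \<open>The kth approximation respects the bounds \<open>m\<close> only in its first k
  coordinates, but each coordinate can exceed its bound for finitely many k only, so all parameters
  lie in one product of finite sets. As coordinate 0 also bounds \<open>norm x\<close>, a
  subsequence of points and parameters converges, and closedness of \<open>C\<close> keeps the
  limit.\<close>

lemma sigma_bounded_limit:
  fixes C :: "(('a::euclidean_space \<times> 'b::euclidean_space) \<times> (nat \<Rightarrow> nat)) set"
  assumes C: "closed C"
    and y: "\<And>k. \<exists>x \<sigma> y'. ((x, y'), \<sigma>) \<in> C \<and> norm x \<le> real (\<sigma> 0) \<and> (\<forall>i<k. \<sigma> i \<le> m i) \<and> dist y' y < inverse (real (Suc k))"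
  shows "\<exists>x \<sigma>. ((x, y), \<sigma>) \<in> C"
proof -
  obtain X \<Sigma> Y where *: "\<And>k. ((X k, Y k), \<Sigma> k) \<in> C" "\<And>k. norm (X k) \<le> real (\<Sigma> k 0)"
    "\<And>k i. i < k \<Longrightarrow> \<Sigma> k i \<le> m i" "\<And>k. dist (Y k) y < inverse (real (Suc k))"
    using y by metis
  \<comment> \<open>For k > i the bound is \<open>m i\<close>; the finitely many k up to i are
    absorbed in the maximum.\<close>
  define s where "s i = Max (insert (m i) ((\<lambda>k. \<Sigma> k i) ` {..i}))" for i
  have s: "\<Sigma> k i \<le> s i" for k i
  proof (cases "i < k")
    case True
    then have "\<Sigma> k i \<le> m i" using * by auto
    also have "\<dots> \<le> s i" unfolding s_def by (intro Max_ge) auto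
    finally show ?thesis .
  next
    case False
    then show ?thesis unfolding s_def by (intro Max_ge) auto
  qed
  have "compact (cball (0::'a) (real (s 0)) \<times> {\<sigma>::nat \<Rightarrow> nat. \<forall>i. \<sigma> i \<le> s i})"
    by (intro compact_Times compact_cball compact_Pi_atMost_nat)
  then have "seq_compact (cball (0::'a) (real (s 0)) \<times> {\<sigma>::nat \<Rightarrow> nat. \<forall>i. \<sigma> i \<le> s i})"
    by (rule compact_imp_seq_compact)
  moreover have "\<forall>k. (X k, \<Sigma> k) \<in> cball (0::'a) (real (s 0)) \<times> {\<sigma>::nat \<Rightarrow> nat. \<forall>i. \<sigma> i \<le> s i}"
  proof
    fix k show "(X k, \<Sigma> k) \<in> cball (0::'a) (real (s 0)) \<times> {\<sigma>::nat \<Rightarrow> nat. \<forall>i. \<sigma> i \<le> s i}"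
    using s[of k] order_trans[OF *(2)[of k], of "real (s 0)"] by simp
  qed
  ultimately obtain l r where r: "strict_mono (r::nat\<Rightarrow>nat)" "((\<lambda>k. (X k, \<Sigma> k)) \<circ> r) \<longlonglongrightarrow> l"
    by (rule seq_compactE)
  have Y: "Y \<longlonglongrightarrow> y"
  proof (rule metric_tendsto_imp_tendsto[OF LIMSEQ_inverse_real_of_nat])
    show "\<forall>\<^sub>F k in sequentially. dist (Y k) y \<le> dist (inverse (real (Suc k))) 0"
      using *(4) by (auto simp: less_imp_le)
  qed
  have l1: "(\<lambda>k. X (r k)) \<longlonglongrightarrow> fst l" using tendsto_fst[OF r(2)] by (simp add: o_def)
  have l2: "(\<lambda>k. \<Sigma> (r k)) \<longlonglongrightarrow> snd l" using tendsto_snd[OF r(2)] by (simp add: o_def)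
  have l3: "(\<lambda>k. Y (r k)) \<longlonglongrightarrow> y" using LIMSEQ_subseq_LIMSEQ[OF Y r(1)] by (simp add: o_def)
  have "(\<lambda>k. ((X (r k), Y (r k)), \<Sigma> (r k))) \<longlonglongrightarrow> ((fst l, y), snd l)"
    by (intro tendsto_Pair l1 l2 l3)
  from closed_sequentially[OF C _ this] have "((fst l, y), snd l) \<in> C"
    using *(1) by simp
  then show ?thesis by blast
qed

text \<open>Capacitability of analytic sets: bounding the coordinates of the parameter one at a time keeps
  the outer measure above \<open>a\<close> and makes the projection closed in the limit.\<close>
lemma projection_inner_closed:
  fixes A :: "('a::euclidean_space \<times> 'b::euclidean_space) set"
  assumes "finite_measure \<mu>" and sets\<mu>: "sets \<mu> = sets borel"
    and A: "A \<in> sets borel" and a: "a < outer_measure_of \<mu> (snd ` A)"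
  shows "\<exists>E\<in>sets borel. E \<subseteq> snd ` A \<and> a \<le> emeasure \<mu> E"
proof -
  interpret finite_measure \<mu> by fact
  obtain C0 :: "(('a \<times> 'b) \<times> (nat \<Rightarrow> nat)) set" where C0: "closed C0" "A = fst ` C0"
    using souslin_borel[OF A] unfolding souslin_def by blast
  \<comment> \<open>A new leading coordinate bounds the norm of the variable that is projected away,
    so that bounding the parameter also confines that variable to a compact ball.\<close>
  define C where "C = {p. norm (fst (fst p)) \<le> real (snd p 0)} \<inter> (\<lambda>p. (fst p, \<lambda>k. snd p (Suc k))) -` C0"
  have coord: "continuous_on UNIV (\<lambda>p::('a \<times> 'b) \<times> (nat \<Rightarrow> nat). snd p k)" for k
    by (rule continuous_on_product_then_coordinatewise[OF continuous_on_snd[OF continuous_on_id]])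
  have rcoord: "continuous_on UNIV (\<lambda>p::('a \<times> 'b) \<times> (nat \<Rightarrow> nat). real (snd p k))" for k
    by (rule continuous_on_compose2[OF _ coord, of UNIV real]) (auto intro: continuous_on_discrete)
  have clC: "closed C"
    unfolding C_def
    by (intro closed_Int closed_vimage closed_Collect_le C0 continuous_intros coord rcoord
        continuous_on_coordinatewise_then_product)
  have projC: "snd ` A = snd ` fst ` C"
  proof (intro equalityI subsetI)
    fix y assume "y \<in> snd ` A"
    then obtain x \<sigma> where "((x, y), \<sigma>) \<in> C0" using C0 by force
    then have "((x, y), case_nat (nat \<lceil>norm x\<rceil>) \<sigma>) \<in> C" by (simp add: C_def)
    then show "y \<in> snd ` fst ` C" by force
  next
    fix y assume "y \<in> snd ` fst ` C"
    then show "y \<in> snd ` A" using C0 by (force simp: C_def)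
  qed
  define S where "S l = {y. \<exists>x \<sigma>. ((x, y), \<sigma>) \<in> C \<and> (\<forall>i<length l. \<sigma> i \<le> l ! i)}" for l
  have step: "\<exists>j. a < outer_measure_of \<mu> (S (l @ [j]))" if "a < outer_measure_of \<mu> (S l)" for l
  proof -
    have eq: "S l = (\<Union>j. S (l @ [j]))"
    proof (intro equalityI subsetI)
      fix y assume "y \<in> S l"
      then obtain x \<sigma> where "((x, y), \<sigma>) \<in> C" "\<forall>i<length l. \<sigma> i \<le> l ! i" by (auto simp: S_def)
      then have "y \<in> S (l @ [\<sigma> (length l)])"
        unfolding S_def by (auto intro!: exI[of _ x] exI[of _ \<sigma>] simp: nth_append less_Suc_eq)
      then show "y \<in> (\<Union>j. S (l @ [j]))" by blast
    next
      fix y assume "y \<in> (\<Union>j. S (l @ [j]))"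
      then obtain j x \<sigma> where "((x, y), \<sigma>) \<in> C" "\<forall>i<Suc (length l). \<sigma> i \<le> (l @ [j]) ! i" by (auto simp: S_def)
      moreover have "\<sigma> i \<le> l ! i" if "i < length l" for i
        using calculation(2)[rule_format, of i] that by (simp add: nth_append)
      ultimately show "y \<in> S l" unfolding S_def by blast
    qed
    have inc: "incseq (\<lambda>j. S (l @ [j]))"
    proof (intro incseq_SucI subsetI)
      fix j y assume "y \<in> S (l @ [j])"
      then obtain x \<sigma> where *: "((x, y), \<sigma>) \<in> C" "\<forall>i<Suc (length l). \<sigma> i \<le> (l @ [j]) ! i" by (auto simp: S_def)
      have "\<sigma> i \<le> (l @ [Suc j]) ! i" if "i < Suc (length l)" for i
        using *(2)[rule_format, OF that] that by (auto simp: nth_append split: if_splits)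
      then show "y \<in> S (l @ [Suc j])" using *(1) unfolding S_def by auto
    qed
    \<comment> \<open>Continuity from below holds for the outer measure of arbitrary sets, so the
      pieces \<open>S l\<close> may be nonmeasurable.\<close>
    have "(SUP j. outer_measure_of \<mu> (S (l @ [j]))) = outer_measure_of \<mu> (\<Union>j. S (l @ [j]))"
      by (rule SUP_outer_measure_of_incseq[OF _ inc]) (simp add: sets_eq_imp_space_eq[OF sets\<mu>])
    then have "a < (SUP j. outer_measure_of \<mu> (S (l @ [j])))"
      using that unfolding eq[symmetric] by simp
    then show ?thesis by (auto simp: less_SUP_iff)
  qed
  have "\<exists>f. \<forall>n. (length (f n) = n \<and> a < outer_measure_of \<mu> (S (f n))) \<and> (\<exists>j. f (Suc n) = f n @ [j])"
  proof (rule dependent_nat_choice)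
    have "S [] = snd ` A" unfolding projC by (force simp: S_def)
    then show "\<exists>l. length l = 0 \<and> a < outer_measure_of \<mu> (S l)" using a by auto
  next
    fix l :: "nat list" and n assume "length l = n \<and> a < outer_measure_of \<mu> (S l)"
    then show "\<exists>l'. (length l' = Suc n \<and> a < outer_measure_of \<mu> (S l')) \<and> (\<exists>j. l' = l @ [j])"
      using step[of l] by (metis length_append_singleton)
  qed
  then obtain f where f: "\<And>n. length (f n) = n" "\<And>n. a < outer_measure_of \<mu> (S (f n))" "\<And>n. \<exists>j. f (Suc n) = f n @ [j]"
    by blast
  define m where "m i = f (Suc i) ! i" for i
  have fm: "f k ! i = m i" if "i < k" for i k
    using that
  proof (induction k)
    case (Suc k)
    obtain j where j: "f (Suc k) = f k @ [j]" using f by blast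
    show ?case
    proof (cases "i = k")
      case False
      then show ?thesis using Suc j f(1)[of k] by (simp add: nth_append)
    qed (simp add: m_def)
  qed simp
  \<comment> \<open>The sets \<open>S (f k)\<close> need not be Borel, hence the closures. By
    \<open>sigma_bounded_limit\<close> a point in all these closures still has an exact
    preimage.\<close>
  define E where "E = (\<Inter>k. closure (S (f k)))"
  have dec: "decseq (\<lambda>k. closure (S (f k)))"
  proof (rule decseq_SucI)
    fix k
    have "S (f (Suc k)) \<subseteq> S (f k)"
    proof
      fix y assume "y \<in> S (f (Suc k))"
      then obtain x \<sigma> where *: "((x, y), \<sigma>) \<in> C" "\<forall>i<Suc k. \<sigma> i \<le> m i"
        unfolding S_def using fm f(1) by auto
      then show "y \<in> S (f k)"
        unfolding S_def using fm f(1)[of k] by (auto intro!: exI[of _ x] exI[of _ \<sigma>])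
    qed
    then show "closure (S (f (Suc k))) \<subseteq> closure (S (f k))" by (rule closure_mono)
  qed
  have "a \<le> emeasure \<mu> E"
  proof -
    have "emeasure \<mu> E = (INF k. emeasure \<mu> (closure (S (f k))))"
      unfolding E_def by (subst INF_emeasure_decseq) (auto simp: sets\<mu> dec)
    moreover have "a \<le> emeasure \<mu> (closure (S (f k)))" for k
    proof -
      have "a \<le> outer_measure_of \<mu> (S (f k))" using f(2)[of k] by simp
      also have "\<dots> \<le> outer_measure_of \<mu> (closure (S (f k)))"
        by (intro outer_measure_of_mono closure_subset)
      finally show ?thesis by (simp add: sets\<mu>)
    qed
    ultimately show ?thesis by (simp add: INF_greatest)
  qed
  moreover have "E \<subseteq> snd ` A"
  proof
    fix y assume "y \<in> E"
    have "\<exists>x \<sigma>. ((x, y), \<sigma>) \<in> C"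
    proof (rule sigma_bounded_limit[OF clC])
      fix k
      have "y \<in> closure (S (f k))" using \<open>y \<in> E\<close> by (auto simp: E_def)
      then obtain y' where "y' \<in> S (f k)" "dist y' y < inverse (real (Suc k))"
        unfolding closure_approachable by (metis inverse_positive_iff_positive of_nat_0_less_iff zero_less_Suc)
      moreover obtain x \<sigma> where "((x, y'), \<sigma>) \<in> C" "\<forall>i<k. \<sigma> i \<le> m i"
        using \<open>y' \<in> S (f k)\<close> fm f(1)[of k] unfolding S_def by auto
      moreover have "norm x \<le> real (\<sigma> 0)" using \<open>((x, y'), \<sigma>) \<in> C\<close> by (simp add: C_def)
      ultimately show "\<exists>x \<sigma> y'. ((x, y'), \<sigma>) \<in> C \<and> norm x \<le> real (\<sigma> 0) \<and> (\<forall>i<k. \<sigma> i \<le> m i) \<and> dist y' y < inverse (real (Suc k))"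
        by blast
    qed
    then show "y \<in> snd ` A" unfolding projC by force
  qed
  moreover have "E \<in> sets borel" unfolding E_def by auto
  ultimately show ?thesis by blast
qed

text \<open>The values y that have some x with (x, y) in \<Delta> form a projection, which may fail
  to be Borel, so equality of laws cannot be applied to it directly. Inner approximation shows that
  its outer measure under the common law is 0; a Borel null set containing it is then transported
  from \<open>\<xi>\<close> to \<open>\<xi>'\<close>.\<close>

lemma AE_all_transfer:
  fixes \<xi> \<xi>' :: "'w \<Rightarrow> 'b::euclidean_space" and \<Delta> :: "('a::euclidean_space \<times> 'b) set"
  assumes "prob_space M" and [measurable]: "\<xi> \<in> borel_measurable M" "\<xi>' \<in> borel_measurable M"
    and eq: "distr M borel \<xi>' = distr M borel \<xi>"
    and \<Delta>: "\<Delta> \<in> sets borel" and ae: "AE w in M. \<forall>x. (x, \<xi> w) \<notin> \<Delta>"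
  shows "AE w in M. \<forall>x. (x, \<xi>' w) \<notin> \<Delta>"
proof -
  interpret prob_space M by fact
  define \<mu> where "\<mu> = distr M borel \<xi>"
  have fin: "finite_measure \<mu>"
    unfolding \<mu>_def by (rule finite_measure_distr) measurable
  have "outer_measure_of \<mu> (snd ` \<Delta>) = 0"
  proof (rule ccontr)
    assume "outer_measure_of \<mu> (snd ` \<Delta>) \<noteq> 0"
    then have "0 < outer_measure_of \<mu> (snd ` \<Delta>)" by (simp add: zero_less_iff_neq_zero)
    then obtain a where "0 < a" "a < outer_measure_of \<mu> (snd ` \<Delta>)" using dense by blast
    then obtain E where E: "E \<in> sets borel" "E \<subseteq> snd ` \<Delta>" "a \<le> emeasure \<mu> E"
      using projection_inner_closed[OF fin _ \<Delta>] by (auto simp: \<mu>_def)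
    have "AE w in M. \<xi> w \<notin> E" using ae by eventually_elim (use E(2) in force)
    then have "emeasure M {w\<in>space M. \<xi> w \<in> E} = 0"
      using E(1) by (subst (asm) AE_iff_measurable[OF _ refl]) auto
    moreover have "emeasure \<mu> E = emeasure M {w\<in>space M. \<xi> w \<in> E}"
      unfolding \<mu>_def using E(1) by (subst emeasure_distr) (auto intro!: arg_cong[where f="emeasure M"])
    ultimately show False using E(3) \<open>0 < a\<close> by auto
  qed
  then obtain E where E: "E \<in> sets borel" "snd ` \<Delta> \<subseteq> E" "emeasure \<mu> E = 0"
    using outer_measure_of_attain[of "snd ` \<Delta>" \<mu>] by (auto simp: \<mu>_def)
  have "emeasure M {w\<in>space M. \<xi>' w \<in> E} = 0"
    using E(1,3) unfolding \<mu>_def eq[symmetric]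
    by (subst (asm) emeasure_distr) (auto simp: vimage_def Int_def conj_commute)
  then have "AE w in M. \<xi>' w \<notin> E"
    using E(1) by (subst AE_iff_measurable[OF _ refl]) auto
  then show ?thesis by eventually_elim (use E(2) in force)
qed

section \<open>Law of large numbers and multivariate central limit theorem\<close>

lemma (in prob_space) weak_law_bounded:
  fixes X :: "nat \<Rightarrow> 'a \<Rightarrow> real"
  assumes indep: "indep_vars (\<lambda>_. borel) X {1..}"
    and ident: "\<And>i. 1 \<le> i \<Longrightarrow> distr M borel (X i) = distr M borel Y"
    and Y[measurable]: "Y \<in> borel_measurable M" and bdd: "\<And>w. \<bar>Y w\<bar> \<le> B" and \<epsilon>: "\<epsilon> > 0"
  shows "(\<lambda>n. prob {w \<in> space M. \<epsilon> \<le> \<bar>(\<Sum>i=1..n. X i w) / real n - expectation Y\<bar>}) \<longlonglongrightarrow> 0"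
proof -
  \<comment> \<open>The added 1 keeps the interval from -B' to B' nondegenerate, as Hoeffding's
    bound divides by its squared length.\<close>
  define B' where "B' = \<bar>B\<bar> + 1"
  have B': "B' > 0" by (simp add: B'_def)
  have upper: "prob {w \<in> space M. \<epsilon> \<le> \<bar>(\<Sum>i=1..n. X i w) / real n - expectation Y\<bar>}
      \<le> 2 * exp (- (2 * real n * \<epsilon>\<^sup>2 / (2 * B')\<^sup>2))" if "n \<ge> 1" for n
  proof -
    interpret I: Hoeffding_ineq_iid M "{1..n}" X Y "- B'" "B'" "expectation Y"
    proof unfold_locales
      show "AE x in M. Y x \<in> {- B'..B'}"
      proof (rule AE_I2)
        fix x show "Y x \<in> {- B'..B'}" using bdd[of x] unfolding B'_def atLeastAtMost_iff by linarith
      qed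
      show "indep_vars (\<lambda>_. borel) X {1..n}"
        by (rule indep_vars_subset[OF indep]) auto
    qed (use ident in auto)
    have "prob {w \<in> space M. \<bar>(\<Sum>i=1..n. X i w) - real (card {1..n}) * expectation Y\<bar> \<ge> real n * \<epsilon>}
       \<le> 2 * exp (-2 * (real n * \<epsilon>)\<^sup>2 / (real (card {1..n}) * (B' - - B')\<^sup>2))"
      by (rule I.Hoeffding_ineq_abs_ge) (use B' \<epsilon> that in auto)
    moreover have "real n * \<epsilon> \<le> \<bar>s - real n * e\<bar> \<longleftrightarrow> \<epsilon> \<le> \<bar>s / real n - e\<bar>" for s e
    proof -
      have "\<bar>s / real n - e\<bar> = \<bar>s - real n * e\<bar> / real n"
      proof -
        have "s / real n - e = (s - real n * e) / real n" using that by (simp add: field_simps)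
        then show ?thesis by simp
      qed
      then show ?thesis using that by (simp add: pos_le_divide_eq mult.commute)
    qed
    moreover have "-2 * (real n * \<epsilon>)\<^sup>2 / (real n * (B' - - B')\<^sup>2) = - (2 * real n * \<epsilon>\<^sup>2 / (2 * B')\<^sup>2)"
      using that B' by (simp add: field_simps power2_eq_square)
    ultimately show ?thesis by simp
  qed
  have "(\<lambda>n. 2 * exp (- (2 * real n * \<epsilon>\<^sup>2 / (2 * B')\<^sup>2))) \<longlonglongrightarrow> 2 * 0"
  proof (intro tendsto_mult tendsto_const filterlim_compose[OF exp_at_bot] filterlim_uminus_at_bot_at_top)
    have "filterlim (\<lambda>n. (2 * \<epsilon>\<^sup>2 / (2 * B')\<^sup>2) * real n) at_top sequentially"
      using \<epsilon> B' by (intro filterlim_tendsto_pos_mult_at_top[OF tendsto_const] filterlim_real_sequentially) auto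
    then have "filterlim (\<lambda>n. 2 * real n * \<epsilon>\<^sup>2 / (2 * B')\<^sup>2) at_top sequentially"
      by (simp add: mult_ac)
    then show "filterlim (\<lambda>n. - (2 * real n * \<epsilon>\<^sup>2 / (2 * B')\<^sup>2)) at_bot sequentially"
      by (simp add: filterlim_uminus_at_bot)
  qed
  then have "(\<lambda>n. 2 * exp (- (2 * real n * \<epsilon>\<^sup>2 / (2 * B')\<^sup>2))) \<longlonglongrightarrow> 0" by simp
  then show ?thesis
  proof (rule tendsto_sandwich[OF _ _ tendsto_const, rotated 2])
    show "\<forall>\<^sub>F n in sequentially. prob {w \<in> space M. \<epsilon> \<le> \<bar>(\<Sum>i=1..n. X i w) / real n - expectation Y\<bar>}
        \<le> 2 * exp (- (2 * real n * \<epsilon>\<^sup>2 / (2 * B')\<^sup>2))"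
      by (rule eventually_sequentiallyI[of 1], rule upper)
  qed (simp add: always_eventually)
qed

text \<open>Truncation: Hoeffding's inequality handles the bounded part, Markov's inequality the
  integrable remainder. No second moment is assumed because the law will be applied to squares and
  products of square integrable quantities.\<close>

lemma (in prob_space) weak_law_large_numbers:
  fixes X :: "nat \<Rightarrow> 'a \<Rightarrow> real"
  assumes indep: "indep_vars (\<lambda>_. borel) X {1..}"
    and ident: "\<And>i. 1 \<le> i \<Longrightarrow> distr M borel (X i) = distr M borel Y"
    and Y[measurable]: "Y \<in> borel_measurable M" and int: "integrable M Y" and \<epsilon>: "\<epsilon> > 0"
  shows "(\<lambda>n. prob {w \<in> space M. \<epsilon> \<le> \<bar>(\<Sum>i=1..n. X i w) / real n - expectation Y\<bar>}) \<longlonglongrightarrow> 0"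
proof (rule LIMSEQ_I)
  fix \<eta> :: real assume \<eta>: "0 < \<eta>"
  define T where "T m x = (if \<bar>x\<bar> \<le> real m then x else 0)" for m and x :: real
  have T[measurable]: "T m \<in> borel_measurable borel" for m unfolding T_def by measurable
  have X[measurable]: "X i \<in> borel_measurable M" if "1 \<le> i" for i
    using indep that by (auto simp: indep_vars_def)
  have "(\<lambda>m. expectation (\<lambda>w. \<bar>Y w - T m (Y w)\<bar>)) \<longlonglongrightarrow> expectation (\<lambda>w. 0)"
  proof (rule integral_dominated_convergence[where w="\<lambda>w. \<bar>Y w\<bar>"])
    show "AE w in M. (\<lambda>m. \<bar>Y w - T m (Y w)\<bar>) \<longlonglongrightarrow> 0"
    proof (rule AE_I2)
      fix w
      have "\<forall>m\<ge>nat \<lceil>\<bar>Y w\<bar>\<rceil>. \<bar>Y w - T m (Y w)\<bar> = 0"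
        unfolding T_def by (auto simp: nat_ceiling_le_eq)
      then have "\<forall>\<^sub>F m in sequentially. \<bar>Y w - T m (Y w)\<bar> = 0"
        unfolding eventually_sequentially by blast
      then show "(\<lambda>m. \<bar>Y w - T m (Y w)\<bar>) \<longlonglongrightarrow> 0" by (rule tendsto_eventually)
    qed
    show "AE w in M. norm \<bar>Y w - T m (Y w)\<bar> \<le> \<bar>Y w\<bar>" for m
      by (rule AE_I2) (simp add: T_def)
  qed (use int in auto)
  \<comment> \<open>The bound \<epsilon>/3 controls the bias of the truncated mean; \<eta>
    \<epsilon>/6 makes Markov's inequality at level \<epsilon>/3 yield \<eta>/2.\<close>
  then have "\<forall>\<^sub>F m in sequentially. expectation (\<lambda>w. \<bar>Y w - T m (Y w)\<bar>) < min (\<epsilon> / 3) (\<eta> * \<epsilon> / 6)"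
    using \<epsilon> \<eta> by (intro order_tendstoD(2)[where y=0]) auto
  then obtain m where m: "expectation (\<lambda>w. \<bar>Y w - T m (Y w)\<bar>) < \<epsilon> / 3"
      "expectation (\<lambda>w. \<bar>Y w - T m (Y w)\<bar>) < \<eta> * \<epsilon> / 6"
    by (auto simp: eventually_sequentially)
  have intT: "integrable M (\<lambda>w. T m (Y w))"
    by (rule Bochner_Integration.integrable_bound[OF int]) (auto simp: T_def)
  have iYT: "integrable M (\<lambda>w. \<bar>Y w - T m (Y w)\<bar>)" using int intT by auto
  have EY: "\<bar>expectation Y - expectation (\<lambda>w. T m (Y w))\<bar> < \<epsilon> / 3"
  proof -
    have "\<bar>expectation Y - expectation (\<lambda>w. T m (Y w))\<bar> = \<bar>expectation (\<lambda>w. Y w - T m (Y w))\<bar>"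
      using int intT by simp
    also have "\<dots> \<le> expectation (\<lambda>w. \<bar>Y w - T m (Y w)\<bar>)"
      by (rule integral_abs_bound)
    finally show ?thesis using m by simp
  qed
  have identg: "distr M borel (\<lambda>w. g (X i w)) = distr M borel (\<lambda>w. g (Y w))"
    if "1 \<le> i" and [measurable]: "g \<in> borel_measurable borel" for i and g :: "real \<Rightarrow> real"
  proof -
    have "distr M borel (\<lambda>w. g (X i w)) = distr (distr M borel (X i)) borel g"
      using that(1) by (subst distr_distr) (auto simp: o_def)
    also have "\<dots> = distr M borel (\<lambda>w. g (Y w))"
      unfolding ident[OF that(1)] by (subst distr_distr) (auto simp: o_def)
    finally show ?thesis .
  qed
  have tail: "integrable M (\<lambda>w. \<bar>X i w - T m (X i w)\<bar>) \<and>
      expectation (\<lambda>w. \<bar>X i w - T m (X i w)\<bar>) = expectation (\<lambda>w. \<bar>Y w - T m (Y w)\<bar>)" if i: "1 \<le> i" for i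
  proof -
    define g where "g x = \<bar>x - T m x\<bar>" for x
    have [measurable]: "g \<in> borel_measurable borel" unfolding g_def by measurable
    have [measurable]: "X i \<in> borel_measurable M" by (rule X[OF i])
    have "integrable (distr M borel Y) g" using iYT by (subst integrable_distr_eq) (auto simp: g_def)
    then have "integrable M (\<lambda>w. g (X i w))"
      unfolding ident[OF i, symmetric] by (subst (asm) integrable_distr_eq) auto
    moreover have "expectation (\<lambda>w. g (X i w)) = expectation (\<lambda>w. g (Y w))"
    proof -
      have "expectation (\<lambda>w. g (X i w)) = integral\<^sup>L (distr M borel (X i)) g" by (subst integral_distr) auto
      also have "\<dots> = expectation (\<lambda>w. g (Y w))" unfolding ident[OF i] by (subst integral_distr) auto
      finally show ?thesis .
    qed
    ultimately show ?thesis by (simp add: g_def)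
  qed
  have second: "prob {w \<in> space M. \<epsilon> / 3 \<le> (\<Sum>i=1..n. \<bar>X i w - T m (X i w)\<bar>) / real n} \<le> \<eta> / 2" if "n \<ge> 1" for n
  proof -
    have int1: "integrable M (\<lambda>w. (\<Sum>i=1..n. \<bar>X i w - T m (X i w)\<bar>) / real n)"
      using tail by (intro integrable_divide Bochner_Integration.integrable_sum) auto
    have "expectation (\<lambda>w. (\<Sum>i=1..n. \<bar>X i w - T m (X i w)\<bar>) / real n)
       = (\<Sum>i=1..n. expectation (\<lambda>w. \<bar>X i w - T m (X i w)\<bar>)) / real n"
      using tail by (subst integral_divide_zero, subst Bochner_Integration.integral_sum) auto
    also have "(\<Sum>i=1..n. expectation (\<lambda>w. \<bar>X i w - T m (X i w)\<bar>)) = (\<Sum>i=1..n. expectation (\<lambda>w. \<bar>Y w - T m (Y w)\<bar>))"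
      using tail by (intro sum.cong) auto
    also have "\<dots> / real n = expectation (\<lambda>w. \<bar>Y w - T m (Y w)\<bar>)" using that by simp
    finally have E: "expectation (\<lambda>w. (\<Sum>i=1..n. \<bar>X i w - T m (X i w)\<bar>) / real n) = expectation (\<lambda>w. \<bar>Y w - T m (Y w)\<bar>)" .
    have "prob {w \<in> space M. \<epsilon> / 3 \<le> (\<Sum>i=1..n. \<bar>X i w - T m (X i w)\<bar>) / real n}
        \<le> expectation (\<lambda>w. (\<Sum>i=1..n. \<bar>X i w - T m (X i w)\<bar>) / real n) / (\<epsilon> / 3)"
      by (rule integral_Markov_inequality_measure[OF int1, where A="{}"]) (use \<epsilon> in \<open>auto intro!: AE_I2 divide_nonneg_nonneg sum_nonneg\<close>)
    also have "\<dots> \<le> \<eta> / 2" unfolding E using m \<epsilon> by (simp add: field_simps)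
    finally show ?thesis .
  qed
  have first: "(\<lambda>n. prob {w \<in> space M. \<epsilon> / 3 \<le> \<bar>(\<Sum>i=1..n. T m (X i w)) / real n - expectation (\<lambda>w. T m (Y w))\<bar>}) \<longlonglongrightarrow> 0"
  proof (rule weak_law_bounded[where B="real m"])
    show "indep_vars (\<lambda>_. borel) (\<lambda>i w. T m (X i w)) {1..}"
      by (rule indep_vars_compose2[OF indep]) auto
    show "distr M borel (\<lambda>w. T m (X i w)) = distr M borel (\<lambda>w. T m (Y w))" if "1 \<le> i" for i
      by (rule identg[OF that]) auto
  qed (use \<epsilon> in \<open>auto simp: T_def\<close>)
  have "\<forall>\<^sub>F n in sequentially. prob {w \<in> space M. \<epsilon> / 3 \<le> \<bar>(\<Sum>i=1..n. T m (X i w)) / real n - expectation (\<lambda>w. T m (Y w))\<bar>} < \<eta> / 2"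
    using order_tendstoD(2)[OF first, of "\<eta> / 2"] \<eta> by auto
  then have "\<forall>\<^sub>F n in sequentially. prob {w \<in> space M. \<epsilon> \<le> \<bar>(\<Sum>i=1..n. X i w) / real n - expectation Y\<bar>} < \<eta>"
    using eventually_ge_at_top[of 1]
  proof eventually_elim
    case (elim n)
    let ?A = "{w \<in> space M. \<epsilon> / 3 \<le> \<bar>(\<Sum>i=1..n. T m (X i w)) / real n - expectation (\<lambda>w. T m (Y w))\<bar>}"
    let ?B = "{w \<in> space M. \<epsilon> / 3 \<le> (\<Sum>i=1..n. \<bar>X i w - T m (X i w)\<bar>) / real n}"
    have XS: "(\<lambda>w. \<Sum>i=1..n. h (X i w)) \<in> borel_measurable M" if "h \<in> borel_measurable borel" for h :: "real \<Rightarrow> real"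
      using that by (intro borel_measurable_sum measurable_compose[OF X]) auto
    have meas: "?A \<in> sets M" "?B \<in> sets M"
      using XS[OF T] XS[of "\<lambda>x. \<bar>x - T m x\<bar>"] by (auto simp del: sum.cl_ivl_Suc)
    have "{w \<in> space M. \<epsilon> \<le> \<bar>(\<Sum>i=1..n. X i w) / real n - expectation Y\<bar>} \<subseteq> ?A \<union> ?B"
    proof (rule subsetI, rule ccontr)
      fix w assume w: "w \<in> {w \<in> space M. \<epsilon> \<le> \<bar>(\<Sum>i=1..n. X i w) / real n - expectation Y\<bar>}" "w \<notin> ?A \<union> ?B"
      have "\<bar>(\<Sum>i=1..n. X i w) / real n - (\<Sum>i=1..n. T m (X i w)) / real n\<bar> = \<bar>\<Sum>i=1..n. X i w - T m (X i w)\<bar> / real n"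
        by (simp add: sum_subtractf diff_divide_distrib[symmetric])
      also have "\<dots> \<le> (\<Sum>i=1..n. \<bar>X i w - T m (X i w)\<bar>) / real n"
        by (intro divide_right_mono sum_abs) auto
      finally have d: "\<bar>(\<Sum>i=1..n. X i w) / real n - (\<Sum>i=1..n. T m (X i w)) / real n\<bar>
          \<le> (\<Sum>i=1..n. \<bar>X i w - T m (X i w)\<bar>) / real n" .
      have w': "\<epsilon> \<le> \<bar>(\<Sum>i=1..n. X i w) / real n - expectation Y\<bar>"
        "\<bar>(\<Sum>i=1..n. T m (X i w)) / real n - expectation (\<lambda>w. T m (Y w))\<bar> < \<epsilon> / 3"
        "(\<Sum>i=1..n. \<bar>X i w - T m (X i w)\<bar>) / real n < \<epsilon> / 3"
        using w by (auto simp: not_le)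
      show False using d w' EY by linarith
    qed
    then have "prob {w \<in> space M. \<epsilon> \<le> \<bar>(\<Sum>i=1..n. X i w) / real n - expectation Y\<bar>} \<le> prob (?A \<union> ?B)"
      using meas by (intro finite_measure_mono) auto
    also have "\<dots> \<le> prob ?A + prob ?B" by (rule measure_Un_le) (use meas in auto)
    also have "\<dots> < \<eta>" using elim second[of n] by simp
    finally show ?case .
  qed
  then obtain n0 where "\<forall>n\<ge>n0. prob {w \<in> space M. \<epsilon> \<le> \<bar>(\<Sum>i=1..n. X i w) / real n - expectation Y\<bar>} < \<eta>"
    unfolding eventually_sequentially by blast
  then show "\<exists>n0. \<forall>n\<ge>n0. norm (prob {w \<in> space M. \<epsilon> \<le> \<bar>(\<Sum>i=1..n. X i w) / real n - expectation Y\<bar>} - 0) < \<eta>"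
    by auto
qed

section \<open>Trigonometric sums and the Cramer-Wold device\<close>

inductive trig_sum :: "('a::euclidean_space \<Rightarrow> real) \<Rightarrow> bool" where
  single: "trig_sum (\<lambda>y. c * cos (a \<bullet> y + b))"
| add: "trig_sum f \<Longrightarrow> trig_sum g \<Longrightarrow> trig_sum (\<lambda>y. f y + g y)"

lemma trig_sum_const: "trig_sum (\<lambda>y. c)"
  using single[of c 0 0] by simp

text \<open>The product-to-sum formula. It makes these sums an algebra, while each summand still
  sees \<open>y\<close> through a single linear functional, which is what one-dimensional
  convergence can handle.\<close>

lemma trig_sum_mult:
  assumes "trig_sum f" "trig_sum g"
  shows "trig_sum (\<lambda>y. f y * g y)"
  using assms
proof (induction f)
  case (single c a b)
  from single show ?case
  proof (induction g)
    case (single c' a' b')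
    have eq: "c * cos (a \<bullet> y + b) * (c' * cos (a' \<bullet> y + b')) =
       (c * c' / 2) * cos ((a - a') \<bullet> y + (b - b')) + (c * c' / 2) * cos ((a + a') \<bullet> y + (b + b'))" for y
    proof -
      have "cos (a \<bullet> y + b) * cos (a' \<bullet> y + b') =
         (cos ((a \<bullet> y + b) - (a' \<bullet> y + b')) + cos ((a \<bullet> y + b) + (a' \<bullet> y + b'))) / 2"
        by (rule cos_times_cos)
      moreover have "(a \<bullet> y + b) - (a' \<bullet> y + b') = (a - a') \<bullet> y + (b - b')"
        "(a \<bullet> y + b) + (a' \<bullet> y + b') = (a + a') \<bullet> y + (b + b')"
        by (auto simp: algebra_simps)
      ultimately have *: "cos (a \<bullet> y + b) * cos (a' \<bullet> y + b') =
         (cos ((a - a') \<bullet> y + (b - b')) + cos ((a + a') \<bullet> y + (b + b'))) / 2"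
        by simp
      have "c * cos (a \<bullet> y + b) * (c' * cos (a' \<bullet> y + b')) = c * c' * (cos (a \<bullet> y + b) * cos (a' \<bullet> y + b'))"
        by (simp add: mult_ac)
      then show ?thesis unfolding * by (simp add: algebra_simps)
    qed
    show ?case unfolding eq by (intro trig_sum.intros)
  next
    case (add f g)
    then show ?case using trig_sum.add by (simp add: distrib_left)
  qed
next
  case (add f1 f2)
  then show ?case using trig_sum.add by (simp add: distrib_right)
qed

lemma trig_sum_continuous: "trig_sum f \<Longrightarrow> continuous_on S f"
  by (induction rule: trig_sum.induct) (auto intro!: continuous_intros)

lemma trig_sum_bounded: "trig_sum f \<Longrightarrow> \<exists>B. \<forall>y. \<bar>f y\<bar> \<le> B"
proof (induction rule: trig_sum.induct)
  case (single c a b)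
  have "\<bar>c * cos (a \<bullet> y + b)\<bar> \<le> \<bar>c\<bar>" for y
    by (simp add: abs_mult mult_left_le)
  then show ?case by blast
next
  case (add f g)
  then obtain B C where "\<And>y. \<bar>f y\<bar> \<le> B" "\<And>y. \<bar>g y\<bar> \<le> C" by blast
  then have "\<bar>f y + g y\<bar> \<le> B + C" for y
    by (meson abs_triangle_ineq add_mono order_trans)
  then show ?case by blast
qed

lemma trig_sum_polynomial:
  assumes "real_polynomial_function q" "trig_sum p"
  shows "trig_sum (\<lambda>y. q (p y))"
  using assms(1)
proof (induction q)
  case (linear f)
  then have "f t = f 1 * t" for t
    using linear_scale[OF bounded_linear.linear[OF linear], of t 1] by (simp add: mult.commute)
  then have "(\<lambda>y. f (p y)) = (\<lambda>y. f 1 * p y)" by blast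
  then show ?case using trig_sum_mult[OF trig_sum_const assms(2)] by simp
qed (auto intro: trig_sum_const trig_sum.add trig_sum_mult)

text \<open>Composing a trigonometric approximation with a polynomial that approximates the truncation of
  the real line to \<open>[-B, B]\<close> gives an approximation that is also globally bounded.\<close>
lemma trig_sum_approx:
  fixes \<phi> :: "'a::euclidean_space \<Rightarrow> real"
  assumes \<phi>: "continuous_on UNIV \<phi>" "\<And>y. \<bar>\<phi> y\<bar> \<le> B" and e: "0 < e"
  shows "\<exists>f. trig_sum f \<and> (\<forall>y\<in>cball 0 R. \<bar>f y - \<phi> y\<bar> < e) \<and> (\<forall>y. \<bar>f y\<bar> \<le> B + e)"
proof -
  have "function_ring_on (Collect trig_sum) (cball (0::'a) R)"
  proof
    fix x y :: 'a assume "x \<noteq> y"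
    have neq: "(x - y) \<bullet> x - (x - y) \<bullet> y > 0"
      using \<open>x \<noteq> y\<close> by (simp add: inner_diff_right[symmetric])
    \<comment> \<open>The frequency is x - y, scaled so that the phases at x and y differ by pi: the
      cosine takes the values -1 and 1 there.\<close>
    define t where "t = pi / ((x - y) \<bullet> x - (x - y) \<bullet> y)"
    have t: "t * ((x - y) \<bullet> x - (x - y) \<bullet> y) = pi" using neq by (simp add: t_def)
    have "cos ((t *\<^sub>R (x - y)) \<bullet> x + (- (t *\<^sub>R (x - y)) \<bullet> y)) = - 1"
      using t by (simp add: algebra_simps)
    moreover have "cos ((t *\<^sub>R (x - y)) \<bullet> y + (- (t *\<^sub>R (x - y)) \<bullet> y)) = 1" by simp
    moreover have "trig_sum (\<lambda>u. 1 * cos ((t *\<^sub>R (x - y)) \<bullet> u + (- (t *\<^sub>R (x - y)) \<bullet> y)))"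
      by (rule trig_sum.single)
    ultimately show "\<exists>f\<in>Collect trig_sum. f x \<noteq> f y"
      by (intro bexI[of _ "\<lambda>u. 1 * cos ((t *\<^sub>R (x - y)) \<bullet> u + (- (t *\<^sub>R (x - y)) \<bullet> y))"]) auto
  qed (auto intro: trig_sum_continuous trig_sum.add trig_sum_mult trig_sum_const)
  then obtain p where p: "trig_sum p" "\<And>y. y \<in> cball 0 R \<Longrightarrow> \<bar>\<phi> y - p y\<bar> < e / 2"
    using function_ring_on.Stone_Weierstrass_basic[of "Collect trig_sum" "cball 0 R" \<phi> "e / 2"]
      \<phi>(1) e continuous_on_subset[OF \<phi>(1)] by auto
  obtain C where C: "\<And>y. \<bar>p y\<bar> \<le> C" using trig_sum_bounded[OF p(1)] by blast
  define h where "h t = max (- B) (min B t)" for t :: real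
  have "B \<ge> 0" using \<phi>(2)[of 0] by linarith
  have "continuous_on (cbox (- C) C) h" unfolding h_def by (intro continuous_intros)
  then obtain q where q: "real_polynomial_function q" "\<And>t. t \<in> cbox (- C) C \<Longrightarrow> \<bar>h t - q t\<bar> < e / 2"
    using Stone_Weierstrass_real_polynomial_function[of "cbox (- C) C" h "e / 2"] e by auto
  have pC: "p y \<in> cbox (- C) C" for y using C[of y] by (auto simp: abs_le_iff)
  have "\<bar>q (p y) - \<phi> y\<bar> < e" if "y \<in> cball 0 R" for y
  proof -
    \<comment> \<open>Clamping to the range of \<phi> cannot increase the distance to
      \<phi>.\<close>
    have "\<bar>h (p y) - \<phi> y\<bar> \<le> \<bar>p y - \<phi> y\<bar>"
      using \<phi>(2)[of y] unfolding h_def by (auto simp: max_def min_def abs_if split: if_splits)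
    then show ?thesis using q(2)[OF pC[of y]] p(2)[OF that] by linarith
  qed
  moreover have "\<bar>q (p y)\<bar> \<le> B + e" for y
  proof -
    have "\<bar>h (p y)\<bar> \<le> B" using \<open>B \<ge> 0\<close> unfolding h_def by auto
    then show ?thesis using q(2)[OF pC[of y]] e by linarith
  qed
  ultimately show ?thesis using trig_sum_polynomial[OF q(1) p(1)]
    by (intro exI[of _ "\<lambda>y. q (p y)"]) blast
qed

lemma (in prob_space) integrable_bounded_continuous:
  fixes \<phi> :: "'b::euclidean_space \<Rightarrow> real"
  assumes "continuous_on UNIV \<phi>" "\<And>y. \<bar>\<phi> y\<bar> \<le> B" "X \<in> borel_measurable M"
  shows "integrable M (\<lambda>w. \<phi> (X w))"
proof (rule integrable_const_bound[where B=B])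
  show "(\<lambda>w. \<phi> (X w)) \<in> borel_measurable M"
    using borel_measurable_continuous_onI[OF assms(1)] assms(3) by measurable
qed (use assms(2) in auto)

text \<open>Inside the ball the two functions differ by less than e, outside by at most 2 B + e. The
  second estimate is where a global bound on the approximating function is indispensable.\<close>

lemma (in prob_space) expectation_split_bound:
  fixes \<phi> f :: "'b::euclidean_space \<Rightarrow> real"
  assumes \<phi>: "continuous_on UNIV \<phi>" "\<And>y. \<bar>\<phi> y\<bar> \<le> B" and f: "continuous_on UNIV f" "\<And>y. \<bar>f y\<bar> \<le> B + e"
    and close: "\<And>y. y \<in> cball 0 R \<Longrightarrow> \<bar>f y - \<phi> y\<bar> < e" and e: "0 < e"
    and X[measurable]: "X \<in> borel_measurable M"
  shows "\<bar>expectation (\<lambda>w. f (X w)) - expectation (\<lambda>w. \<phi> (X w))\<bar> \<le> e + (2 * B + e) * prob {w\<in>space M. R < norm (X w)}"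
proof -
  have i: "integrable M (\<lambda>w. f (X w))" "integrable M (\<lambda>w. \<phi> (X w))"
    using integrable_bounded_continuous[OF f X] integrable_bounded_continuous[OF \<phi> X] by auto
  have B: "B \<ge> 0" using \<phi>(2)[of 0] by linarith
  let ?A = "{w\<in>space M. R < norm (X w)}"
  have iA: "integrable M (\<lambda>w. e + (2 * B + e) * indicator ?A w)"
    by (intro Bochner_Integration.integrable_add integrable_mult_right integrable_real_indicator) (auto simp: emeasure_eq_measure)
  have "\<bar>expectation (\<lambda>w. f (X w)) - expectation (\<lambda>w. \<phi> (X w))\<bar> = \<bar>expectation (\<lambda>w. f (X w) - \<phi> (X w))\<bar>"
    using i by simp
  also have "\<dots> \<le> expectation (\<lambda>w. \<bar>f (X w) - \<phi> (X w)\<bar>)" by (rule integral_abs_bound)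
  also have "\<dots> \<le> expectation (\<lambda>w. e + (2 * B + e) * indicator ?A w)"
  proof (rule integral_mono)
    fix w assume w: "w \<in> space M"
    show "\<bar>f (X w) - \<phi> (X w)\<bar> \<le> e + (2 * B + e) * indicator ?A w"
    proof (cases "R < norm (X w)")
      case True
      then have "indicator ?A w = (1::real)" using w by simp
      moreover have "\<bar>f (X w) - \<phi> (X w)\<bar> \<le> (B + e) + B"
        using f(2)[of "X w"] \<phi>(2)[of "X w"] by linarith
      ultimately show ?thesis using e by simp
    next
      case False
      then have "X w \<in> cball 0 R" by simp
      then show ?thesis using close[of "X w"] B e False by simp
    qed
  qed (use i iA in auto)
  also have "\<dots> = e + (2 * B + e) * prob ?A"
    by (subst Bochner_Integration.integral_add) (auto simp: prob_space emeasure_eq_measure)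
  finally show ?thesis .
qed

text \<open>Trigonometric sums converge in mean because every summand depends on one functional a
  \<bullet> y. Tightness follows from the coordinate functionals, and on a large ball \<phi> is
  replaced by a trigonometric sum.\<close>

theorem cramer_wold:
  fixes V :: "nat \<Rightarrow> 'w \<Rightarrow> 'a::euclidean_space" and Y :: "'v \<Rightarrow> 'a" and \<phi> :: "'a \<Rightarrow> real"
  assumes "prob_space M" "prob_space N"
    and V[measurable]: "\<And>n. V n \<in> borel_measurable M" and Y[measurable]: "Y \<in> borel_measurable N"
    and W: "\<And>a (\<psi>::real \<Rightarrow> real) B. continuous_on UNIV \<psi> \<Longrightarrow> (\<And>t. \<bar>\<psi> t\<bar> \<le> B) \<Longrightarrow>
      (\<lambda>n. \<integral>w. \<psi> (a \<bullet> V n w) \<partial>M) \<longlonglongrightarrow> (\<integral>v. \<psi> (a \<bullet> Y v) \<partial>N)"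
    and \<phi>: "continuous_on UNIV \<phi>" "\<And>y. \<bar>\<phi> y\<bar> \<le> B"
  shows "(\<lambda>n. \<integral>w. \<phi> (V n w) \<partial>M) \<longlonglongrightarrow> (\<integral>v. \<phi> (Y v) \<partial>N)"
proof -
  interpret M: prob_space M by fact
  interpret N: prob_space N by fact
  have trig: "(\<lambda>n. \<integral>w. f (V n w) \<partial>M) \<longlonglongrightarrow> (\<integral>v. f (Y v) \<partial>N)" if "trig_sum f" for f
    using that
  proof (induction rule: trig_sum.induct)
    case (single c a b)
    have "\<bar>c * cos (t + b)\<bar> \<le> \<bar>c\<bar>" for t
      by (simp add: abs_mult mult_left_le)
    then show ?case by (intro W[of "\<lambda>t. c * cos (t + b)"]) (auto intro!: continuous_intros)
  next
    case (add f g)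
    have int: "integrable M (\<lambda>w. h (V n w))" "integrable N (\<lambda>w. h (Y w))" if h: "trig_sum h" for h n
      using trig_sum_bounded[OF h] M.integrable_bounded_continuous[OF trig_sum_continuous[OF h] _ V]
        N.integrable_bounded_continuous[OF trig_sum_continuous[OF h] _ Y] by blast+
    show ?case using add int by (simp add: tendsto_add)
  qed
  \<comment> \<open>Continuous tail functions: 0 on [-m, m] and 1 beyond m + 1, so that they
    dominate the indicator of the tail and are admissible in \<open>W\<close>.\<close>
  define \<psi> where "\<psi> m t = min 1 (max 0 (\<bar>t\<bar> - real m))" for m and t :: real
  have \<psi>c: "continuous_on UNIV (\<psi> m)" for m unfolding \<psi>_def by (intro continuous_intros)
  have \<psi>b: "\<bar>\<psi> m t\<bar> \<le> 1" for m t unfolding \<psi>_def by auto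
  have \<psi>m[measurable]: "\<psi> m \<in> borel_measurable borel" for m using borel_measurable_continuous_onI[OF \<psi>c] .
  have \<psi>0: "(\<lambda>m. \<integral>v. \<psi> m (b \<bullet> Y v) \<partial>N) \<longlonglongrightarrow> (\<integral>v. 0 \<partial>N)" for b
  proof (rule integral_dominated_convergence[where w="\<lambda>_. 1"])
    show "AE v in N. (\<lambda>m. \<psi> m (b \<bullet> Y v)) \<longlonglongrightarrow> 0"
    proof (rule AE_I2)
      fix v
      have "\<psi> m (b \<bullet> Y v) = 0" if "nat \<lceil>\<bar>b \<bullet> Y v\<bar>\<rceil> \<le> m" for m
        using that unfolding \<psi>_def by (simp add: nat_ceiling_le_eq)
      then show "(\<lambda>m. \<psi> m (b \<bullet> Y v)) \<longlonglongrightarrow> 0"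
        by (intro tendsto_eventually eventually_sequentiallyI)
    qed
  qed (use \<psi>b in auto)
  have prob\<psi>: "measure Q {w\<in>space Q. real m + 1 < \<bar>b \<bullet> X w\<bar>} \<le> (\<integral>w. \<psi> m (b \<bullet> X w) \<partial>Q)"
    if Q: "prob_space Q" and X[measurable]: "X \<in> borel_measurable Q" for Q m b and X :: "_ \<Rightarrow> 'a"
  proof -
    interpret Q: prob_space Q by fact
    have "measure Q {w\<in>space Q. real m + 1 < \<bar>b \<bullet> X w\<bar>} = (\<integral>w. indicator {w\<in>space Q. real m + 1 < \<bar>b \<bullet> X w\<bar>} w \<partial>Q)"
      by (subst Bochner_Integration.integral_indicator) (auto intro!: arg_cong[where f="measure Q"])
    also have "\<dots> \<le> (\<integral>w. \<psi> m (b \<bullet> X w) \<partial>Q)"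
    proof (rule integral_mono)
      show "integrable Q (\<lambda>w. \<psi> m (b \<bullet> X w))"
        by (rule Q.integrable_const_bound[where B=1]) (use \<psi>b in auto)
      show "integrable Q (indicator {w\<in>space Q. real m + 1 < \<bar>b \<bullet> X w\<bar>} :: _ \<Rightarrow> real)"
        by (rule integrable_real_indicator) (auto simp: Q.emeasure_eq_measure)
    qed (auto simp: \<psi>_def indicator_def)
    finally show ?thesis .
  qed
  have tight: "\<exists>R. (\<forall>\<^sub>F n in sequentially. measure M {w\<in>space M. R < norm (V n w)} \<le> \<eta>) \<and> measure N {v\<in>space N. R < norm (Y v)} \<le> \<eta>"
    if \<eta>: "\<eta> > 0" for \<eta>
  proof -
    let ?d = "real DIM('a)"
    have "\<forall>\<^sub>F m in sequentially. \<forall>b\<in>Basis. (\<integral>v. \<psi> m (b \<bullet> Y v) \<partial>N) < \<eta> / ?d"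
      using order_tendstoD(2)[OF \<psi>0, of "\<eta> / ?d"] \<eta> by (subst eventually_ball_finite_distrib) auto
    then obtain m where m: "\<And>b. b \<in> Basis \<Longrightarrow> (\<integral>v. \<psi> m (b \<bullet> Y v) \<partial>N) < \<eta> / ?d"
      by (auto simp: eventually_sequentially)
    \<comment> \<open>If every coordinate is at most m + 1 in absolute value, the norm is at most
      the dimension times m + 1.\<close>
    define R where "R = ?d * (real m + 1)"
    have norm_le: "measure Q {w\<in>space Q. R < norm (X w)} \<le> \<eta>"
      if Q: "prob_space Q" and X[measurable]: "X \<in> borel_measurable Q"
        and small: "\<And>b. b \<in> Basis \<Longrightarrow> (\<integral>v. \<psi> m (b \<bullet> X v) \<partial>Q) < \<eta> / ?d" for Q and X :: "_ \<Rightarrow> 'a"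
    proof -
      interpret Q: prob_space Q by fact
      have "{w\<in>space Q. R < norm (X w)} \<subseteq> (\<Union>b\<in>Basis. {w\<in>space Q. real m + 1 < \<bar>b \<bullet> X w\<bar>})"
      proof (rule subsetI, rule ccontr)
        fix w assume w: "w \<in> {w\<in>space Q. R < norm (X w)}" "w \<notin> (\<Union>b\<in>Basis. {w\<in>space Q. real m + 1 < \<bar>b \<bullet> X w\<bar>})"
        have "norm (X w) \<le> (\<Sum>b\<in>Basis. \<bar>X w \<bullet> b\<bar>)" by (rule norm_le_l1)
        also have "\<dots> \<le> (\<Sum>b\<in>(Basis::'a set). real m + 1)"
          using w by (intro sum_mono) (auto simp: inner_commute not_less)
        also have "\<dots> = R" by (simp add: R_def)
        finally show False using w by simp
      qed
      then have "measure Q {w\<in>space Q. R < norm (X w)} \<le> measure Q (\<Union>b\<in>Basis. {w\<in>space Q. real m + 1 < \<bar>b \<bullet> X w\<bar>})"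
        by (intro Q.finite_measure_mono) auto
      also have "\<dots> \<le> (\<Sum>b\<in>Basis. measure Q {w\<in>space Q. real m + 1 < \<bar>b \<bullet> X w\<bar>})"
        by (intro Q.finite_measure_subadditive_finite) auto
      also have "\<dots> \<le> (\<Sum>b\<in>(Basis::'a set). \<eta> / ?d)"
        using prob\<psi>[OF Q X] small by (intro sum_mono) (meson order.strict_implies_order order_trans)
      also have "\<dots> = \<eta>" by simp
      finally show ?thesis .
    qed
    have "\<forall>\<^sub>F n in sequentially. \<forall>b\<in>Basis. (\<integral>v. \<psi> m (b \<bullet> V n v) \<partial>M) < \<eta> / ?d"
      using order_tendstoD(2)[OF W[OF \<psi>c \<psi>b] m] by (subst eventually_ball_finite_distrib) auto
    then have "\<forall>\<^sub>F n in sequentially. measure M {w\<in>space M. R < norm (V n w)} \<le> \<eta>"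
      by eventually_elim (rule norm_le[OF \<open>prob_space M\<close> V], blast)
    moreover have "measure N {v\<in>space N. R < norm (Y v)} \<le> \<eta>"
      by (rule norm_le[OF \<open>prob_space N\<close> Y m])
    ultimately show ?thesis by blast
  qed
  have B: "B \<ge> 0" using \<phi>(2)[of 0] by linarith
  show ?thesis
  proof (rule LIMSEQ_I)
    fix \<epsilon> :: real assume \<epsilon>: "0 < \<epsilon>"
    \<comment> \<open>With these choices each of the two applications of the split bound costs at
      most \<epsilon>/4, and the trigonometric sum itself \<epsilon>/8.\<close>
    define e where "e = min 1 (\<epsilon> / 8)"
    define \<eta> where "\<eta> = \<epsilon> / (8 * (2 * B + 1))"
    have e: "0 < e" "e \<le> 1" "e \<le> \<epsilon> / 8" and \<eta>: "\<eta> > 0" using \<epsilon> B by (auto simp: e_def \<eta>_def)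
    have bd: "(2 * B + e) * p \<le> \<epsilon> / 8" if "p \<le> \<eta>" "0 \<le> p" for p
    proof -
      have "(2 * B + e) * p \<le> (2 * B + 1) * \<eta>" using that e B by (intro mult_mono) auto
      also have "\<dots> = \<epsilon> / 8" using B by (simp add: \<eta>_def divide_simps)
      finally show ?thesis .
    qed
    obtain R where R: "\<forall>\<^sub>F n in sequentially. measure M {w\<in>space M. R < norm (V n w)} \<le> \<eta>"
      "measure N {v\<in>space N. R < norm (Y v)} \<le> \<eta>" using tight[OF \<eta>] by blast
    obtain f where f: "trig_sum f" "\<And>y. y \<in> cball 0 R \<Longrightarrow> \<bar>f y - \<phi> y\<bar> < e" "\<And>y. \<bar>f y\<bar> \<le> B + e"
      using trig_sum_approx[OF \<phi> e(1), of R] by blast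
    note bnd = \<phi> trig_sum_continuous[OF f(1)] f(3) f(2) e(1)
    have "\<forall>\<^sub>F n in sequentially. \<bar>(\<integral>w. f (V n w) \<partial>M) - (\<integral>v. f (Y v) \<partial>N)\<bar> < \<epsilon> / 8"
      using tendstoD[OF trig[OF f(1)], of "\<epsilon> / 8"] \<epsilon> by (simp add: dist_real_def)
    with R(1) have "\<forall>\<^sub>F n in sequentially. \<bar>(\<integral>w. \<phi> (V n w) \<partial>M) - (\<integral>v. \<phi> (Y v) \<partial>N)\<bar> < \<epsilon>"
    proof eventually_elim
      case (elim n)
      have "\<bar>(\<integral>w. f (V n w) \<partial>M) - (\<integral>w. \<phi> (V n w) \<partial>M)\<bar> \<le> e + (2 * B + e) * measure M {w\<in>space M. R < norm (V n w)}"
        by (rule M.expectation_split_bound[OF bnd V])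
      moreover have "\<bar>(\<integral>v. f (Y v) \<partial>N) - (\<integral>v. \<phi> (Y v) \<partial>N)\<bar> \<le> e + (2 * B + e) * measure N {v\<in>space N. R < norm (Y v)}"
        by (rule N.expectation_split_bound[OF bnd Y])
      ultimately show ?case
        using elim bd[OF elim(1)] bd[OF R(2)] e \<epsilon> by (simp, linarith)
    qed
    then show "\<exists>n0. \<forall>n\<ge>n0. norm ((\<integral>w. \<phi> (V n w) \<partial>M) - (\<integral>v. \<phi> (Y v) \<partial>N)) < \<epsilon>"
      by (auto simp: eventually_sequentially)
  qed
qed

section \<open>Portmanteau inequalities\<close>

lemma portmanteau_closed:
  fixes V :: "nat \<Rightarrow> 'w \<Rightarrow> 'a::euclidean_space" and Y :: "'v \<Rightarrow> 'a"
  assumes "prob_space M" "prob_space N"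
    and V[measurable]: "\<And>n. V n \<in> borel_measurable M" and Y[measurable]: "Y \<in> borel_measurable N"
    and W: "\<And>(\<phi>::'a \<Rightarrow> real) B. continuous_on UNIV \<phi> \<Longrightarrow> (\<And>t. \<bar>\<phi> t\<bar> \<le> B) \<Longrightarrow>
      (\<lambda>n. \<integral>w. \<phi> (V n w) \<partial>M) \<longlonglongrightarrow> (\<integral>v. \<phi> (Y v) \<partial>N)"
    and C: "closed C" and \<epsilon>: "0 < \<epsilon>"
  shows "\<forall>\<^sub>F n in sequentially. measure M {w\<in>space M. V n w \<in> C} \<le> measure N {v\<in>space N. Y v \<in> C} + \<epsilon>"
proof (cases "C = {}")
  case True
  then show ?thesis using \<epsilon> by simp
next
  case False
  interpret M: prob_space M by fact
  interpret N: prob_space N by fact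
  have [measurable]: "C \<in> sets borel" using C by simp
  \<comment> \<open>Continuous functions above the indicator of \<open>C\<close> that tend to it
    pointwise because \<open>C\<close> is closed. The empty set was set apart since
    \<open>infdist\<close> to it is 0.\<close>
  define \<phi> where "\<phi> m y = max 0 (1 - real m * infdist y C)" for m y
  have \<phi>c: "continuous_on UNIV (\<phi> m)" for m unfolding \<phi>_def by (intro continuous_intros)
  have \<phi>b: "\<bar>\<phi> m t\<bar> \<le> 1" for m t unfolding \<phi>_def by (auto simp: infdist_nonneg)
  have \<phi>C: "indicator C y \<le> \<phi> m y" for m y
    unfolding \<phi>_def by (auto simp: indicator_def)
  have "(\<lambda>m. \<integral>v. \<phi> m (Y v) \<partial>N) \<longlonglongrightarrow> (\<integral>v. indicator C (Y v) \<partial>N)"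
  proof (rule integral_dominated_convergence[where w="\<lambda>_. 1"])
    show "AE v in N. (\<lambda>m. \<phi> m (Y v)) \<longlonglongrightarrow> indicator C (Y v)"
    proof (rule AE_I2)
      fix v
      show "(\<lambda>m. \<phi> m (Y v)) \<longlonglongrightarrow> indicator C (Y v)"
      proof (cases "Y v \<in> C")
        case False
        then have d: "infdist (Y v) C > 0"
          using C \<open>C \<noteq> {}\<close> by (intro infdist_pos_not_in_closed) auto
        have "\<phi> m (Y v) = indicator C (Y v)" if "nat \<lceil>1 / infdist (Y v) C\<rceil> \<le> m" for m
        proof -
          have "1 / infdist (Y v) C \<le> real m" using that by (simp add: nat_ceiling_le_eq)
          then have "1 \<le> real m * infdist (Y v) C" using d by (simp add: pos_divide_le_eq)
          then show ?thesis using False unfolding \<phi>_def by simp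
        qed
        then show ?thesis by (intro tendsto_eventually eventually_sequentiallyI)
      qed (simp add: \<phi>_def)
    qed
    show "(\<lambda>v. \<phi> m (Y v)) \<in> borel_measurable N" for m
      using borel_measurable_continuous_onI[OF \<phi>c] by measurable
  qed (use \<phi>b in auto)
  moreover have ind: "(\<integral>w. indicator C (X w) \<partial>Q) = measure Q {w\<in>space Q. X w \<in> C}"
    if "X \<in> borel_measurable Q" "prob_space Q" for Q and X :: "_ \<Rightarrow> 'a"
  proof -
    have [measurable]: "X \<in> borel_measurable Q" by fact
    interpret Q: prob_space Q by fact
    have "(\<integral>w. indicator C (X w) \<partial>Q) = (\<integral>w. indicator {w\<in>space Q. X w \<in> C} w \<partial>Q)"
      by (intro Bochner_Integration.integral_cong) (auto simp: indicator_def)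
    also have "\<dots> = measure Q {w\<in>space Q. X w \<in> C}"
      by (subst Bochner_Integration.integral_indicator) (auto intro!: arg_cong[where f="measure Q"])
    finally show ?thesis .
  qed
  ultimately have "\<forall>\<^sub>F m in sequentially. (\<integral>v. \<phi> m (Y v) \<partial>N) < measure N {v\<in>space N. Y v \<in> C} + \<epsilon>"
    using \<epsilon> ind[OF Y \<open>prob_space N\<close>] by (intro order_tendstoD(2)) auto
  then obtain m where m: "(\<integral>v. \<phi> m (Y v) \<partial>N) < measure N {v\<in>space N. Y v \<in> C} + \<epsilon>"
    by (auto simp: eventually_sequentially)
  have "\<forall>\<^sub>F n in sequentially. (\<integral>w. \<phi> m (V n w) \<partial>M) < measure N {v\<in>space N. Y v \<in> C} + \<epsilon>"
    using order_tendstoD(2)[OF W[OF \<phi>c \<phi>b] m] .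
  then show ?thesis
  proof eventually_elim
    case (elim n)
    have "measure M {w\<in>space M. V n w \<in> C} = (\<integral>w. indicator C (V n w) \<partial>M)"
      using ind[OF V \<open>prob_space M\<close>] by simp
    also have "\<dots> \<le> (\<integral>w. \<phi> m (V n w) \<partial>M)"
    proof (rule integral_mono)
      show "integrable M (\<lambda>w. indicator C (V n w) :: real)"
        by (rule M.integrable_const_bound[where B=1]) auto
      show "integrable M (\<lambda>w. \<phi> m (V n w))"
        by (rule M.integrable_bounded_continuous[OF \<phi>c \<phi>b V])
    qed (rule \<phi>C)
    finally show ?case using elim by simp
  qed
qed

text \<open>The closed-set bound is applied to the closure of \<open>A\<close> and to the complement
  of its interior. The limit gives both the same mass as \<open>A\<close> and its complement, so the
  two one-sided estimates meet.\<close>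

lemma portmanteau_frontier:
  fixes V :: "nat \<Rightarrow> 'w \<Rightarrow> 'a::euclidean_space" and Y :: "'v \<Rightarrow> 'a"
  assumes "prob_space M" "prob_space N"
    and V[measurable]: "\<And>n. V n \<in> borel_measurable M" and Y[measurable]: "Y \<in> borel_measurable N"
    and W: "\<And>(\<phi>::'a \<Rightarrow> real) B. continuous_on UNIV \<phi> \<Longrightarrow> (\<And>t. \<bar>\<phi> t\<bar> \<le> B) \<Longrightarrow>
      (\<lambda>n. \<integral>w. \<phi> (V n w) \<partial>M) \<longlonglongrightarrow> (\<integral>v. \<phi> (Y v) \<partial>N)"
    and A[measurable]: "A \<in> sets borel" and fr: "AE v in N. Y v \<notin> frontier A"
  shows "(\<lambda>n. measure M {w\<in>space M. V n w \<in> A}) \<longlonglongrightarrow> measure N {v\<in>space N. Y v \<in> A}"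
proof (rule LIMSEQ_I)
  interpret M: prob_space M by fact
  interpret N: prob_space N by fact
  fix \<epsilon> :: real assume \<epsilon>: "0 < \<epsilon>"
  have [measurable]: "closure A \<in> sets borel" "interior A \<in> sets borel" "- interior A \<in> sets borel" "- A \<in> sets borel"
    by (auto simp: borel_comp)
  have cl: "measure N {v\<in>space N. Y v \<in> closure A} = measure N {v\<in>space N. Y v \<in> A}"
    using fr by (intro N.finite_measure_eq_AE) (auto elim!: eventually_mono simp: frontier_def dest: subsetD[OF interior_subset] subsetD[OF closure_subset])
  have op: "measure N {v\<in>space N. Y v \<in> - interior A} = measure N {v\<in>space N. Y v \<in> - A}"
    using fr by (intro N.finite_measure_eq_AE) (auto elim!: eventually_mono simp: frontier_def dest: subsetD[OF interior_subset] subsetD[OF closure_subset])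
  have comp: "measure Q {w\<in>space Q. X w \<in> - A} = 1 - measure Q {w\<in>space Q. X w \<in> A}"
    if "prob_space Q" "X \<in> borel_measurable Q" for Q and X :: "_ \<Rightarrow> 'a"
  proof -
    have [measurable]: "X \<in> borel_measurable Q" by fact
    have "{w\<in>space Q. X w \<in> - A} = space Q - {w\<in>space Q. X w \<in> A}" by auto
    then show ?thesis using prob_space.prob_compl[OF \<open>prob_space Q\<close>, of "{w\<in>space Q. X w \<in> A}"] by simp
  qed
  have "\<forall>\<^sub>F n in sequentially. measure M {w\<in>space M. V n w \<in> closure A} \<le> measure N {v\<in>space N. Y v \<in> closure A} + \<epsilon> / 2"
    by (rule portmanteau_closed[OF \<open>prob_space M\<close> \<open>prob_space N\<close> V Y W]) (use \<epsilon> in auto)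
  moreover have "\<forall>\<^sub>F n in sequentially. measure M {w\<in>space M. V n w \<in> - interior A} \<le> measure N {v\<in>space N. Y v \<in> - interior A} + \<epsilon> / 2"
    by (rule portmanteau_closed[OF \<open>prob_space M\<close> \<open>prob_space N\<close> V Y W]) (use \<epsilon> in auto)
  ultimately have "\<forall>\<^sub>F n in sequentially. norm (measure M {w\<in>space M. V n w \<in> A} - measure N {v\<in>space N. Y v \<in> A}) < \<epsilon>"
  proof eventually_elim
    case (elim n)
    have "measure M {w\<in>space M. V n w \<in> A} \<le> measure M {w\<in>space M. V n w \<in> closure A}"
      using closure_subset by (intro M.finite_measure_mono) auto
    moreover have "measure M {w\<in>space M. V n w \<in> - A} \<le> measure M {w\<in>space M. V n w \<in> - interior A}"
      using interior_subset by (intro M.finite_measure_mono) auto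
    ultimately show ?case
      using elim cl op comp[OF \<open>prob_space M\<close> V[of n]] comp[OF \<open>prob_space N\<close> Y] \<epsilon>
      by (simp add: abs_less_iff)
  qed
  then show "\<exists>n0. \<forall>n\<ge>n0. norm (measure M {w\<in>space M. V n w \<in> A} - measure N {v\<in>space N. Y v \<in> A}) < \<epsilon>"
    by (simp add: eventually_sequentially)
qed

section \<open>Central limit theorem\<close>

lemma (in prob_space) indep_vars_Suc:
  assumes "indep_vars (\<lambda>_. borel) X {1..}"
  shows "indep_vars (\<lambda>_. borel) (\<lambda>i. X (Suc i)) UNIV"
  unfolding indep_vars_def2
proof
  let ?F = "\<lambda>i. {X i -` A \<inter> space M |A. A \<in> sets borel}"
  have rv: "\<And>i. i \<in> {1..} \<Longrightarrow> X i \<in> borel_measurable M" and ind: "indep_sets ?F {1..}"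
    using assms unfolding indep_vars_def2 by auto
  then show "\<forall>i\<in>UNIV. X (Suc i) \<in> borel_measurable M" by auto
  show "indep_sets (\<lambda>i. ?F (Suc i)) UNIV"
    unfolding indep_sets_def
  proof (intro conjI ballI allI impI)
    have "\<forall>i\<in>{1..}. ?F i \<subseteq> events" using ind unfolding indep_sets_def by blast
    then show "?F (Suc i) \<subseteq> events" for i by (rule bspec) simp
    fix J :: "nat set" and A assume J: "J \<subseteq> UNIV" "J \<noteq> {}" "finite J" and A: "A \<in> (\<Pi> j\<in>J. ?F (Suc j))"
    have "prob (\<Inter>j\<in>Suc ` J. A (j - 1)) = (\<Prod>j\<in>Suc ` J. prob (A (j - 1)))"
    proof (rule indep_setsD[OF ind])
      show "\<forall>j\<in>Suc ` J. A (j - 1) \<in> ?F j" using A by (auto simp: Pi_def)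
    qed (use J in auto)
    then show "prob (\<Inter>(A ` J)) = (\<Prod>j\<in>J. prob (A j))"
      by (simp add: prod.reindex image_image)
  qed
qed

lemma (in prob_space) clt_expectation:
  fixes Z :: "nat \<Rightarrow> 'a \<Rightarrow> real" and \<psi> :: "real \<Rightarrow> real"
  assumes indep: "indep_vars (\<lambda>_. borel) Z {1..}"
    and ident: "\<And>i. 1 \<le> i \<Longrightarrow> distr M borel (Z i) = distr M borel Z0"
    and Z0[measurable]: "Z0 \<in> borel_measurable M" and int2: "integrable M (\<lambda>w. (Z0 w)\<^sup>2)"
    and mean: "expectation Z0 = 0" and var: "expectation (\<lambda>w. (Z0 w)\<^sup>2) = \<sigma>\<^sup>2" and \<sigma>: "0 < \<sigma>"
    and \<psi>: "continuous_on UNIV \<psi>" "\<And>t. \<bar>\<psi> t\<bar> \<le> B"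
  shows "(\<lambda>n. expectation (\<lambda>w. \<psi> ((\<Sum>i=1..n. Z i w) / sqrt (real n)))) \<longlonglongrightarrow> (\<integral>t. \<psi> (\<sigma> * t) \<partial>std_normal_distribution)"
proof -
  \<comment> \<open>The sample is indexed from 1, the scalar limit theorem from 0.\<close>
  let ?X = "\<lambda>i. Z (Suc i)"
  have Z[measurable]: "Z (Suc i) \<in> borel_measurable M" for i
    using indep unfolding indep_vars_def by auto
  have id: "distr M borel (?X i) = distr M borel Z0" for i using ident[of "Suc i"] by simp
  have m: "expectation (?X i) = 0" for i
  proof -
    have "expectation (?X i) = integral\<^sup>L (distr M borel (?X i)) (\<lambda>x. x)" by (subst integral_distr) auto
    also have "\<dots> = 0" unfolding id by (subst integral_distr) (auto simp: mean)
    finally show ?thesis .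
  qed
  have v2: "expectation (\<lambda>w. (?X i w)\<^sup>2) = \<sigma>\<^sup>2" for i
  proof -
    have "expectation (\<lambda>w. (?X i w)\<^sup>2) = integral\<^sup>L (distr M borel (?X i)) (\<lambda>x. x\<^sup>2)" by (subst integral_distr) auto
    also have "\<dots> = \<sigma>\<^sup>2" unfolding id by (subst integral_distr) (auto simp: var)
    finally show ?thesis .
  qed
  have i2: "integrable M (\<lambda>w. (?X i w)\<^sup>2)" for i
  proof -
    have "integrable (distr M borel Z0) (\<lambda>x. x\<^sup>2)" using int2 by (subst integrable_distr_eq) auto
    then show ?thesis unfolding id[of i, symmetric] by (subst (asm) integrable_distr_eq) auto
  qed
  \<comment> \<open>Normalised to unit variance; the factor \<sigma> is restored inside the test
    function.\<close>
  let ?S = "\<lambda>n w. (\<Sum>i<n. ?X i w) / sqrt (real n * \<sigma>\<^sup>2)"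
  have wc: "weak_conv_m (\<lambda>n. distr M borel (?S n)) std_normal_distribution"
  proof (rule central_limit_theorem_zero_mean[of ?X \<sigma> "distr M borel Z0"])
    show "variance (?X i) = \<sigma>\<^sup>2" for i unfolding m by (simp add: v2)
  qed (fact indep_vars_Suc[OF indep] m \<sigma> i2 id)+
  have "(\<lambda>n. integral\<^sup>L (distr M borel (?S n)) (\<lambda>t. \<psi> (\<sigma> * t))) \<longlonglongrightarrow> (\<integral>t. \<psi> (\<sigma> * t) \<partial>std_normal_distribution)"
  proof (rule weak_conv_imp_integral_bdd_continuous_conv[OF _ _ wc, where B=B])
    show "real_distribution (distr M borel (?S n))" for n by (rule real_distribution_distr) measurable
    show "real_distribution std_normal_distribution" by (rule real_dist_normal_dist)
    show "isCont (\<lambda>t. \<psi> (\<sigma> * t)) x" for x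
    proof -
      have "continuous_on UNIV (\<lambda>t. \<psi> (\<sigma> * t))"
        by (rule continuous_on_compose2[OF \<psi>(1) continuous_on_mult_left[OF continuous_on_id]]) simp
      then show ?thesis unfolding continuous_on_eq_continuous_at[OF open_UNIV] by simp
    qed
  qed (use \<psi>(2) in auto)
  moreover have "integral\<^sup>L (distr M borel (?S n)) (\<lambda>t. \<psi> (\<sigma> * t)) = expectation (\<lambda>w. \<psi> ((\<Sum>i=1..n. Z i w) / sqrt (real n)))" for n
  proof -
    have [measurable]: "\<psi> \<in> borel_measurable borel" using borel_measurable_continuous_onI[OF \<psi>(1)] .
    have "integral\<^sup>L (distr M borel (?S n)) (\<lambda>t. \<psi> (\<sigma> * t)) = expectation (\<lambda>w. \<psi> (\<sigma> * ?S n w))"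
      by (subst integral_distr) auto
    moreover have "\<sigma> * ?S n w = (\<Sum>i=1..n. Z i w) / sqrt (real n)" for w
    proof -
      have "(\<Sum>i=1..n. Z i w) = (\<Sum>i<n. ?X i w)"
        by (rule sum.reindex_bij_witness[of _ Suc "\<lambda>i. i - 1"]) auto
      then show ?thesis using \<sigma> by (simp add: real_sqrt_mult)
    qed
    ultimately show ?thesis by simp
  qed
  ultimately show ?thesis by simp
qed

lemma normal_random_vector_inner_distributed:
  fixes Y :: "'v \<Rightarrow> real^'n"
  assumes N: "prob_space N" and Y: "normal_random_vector N Y 0 V" and pos: "0 < a \<bullet> (V *v a)"
  shows "distr N borel (\<lambda>v. (a \<bullet> Y v) / sqrt (a \<bullet> (V *v a))) = std_normal_distribution"
proof -
  interpret prob_space N by fact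
  have [measurable]: "Y \<in> borel_measurable N" using Y by (simp add: normal_random_vector_def)
  let ?s = "sqrt (a \<bullet> (V *v a))"
  have "distr N borel (\<lambda>v. a \<bullet> Y v) = density lborel (normal_density 0 ?s)"
    using Y pos unfolding normal_random_vector_def Let_def by auto
  then have "distributed N lborel (\<lambda>v. a \<bullet> Y v) (normal_density 0 ?s)"
    unfolding distributed_def by (auto cong: distr_cong)
  then have "distributed N lborel (\<lambda>v. (a \<bullet> Y v - 0) / ?s) std_normal_density"
    using pos by (subst (asm) normal_standard_normal_convert) auto
  then show ?thesis unfolding distributed_def by (auto cong: distr_cong)
qed

text \<open>Convergence of each linear functional, in the form that \<open>cramer_wold\<close>
  consumes. The functional a = 0 has variance 0 and lies outside the scalar theorem.\<close>

theorem multivariate_clt: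
  fixes X :: "nat \<Rightarrow> 'w \<Rightarrow> real^'n" and Y :: "'v \<Rightarrow> real^'n" and \<psi> :: "real \<Rightarrow> real"
  assumes M: "prob_space M" and N: "prob_space N"
    and indep: "prob_space.indep_vars M (\<lambda>_. borel) X {1..}"
    and ident: "\<And>i. 1 \<le> i \<Longrightarrow> distr M borel (X i) = distr M borel X0"
    and X0[measurable]: "X0 \<in> borel_measurable M"
    and int: "\<And>a. integrable M (\<lambda>w. (a \<bullet> X0 w)\<^sup>2)"
    and mean: "\<And>a. (\<integral>w. a \<bullet> X0 w \<partial>M) = 0" and var: "\<And>a. (\<integral>w. (a \<bullet> X0 w)\<^sup>2 \<partial>M) = a \<bullet> (V *v a)"
    and pos: "\<And>a. a \<noteq> 0 \<Longrightarrow> 0 < a \<bullet> (V *v a)"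
    and Y: "normal_random_vector N Y 0 V"
    and \<psi>: "continuous_on UNIV \<psi>" "\<And>t. \<bar>\<psi> t\<bar> \<le> B"
  shows "(\<lambda>n. \<integral>w. \<psi> (a \<bullet> ((\<Sum>i=1..n. X i w) /\<^sub>R sqrt (real n))) \<partial>M) \<longlonglongrightarrow> (\<integral>v. \<psi> (a \<bullet> Y v) \<partial>N)"
proof (cases "a = 0")
  case True
  then show ?thesis using prob_space.prob_space[OF M] prob_space.prob_space[OF N] by simp
next
  case False
  interpret prob_space M by fact
  have [measurable]: "Y \<in> borel_measurable N" "\<psi> \<in> borel_measurable borel"
    using Y borel_measurable_continuous_onI[OF \<psi>(1)] by (auto simp: normal_random_vector_def)
  define \<sigma> where "\<sigma> = sqrt (a \<bullet> (V *v a))"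
  have \<sigma>: "\<sigma> > 0" "\<sigma>\<^sup>2 = a \<bullet> (V *v a)" using pos[OF False] by (auto simp: \<sigma>_def)
  have "(\<lambda>n. expectation (\<lambda>w. \<psi> ((\<Sum>i=1..n. a \<bullet> X i w) / sqrt (real n)))) \<longlonglongrightarrow> (\<integral>t. \<psi> (\<sigma> * t) \<partial>std_normal_distribution)"
  proof (rule clt_expectation[OF _ _ _ _ _ _ \<sigma>(1) \<psi>])
    show "indep_vars (\<lambda>_. borel) (\<lambda>i w. a \<bullet> X i w) {1..}"
      by (rule indep_vars_compose2[OF indep]) auto
    show "distr M borel (\<lambda>w. a \<bullet> X i w) = distr M borel (\<lambda>w. a \<bullet> X0 w)" if i: "1 \<le> i" for i
    proof -
      have [measurable]: "X i \<in> borel_measurable M" using indep i unfolding indep_vars_def by auto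
      have "distr M borel (\<lambda>w. a \<bullet> X i w) = distr (distr M borel (X i)) borel (\<lambda>x. a \<bullet> x)"
        by (subst distr_distr) (auto simp: o_def)
      also have "\<dots> = distr M borel (\<lambda>w. a \<bullet> X0 w)"
        unfolding ident[OF i] by (subst distr_distr) (auto simp: o_def)
      finally show ?thesis .
    qed
  qed (use int mean var \<sigma> in auto)
  moreover have "(\<integral>t. \<psi> (\<sigma> * t) \<partial>std_normal_distribution) = (\<integral>v. \<psi> (a \<bullet> Y v) \<partial>N)"
  proof -
    have "(\<integral>t. \<psi> (\<sigma> * t) \<partial>std_normal_distribution) = (\<integral>v. \<psi> (\<sigma> * ((a \<bullet> Y v) / \<sigma>)) \<partial>N)"
      unfolding normal_random_vector_inner_distributed[OF N Y pos[OF False], symmetric] \<sigma>_def[symmetric]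
      by (subst integral_distr) auto
    then show ?thesis using \<sigma>(1) by simp
  qed
  moreover have "a \<bullet> ((\<Sum>i=1..n. X i w) /\<^sub>R sqrt (real n)) = (\<Sum>i=1..n. a \<bullet> X i w) / sqrt (real n)" for n w
    by (simp add: inner_sum_right divide_inverse mult.commute)
  ultimately show ?thesis by simp
qed

section \<open>Projection onto a polyhedron\<close>

lemma closest_pointI:
  fixes S :: "'a::euclidean_space set"
  assumes "convex S" "closed S" "p \<in> S" "\<And>s. s \<in> S \<Longrightarrow> (z - p) \<bullet> (s - p) \<le> 0"
  shows "closest_point S z = p"
proof -
  let ?q = "closest_point S z"
  have q: "?q \<in> S" using closest_point_in_set[of S z] assms by auto
  have "(z - p) \<bullet> (?q - p) \<le> 0" using assms(4)[OF q] .
  moreover have "(z - ?q) \<bullet> (p - ?q) \<le> 0" by (rule closest_point_dot[OF assms(1-3)])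
  ultimately have "(?q - p) \<bullet> (?q - p) \<le> 0"
    by (simp add: inner_diff_left inner_diff_right inner_commute)
  then have "(?q - p) \<bullet> (?q - p) = 0" using inner_ge_zero[of "?q - p"] by linarith
  then show ?thesis by simp
qed

text \<open>Constraints inactive at \<open>x\<close> have slack, and by Cauchy-Schwarz a step no
  longer than the slack over the norm of the normal cannot violate them. Near \<open>x\<close> only
  active constraints count, so one radius \<rho> serves all directions of the cone.\<close>

lemma polyhedron_tangent_cone:
  fixes S :: "'a::euclidean_space set"
  assumes S: "polyhedron S" and x: "x \<in> S"
  obtains A \<rho> where "finite A" "0 \<notin> A" "\<rho> > 0" "tangent_cone S x = {v. \<forall>a\<in>A. a \<bullet> v \<le> 0}"
    "\<And>v. v \<in> tangent_cone S x \<Longrightarrow> norm v \<le> \<rho> \<Longrightarrow> x + v \<in> S"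
proof -
  obtain F where F: "finite F" "S = \<Inter>F" "\<forall>h\<in>F. \<exists>a b. a \<noteq> 0 \<and> h = {x. a \<bullet> x \<le> b}"
    using S unfolding polyhedron_def by auto
  from F(3) obtain a b where ab: "\<And>h. h \<in> F \<Longrightarrow> a h \<noteq> 0" "\<And>h. h \<in> F \<Longrightarrow> h = {x. a h \<bullet> x \<le> b h}"
    by metis
  define A where "A = a ` {h\<in>F. a h \<bullet> x = b h}"
  define I where "I = {h\<in>F. a h \<bullet> x \<noteq> b h}"
  \<comment> \<open>The 1 keeps the minimum defined when every constraint is active.\<close>
  define \<rho> where "\<rho> = Min (insert 1 ((\<lambda>h. (b h - a h \<bullet> x) / norm (a h)) ` I))"
  have mem: "y \<in> S \<longleftrightarrow> (\<forall>h\<in>F. a h \<bullet> y \<le> b h)" for y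
    unfolding F(2) using ab(2) by blast
  have xh: "a h \<bullet> x \<le> b h" if "h \<in> F" for h using x mem that by blast
  have fin: "finite I" using F(1) by (simp add: I_def)
  have pos: "(b h - a h \<bullet> x) / norm (a h) > 0" if "h \<in> I" for h
    using that xh[of h] ab(1)[of h] by (auto simp: I_def)
  have \<rho>: "\<rho> > 0" unfolding \<rho>_def using fin pos by (subst Min_gr_iff) auto
  have \<rho>I: "\<rho> \<le> (b h - a h \<bullet> x) / norm (a h)" if "h \<in> I" for h
    unfolding \<rho>_def using fin that by (intro Min_le) auto
  have local: "x + v \<in> S" if v: "\<forall>c\<in>A. c \<bullet> v \<le> 0" "norm v \<le> \<rho>" for v
    unfolding mem
  proof
    fix h assume h: "h \<in> F"
    show "a h \<bullet> (x + v) \<le> b h"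
    proof (cases "a h \<bullet> x = b h")
      case True
      then have "a h \<bullet> v \<le> 0" using v(1) h by (auto simp: A_def)
      then show ?thesis using True by (simp add: inner_add_right)
    next
      case False
      then have hI: "h \<in> I" using h by (simp add: I_def)
      have "a h \<bullet> v \<le> norm (a h) * norm v" by (rule norm_cauchy_schwarz)
      also have "\<dots> \<le> norm (a h) * ((b h - a h \<bullet> x) / norm (a h))"
        using v(2) \<rho>I[OF hI] by (intro mult_left_mono) auto
      also have "\<dots> = b h - a h \<bullet> x" using ab(1)[OF h] by simp
      finally show ?thesis by (simp add: inner_add_right)
    qed
  qed
  have T: "tangent_cone S x = {v. \<forall>c\<in>A. c \<bullet> v \<le> 0}"
  proof (intro equalityI subsetI)
    fix v assume "v \<in> tangent_cone S x"
    then obtain t where t: "t > 0" "x + t *\<^sub>R v \<in> S" by (auto simp: tangent_cone_def)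
    show "v \<in> {v. \<forall>c\<in>A. c \<bullet> v \<le> 0}"
    proof (intro CollectI ballI)
      fix c assume "c \<in> A"
      then obtain h where h: "h \<in> F" "c = a h" "a h \<bullet> x = b h" by (auto simp: A_def)
      have "a h \<bullet> (x + t *\<^sub>R v) \<le> b h" using t(2) mem h(1) by blast
      then have "t * (a h \<bullet> v) \<le> 0" using h(3) by (simp add: inner_add_right)
      then show "c \<bullet> v \<le> 0" using t(1) h(2) by (simp add: mult_le_0_iff)
    qed
  next
    fix v assume v: "v \<in> {v. \<forall>c\<in>A. c \<bullet> v \<le> 0}"
    define t where "t = \<rho> / (norm v + 1)"
    have t: "t > 0" using \<rho> by (simp add: t_def add_nonneg_pos)
    have "t * norm v \<le> \<rho>"
      using \<rho> unfolding t_def by (simp add: pos_divide_le_eq add_nonneg_pos mult_left_mono)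
    then have "x + t *\<^sub>R v \<in> S"
      using v t by (intro local) (auto simp: mult_le_0_iff)
    then show "v \<in> tangent_cone S x" using t by (auto simp: tangent_cone_def)
  qed
  show thesis
  proof (rule that[OF _ _ \<rho> T])
    show "finite A" "0 \<notin> A" using F(1) ab(1) by (auto simp: A_def)
    show "x + v \<in> S" if "v \<in> tangent_cone S x" "norm v \<le> \<rho>" for v
      using local that unfolding T by blast
  qed
qed

lemma tangent_cone_props:
  fixes S :: "'a::euclidean_space set"
  assumes S: "polyhedron S" and x: "x \<in> S"
  shows "polyhedron (tangent_cone S x)" "0 \<in> tangent_cone S x"
    "\<And>v t. v \<in> tangent_cone S x \<Longrightarrow> 0 \<le> t \<Longrightarrow> t *\<^sub>R v \<in> tangent_cone S x"
    "\<And>v w. v \<in> tangent_cone S x \<Longrightarrow> w \<in> tangent_cone S x \<Longrightarrow> v + w \<in> tangent_cone S x"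
    "\<And>s. s \<in> S \<Longrightarrow> s - x \<in> tangent_cone S x"
proof -
  obtain A \<rho> where A: "finite A" "0 \<notin> A" "\<rho> > 0" "tangent_cone S x = {v. \<forall>a\<in>A. a \<bullet> v \<le> 0}"
      "\<And>v. v \<in> tangent_cone S x \<Longrightarrow> norm v \<le> \<rho> \<Longrightarrow> x + v \<in> S"
    by (rule polyhedron_tangent_cone[OF assms]) (rule that)
  have "tangent_cone S x = \<Inter>((\<lambda>a. {v. a \<bullet> v \<le> 0}) ` A)" unfolding A(4) by auto
  then show "polyhedron (tangent_cone S x)"
    using A(1) by (auto intro!: polyhedron_Inter polyhedron_halfspace_le)
  show "0 \<in> tangent_cone S x" by (simp add: A(4))
  show "t *\<^sub>R v \<in> tangent_cone S x" if "v \<in> tangent_cone S x" "0 \<le> t" for v t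
    using that unfolding A(4) by (auto simp: mult_nonneg_nonpos)
  show "v + w \<in> tangent_cone S x" if "v \<in> tangent_cone S x" "w \<in> tangent_cone S x" for v w
    using that unfolding A(4) by (auto simp: inner_add_right intro: add_nonpos_nonpos)
  show "s - x \<in> tangent_cone S x" if "s \<in> S" for s
    unfolding tangent_cone_def using that by (auto intro!: exI[of _ 1])
qed

text \<open>The part of the cone in the unit box is a polytope, and every nonzero element of the
  cone can be scaled into it, so the finitely many hull points test the whole cone. Finiteness is
  what provides a positive margin in the local reduction.\<close>

lemma polyhedral_cone_generators:
  fixes T :: "'a::euclidean_space set"
  assumes T: "polyhedron T" and scale: "\<And>v t. v \<in> T \<Longrightarrow> 0 \<le> t \<Longrightarrow> t *\<^sub>R v \<in> T"
  shows "\<exists>V. finite V \<and> V \<subseteq> T \<and> (\<forall>u. (\<forall>v\<in>V. u \<bullet> v \<le> 0) \<longrightarrow> (\<forall>t\<in>T. u \<bullet> t \<le> 0))"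
proof -
  have "polytope (T \<inter> cbox (- One) One)"
    unfolding polytope_eq_bounded_polyhedron using T by (auto intro: bounded_Int)
  then obtain V where V: "finite V" "T \<inter> cbox (- One) One = convex hull V"
    unfolding polytope_def by auto
  have gen: "u \<bullet> t \<le> 0" if u: "\<And>v. v \<in> V \<Longrightarrow> u \<bullet> v \<le> 0" and t: "t \<in> T" for u t
  proof (cases "t = 0")
    case False
    have "convex hull V \<subseteq> {y. u \<bullet> y \<le> 0}"
      using u by (intro hull_minimal convex_halfspace_le) auto
    moreover have "(1 / norm t) *\<^sub>R t \<in> T \<inter> cbox (- One) One"
    proof
      show "(1 / norm t) *\<^sub>R t \<in> T" using scale[OF t] by simp
      have "\<bar>t \<bullet> i\<bar> \<le> norm t" if "i \<in> Basis" for i using that by (rule Basis_le_norm)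
      then have "\<bar>(1 / norm t) * (t \<bullet> i)\<bar> \<le> 1" if "i \<in> Basis" for i
        using that False by (simp add: abs_mult)
      then have "- 1 \<le> (1 / norm t) * (t \<bullet> i) \<and> (1 / norm t) * (t \<bullet> i) \<le> 1" if "i \<in> Basis" for i
        using that by (metis abs_le_iff minus_le_iff)
      then show "(1 / norm t) *\<^sub>R t \<in> cbox (- One) One"
        unfolding mem_box by simp
    qed
    ultimately have "u \<bullet> ((1 / norm t) *\<^sub>R t) \<le> 0" using V(2) by blast
    then show ?thesis using False by (simp add: divide_le_0_iff)
  qed simp
  have "V \<subseteq> T" using V(2) hull_subset[of V convex] by blast
  with V(1) show ?thesis
  proof (intro exI[of _ V] conjI allI impI ballI)
    fix u t assume u: "\<forall>v\<in>V. u \<bullet> v \<le> 0" and t: "t \<in> T"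
    show "u \<bullet> t \<le> 0" by (rule gen[OF bspec[OF u] t])
  qed
qed

definition critical_cone :: "'a::euclidean_space set \<Rightarrow> 'a \<Rightarrow> 'a set" where
  "critical_cone S z = tangent_cone S (closest_point S z) \<inter> {v. (z - closest_point S z) \<bullet> v = 0}"

text \<open>Moreau's decomposition of \<open>h\<close> along \<open>K\<close> and its polar cone.
  The variational inequality at 0 and at twice the projection gives orthogonality; at w plus the
  projection it gives polarity.\<close>

lemma closest_point_cone:
  fixes K :: "'a::euclidean_space set"
  assumes K: "convex K" "closed K" "0 \<in> K"
    and scale: "\<And>v t. v \<in> K \<Longrightarrow> 0 \<le> t \<Longrightarrow> t *\<^sub>R v \<in> K" and add: "\<And>v w. v \<in> K \<Longrightarrow> w \<in> K \<Longrightarrow> v + w \<in> K"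
  shows "closest_point K h \<in> K" "(h - closest_point K h) \<bullet> closest_point K h = 0"
    "\<And>w. w \<in> K \<Longrightarrow> (h - closest_point K h) \<bullet> w \<le> 0" "norm (closest_point K h) \<le> norm h"
    "\<And>t. 0 \<le> t \<Longrightarrow> closest_point K (t *\<^sub>R h) = t *\<^sub>R closest_point K h"
proof -
  let ?k = "closest_point K h"
  have ne: "K \<noteq> {}" using K by auto
  show k: "?k \<in> K" using closest_point_in_set[OF K(2) ne] .
  note dot = closest_point_dot[OF K(1,2)]
  have "(h - ?k) \<bullet> (0 - ?k) \<le> 0" by (rule dot[OF K(3)])
  moreover have "(h - ?k) \<bullet> ((?k + ?k) - ?k) \<le> 0" by (rule dot[OF add[OF k k]])
  ultimately show orth: "(h - ?k) \<bullet> ?k = 0" by simp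
  show pol: "(h - ?k) \<bullet> w \<le> 0" if "w \<in> K" for w
    using dot[OF add[OF that k], of h] by simp
  have "?k \<bullet> ?k = h \<bullet> ?k" using orth by (simp add: inner_diff_left)
  also have "\<dots> \<le> norm h * norm ?k" by (rule norm_cauchy_schwarz)
  finally have "norm ?k * norm ?k \<le> norm h * norm ?k" by (simp add: dot_square_norm power2_eq_square)
  then show "norm ?k \<le> norm h" by (cases "?k = 0") auto
  show "closest_point K (t *\<^sub>R h) = t *\<^sub>R ?k" if "0 \<le> t" for t
  proof (rule closest_pointI[OF K(1,2)])
    show "t *\<^sub>R ?k \<in> K" using scale k that by blast
    fix s assume s: "s \<in> K"
    have "(t *\<^sub>R h - t *\<^sub>R ?k) \<bullet> (s - t *\<^sub>R ?k) = t * ((h - ?k) \<bullet> s) - t * t * ((h - ?k) \<bullet> ?k)"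
      unfolding scaleR_diff_right[symmetric] by (simp add: inner_diff_right right_diff_distrib)
    also have "\<dots> \<le> 0" using orth pol[OF s] that by (simp add: mult_nonneg_nonpos)
    finally show "(t *\<^sub>R h - t *\<^sub>R ?k) \<bullet> (s - t *\<^sub>R ?k) \<le> 0" .
  qed
qed

lemma critical_cone_props:
  fixes S :: "'a::euclidean_space set"
  assumes S: "polyhedron S" "S \<noteq> {}"
  shows "convex (critical_cone S z)" "closed (critical_cone S z)" "0 \<in> critical_cone S z"
    "\<And>v t. v \<in> critical_cone S z \<Longrightarrow> 0 \<le> t \<Longrightarrow> t *\<^sub>R v \<in> critical_cone S z"
    "\<And>v w. v \<in> critical_cone S z \<Longrightarrow> w \<in> critical_cone S z \<Longrightarrow> v + w \<in> critical_cone S z"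
proof -
  have x: "closest_point S z \<in> S"
    using S polyhedron_imp_closed by (intro closest_point_in_set) auto
  note T = tangent_cone_props[OF S(1) x]
  show "convex (critical_cone S z)" "closed (critical_cone S z)"
    unfolding critical_cone_def
    by (auto intro!: convex_Int closed_Int polyhedron_imp_closed[OF T(1)] convex_hyperplane closed_hyperplane polyhedron_imp_convex[OF T(1)])
  show "0 \<in> critical_cone S z"
    "\<And>v t. v \<in> critical_cone S z \<Longrightarrow> 0 \<le> t \<Longrightarrow> t *\<^sub>R v \<in> critical_cone S z"
    "\<And>v w. v \<in> critical_cone S z \<Longrightarrow> w \<in> critical_cone S z \<Longrightarrow> v + w \<in> critical_cone S z"
    unfolding critical_cone_def using T(2-4) by (auto simp: inner_add_right)
qed

text \<open>Robinson's reduction: testing against finitely many generators of the tangent cone, the strict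
  inequalities survive a small perturbation and the tight ones lie in the critical cone.\<close>
lemma closest_point_polyhedron_local:
  fixes S :: "'a::euclidean_space set"
  assumes S: "polyhedron S" "S \<noteq> {}"
  shows "\<exists>\<rho>>0. \<forall>h. norm h \<le> \<rho> \<longrightarrow>
     closest_point S (z + h) = closest_point S z + closest_point (critical_cone S z) h"
proof -
  define x where "x = closest_point S z"
  define v where "v = z - x"
  define K where "K = critical_cone S z"
  have cS: "convex S" "closed S" using S(1) polyhedron_imp_convex polyhedron_imp_closed by auto
  have x: "x \<in> S" unfolding x_def using S cS by (intro closest_point_in_set) auto
  note T = tangent_cone_props[OF S(1) x]
  note KK = closest_point_cone[OF critical_cone_props(1-3)[OF S] critical_cone_props(4,5)[OF S], of z, folded K_def]
  have Kdef: "K = tangent_cone S x \<inter> {w. v \<bullet> w = 0}" by (simp add: K_def critical_cone_def x_def v_def)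
  obtain A \<rho>0 where "finite A" "0 \<notin> A" and \<rho>0: "\<rho>0 > 0" and "tangent_cone S x = {v. \<forall>a\<in>A. a \<bullet> v \<le> 0}" and \<rho>0': "\<And>v. v \<in> tangent_cone S x \<Longrightarrow> norm v \<le> \<rho>0 \<Longrightarrow> x + v \<in> S"
    by (rule polyhedron_tangent_cone[OF S(1) x]) (rule that)
  obtain V where V: "finite V" "V \<subseteq> tangent_cone S x"
    "\<forall>u. (\<forall>v\<in>V. u \<bullet> v \<le> 0) \<longrightarrow> (\<forall>t\<in>tangent_cone S x. u \<bullet> t \<le> 0)"
    using polyhedral_cone_generators[OF T(1,3)] by blast
  have vT: "v \<bullet> t \<le> 0" if t: "t \<in> tangent_cone S x" for t
  proof -
    obtain s where s: "s > 0" "x + s *\<^sub>R t \<in> S" using t by (auto simp: tangent_cone_def)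
    have "(z - x) \<bullet> ((x + s *\<^sub>R t) - x) \<le> 0"
      unfolding x_def by (rule closest_point_dot[OF cS]) (use s x_def in auto)
    then show ?thesis using s(1) by (simp add: v_def mult_le_0_iff)
  qed
  define W where "W = {t\<in>V. v \<bullet> t < 0}"
  \<comment> \<open>For t in \<open>W\<close> the slack is -(v \<bullet> t), and the perturbation h
    - k has norm at most 2 \<rho>. The added 1 avoids division by zero.\<close>
  define \<rho> where "\<rho> = Min (insert \<rho>0 ((\<lambda>t. - (v \<bullet> t) / (2 * (norm t + 1))) ` W))"
  have fin: "finite W" using V(1) by (simp add: W_def)
  have pos: "- (v \<bullet> t) / (2 * (norm t + 1)) > 0" if "t \<in> W" for t
    using that by (intro divide_pos_pos) (auto simp: W_def add_nonneg_pos)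
  have \<rho>: "\<rho> > 0" unfolding \<rho>_def using fin pos \<rho>0 by (subst Min_gr_iff) auto
  have \<rho>W: "\<rho> \<le> - (v \<bullet> t) / (2 * (norm t + 1))" if "t \<in> W" for t
    unfolding \<rho>_def using fin that by (intro Min_le) auto
  have \<rho>\<rho>0: "\<rho> \<le> \<rho>0" unfolding \<rho>_def using fin by (intro Min_le) auto
  have "closest_point S (z + h) = x + closest_point K h" if h: "norm h \<le> \<rho>" for h
  proof (rule closest_pointI[OF cS])
    define k where "k = closest_point K h"
    have k: "k \<in> tangent_cone S x" "v \<bullet> k = 0" "(h - k) \<bullet> k = 0" "norm k \<le> norm h"
      using KK(1,2,4)[of h] by (auto simp: k_def Kdef)
    show "x + closest_point K h \<in> S"
      using k \<rho>0' h \<rho>\<rho>0 by (auto simp: k_def[symmetric])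
    fix s assume s: "s \<in> S"
    have pol: "(v + (h - k)) \<bullet> t \<le> 0" if t: "t \<in> V" for t
    proof (cases "t \<in> W")
      case True
      have "(h - k) \<bullet> t \<le> norm (h - k) * norm t" by (rule norm_cauchy_schwarz)
      also have "\<dots> \<le> (2 * \<rho>) * (norm t + 1)"
      proof (rule mult_mono)
        show "norm (h - k) \<le> 2 * \<rho>" using norm_triangle_ineq4[of h k] k(4) h by linarith
      qed (use \<rho> in auto)
      also have "\<dots> \<le> - (v \<bullet> t)"
      proof -
        have p: "2 * (norm t + 1) > 0" by (simp add: add_nonneg_pos)
        have "\<rho> * (2 * (norm t + 1)) \<le> - (v \<bullet> t)" using \<rho>W[OF True] unfolding pos_le_divide_eq[OF p] .
        then show ?thesis by (simp add: algebra_simps)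
      qed
      finally show ?thesis by (simp add: inner_add_left)
    next
      case False
      then have "v \<bullet> t = 0" using vT t V(2) by (force simp: W_def)
      then have "t \<in> K" using t V(2) by (auto simp: Kdef)
      then show ?thesis using KK(3)[of t h] \<open>v \<bullet> t = 0\<close> by (simp add: inner_add_left k_def)
    qed
    have "(v + (h - k)) \<bullet> (s - x) \<le> 0" using V(3) pol T(5)[OF s] by blast
    then have "(v + (h - k)) \<bullet> (s - x - k) \<le> 0"
      using k by (simp add: inner_add_left inner_diff_right)
    then show "(z + h - (x + closest_point K h)) \<bullet> (s - (x + closest_point K h)) \<le> 0"
      by (simp add: v_def k_def[symmetric] algebra_simps)
  qed
  then show ?thesis using \<rho> unfolding x_def K_def by blast
qed

section \<open>The normal manifold\<close>

text \<open>From g the segment can be prolonged beyond the relative interior point \<open>x\<close>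
  inside \<open>G\<close>. The normal inequality at g and at the prolonged end force v to be
  constant on \<open>G\<close>, so v is normal at every point of \<open>G\<close>.\<close>

lemma normal_cone_face:
  fixes S :: "'a::euclidean_space set"
  assumes G: "G face_of S" and x: "x \<in> rel_interior G" and g: "g \<in> G" and v: "v \<in> normal_cone S x"
  shows "v \<bullet> (g - x) = 0" "v \<in> normal_cone S g"
proof -
  have cG: "convex G" and GS: "G \<subseteq> S" using G by (auto simp: face_of_def)
  obtain e where e: "e > 1" "(1 - e) *\<^sub>R g + e *\<^sub>R x \<in> G"
    using x g cG by (metis convex_rel_interior_iff empty_iff)
  have "v \<bullet> (((1 - e) *\<^sub>R g + e *\<^sub>R x) - x) \<le> 0" using v e(2) GS by (auto simp: normal_cone_def)
  moreover have "((1 - e) *\<^sub>R g + e *\<^sub>R x) - x = (1 - e) *\<^sub>R (g - x)" by (simp add: algebra_simps)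
  ultimately have "(1 - e) * (v \<bullet> (g - x)) \<le> 0" by simp
  then have "v \<bullet> (g - x) \<ge> 0" using e(1) by (simp add: mult_le_0_iff)
  moreover have "v \<bullet> (g - x) \<le> 0" using v g GS by (auto simp: normal_cone_def)
  ultimately show *: "v \<bullet> (g - x) = 0" by simp
  have "v \<bullet> (s - g) \<le> 0" if "s \<in> S" for s
  proof -
    have "v \<bullet> (s - g) = v \<bullet> (s - x) - v \<bullet> (g - x)" by (simp add: inner_diff_right)
    then show ?thesis using v that * by (simp add: normal_cone_def)
  qed
  then show "v \<in> normal_cone S g" by (simp add: normal_cone_def)
qed

lemma closest_point_add_normal:
  fixes S :: "'a::euclidean_space set"
  assumes "convex S" "closed S" "g \<in> S" "v \<in> normal_cone S g"
  shows "closest_point S (g + v) = g"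
  by (rule closest_pointI[OF assms(1-3)]) (use assms(4) in \<open>auto simp: normal_cone_def\<close>)

lemma normal_cone_closest_point:
  fixes S :: "'a::euclidean_space set"
  assumes "convex S" "closed S"
  shows "z - closest_point S z \<in> normal_cone S (closest_point S z)"
  using closest_point_dot[OF assms] by (simp add: normal_cone_def)

lemma normal_cone_rel_interior_eq:
  fixes S :: "'a::euclidean_space set"
  assumes "G face_of S" "x \<in> rel_interior G" "y \<in> rel_interior G"
  shows "normal_cone S x = normal_cone S y"
  using normal_cone_face(2)[OF assms(1)] assms rel_interior_subset by blast

text \<open>The description by sums suits convexity; the one by preimages under the continuous
  projection suits closedness.\<close>

lemma cell_eq:
  fixes S :: "'a::euclidean_space set"
  assumes S: "polyhedron S" and G: "G face_of S" and x: "x \<in> rel_interior G"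
  shows "{g + v | g v. g \<in> G \<and> v \<in> normal_cone S x} =
    {z. closest_point S z \<in> G \<and> z - closest_point S z \<in> normal_cone S x}"
proof (intro equalityI subsetI)
  fix z assume "z \<in> {g + v | g v. g \<in> G \<and> v \<in> normal_cone S x}"
  then obtain g v where z: "z = g + v" "g \<in> G" "v \<in> normal_cone S x" by blast
  then have "closest_point S z = g"
    using closest_point_add_normal[of S g v] normal_cone_face(2)[OF G x] S polyhedron_imp_convex
      polyhedron_imp_closed face_of_imp_subset[OF G] by blast
  then show "z \<in> {z. closest_point S z \<in> G \<and> z - closest_point S z \<in> normal_cone S x}" using z by simp
next
  fix z assume z: "z \<in> {z. closest_point S z \<in> G \<and> z - closest_point S z \<in> normal_cone S x}"
  then show "z \<in> {g + v | g v. g \<in> G \<and> v \<in> normal_cone S x}"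
    by (intro CollectI exI[of _ "closest_point S z"] exI[of _ "z - closest_point S z"]) auto
qed

lemma normal_manifoldE:
  fixes S :: "'a::euclidean_space set"
  assumes S: "polyhedron S" and Q: "Q \<in> normal_manifold S"
  shows "\<exists>G x. G face_of S \<and> x \<in> rel_interior G \<and> x \<in> G \<and>
    Q = {g + v | g v. g \<in> G \<and> v \<in> normal_cone S x} \<and>
    Q = {z. closest_point S z \<in> G \<and> z - closest_point S z \<in> normal_cone S x}"
proof -
  obtain G x where *: "G face_of S" "x \<in> rel_interior G" "Q = {g + v | g v. g \<in> G \<and> v \<in> normal_cone S x}"
    using Q unfolding normal_manifold_def by blast
  then show ?thesis using cell_eq[OF S *(1,2)] rel_interior_subset[of G] by blast
qed

lemma closed_normal_cone: "closed (normal_cone S x)"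
proof -
  have "normal_cone S x = (\<Inter>s\<in>S. {v. (s - x) \<bullet> v \<le> 0})"
    by (auto simp: normal_cone_def inner_commute)
  then show ?thesis by (auto intro: closed_INT closed_halfspace_le)
qed

lemma convex_normal_cone: "convex (normal_cone S x)"
proof -
  have "normal_cone S x = (\<Inter>s\<in>S. {v. (s - x) \<bullet> v \<le> 0})"
    by (auto simp: normal_cone_def inner_commute)
  then show ?thesis by (auto intro: convex_INT convex_halfspace_le)
qed

lemma normal_manifold_finite:
  fixes S :: "'a::euclidean_space set"
  assumes S: "polyhedron S"
  shows "finite (normal_manifold S)"
proof -
  \<comment> \<open>The normal cone is the same at all relative interior points, so the choice is
    harmless and a cell is a function of its face, of which there are finitely many.\<close>
  let ?f = "\<lambda>G. {g + v | g v. g \<in> G \<and> v \<in> normal_cone S (SOME x. x \<in> rel_interior G)}"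
  have "normal_manifold S \<subseteq> ?f ` {G. G face_of S}"
  proof
    fix Q assume "Q \<in> normal_manifold S"
    then obtain G x where *: "G face_of S" "x \<in> rel_interior G" "Q = {g + v | g v. g \<in> G \<and> v \<in> normal_cone S x}"
      unfolding normal_manifold_def by blast
    have "(SOME x. x \<in> rel_interior G) \<in> rel_interior G" using *(2) by (rule someI)
    then have "Q = ?f G" using normal_cone_rel_interior_eq[OF *(1,2)] *(3) by simp
    then show "Q \<in> ?f ` {G. G face_of S}" using *(1) by blast
  qed
  then show ?thesis using finite_polyhedron_faces[OF S] by (meson finite_imageI finite_subset)
qed

lemma normal_manifold_closed:
  fixes S :: "'a::euclidean_space set"
  assumes S: "polyhedron S" and Q: "Q \<in> normal_manifold S"
  shows "closed Q"
proof -
  obtain G x where G: "G face_of S" "x \<in> rel_interior G" "x \<in> G"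
    "Q = {z. closest_point S z \<in> G \<and> z - closest_point S z \<in> normal_cone S x}"
    using normal_manifoldE[OF S Q] by blast
  have "S \<noteq> {}" using G face_of_imp_subset by blast
  then have c: "continuous_on UNIV (closest_point S)"
    using S by (intro continuous_on_closest_point polyhedron_imp_convex polyhedron_imp_closed)
  have "closed G" using face_of_polyhedron_polyhedron[OF S G(1)] polyhedron_imp_closed by blast
  then have "closed (closest_point S -` G)" "closed ((\<lambda>z. z - closest_point S z) -` normal_cone S x)"
    by (auto intro!: closed_vimage closed_normal_cone c continuous_on_diff continuous_on_id)
  moreover have "Q = closest_point S -` G \<inter> (\<lambda>z. z - closest_point S z) -` normal_cone S x"
    using G(4) by auto
  ultimately show ?thesis by auto
qed

text \<open>A convex combination of decompositions g + v is again such a decomposition, and the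
  decomposition determines the projection. Hence the projection is affine along segments in a
  cell.\<close>

lemma normal_manifold_convex:
  fixes S :: "'a::euclidean_space set"
  assumes S: "polyhedron S" and Q: "Q \<in> normal_manifold S"
    and z: "z \<in> Q" "z' \<in> Q" and t: "0 \<le> t" "t \<le> 1"
  shows "(1 - t) *\<^sub>R z + t *\<^sub>R z' \<in> Q"
    "closest_point S ((1 - t) *\<^sub>R z + t *\<^sub>R z') = (1 - t) *\<^sub>R closest_point S z + t *\<^sub>R closest_point S z'"
proof -
  obtain G x where G: "G face_of S" "x \<in> rel_interior G"
    "Q = {g + v | g v. g \<in> G \<and> v \<in> normal_cone S x}"
    "Q = {z. closest_point S z \<in> G \<and> z - closest_point S z \<in> normal_cone S x}"
    using normal_manifoldE[OF S Q] by blast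
  define g where "g = (1 - t) *\<^sub>R closest_point S z + t *\<^sub>R closest_point S z'"
  define v where "v = (1 - t) *\<^sub>R (z - closest_point S z) + t *\<^sub>R (z' - closest_point S z')"
  have zz: "closest_point S z \<in> G" "z - closest_point S z \<in> normal_cone S x"
    "closest_point S z' \<in> G" "z' - closest_point S z' \<in> normal_cone S x"
    using z G(4) by auto
  have gG: "g \<in> G" unfolding g_def
    using zz t G(1) by (intro convexD) (auto simp: face_of_def)
  have vN: "v \<in> normal_cone S x" unfolding v_def
    using zz t by (intro convexD[OF convex_normal_cone]) auto
  have eq: "(1 - t) *\<^sub>R z + t *\<^sub>R z' = g + v" by (simp add: g_def v_def algebra_simps)
  show "(1 - t) *\<^sub>R z + t *\<^sub>R z' \<in> Q" unfolding eq G(3) using gG vN by blast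
  show "closest_point S ((1 - t) *\<^sub>R z + t *\<^sub>R z') = (1 - t) *\<^sub>R closest_point S z + t *\<^sub>R closest_point S z'"
    unfolding eq g_def[symmetric]
    by (rule closest_point_add_normal[OF polyhedron_imp_convex[OF S] polyhedron_imp_closed[OF S] _ normal_cone_face(2)[OF G(1,2) gG vN]])
      (rule subsetD[OF face_of_imp_subset[OF G(1)] gG])
qed

text \<open>Take a minimal face containing \<open>x\<close>: were \<open>x\<close> on its relative
  boundary, a facet of it would be a smaller face containing \<open>x\<close>.\<close>

lemma polyhedron_face_rel_interior:
  fixes S :: "'a::euclidean_space set"
  assumes S: "polyhedron S" and x: "x \<in> S"
  shows "\<exists>G. G face_of S \<and> x \<in> rel_interior G"
proof -
  let ?F = "{G. G face_of S \<and> x \<in> G}"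
  have "finite ?F" using finite_polyhedron_faces[OF S] by (rule rev_finite_subset) auto
  have "S \<in> ?F" using x face_of_refl[OF polyhedron_imp_convex[OF S]] by simp
  then have "?F \<noteq> {}" by blast
  from finite_has_minimal[OF \<open>finite ?F\<close> this]
  obtain G where G: "G \<in> ?F" "\<And>H. H \<in> ?F \<Longrightarrow> H \<subseteq> G \<Longrightarrow> G = H" by blast
  have "x \<in> rel_interior G"
  proof (rule ccontr)
    assume "x \<notin> rel_interior G"
    then have "x \<in> \<Union>{F. F facet_of G}"
      using rel_boundary_of_polyhedron[OF face_of_polyhedron_polyhedron[OF S]] G(1) by blast
    then obtain F where F: "F facet_of G" "x \<in> F" by blast
    then have "F face_of G" "aff_dim F = aff_dim G - 1" by (auto simp: facet_of_def)
    then have "F \<in> ?F" "F \<subseteq> G" using G(1) F(2) face_of_trans face_of_imp_subset by blast+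
    then have "G = F" by (rule G(2))
    then show False using \<open>aff_dim F = aff_dim G - 1\<close> by simp
  qed
  then show ?thesis using G(1) by blast
qed

lemma normal_manifold_covers:
  fixes S :: "'a::euclidean_space set"
  assumes S: "polyhedron S" "S \<noteq> {}"
  shows "\<exists>Q\<in>normal_manifold S. z \<in> Q"
proof -
  have "closest_point S z \<in> S" using S polyhedron_imp_closed by (intro closest_point_in_set) auto
  from polyhedron_face_rel_interior[OF S(1) this]
  obtain G where G: "G face_of S" "closest_point S z \<in> rel_interior G" by blast
  have "closest_point S z \<in> G" using G(2) rel_interior_subset by blast
  moreover have "z - closest_point S z \<in> normal_cone S (closest_point S z)"
    using S(1) by (intro normal_cone_closest_point polyhedron_imp_convex polyhedron_imp_closed)
  ultimately have "z \<in> {z'. closest_point S z' \<in> G \<and> z' - closest_point S z' \<in> normal_cone S (closest_point S z)}"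
    by simp
  then have "z \<in> {g + v | g v. g \<in> G \<and> v \<in> normal_cone S (closest_point S z)}"
    unfolding cell_eq[OF S(1) G] .
  moreover have "{g + v | g v. g \<in> G \<and> v \<in> normal_cone S (closest_point S z)} \<in> normal_manifold S"
    unfolding normal_manifold_def
    by (intro CollectI exI[of _ G] exI[of _ "closest_point S z"] conjI G refl) (use \<open>closest_point S z \<in> G\<close> in auto)
  ultimately show ?thesis by (rule bexI)
qed

text \<open>A normal to a hyperplane containing the cell would be orthogonal to the normal cone, hence lie in
  the lineality space of its polar, the tangent cone, whose directions also belong to the cell.\<close>
lemma normal_manifold_interior_nonempty:
  fixes S :: "'a::euclidean_space set"
  assumes S: "polyhedron S" and Q: "Q \<in> normal_manifold S"
  shows "interior Q \<noteq> {}"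
proof
  assume int: "interior Q = {}"
  obtain G x where G: "G face_of S" "x \<in> rel_interior G" "x \<in> G"
    "Q = {g + v | g v. g \<in> G \<and> v \<in> normal_cone S x}"
    using normal_manifoldE[OF S Q] by blast
  have x: "x \<in> S" using G(1,3) face_of_imp_subset by blast
  have "convex Q" using normal_manifold_convex(1)[OF S Q] by (auto simp: convex_alt)
  then obtain a b where ab: "a \<noteq> 0" "Q \<subseteq> {y. a \<bullet> y = b}"
    using empty_interior_subset_hyperplane[OF _ int] by metis
  note T = tangent_cone_props[OF S x]
  have N0: "0 \<in> normal_cone S x" by (simp add: normal_cone_def)
  have xQ: "x \<in> Q" unfolding G(4) using G(3) N0 by (intro CollectI exI[of _ x] exI[of _ 0]) auto
  have aN: "a \<bullet> v = 0" if v: "v \<in> normal_cone S x" for v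
  proof -
    have "x + v \<in> Q" unfolding G(4) using G(3) v by blast
    then have "a \<bullet> (x + v) = a \<bullet> x" using ab(2) xQ by auto
    then show ?thesis by (simp add: inner_add_right)
  qed
  \<comment> \<open>If k is the projection of c onto the tangent cone, then c - k is a normal, so c
    is orthogonal to it; k is orthogonal to it as well, hence c = k.\<close>
  have bipolar: "c \<in> tangent_cone S x" if c: "\<And>v. v \<in> normal_cone S x \<Longrightarrow> c \<bullet> v = 0" for c
  proof -
    define k where "k = closest_point (tangent_cone S x) c"
    note K = closest_point_cone[OF polyhedron_imp_convex[OF T(1)] polyhedron_imp_closed[OF T(1)] T(2) T(3) T(4), where h=c, folded k_def]
    have "c - k \<in> normal_cone S x" unfolding normal_cone_def using K(3) T(5) by blast
    then have "c \<bullet> (c - k) = 0" by (rule c)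
    moreover have "(c - k) \<bullet> k = 0" by (rule K(2))
    ultimately have "(c - k) \<bullet> (c - k) = 0" by (simp add: inner_diff_left inner_diff_right inner_commute)
    then show ?thesis using K(1) by simp
  qed
  have "a \<in> tangent_cone S x" "- a \<in> tangent_cone S x" using aN by (auto intro!: bipolar)
  then obtain s t where st: "s > 0" "x + s *\<^sub>R a \<in> S" "t > 0" "x - t *\<^sub>R a \<in> S"
    unfolding tangent_cone_def by auto
  \<comment> \<open>\<open>x\<close> is an inner point of a segment in \<open>S\<close> parallel to
    \<open>a\<close>. By the face property its ends lie in \<open>G\<close> and so in
    \<open>Q\<close>, which cannot be inside a hyperplane with normal \<open>a\<close>.\<close>
  have "x \<in> open_segment (x + s *\<^sub>R a) (x - t *\<^sub>R a)"
  proof -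
    have "x + s *\<^sub>R a \<noteq> x - t *\<^sub>R a"
    proof
      assume "x + s *\<^sub>R a = x - t *\<^sub>R a"
      then have "(s + t) *\<^sub>R a = 0" by (simp add: algebra_simps)
      then show False using ab(1) st by simp
    qed
    moreover have "x = (1 - s / (s + t)) *\<^sub>R (x + s *\<^sub>R a) + (s / (s + t)) *\<^sub>R (x - t *\<^sub>R a)"
    proof -
      have "(1 - s / (s + t)) * s = s / (s + t) * t" using st by (simp add: field_simps)
      then have "((1 - s / (s + t)) * s) *\<^sub>R a = (s / (s + t) * t) *\<^sub>R a" by simp
      then show ?thesis by (simp add: scaleR_add_right scaleR_diff_right scaleR_left_diff_distrib del: times_divide_eq_left times_divide_eq_right)
    qed
    moreover have "0 < s / (s + t)" "s / (s + t) < 1" using st by auto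
    ultimately show ?thesis unfolding in_segment(2) by blast
  qed
  then have "x + s *\<^sub>R a \<in> G" using face_ofD[OF G(1) _ st(2,4) G(3)] by blast
  then have "x + s *\<^sub>R a \<in> Q"
    unfolding G(4) using N0 by (intro CollectI exI[of _ "x + s *\<^sub>R a"] exI[of _ 0]) auto
  then have "a \<bullet> (x + s *\<^sub>R a) = a \<bullet> x" using ab(2) xQ by auto
  then show False using st(1) ab(1) by (simp add: inner_add_right)
qed

text \<open>A small move of \<open>z\<close> along g - x stays in \<open>Q\<close>, hence equals g'
  + v'. The vector v - v' is a combination of directions of \<open>G\<close> and also orthogonal to
  all of them, so it is 0. Then g lies on the segment from \<open>x\<close> to g' short of g', which
  is in the relative interior.\<close>

lemma normal_manifold_interior_rel_interior:
  fixes S :: "'a::euclidean_space set"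
  assumes S: "polyhedron S" and G: "G face_of S" "x \<in> rel_interior G"
    and Q: "Q = {z. closest_point S z \<in> G \<and> z - closest_point S z \<in> normal_cone S x}"
    and z: "z \<in> interior Q"
  shows "closest_point S z \<in> rel_interior G"
proof -
  define g where "g = closest_point S z"
  define v where "v = z - g"
  have gv: "g \<in> G" "v \<in> normal_cone S x" using z interior_subset Q by (auto simp: g_def v_def)
  obtain e where e: "e > 0" "ball z e \<subseteq> Q" using z unfolding mem_interior by blast
  define \<epsilon> where "\<epsilon> = e / (2 * (norm (g - x) + 1))"
  have n: "norm (g - x) + 1 > 0" by (simp add: add_nonneg_pos)
  have \<epsilon>: "\<epsilon> > 0" using e n by (simp add: \<epsilon>_def)
  have "\<epsilon> * norm (g - x) < e"
  proof -
    have "\<epsilon> * norm (g - x) \<le> \<epsilon> * (norm (g - x) + 1)" using \<epsilon> by (intro mult_left_mono) auto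
    also have "\<dots> = e / 2"
    proof -
      have "e / (2 * m) * m = e / 2" if "m > 0" for m :: real using that by (simp add: field_simps)
      from this[OF n] show ?thesis unfolding \<epsilon>_def .
    qed
    also have "\<dots> < e" using e by simp
    finally show ?thesis .
  qed
  then have "z + \<epsilon> *\<^sub>R (g - x) \<in> ball z e" using \<epsilon> by (simp add: dist_norm)
  then have "z + \<epsilon> *\<^sub>R (g - x) \<in> Q" using e(2) by blast
  then obtain g' v' where g': "g' \<in> G" "v' \<in> normal_cone S x" "z + \<epsilon> *\<^sub>R (g - x) = g' + v'"
    unfolding Q cell_eq[OF S G, symmetric] by blast
  define d where "d = v - v'"
  have d: "d = (g' - x) - (1 + \<epsilon>) *\<^sub>R (g - x)"
    using g'(3) by (simp add: d_def v_def algebra_simps)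
  have "d \<bullet> (y - x) = 0" if "y \<in> G" for y
    using normal_cone_face(1)[OF G that gv(2)] normal_cone_face(1)[OF G that g'(2)] by (simp add: d_def inner_diff_left)
  then have "d \<bullet> ((g' - x) - (1 + \<epsilon>) *\<^sub>R (g - x)) = 0"
    using g'(1) gv(1) by (simp only: inner_diff_right[of d "g' - x"] inner_scaleR_right)
  then have "d = 0" using d by (metis inner_eq_zero_iff)
  then have "g' - x = (1 + \<epsilon>) *\<^sub>R (g - x)" using d by simp
  then have "g = g' - (\<epsilon> / (1 + \<epsilon>)) *\<^sub>R (g' - x)"
  proof -
    assume *: "g' - x = (1 + \<epsilon>) *\<^sub>R (g - x)"
    have "(\<epsilon> / (1 + \<epsilon>)) *\<^sub>R (g' - x) = \<epsilon> *\<^sub>R (g - x)" unfolding * using \<epsilon> by simp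
    moreover have "g' = x + (1 + \<epsilon>) *\<^sub>R (g - x)" using * by (simp add: diff_eq_eq add.commute)
    ultimately show ?thesis by (simp add: scaleR_add_left)
  qed
  moreover have "g' - (\<epsilon> / (1 + \<epsilon>)) *\<^sub>R (g' - x) \<in> rel_interior G"
    using \<epsilon> G g'(1) by (intro rel_interior_convex_shrink) (auto simp: face_of_def)
  ultimately show ?thesis by (simp add: g_def)
qed

text \<open>The projection of a common interior point would be in the relative interiors of both
  faces, and distinct faces have disjoint relative interiors.\<close>

lemma normal_manifold_interior_disjoint:
  fixes S :: "'a::euclidean_space set"
  assumes S: "polyhedron S" and Q: "Q \<in> normal_manifold S" "Q' \<in> normal_manifold S"
    and z: "z \<in> interior Q" "z \<in> interior Q'"
  shows "Q = Q'"
proof -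
  obtain G x where G: "G face_of S" "x \<in> rel_interior G"
    "Q = {z. closest_point S z \<in> G \<and> z - closest_point S z \<in> normal_cone S x}"
    using normal_manifoldE[OF S Q(1)] by blast
  obtain G' x' where G': "G' face_of S" "x' \<in> rel_interior G'"
    "Q' = {z. closest_point S z \<in> G' \<and> z - closest_point S z \<in> normal_cone S x'}"
    using normal_manifoldE[OF S Q(2)] by blast
  have "closest_point S z \<in> rel_interior G" "closest_point S z \<in> rel_interior G'"
    using normal_manifold_interior_rel_interior[OF S G z(1)] normal_manifold_interior_rel_interior[OF S G' z(2)] by auto
  then have "G = G'" using face_of_eq[OF G(1) G'(1)] by blast
  then show ?thesis using normal_cone_rel_interior_eq[OF G(1,2)] G'(2) G(3) G'(3) by auto
qed

lemma polyhedron_affine_vimage: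
  fixes C :: "'a::euclidean_space set" and B :: "'b::euclidean_space \<Rightarrow> 'a"
  assumes C: "polyhedron C" and B: "linear B"
  shows "polyhedron {z. c + B z \<in> C}"
proof -
  obtain F where F: "finite F" "C = \<Inter>F" "\<forall>h\<in>F. \<exists>a b. a \<noteq> 0 \<and> h = {x. a \<bullet> x \<le> b}"
    using C unfolding polyhedron_def by auto
  have "polyhedron {z. c + B z \<in> h}" if hF: "h \<in> F" for h
  proof -
    obtain a b where h: "h = {x. a \<bullet> x \<le> b}" using F(3) hF by blast
    have "{z. c + B z \<in> h} = {z. adjoint B a \<bullet> z \<le> b - a \<bullet> c}"
      unfolding h using adjoint_works[OF B] by (auto simp: inner_add_right inner_commute algebra_simps)
    then show ?thesis by (simp add: polyhedron_halfspace_le)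
  qed
  then have "polyhedron (\<Inter>h\<in>F. {z. c + B z \<in> h})" using F(1) by (intro polyhedron_Inter) auto
  moreover have "{z. c + B z \<in> C} = (\<Inter>h\<in>F. {z. c + B z \<in> h})" using F(2) by auto
  ultimately show ?thesis by simp
qed

text \<open>The normal cone is the polar of the tangent cone, so finitely many generators of the
  latter define it.\<close>

lemma polyhedron_normal_cone:
  fixes S :: "'a::euclidean_space set"
  assumes S: "polyhedron S" and x: "x \<in> S"
  shows "polyhedron (normal_cone S x)"
proof -
  note T = tangent_cone_props[OF S x]
  obtain V where V: "finite V" "V \<subseteq> tangent_cone S x"
    "\<forall>u. (\<forall>v\<in>V. u \<bullet> v \<le> 0) \<longrightarrow> (\<forall>t\<in>tangent_cone S x. u \<bullet> t \<le> 0)"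
    using polyhedral_cone_generators[OF T(1,3)] by blast
  have "normal_cone S x = (\<Inter>v\<in>V. {u. v \<bullet> u \<le> 0})"
  proof (intro equalityI subsetI)
    fix u assume u: "u \<in> normal_cone S x"
    show "u \<in> (\<Inter>v\<in>V. {u. v \<bullet> u \<le> 0})"
    proof (intro INT_I CollectI)
      fix v assume "v \<in> V"
      then obtain s where s: "s > 0" "x + s *\<^sub>R v \<in> S" using V(2) by (auto simp: tangent_cone_def)
      then have "u \<bullet> ((x + s *\<^sub>R v) - x) \<le> 0" using u unfolding normal_cone_def by blast
      then show "v \<bullet> u \<le> 0" using s(1) by (simp add: mult_le_0_iff inner_commute)
    qed
  next
    fix u assume "u \<in> (\<Inter>v\<in>V. {u. v \<bullet> u \<le> 0})"
    then have "\<forall>v\<in>V. u \<bullet> v \<le> 0" by (auto simp: inner_commute)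
    then show "u \<in> normal_cone S x" unfolding normal_cone_def using V(3) T(5) by blast
  qed
  then show ?thesis using V(1) by (auto intro!: polyhedron_Inter polyhedron_halfspace_le)
qed

text \<open>\<open>Q\<close> is the intersection of two affine preimages of polyhedra. The affine
  map is known to be the projection on \<open>Q\<close> only; the converse inclusion therefore uses
  that every point is the sum of its image and the remainder.\<close>

lemma normal_manifold_polyhedron:
  fixes S :: "'a::euclidean_space set"
  assumes S: "polyhedron S" and Q: "Q \<in> normal_manifold S"
    and B: "linear B" and aff: "\<And>z. z \<in> Q \<Longrightarrow> closest_point S z = p + B (z - y)"
  shows "polyhedron Q"
proof -
  obtain G x where G: "G face_of S" "x \<in> rel_interior G" "x \<in> G"
    "Q = {g + v | g v. g \<in> G \<and> v \<in> normal_cone S x}"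
    "Q = {z. closest_point S z \<in> G \<and> z - closest_point S z \<in> normal_cone S x}"
    using normal_manifoldE[OF S Q] by blast
  have x: "x \<in> S" using G(1,3) face_of_imp_subset by blast
  have eq: "p + B (z - y) = (p - B y) + B z" "z - (p + B (z - y)) = (B y - p) + (z - B z)" for z
    using B by (auto simp: linear_diff algebra_simps)
  have "Q = {z. (p - B y) + B z \<in> G} \<inter> {z. (B y - p) + (z - B z) \<in> normal_cone S x}"
  proof (intro equalityI subsetI)
    fix z assume z: "z \<in> Q"
    then have "closest_point S z \<in> G \<and> z - closest_point S z \<in> normal_cone S x"
      unfolding G(5) by simp
    then show "z \<in> {z. (p - B y) + B z \<in> G} \<inter> {z. (B y - p) + (z - B z) \<in> normal_cone S x}"
      unfolding aff[OF z] eq(2)[symmetric] unfolding eq(1) by simp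
  next
    fix z assume "z \<in> {z. (p - B y) + B z \<in> G} \<inter> {z. (B y - p) + (z - B z) \<in> normal_cone S x}"
    then show "z \<in> Q" unfolding G(4)
      by (intro CollectI exI[of _ "(p - B y) + B z"] exI[of _ "(B y - p) + (z - B z)"]) auto
  qed
  moreover have "polyhedron {z. (p - B y) + B z \<in> G}"
    by (rule polyhedron_affine_vimage[OF face_of_polyhedron_polyhedron[OF S G(1)] B])
  moreover have "polyhedron {z. (B y - p) + (z - B z) \<in> normal_cone S x}"
    by (rule polyhedron_affine_vimage[OF polyhedron_normal_cone[OF S x]]) (intro linear_compose_sub linear_id B; simp add: linear_id[unfolded id_def])
  ultimately show ?thesis by simp
qed

section \<open>B-derivatives\<close>

text \<open>Homogeneity cancels the step length, so \<open>G\<close> is recovered from one-sided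
  difference quotients along rays. This is the uniqueness behind the \<open>THE\<close> in
  \<open>B_deriv\<close>.\<close>

lemma has_B_derivative_quotient:
  fixes g :: "'a::euclidean_space \<Rightarrow> 'b::euclidean_space"
  assumes "has_B_derivative g G x"
  shows "((\<lambda>t. (g (x + t *\<^sub>R d) - g x) /\<^sub>R t) \<longlongrightarrow> G d) (at_right 0)"
proof (cases "d = 0")
  case True
  \<comment> \<open>Homogeneity is given for positive factors only; the factor 2 forces G 0 =
    0.\<close>
  have "G (2 *\<^sub>R 0) = 2 *\<^sub>R G 0" using assms unfolding has_B_derivative_def by (metis zero_less_numeral)
  then have "G 0 = 0" by (simp add: scaleR_2)
  then show ?thesis using True by simp
next
  case False
  have lim: "((\<lambda>v. (g (x + v) - g x - G v) /\<^sub>R norm v) \<longlongrightarrow> 0) (at 0)"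
    and hom: "\<And>t v. t > 0 \<Longrightarrow> G (t *\<^sub>R v) = t *\<^sub>R G v"
    using assms unfolding has_B_derivative_def by auto
  have "filterlim (\<lambda>t. t *\<^sub>R d) (at 0) (at_right 0)"
    unfolding filterlim_at
  proof
    show "((\<lambda>t. t *\<^sub>R d) \<longlongrightarrow> 0) (at_right 0)"
      by (rule tendsto_eq_intros) (auto intro!: tendsto_eq_intros)
    show "\<forall>\<^sub>F t in at_right 0. t *\<^sub>R d \<in> UNIV \<and> t *\<^sub>R d \<noteq> 0"
      using eventually_at_right_less[of "0::real"] by eventually_elim (use False in auto)
  qed
  from filterlim_compose[OF lim this]
  have lim1: "((\<lambda>t. norm d *\<^sub>R ((g (x + t *\<^sub>R d) - g x - G (t *\<^sub>R d)) /\<^sub>R norm (t *\<^sub>R d))) \<longlongrightarrow> norm d *\<^sub>R 0) (at_right 0)"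
    by (intro tendsto_scaleR tendsto_const)
  have "\<forall>\<^sub>F t in at_right 0. norm d *\<^sub>R ((g (x + t *\<^sub>R d) - g x - G (t *\<^sub>R d)) /\<^sub>R norm (t *\<^sub>R d)) =
      (g (x + t *\<^sub>R d) - g x) /\<^sub>R t - G d"
    using eventually_at_right_less[of "0::real"]
  proof eventually_elim
    case (elim t)
    have *: "norm d *\<^sub>R (u /\<^sub>R norm (t *\<^sub>R d)) = u /\<^sub>R t" for u :: 'b
      using elim False by simp
    show ?case unfolding * using elim hom[OF elim] by (simp add: scaleR_diff_right)
  qed
  from Lim_transform_eventually[OF lim1 this]
  have "((\<lambda>t. (g (x + t *\<^sub>R d) - g x) /\<^sub>R t - G d) \<longlongrightarrow> 0) (at_right 0)" by simp
  then show ?thesis by (simp add: LIM_zero_iff)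
qed

lemma has_B_derivative_unique:
  fixes g :: "'a::euclidean_space \<Rightarrow> 'b::euclidean_space"
  assumes "has_B_derivative g G x" "has_B_derivative g H x"
  shows "G = H"
proof
  fix d
  show "G d = H d"
    by (rule tendsto_unique[OF _ has_B_derivative_quotient[OF assms(1)] has_B_derivative_quotient[OF assms(2)]]) simp
qed

lemma B_deriv_eq:
  fixes g :: "'a::euclidean_space \<Rightarrow> 'b::euclidean_space"
  assumes "has_B_derivative g G x"
  shows "B_deriv g x = G"
  unfolding B_deriv_def using assms has_B_derivative_unique by blast

lemma has_B_derivative_ray:
  fixes g :: "'a::euclidean_space \<Rightarrow> 'b::euclidean_space"
  assumes "has_B_derivative g G x" "\<And>t. 0 \<le> t \<Longrightarrow> t \<le> 1 \<Longrightarrow> g (x + t *\<^sub>R d) = g x + t *\<^sub>R e"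
  shows "G d = e"
proof -
  have "((\<lambda>t. (g (x + t *\<^sub>R d) - g x) /\<^sub>R t) \<longlongrightarrow> e) (at_right 0)"
  proof (rule tendsto_eventually)
    show "\<forall>\<^sub>F t in at_right 0. (g (x + t *\<^sub>R d) - g x) /\<^sub>R t = e"
      using eventually_at_right_real[of 0 1] by (auto elim!: eventually_mono simp: assms(2))
  qed
  then show ?thesis
    using tendsto_unique[OF _ has_B_derivative_quotient[OF assms(1)]] by (metis trivial_limit_at_right_real)
qed

lemma lipschitz_on_closest_point:
  fixes S :: "'a::euclidean_space set"
  assumes "convex S" "closed S" "S \<noteq> {}"
  shows "1-lipschitz_on U (closest_point S)"
  using closest_point_lipschitz[OF assms] by (auto intro!: lipschitz_onI)

text \<open>The local reduction is exact, so the remainder vanishes identically for small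
  directions.\<close>

lemma closest_point_has_B_derivative:
  fixes S :: "'a::euclidean_space set"
  assumes S: "polyhedron S" "S \<noteq> {}"
  shows "has_B_derivative (closest_point S) (closest_point (critical_cone S z)) z"
proof -
  have cS: "convex S" "closed S" using S polyhedron_imp_convex polyhedron_imp_closed by auto
  note KK = closest_point_cone[OF critical_cone_props(1-3)[OF S] critical_cone_props(4,5)[OF S], of z]
  obtain \<rho> where \<rho>: "\<rho> > 0" "\<And>h. norm h \<le> \<rho> \<Longrightarrow>
     closest_point S (z + h) = closest_point S z + closest_point (critical_cone S z) h"
    using closest_point_polyhedron_local[OF S] by blast
  have "\<forall>\<^sub>F v in at 0. (closest_point S (z + v) - closest_point S z - closest_point (critical_cone S z) v) /\<^sub>R norm v = 0"
    unfolding eventually_at using \<rho> by (auto intro!: exI[of _ \<rho>])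
  then have "((\<lambda>v. (closest_point S (z + v) - closest_point S z - closest_point (critical_cone S z) v) /\<^sub>R norm v) \<longlongrightarrow> 0) (at 0)"
    by (rule tendsto_eventually)
  then show ?thesis unfolding has_B_derivative_def
    using lipschitz_on_closest_point[OF cS S(2), of UNIV] KK(5) by (auto intro!: exI[of _ UNIV])
qed

text \<open>Exactness of the local reduction cancels the terms outside \<open>f\<close>. What
  remains is the remainder of \<open>f\<close> at a displacement that is no longer than the given
  one, because the projection onto a cone does not increase the norm.\<close>

lemma normal_map_has_B_derivative:
  fixes S :: "'a::euclidean_space set" and f :: "'a \<Rightarrow> 'a"
  assumes S: "polyhedron S" "S \<noteq> {}" and U: "open U" "closest_point S z \<in> U" "C-lipschitz_on U f"
    and f: "(f has_derivative J) (at (closest_point S z))"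
  shows "has_B_derivative (normal_map f S)
    (\<lambda>h. J (closest_point (critical_cone S z) h) + h - closest_point (critical_cone S z) h) z"
proof -
  define x where "x = closest_point S z"
  define K where "K = critical_cone S z"
  have cS: "convex S" "closed S" using S polyhedron_imp_convex polyhedron_imp_closed by auto
  note KK = closest_point_cone[OF critical_cone_props(1-3)[OF S] critical_cone_props(4,5)[OF S], of z, folded K_def]
  have J: "linear J" using f has_derivative_linear by blast
  obtain \<rho> where \<rho>: "\<rho> > 0" "\<And>h. norm h \<le> \<rho> \<Longrightarrow> closest_point S (z + h) = x + closest_point K h"
    using closest_point_polyhedron_local[OF S, of z] unfolding x_def K_def by blast
  have lip: "1-lipschitz_on W (closest_point S)" for W by (rule lipschitz_on_closest_point[OF cS S(2)])
  have cont: "continuous_on UNIV (closest_point S)" by (rule continuous_on_closest_point[OF cS S(2)])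
  let ?V = "closest_point S -` U"
  have "open ?V" by (rule open_vimage[OF U(1) cont])
  moreover have "(C * 1 + 1 + 1)-lipschitz_on ?V (normal_map f S)"
    unfolding normal_map_def
  proof (intro lipschitz_on_add lipschitz_on_diff lip)
    show "(C * 1)-lipschitz_on ?V (\<lambda>z. f (closest_point S z))"
      by (rule lipschitz_on_compose2[OF lip lipschitz_on_subset[OF U(3)]]) auto
    show "1-lipschitz_on ?V (\<lambda>z. z)" by (auto intro: lipschitz_onI)
  qed
  moreover have "((\<lambda>v. (normal_map f S (z + v) - normal_map f S z - (J (closest_point K v) + v - closest_point K v)) /\<^sub>R norm v) \<longlongrightarrow> 0) (at 0)"
  proof (rule tendstoI)
    fix e :: real assume e: "0 < e"
    have fd: "\<forall>e>0. \<exists>d>0. \<forall>y. norm (y - x) < d \<longrightarrow> norm (f y - f x - J (y - x)) \<le> e * norm (y - x)"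
      using f unfolding has_derivative_at_alt x_def[symmetric] by blast
    obtain d where d: "d > 0" "\<And>y. norm (y - x) < d \<Longrightarrow> norm (f y - f x - J (y - x)) \<le> (e / 2) * norm (y - x)"
      using fd[rule_format, of "e / 2"] e by auto
    have "\<forall>\<^sub>F v in at (0::'a). norm v < min d \<rho> \<and> v \<noteq> 0"
      unfolding eventually_at using d \<rho> by (auto intro!: exI[of _ "min d \<rho>"])
    then show "\<forall>\<^sub>F v in at 0. dist ((normal_map f S (z + v) - normal_map f S z - (J (closest_point K v) + v - closest_point K v)) /\<^sub>R norm v) 0 < e"
    proof eventually_elim
      case (elim v)
      let ?k = "closest_point K v"
      have k: "norm ?k \<le> norm v" by (rule KK(4))
      let ?r = "normal_map f S (z + v) - normal_map f S z - (J ?k + v - ?k)"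
      have "?r = f (x + ?k) - f x - J ?k"
        using elim by (simp add: normal_map_def \<rho>(2) x_def[symmetric])
      moreover have "norm (f (x + ?k) - f x - J ?k) \<le> (e / 2) * norm ?k"
        using d(2)[of "x + ?k"] elim k by simp
      moreover have "(e / 2) * norm ?k \<le> (e / 2) * norm v" using k e by (intro mult_left_mono) auto
      moreover have "(e / 2) * norm v < e * norm v" using elim e by simp
      ultimately have "norm ?r < e * norm v" by (metis order.strict_trans1)
      moreover have "dist (?r /\<^sub>R norm v) 0 = norm ?r / norm v" by (simp add: divide_inverse_commute)
      ultimately show ?case using elim by (simp add: pos_divide_less_eq)
    qed
  qed
  moreover have "J (closest_point K (t *\<^sub>R v)) + t *\<^sub>R v - closest_point K (t *\<^sub>R v) = t *\<^sub>R (J (closest_point K v) + v - closest_point K v)" if "t > 0" for t v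
    using KK(5)[of t v] that J by (simp add: linear_scale algebra_simps)
  ultimately show ?thesis unfolding has_B_derivative_def K_def[symmetric]
    using U(2) by (intro conjI exI[of _ ?V] exI[of _ "C * 1 + 1 + 1"]) auto
qed

section \<open>Standard deviations of coordinates\<close>

text \<open>A choice-free inverse, from which measurability and continuity can be read off.\<close>
definition cramer_inv :: "real^'n^'n \<Rightarrow> real^'n^'n" where
  "cramer_inv B = (\<chi> k l. det (\<chi> i j. if j = k then axis l 1 $ i else B $ i $ j) / det B)"

lemma matrix_inv_inverse:
  fixes B :: "real^'n^'n"
  assumes "det B \<noteq> 0"
  shows "B ** matrix_inv B = mat 1 \<and> matrix_inv B ** B = mat 1"
  unfolding matrix_inv_def
  by (rule someI_ex) (use assms in \<open>simp add: invertible_det_nz[symmetric] invertible_def\<close>)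

lemma matrix_inv_cramer:
  fixes B :: "real^'n^'n"
  assumes "det B \<noteq> 0"
  shows "matrix_inv B = cramer_inv B"
proof -
  have inv: "B ** matrix_inv B = mat 1"
    using matrix_inv_inverse[OF assms] by blast
  have "matrix_inv B $ k $ l = cramer_inv B $ k $ l" for k l
  proof -
    have "B *v (matrix_inv B *v axis l 1) = axis l 1"
      by (simp add: matrix_vector_mul_assoc inv)
    then have "matrix_inv B *v axis l 1 = (\<chi> k. det (\<chi> i j. if j = k then axis l 1 $ i else B $ i $ j) / det B)"
      using cramer[OF assms] by blast
    moreover have "(matrix_inv B *v axis l 1) $ k = matrix_inv B $ k $ l"
      by (simp add: matrix_vector_mult_basis column_def)
    ultimately show ?thesis by (simp add: cramer_inv_def)
  qed
  then show ?thesis by (simp add: vec_eq_iff)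
qed

lemma sd_coord_inner: "sd_coord B V j = sqrt (matrix_inv B $ j \<bullet> (V *v (matrix_inv B $ j)))"
proof -
  have "(A ** V ** transpose A) $ j $ j = A $ j \<bullet> (V *v (A $ j))" for A :: "real^'a^'a"
  proof -
    have "(A ** V ** transpose A) $ j $ j = (\<Sum>k\<in>UNIV. (\<Sum>l\<in>UNIV. A $ j $ l * V $ l $ k) * A $ j $ k)"
      by (simp add: matrix_matrix_mult_def transpose_def)
    also have "\<dots> = (\<Sum>k\<in>UNIV. \<Sum>l\<in>UNIV. A $ j $ l * (V $ l $ k * A $ j $ k))"
      by (simp add: sum_distrib_right mult.assoc)
    also have "\<dots> = (\<Sum>l\<in>UNIV. \<Sum>k\<in>UNIV. A $ j $ l * (V $ l $ k * A $ j $ k))" by (rule sum.swap)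
    also have "\<dots> = A $ j \<bullet> (V *v (A $ j))"
      by (simp add: inner_vec_def matrix_vector_mult_def sum_distrib_left)
    finally show ?thesis .
  qed
  then show ?thesis by (simp add: sd_coord_def)
qed

lemma matrix_vector_mult_inner: "(A *v y) $ j = A $ j \<bullet> y" for A :: "real^'n^'m"
  by (simp add: inner_vec_def matrix_vector_mult_def)

lemma measurable_vec_lambda:
  fixes f :: "'n::finite \<Rightarrow> 'w \<Rightarrow> 'b::euclidean_space"
  assumes "\<And>i. f i \<in> borel_measurable M"
  shows "(\<lambda>w. \<chi> i. f i w) \<in> borel_measurable M"
proof -
  have "(\<lambda>w. (\<chi> i. f i w) \<bullet> b) \<in> borel_measurable M" if "b \<in> Basis" for b :: "'b^'n"
  proof -
    obtain i u where b: "b = axis i u" using \<open>b \<in> Basis\<close> by (auto simp: Basis_vec_def)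
    have "(\<lambda>w. (\<chi> i. f i w) \<bullet> b) = (\<lambda>w. f i w \<bullet> u)" unfolding b by (simp add: inner_axis)
    then show ?thesis using assms by simp
  qed
  then show ?thesis by (subst borel_measurable_euclidean_space) auto
qed

lemma measurable_vec_nth[measurable]:
  fixes f :: "'w \<Rightarrow> 'b::euclidean_space^'n"
  assumes [measurable]: "f \<in> borel_measurable M"
  shows "(\<lambda>w. f w $ i) \<in> borel_measurable M"
proof -
  have "(\<lambda>x::'b^'n. x $ i) \<in> borel_measurable borel"
    by (intro borel_measurable_continuous_onI continuous_on_component continuous_on_id)
  then show ?thesis by measurable
qed

lemma continuous_on_det:
  fixes f :: "'a::topological_space \<Rightarrow> real^'n^'n"
  assumes "\<And>i j. continuous_on S (\<lambda>x. f x $ i $ j)"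
  shows "continuous_on S (\<lambda>x. det (f x))"
  unfolding det_def by (intro continuous_on_sum continuous_on_mult continuous_on_const continuous_on_prod assms)

lemma measurable_det:
  fixes f :: "'w \<Rightarrow> real^'n^'n"
  assumes [measurable]: "f \<in> borel_measurable M"
  shows "(\<lambda>x. det (f x)) \<in> borel_measurable M"
  unfolding det_def by measurable

lemma measurable_matrix_vector_mult[measurable]:
  fixes f :: "'w \<Rightarrow> real^'n^'m" and g :: "'w \<Rightarrow> real^'n"
  assumes [measurable]: "f \<in> borel_measurable M" "g \<in> borel_measurable M"
  shows "(\<lambda>w. f w *v g w) \<in> borel_measurable M"
  unfolding matrix_vector_mult_def by (intro measurable_vec_lambda) measurable

lemma measurable_cramer_inv[measurable]:
  fixes f :: "'w \<Rightarrow> real^'n^'n"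
  assumes [measurable]: "f \<in> borel_measurable M"
  shows "(\<lambda>w. cramer_inv (f w)) \<in> borel_measurable M"
  unfolding cramer_inv_def
proof (intro measurable_vec_lambda borel_measurable_divide measurable_det)
  fix k l i j
  show "(\<lambda>w. if j = k then axis l 1 $ i else f w $ i $ j) \<in> borel_measurable M"
    by (cases "j = k") auto
qed auto

text \<open>With a countable dense \<open>Q\<close> this turns linearity into a countable
  conjunction of measurable conditions.\<close>

lemma linear_iff_dense:
  fixes D :: "real^'n \<Rightarrow> real^'n"
  assumes D: "continuous_on UNIV D" and Q: "closure Q = UNIV"
  shows "linear D \<longleftrightarrow> (\<forall>h\<in>Q. D h = matrix D *v h)"
proof
  assume "linear D"
  then show "\<forall>h\<in>Q. D h = matrix D *v h" by (simp add: matrix_works)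
next
  assume Q': "\<forall>h\<in>Q. D h = matrix D *v h"
  have "closed {h. D h = matrix D *v h}"
    by (intro closed_Collect_eq D linear_continuous_on) (simp add: matrix_vector_mul_bounded_linear)
  moreover have "Q \<subseteq> {h. D h = matrix D *v h}" using Q' by blast
  ultimately have "closure Q \<subseteq> {h. D h = matrix D *v h}" by (rule closure_minimal[rotated])
  then have "D = (\<lambda>h. matrix D *v h)" using Q by auto
  then show "linear D" by (metis matrix_vector_mul_linear)
qed

lemma sd_coord_map_measurable:
  fixes D :: "'w \<Rightarrow> real^'n \<Rightarrow> real^'n" and V :: "'w \<Rightarrow> real^'n^'n"
  assumes D[measurable]: "\<And>h. (\<lambda>w. D w h) \<in> borel_measurable M" and cont: "\<And>w. continuous_on UNIV (D w)"
    and V[measurable]: "V \<in> borel_measurable M"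
  shows "(\<lambda>w. sd_coord_map (D w) (V w) j) \<in> borel_measurable M"
proof -
  obtain Q :: "(real^'n) set" where "countable Q" "Q \<subseteq> UNIV" "UNIV \<subseteq> closure Q"
    by (rule separable)
  then have Q: "countable Q" "closure Q = UNIV" by auto
  have mat[measurable]: "(\<lambda>w. matrix (D w)) \<in> borel_measurable M"
    unfolding matrix_def by (intro measurable_vec_lambda) measurable
  have detm[measurable]: "(\<lambda>w. det (matrix (D w))) \<in> borel_measurable M" by (rule measurable_det[OF mat])
  \<comment> \<open>Linearity is tested on \<open>Q\<close>, bijectivity by the determinant, and the
    inverse is written by Cramer's rule: every ingredient is visibly measurable.\<close>
  have eq: "sd_coord_map (D w) (V w) j =
    (if (\<forall>h\<in>Q. D w h = matrix (D w) *v h) \<and> det (matrix (D w)) \<noteq> 0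
     then sqrt (cramer_inv (matrix (D w)) $ j \<bullet> (V w *v (cramer_inv (matrix (D w)) $ j))) else 0)" for w
  proof -
    have "linear (D w) \<Longrightarrow> bij (D w) \<longleftrightarrow> det (matrix (D w)) \<noteq> 0"
    proof -
      assume "linear (D w)"
      then have "(\<lambda>h. matrix (D w) *v h) = D w" by (simp add: matrix_works fun_eq_iff)
      then show ?thesis unfolding invertible_det_nz[symmetric] invertible_eq_bij by simp
    qed
    then show ?thesis
      unfolding sd_coord_map_def linear_iff_dense[OF cont Q(2), symmetric]
      by (auto simp: sd_coord_inner matrix_inv_cramer)
  qed
  have "Measurable.pred M (\<lambda>w. \<forall>h\<in>Q. D w h = matrix (D w) *v h)"
    unfolding pred_def by (intro sets.sets_Collect_countable_All' Q(1)) measurable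
  then show ?thesis unfolding eq by measurable
qed

lemma continuous_on_cramer_inv:
  "continuous_on {B::real^'n^'n. det B \<noteq> 0} (\<lambda>B. cramer_inv B $ k $ l)"
proof -
  have 1: "continuous_on {B::real^'n^'n. det B \<noteq> 0} (\<lambda>B. det (\<chi> i j. if j = k then axis l 1 $ i else B $ i $ j))"
  proof (rule continuous_on_det)
    fix i j show "continuous_on {B::real^'n^'n. det B \<noteq> 0} (\<lambda>x. (\<chi> i j. if j = k then axis l 1 $ i else x $ i $ j) $ i $ j)"
      by (cases "j = k") (auto intro!: continuous_intros)
  qed
  have 2: "continuous_on {B::real^'n^'n. det B \<noteq> 0} (\<lambda>B. det B)"
    by (rule continuous_on_det) (intro continuous_intros)
  show ?thesis unfolding cramer_inv_def using continuous_on_divide[OF 1 2] by simp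
qed

lemma sd_coord_continuous:
  fixes B0 V0 :: "real^'n^'n"
  assumes B0: "det B0 \<noteq> 0" and \<tau>: "\<tau> > 0"
  shows "\<exists>\<epsilon>>0. \<forall>B V. norm (B - B0) < \<epsilon> \<longrightarrow> norm (V - V0) < \<epsilon> \<longrightarrow> det B \<noteq> 0 \<and> \<bar>sd_coord B V j - sd_coord B0 V0 j\<bar> < \<tau>"
proof -
  let ?U = "{B::real^'n^'n. det B \<noteq> 0} \<times> (UNIV :: (real^'n^'n) set)"
  let ?s = "\<lambda>p. sqrt (\<Sum>i\<in>UNIV. \<Sum>k\<in>UNIV. cramer_inv (fst p) $ j $ i * (snd p $ i $ k * cramer_inv (fst p) $ j $ k))"
  have cd: "continuous_on UNIV (\<lambda>B::real^'n^'n. det B)"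
    by (rule continuous_on_det) (intro continuous_intros)
  have "open ((\<lambda>B::real^'n^'n. det B) -` (- {0}))" by (intro open_vimage cd) auto
  moreover have "(\<lambda>B::real^'n^'n. det B) -` (- {0}) = {B. det B \<noteq> 0}" by auto
  ultimately have opU: "open ?U" by (intro open_Times) auto
  have ci: "continuous_on ?U (\<lambda>p. cramer_inv (fst p) $ k $ l)" for k l
    by (rule continuous_on_compose2[OF continuous_on_cramer_inv continuous_on_fst[OF continuous_on_id]]) auto
  have "continuous_on ?U ?s" by (intro continuous_intros ci)
  then have c: "continuous (at (B0, V0)) ?s"
    using continuous_on_eq_continuous_at[OF opU] B0 by auto
  have s: "?s (B, V) = sd_coord B V j" if "det B \<noteq> 0" for B V
    using that by (simp add: sd_coord_inner matrix_inv_cramer inner_vec_def matrix_vector_mult_def sum_distrib_left)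
  obtain e where e: "e > 0" "\<And>p. dist p (B0, V0) < e \<Longrightarrow> dist (?s p) (?s (B0, V0)) < \<tau>"
    using c \<tau> unfolding continuous_at_eps_delta by blast
  obtain e' where e': "e' > 0" "ball (B0, V0) e' \<subseteq> ?U"
    using openE[OF opU, of "(B0, V0)"] B0 by auto
  have "det B \<noteq> 0 \<and> \<bar>sd_coord B V j - sd_coord B0 V0 j\<bar> < \<tau>"
    if "norm (B - B0) < min e e' / 2" "norm (V - V0) < min e e' / 2" for B V
  proof -
    have "dist (B, V) (B0, V0) \<le> dist B B0 + dist V V0"
      unfolding dist_Pair_Pair by (rule sqrt_sum_squares_le_sum) auto
    then have d: "dist (B, V) (B0, V0) < min e e'" using that by (simp add: dist_norm)
    then have "(B, V) \<in> ball (B0, V0) e'" by (simp add: dist_commute)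
    then have "(B, V) \<in> ?U" using e'(2) by blast
    then have "det B \<noteq> 0" by simp
    moreover have "dist (?s (B, V)) (?s (B0, V0)) < \<tau>" by (rule e(2)) (use d in simp)
    ultimately show ?thesis unfolding s[OF B0] s[OF \<open>det B \<noteq> 0\<close>] by (simp add: dist_real_def)
  qed
  then show ?thesis using e e' by (intro exI[of _ "min e e' / 2"]) auto
qed

text \<open>A zero \<open>a\<close> of a semidefinite form minimises it. Moving from
  \<open>a\<close> along V a shows that V a = 0, which contradicts invertibility.\<close>

lemma positive_definite_of_det:
  fixes V :: "real^'n^'n"
  assumes sym: "\<And>x y. x \<bullet> (V *v y) = y \<bullet> (V *v x)" and psd: "\<And>x. 0 \<le> x \<bullet> (V *v x)"
    and det: "det V \<noteq> 0" and a: "a \<noteq> 0"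
  shows "0 < a \<bullet> (V *v a)"
proof (rule ccontr)
  assume "\<not> 0 < a \<bullet> (V *v a)"
  then have z: "a \<bullet> (V *v a) = 0" using psd[of a] by linarith
  define y where "y = V *v a"
  define \<beta> where "\<beta> = y \<bullet> (V *v a)"
  define \<gamma> where "\<gamma> = y \<bullet> (V *v y)"
  have \<gamma>: "\<gamma> \<ge> 0" unfolding \<gamma>_def by (rule psd)
  have q: "0 \<le> 2 * t * \<beta> + t * t * \<gamma>" for t
  proof -
    have "0 \<le> (a + t *\<^sub>R y) \<bullet> (V *v (a + t *\<^sub>R y))" by (rule psd)
    also have "\<dots> = a \<bullet> (V *v a) + t * (a \<bullet> (V *v y)) + t * (y \<bullet> (V *v a)) + t * t * (y \<bullet> (V *v y))"
      by (simp add: matrix_vector_right_distrib matrix_vector_mult_scaleR inner_add_left inner_add_right algebra_simps)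
    also have "a \<bullet> (V *v y) = \<beta>" unfolding \<beta>_def by (rule sym)
    finally show ?thesis using z by (simp add: \<beta>_def \<gamma>_def)
  qed
  \<comment> \<open>Close to the minimiser -\<beta>/\<gamma> of the quadratic; the added 1 covers
    \<gamma> = 0.\<close>
  have "0 \<le> 2 * (- \<beta> / (\<gamma> + 1)) * \<beta> + (- \<beta> / (\<gamma> + 1)) * (- \<beta> / (\<gamma> + 1)) * \<gamma>" by (rule q)
  also have "\<dots> = \<beta>\<^sup>2 * (- \<gamma> - 2) / (\<gamma> + 1)\<^sup>2"
    using \<gamma> by (simp add: power2_eq_square divide_simps) (simp add: algebra_simps)
  finally have "0 \<le> \<beta>\<^sup>2 * (- \<gamma> - 2)" using \<gamma> by (simp add: zero_le_divide_iff)
  then have "\<beta> = 0" using \<gamma> by (simp add: zero_le_mult_iff)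
  then have "V *v a = 0" by (simp add: \<beta>_def y_def)
  then have "matrix_inv V *v (V *v a) = 0" by simp
  then have "a = 0"
    using matrix_inv_inverse[OF det] by (simp add: matrix_vector_mul_assoc)
  then show False using a by simp
qed

section \<open>The normal distribution function and the chi-square quantile\<close>

lemma normal_density_interval_pos:
  assumes "s < (t::real)"
  shows "0 < measure std_normal_distribution {s<..t}"
proof -
  interpret real_distribution std_normal_distribution by (rule real_dist_normal_dist)
  have "emeasure std_normal_distribution {s<..t} \<noteq> 0"
  proof
    assume "emeasure std_normal_distribution {s<..t} = 0"
    then have "{s<..t} \<in> null_sets std_normal_distribution" by (simp add: null_sets_def)
    then have "AE x in lborel. x \<in> {s<..t} \<longrightarrow> ennreal (std_normal_density x) = 0"
      by (subst (asm) null_sets_density_iff) auto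
    then have "AE x in lborel. x \<notin> {s<..t}"
      by eventually_elim (metis ennreal_eq_0_iff normal_density_pos zero_less_one not_less)
    then have "emeasure lborel {s<..t} = 0"
      by (subst (asm) AE_iff_null_sets[symmetric]) (auto simp: null_sets_def)
    then show False using assms by simp
  qed
  then show ?thesis using emeasure_eq_measure[of "{s<..t}"] by (simp add: less_le)
qed

lemma std_normal_cdf:
  shows "continuous_on UNIV (cdf std_normal_distribution)" "measure std_normal_distribution {x} = 0"
proof -
  interpret real_distribution std_normal_distribution by (rule real_dist_normal_dist)
  show *: "measure std_normal_distribution {x} = 0" for x
  proof -
    have "{x} \<in> null_sets lborel" by (simp add: null_sets_def)
    then have "AE y in lborel. y \<notin> {x}" by (rule AE_not_in)
    then have "AE y in lborel. y \<in> {x} \<longrightarrow> ennreal (std_normal_density y) = 0"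
      by eventually_elim simp
    then have "{x} \<in> null_sets std_normal_distribution"
      by (subst null_sets_density_iff) auto
    then show ?thesis by (simp add: null_sets_def measure_def)
  qed
  show "continuous_on UNIV (cdf std_normal_distribution)"
    unfolding continuous_on_eq_continuous_at[OF open_UNIV] isCont_cdf using * by simp
qed

lemma std_normal_abs:
  assumes "0 \<le> s"
  shows "measure std_normal_distribution {x. \<bar>x\<bar> \<le> s} = cdf std_normal_distribution s - cdf std_normal_distribution (- s)"
proof -
  interpret real_distribution std_normal_distribution by (rule real_dist_normal_dist)
  have "{x. \<bar>x\<bar> \<le> s} = {- s<..s} \<union> {- s}" using assms by auto
  moreover have "measure std_normal_distribution ({- s<..s} \<union> {- s}) = measure std_normal_distribution {- s<..s} + measure std_normal_distribution {- s}"
    by (rule finite_measure_Union) auto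
  ultimately have "measure std_normal_distribution {x. \<bar>x\<bar> \<le> s} = measure std_normal_distribution {- s<..s} + measure std_normal_distribution {- s}"
    by (simp only:)
  then have "measure std_normal_distribution {x. \<bar>x\<bar> \<le> s} = measure std_normal_distribution {- s<..s}"
    using std_normal_cdf(2) by simp
  also have "\<dots> = cdf std_normal_distribution s - cdf std_normal_distribution (- s)"
  proof (cases "s = 0")
    case False
    then show ?thesis using assms cdf_diff_eq[of "- s" s] by simp
  qed simp
  finally show ?thesis .
qed

text \<open>The two-sided probability p is continuous and strictly increasing from 0 towards 1 on
  the nonnegative reals, so the equation for the quantile has one solution there. Uniqueness for the
  \<open>THE\<close> must also exclude negative c, where the tail probability is 1.\<close>

lemma chi_square_1_quantile:
  assumes \<alpha>: "\<alpha> \<in> {0<..<1}"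
  shows "0 < chi_square_1_quantile \<alpha>"
    "measure std_normal_distribution {x. \<bar>x\<bar> \<le> sqrt (chi_square_1_quantile \<alpha>)} = 1 - \<alpha>"
proof -
  interpret real_distribution std_normal_distribution by (rule real_dist_normal_dist)
  define p where "p s = cdf std_normal_distribution s - cdf std_normal_distribution (- s)" for s
  have pc: "continuous_on {0..b} p" for b
    unfolding p_def by (intro continuous_on_diff continuous_on_compose2[OF std_normal_cdf(1)] continuous_intros) auto
  have mono: "p s < p t" if "0 \<le> s" "s < t" for s t
  proof -
    have "cdf std_normal_distribution t - cdf std_normal_distribution s > 0"
      using cdf_diff_eq[OF that(2)] normal_density_interval_pos[OF that(2)] by simp
    moreover have "cdf std_normal_distribution (- t) \<le> cdf std_normal_distribution (- s)"
      by (rule cdf_nondecreasing) (use that in auto)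
    ultimately show ?thesis by (simp add: p_def)
  qed
  have tail: "measure chi_square_1 {c<..} = 1 - p (sqrt c)" if "0 \<le> c" for c
  proof -
    have "measure chi_square_1 {c<..} = measure std_normal_distribution {x. x\<^sup>2 > c}"
      unfolding chi_square_1_def by (subst measure_distr) (auto intro!: arg_cong[where f="measure _"])
    also have "{x. x\<^sup>2 > c} = space std_normal_distribution - {x. \<bar>x\<bar> \<le> sqrt c}"
    proof -
      have "x\<^sup>2 \<le> c \<longleftrightarrow> \<bar>x\<bar> \<le> sqrt c" for x
      proof -
        have "\<bar>x\<bar> = sqrt (x\<^sup>2)" by simp
        then show ?thesis by (metis real_sqrt_le_iff)
      qed
      then show ?thesis by (auto simp: not_le[symmetric])
    qed
    also have "measure std_normal_distribution \<dots> = 1 - measure std_normal_distribution {x. \<bar>x\<bar> \<le> sqrt c}"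
      by (rule prob_compl) simp
    finally show ?thesis unfolding p_def using that std_normal_abs[of "sqrt c"] by simp
  qed
  have "((\<lambda>s. p s) \<longlongrightarrow> 1 - 0) at_top"
    unfolding p_def
    by (intro tendsto_diff cdf_lim_at_top_prob filterlim_compose[OF cdf_lim_at_bot filterlim_uminus_at_bot_at_top])
  then have "\<forall>\<^sub>F s in at_top. 1 - \<alpha> < p s" using \<alpha> by (intro order_tendstoD) auto
  then have "\<forall>\<^sub>F s in at_top. 1 - \<alpha> < p s \<and> 0 \<le> s" using eventually_ge_at_top[of 0] by eventually_elim simp
  then obtain b where b: "1 - \<alpha> < p b" "0 \<le> b" by (auto simp: eventually_at_top_linorder)
  have "p 0 = 0" by (simp add: p_def)
  then obtain s where s: "0 \<le> s" "s \<le> b" "p s = 1 - \<alpha>"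
    using IVT'[of p 0 "1 - \<alpha>" b] \<alpha> b pc by auto
  have "s > 0" using s \<open>p 0 = 0\<close> \<alpha> by (cases "s = 0") auto
  have uniq: "chi_square_1_quantile \<alpha> = s\<^sup>2"
    unfolding chi_square_1_quantile_def
  proof (rule the_equality)
    show "measure chi_square_1 {s\<^sup>2<..} = \<alpha>" using tail[of "s\<^sup>2"] s by simp
    fix c assume c: "measure chi_square_1 {c<..} = \<alpha>"
    show "c = s\<^sup>2"
    proof (cases "c < 0")
      case True
      have "measure chi_square_1 {c<..} = measure std_normal_distribution {x. x\<^sup>2 > c}"
        unfolding chi_square_1_def by (subst measure_distr) (auto intro!: arg_cong[where f="measure _"])
      also have "{x. x\<^sup>2 > c} = space std_normal_distribution"
      proof -
        have "x\<^sup>2 > c" for x using True zero_le_power2[of x] by linarith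
        then show ?thesis by auto
      qed
      finally show ?thesis using c \<alpha> prob_space by simp
    next
      case False
      then have "p (sqrt c) = p s" using tail[of c] c s(3) by simp
      then have "sqrt c = s" using mono[of s "sqrt c"] mono[of "sqrt c" s] s(1) False
        by (metis less_irrefl linorder_neqE_linordered_idom not_less real_sqrt_ge_zero)
      then show ?thesis using False by auto
    qed
  qed
  show "0 < chi_square_1_quantile \<alpha>" using uniq \<open>s > 0\<close> by simp
  show "measure std_normal_distribution {x. \<bar>x\<bar> \<le> sqrt (chi_square_1_quantile \<alpha>)} = 1 - \<alpha>"
    unfolding uniq using std_normal_abs[OF s(1)] s by (simp add: p_def)
qed

section \<open>Random fields with Lipschitz Jacobian\<close>

lemma norm_matrix_vector_mult_le: "norm (A *v x) \<le> norm A * norm x" for A :: "real^'n^'m"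
proof -
  have "norm (A *v x) = L2_set (\<lambda>i. norm ((A *v x) $ i)) UNIV" by (simp add: norm_vec_def)
  also have "\<dots> \<le> L2_set (\<lambda>i. norm (A $ i) * norm x) UNIV"
    by (intro L2_set_mono) (auto simp: matrix_vector_mult_inner Cauchy_Schwarz_ineq2)
  also have "\<dots> = norm A * norm x" by (simp add: norm_vec_def L2_set_left_distrib)
  finally show ?thesis .
qed

text \<open>The steps d/(m+1) turn a directional derivative into a limit of a sequence, the form in
  which \<open>Jx\<close> is defined and seen to be measurable.\<close>

lemma has_derivative_sequence:
  fixes f :: "'a::real_normed_vector \<Rightarrow> 'b::real_normed_vector"
  assumes f: "(f has_derivative f') (at x)"
  shows "(\<lambda>m. real (Suc m) *\<^sub>R (f (x + d /\<^sub>R real (Suc m)) - f x)) \<longlonglongrightarrow> f' d"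
proof (rule LIMSEQ_I)
  fix e :: real assume e: "0 < e"
  define e' where "e' = e / (2 * (norm d + 1))"
  have n: "norm d + 1 > 0" by (simp add: add_nonneg_pos)
  have e': "0 < e'" using e n by (simp add: e'_def)
  have lin: "linear f'" using f has_derivative_linear by blast
  obtain \<delta> where \<delta>: "\<delta> > 0" "\<And>y. norm (y - x) < \<delta> \<Longrightarrow> norm (f y - f x - f' (y - x)) \<le> e' * norm (y - x)"
    using f e' unfolding has_derivative_at_alt by blast
  have "(\<lambda>m. norm d * inverse (real (Suc m))) \<longlonglongrightarrow> norm d * 0"
    by (intro tendsto_mult tendsto_const LIMSEQ_inverse_real_of_nat)
  then have "\<forall>\<^sub>F m in sequentially. norm d * inverse (real (Suc m)) < \<delta>"
    using \<delta>(1) by (intro order_tendstoD) auto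
  then obtain N where N: "\<And>m. m \<ge> N \<Longrightarrow> norm d * inverse (real (Suc m)) < \<delta>"
    by (auto simp: eventually_sequentially)
  show "\<exists>N. \<forall>m\<ge>N. norm (real (Suc m) *\<^sub>R (f (x + d /\<^sub>R real (Suc m)) - f x) - f' d) < e"
  proof (intro exI[of _ N] allI impI)
    fix m assume m: "m \<ge> N"
    define s where "s = real (Suc m)"
    have s: "s > 0" by (simp add: s_def)
    have "norm (f (x + d /\<^sub>R s) - f x - f' ((x + d /\<^sub>R s) - x)) \<le> e' * norm ((x + d /\<^sub>R s) - x)"
      using N[OF m] s unfolding s_def[symmetric] by (intro \<delta>(2)) (simp add: mult.commute)
    then have *: "norm (f (x + d /\<^sub>R s) - f x - f' d /\<^sub>R s) \<le> e' * (norm d / s)"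
      using s by (simp add: linear_scale[OF lin] divide_inverse_commute)
    have "s *\<^sub>R (f (x + d /\<^sub>R s) - f x) - f' d = s *\<^sub>R (f (x + d /\<^sub>R s) - f x - f' d /\<^sub>R s)"
      using s by (simp add: scaleR_diff_right)
    then have "norm (s *\<^sub>R (f (x + d /\<^sub>R s) - f x) - f' d) = s * norm (f (x + d /\<^sub>R s) - f x - f' d /\<^sub>R s)"
      using s by simp
    also have "\<dots> \<le> s * (e' * (norm d / s))" using * s by (intro mult_left_mono) auto
    also have "\<dots> = e' * norm d" using s by simp
    also have "\<dots> \<le> e' * (norm d + 1)" using e' by (intro mult_left_mono) auto
    also have "\<dots> = e / 2"
    proof -
      have "e / (2 * k) * k = e / 2" if "k > 0" for k :: real using that by (simp add: field_simps)
      from this[OF n] show ?thesis unfolding e'_def .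
    qed
    also have "\<dots> < e" using e by simp
    finally show "norm (real (Suc m) *\<^sub>R (f (x + d /\<^sub>R real (Suc m)) - f x) - f' d) < e"
      unfolding s_def .
  qed
qed

text \<open>Differentiability is carried as a quadratic remainder bound because such a bound
  survives averaging and integration, with averaged constants.\<close>

lemma has_derivative_of_quadratic_bound:
  fixes f :: "'a::real_normed_vector \<Rightarrow> 'b::real_normed_vector"
  assumes T: "bounded_linear T" and d: "0 < d" and c: "0 \<le> c"
    and f: "\<And>u. norm (u - x) < d \<Longrightarrow> norm (f u - f x - T (u - x)) \<le> c * (norm (u - x))\<^sup>2"
  shows "(f has_derivative T) (at x)"
  unfolding has_derivative_at_alt
proof (intro conjI allI impI T)
  fix e :: real assume e: "0 < e"
  define d' where "d' = min d (e / (c + 1))"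
  have d': "d' > 0" using d e c by (simp add: d'_def)
  have "norm (f u - f x - T (u - x)) \<le> e * norm (u - x)" if u: "norm (u - x) < d'" for u
  proof -
    have "norm (f u - f x - T (u - x)) \<le> c * (norm (u - x))\<^sup>2" using u by (intro f) (simp add: d'_def)
    also have "\<dots> = (c * norm (u - x)) * norm (u - x)" by (simp add: power2_eq_square)
    also have "\<dots> \<le> e * norm (u - x)"
    proof (rule mult_right_mono)
      have "norm (u - x) \<le> e / (c + 1)" using u by (simp add: d'_def)
      then have "(c + 1) * norm (u - x) \<le> e" using c by (simp add: pos_le_divide_eq mult.commute)
      moreover have "c * norm (u - x) \<le> (c + 1) * norm (u - x)" by (intro mult_right_mono) auto
      ultimately show "c * norm (u - x) \<le> e" by linarith
    qed auto
    finally show ?thesis .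
  qed
  then show "\<exists>d>0. \<forall>u. norm (u - x) < d \<longrightarrow> norm (f u - f x - T (u - x)) \<le> e * norm (u - x)"
    using d' by blast
qed

locale random_field =
  fixes F :: "real^'q \<Rightarrow> real^'d \<Rightarrow> real^'q" and Op :: "(real^'q) set" and \<Xi> :: "(real^'d) set"
  assumes open_Op: "open Op" and closed_Xi: "closed \<Xi>"
    and F_meas: "(\<lambda>(x, y). F x y) \<in> borel_measurable (restrict_space borel (Op \<times> \<Xi>))"
begin

text \<open>Total Borel versions of the field, of its Jacobian and of the best Lipschitz constant; they
  agree with the intended objects on the regular samples only.\<close>
definition Fx :: "real^'q \<Rightarrow> real^'d \<Rightarrow> real^'q" where
  "Fx x y = (if x \<in> Op \<and> y \<in> \<Xi> then F x y else 0)"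

definition Jx :: "real^'q \<Rightarrow> real^'d \<Rightarrow> real^'q^'q" where
  "Jx x y = (\<chi> i j. lim (\<lambda>m. real (Suc m) * (Fx (x + axis j 1 /\<^sub>R real (Suc m)) y $ i - Fx x y $ i)))"

definition dense_part :: "(real^'q) set" where
  "dense_part = (SOME Q. countable Q \<and> Q \<subseteq> Op \<and> Op \<subseteq> closure Q)"

definition ratio :: "(real^'q) \<times> (real^'q) \<Rightarrow> real^'d \<Rightarrow> real" where
  "ratio p y = (norm (Fx (fst p) y - Fx (snd p) y) + norm (Jx (fst p) y - Jx (snd p) y)) / norm (fst p - snd p)"

text \<open>A supremum over countably many pairs is measurable. \<open>enn2real\<close> sends an
  infinite supremum to 0, so this is a genuine Lipschitz constant only where \<open>regular\<close>
  says so; equal pairs contribute 0 by division by zero.\<close>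

definition lip_const :: "real^'d \<Rightarrow> real" where
  "lip_const y = enn2real (SUP p\<in>dense_part \<times> dense_part. ennreal (ratio p y))"

text \<open>The distance to the complement would be \<open>0\<close> for \<open>Op = UNIV\<close>, as \<open>infdist x {} = 0\<close>.\<close>
definition bdry_dist :: "real^'q \<Rightarrow> real" where
  "bdry_dist x = (if Op = UNIV then 1 else infdist x (- Op))"

text \<open>Phrased through the Borel functions \<open>Fx\<close>, \<open>Jx\<close> and
  \<open>lip_const\<close> alone, so that failure at a pair of points is a Borel condition. The
  second bound encodes that \<open>Jx\<close> is the derivative.\<close>

definition regular :: "real^'d \<Rightarrow> bool" where
  "regular y \<longleftrightarrow> y \<in> \<Xi> \<and>
    (\<forall>x\<in>Op. \<forall>x'\<in>Op. norm (Fx x y - Fx x' y) + norm (Jx x y - Jx x' y) \<le> lip_const y * norm (x - x')) \<and>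
    (\<forall>x\<in>Op. \<forall>x'. dist x x' < bdry_dist x \<longrightarrow> norm (Fx x' y - Fx x y - Jx x y *v (x' - x)) \<le> lip_const y * (norm (x' - x))\<^sup>2)"

lemma dense_part: "countable dense_part" "dense_part \<subseteq> Op" "Op \<subseteq> closure dense_part"
proof -
  obtain T where "countable T" "T \<subseteq> Op" "Op \<subseteq> closure T" by (rule separable)
  then have "\<exists>Q. countable Q \<and> Q \<subseteq> Op \<and> Op \<subseteq> closure Q" by blast
  from someI_ex[OF this] show "countable dense_part" "dense_part \<subseteq> Op" "Op \<subseteq> closure dense_part" unfolding dense_part_def by auto
qed

lemma Fx_pair_meas: "(\<lambda>p. Fx (fst p) (snd p)) \<in> borel_measurable borel"
proof -
  have "Op \<times> \<Xi> \<in> sets borel"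
    using open_Op closed_Xi by (auto simp: borel_prod[symmetric])
  then have "(\<lambda>p. indicator (Op \<times> \<Xi>) p *\<^sub>R (case p of (x, y) \<Rightarrow> F x y)) \<in> borel_measurable borel"
    using F_meas by (subst (asm) borel_measurable_restrict_space_iff) auto
  moreover have "(\<lambda>p. indicator (Op \<times> \<Xi>) p *\<^sub>R (case p of (x, y) \<Rightarrow> F x y)) = (\<lambda>p. Fx (fst p) (snd p))"
    by (auto simp: Fx_def indicator_def fun_eq_iff split: prod.splits)
  ultimately show ?thesis by simp
qed

lemma Fx_meas[measurable (raw)]:
  assumes f: "f \<in> borel_measurable M" and g: "g \<in> borel_measurable M"
  shows "(\<lambda>w. Fx (f w) (g w)) \<in> borel_measurable M"
proof -
  have "(\<lambda>w. (f w, g w)) \<in> borel_measurable M" using f g by (rule borel_measurable_Pair)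
  from measurable_compose[OF this Fx_pair_meas] show ?thesis by simp
qed

lemma Jx_meas[measurable (raw)]:
  assumes [measurable]: "f \<in> borel_measurable M" "g \<in> borel_measurable M"
  shows "(\<lambda>w. Jx (f w) (g w)) \<in> borel_measurable M"
  unfolding Jx_def by (intro measurable_vec_lambda borel_measurable_lim_metric) measurable

lemma ratio_meas[measurable]: "ratio p \<in> borel_measurable borel"
  unfolding ratio_def by measurable

lemma lip_const_meas[measurable]: "lip_const \<in> borel_measurable borel"
proof -
  have "(\<lambda>y. SUP p\<in>dense_part \<times> dense_part. ennreal (ratio p y)) \<in> borel_measurable borel"
    using dense_part(1) by (intro borel_measurable_SUP) auto
  then show ?thesis unfolding lip_const_def by measurable
qed

lemma lip_const_nonneg: "0 \<le> lip_const y" by (simp add: lip_const_def)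

lemma bdry_dist_pos: "x \<in> Op \<Longrightarrow> 0 < bdry_dist x"
  unfolding bdry_dist_def using infdist_pos_not_in_closed[of "- Op" x] open_Op by (auto simp: closed_def)

lemma bdry_dist_ball: "x \<in> Op \<Longrightarrow> dist x x' < bdry_dist x \<Longrightarrow> x' \<in> Op"
  unfolding bdry_dist_def using infdist_le[of x' "- Op" x] by (auto split: if_splits)

lemma bdry_dist_meas[measurable]: "bdry_dist \<in> borel_measurable borel"
  unfolding bdry_dist_def by (cases "Op = UNIV") (auto intro!: borel_measurable_continuous_onI continuous_on_infdist continuous_on_id)

definition irregular_at :: "real^'q \<Rightarrow> real^'q \<Rightarrow> real^'d \<Rightarrow> bool" where
  "irregular_at x x' y \<longleftrightarrow> y \<notin> \<Xi> \<or>
     (x \<in> Op \<and> x' \<in> Op \<and> lip_const y * norm (x - x') < norm (Fx x y - Fx x' y) + norm (Jx x y - Jx x' y)) \<or>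
     (x \<in> Op \<and> dist x x' < bdry_dist x \<and> lip_const y * (norm (x' - x))\<^sup>2 < norm (Fx x' y - Fx x y - Jx x y *v (x' - x)))"

text \<open>The irregular samples form a projection of this Borel set, which need not be Borel itself.\<close>
definition irregular_pairs :: "(((real^'q) \<times> (real^'q)) \<times> (real^'d)) set" where
  "irregular_pairs = {p. irregular_at (fst (fst p)) (snd (fst p)) (snd p)}"

lemma irregular_at_meas:
  assumes f[measurable]: "f \<in> borel_measurable M" and g[measurable]: "g \<in> borel_measurable M"
    and h[measurable]: "h \<in> borel_measurable M"
  shows "Measurable.pred M (\<lambda>w. irregular_at (f w) (g w) (h w))"
proof -
  have [measurable]: "Op \<in> sets borel" "\<Xi> \<in> sets borel" using open_Op closed_Xi by auto
  show ?thesis unfolding irregular_at_def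
    by (intro pred_intros_logic borel_measurable_pred_less) measurable
qed

lemma irregular_pairs_borel: "irregular_pairs \<in> sets borel"
proof -
  have "Measurable.pred borel (\<lambda>p::(((real^'q) \<times> (real^'q)) \<times> (real^'d)). irregular_at (fst (fst p)) (snd (fst p)) (snd p))"
    by (intro irregular_at_meas borel_measurable_continuous_onI continuous_on_fst continuous_on_snd continuous_on_id)
  then show ?thesis unfolding irregular_pairs_def pred_def by simp
qed

lemma regular_iff: "regular y \<longleftrightarrow> (\<forall>q. (q, y) \<notin> irregular_pairs)"
  unfolding regular_def irregular_pairs_def irregular_at_def
  by (auto simp: not_less) (metis not_less)+

lemma regularD:
  assumes "regular y"
  shows "y \<in> \<Xi>"
    "x \<in> Op \<Longrightarrow> x' \<in> Op \<Longrightarrow> norm (Fx x y - Fx x' y) \<le> lip_const y * norm (x - x')"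
    "x \<in> Op \<Longrightarrow> x' \<in> Op \<Longrightarrow> norm (Jx x y - Jx x' y) \<le> lip_const y * norm (x - x')"
    "x \<in> Op \<Longrightarrow> dist x x' < bdry_dist x \<Longrightarrow> norm (Fx x' y - Fx x y - Jx x y *v (x' - x)) \<le> lip_const y * (norm (x' - x))\<^sup>2"
proof -
  show "y \<in> \<Xi>" using assms by (simp add: regular_def)
  assume "x \<in> Op"
  then show "dist x x' < bdry_dist x \<Longrightarrow> norm (Fx x' y - Fx x y - Jx x y *v (x' - x)) \<le> lip_const y * (norm (x' - x))\<^sup>2"
    using assms by (simp add: regular_def)
  assume "x' \<in> Op"
  then have "norm (Fx x y - Fx x' y) + norm (Jx x y - Jx x' y) \<le> lip_const y * norm (x - x')"
    using assms \<open>x \<in> Op\<close> by (simp add: regular_def)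
  moreover have "norm (Fx x y - Fx x' y) \<ge> 0" "norm (Jx x y - Jx x' y) \<ge> 0" by auto
  ultimately show "norm (Fx x y - Fx x' y) \<le> lip_const y * norm (x - x')" "norm (Jx x y - Jx x' y) \<le> lip_const y * norm (x - x')"
    by linarith+
qed

lemma regular_derivative:
  assumes y: "regular y" and x: "x \<in> Op"
  shows "((\<lambda>u. F u y) has_derivative (\<lambda>h. Jx x y *v h)) (at x)"
proof -
  have "((\<lambda>u. Fx u y) has_derivative (\<lambda>h. Jx x y *v h)) (at x)"
    by (rule has_derivative_of_quadratic_bound[OF matrix_vector_mul_bounded_linear bdry_dist_pos[OF x] lip_const_nonneg])
      (rule regularD(4)[OF y x], simp add: dist_norm norm_minus_commute)
  then show ?thesis
    by (rule has_derivative_transform_within_open[OF _ open_Op x]) (use regularD(1)[OF y] in \<open>simp add: Fx_def\<close>)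
qed

text \<open>The ratio bound on the dense part extends to \<open>Op\<close> by continuity of the
  field and of its Jacobian, and the Taylor bound follows from the mean value inequality.\<close>

lemma regularI:
  assumes y: "y \<in> \<Xi>" and C1: "C1_on Op (\<lambda>x. F x y)" and C: "0 \<le> C"
    and lip: "\<And>x x'. x \<in> Op \<Longrightarrow> x' \<in> Op \<Longrightarrow> norm (F x y - F x' y) +
      norm (jacobian (\<lambda>u. F u y) (at x) - jacobian (\<lambda>u. F u y) (at x')) \<le> C * norm (x - x')"
  shows "regular y" "lip_const y \<le> C"
proof -
  have Feq: "Fx x y = F x y" if "x \<in> Op" for x using that y by (simp add: Fx_def)
  have dF: "((\<lambda>u. F u y) has_derivative (\<lambda>h. jacobian (\<lambda>u. F u y) (at x) *v h)) (at x)" if "x \<in> Op" for x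
    using C1 that unfolding C1_on_def by (simp add: jacobian_works)
  have dFx: "((\<lambda>u. Fx u y) has_derivative (\<lambda>h. jacobian (\<lambda>u. F u y) (at x) *v h)) (at x)" if "x \<in> Op" for x
    by (rule has_derivative_transform_within_open[OF dF[OF that] open_Op that]) (simp add: Feq)
  have Jeq: "Jx x y = jacobian (\<lambda>u. F u y) (at x)" if "x \<in> Op" for x
  proof -
    have "Jx x y $ i $ j = jacobian (\<lambda>u. F u y) (at x) $ i $ j" for i j
    proof -
      have "(\<lambda>m. (real (Suc m) *\<^sub>R (Fx (x + axis j 1 /\<^sub>R real (Suc m)) y - Fx x y)) $ i) \<longlonglongrightarrow> (jacobian (\<lambda>u. F u y) (at x) *v axis j 1) $ i"
        by (intro tendsto_vec_nth has_derivative_sequence[OF dFx[OF that]])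
      then have "(\<lambda>m. real (Suc m) * (Fx (x + axis j 1 /\<^sub>R real (Suc m)) y $ i - Fx x y $ i)) \<longlonglongrightarrow> jacobian (\<lambda>u. F u y) (at x) $ i $ j"
        by (simp add: matrix_vector_mult_basis column_def)
      from limI[OF this] show ?thesis unfolding Jx_def by simp
    qed
    then show ?thesis by (simp add: vec_eq_iff)
  qed
  have r: "ratio p y \<le> C" if "p \<in> dense_part \<times> dense_part" for p
  proof -
    have p: "fst p \<in> Op" "snd p \<in> Op" using that dense_part(2) by auto
    have "norm (Fx (fst p) y - Fx (snd p) y) + norm (Jx (fst p) y - Jx (snd p) y) \<le> C * norm (fst p - snd p)"
      using lip[OF p] p by (simp add: Feq Jeq)
    then show ?thesis unfolding ratio_def using C by (cases "fst p = snd p") (simp_all add: pos_divide_le_eq)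
  qed
  then have sup: "(SUP p\<in>dense_part \<times> dense_part. ennreal (ratio p y)) \<le> ennreal C"
    by (intro SUP_least ennreal_leI)
  then show cC: "lip_const y \<le> C" unfolding lip_const_def using C by (rule enn2real_leI[rotated])
  have rc: "ratio p y \<le> lip_const y" if "p \<in> dense_part \<times> dense_part" for p
  proof -
    \<comment> \<open>The supremum is finite by \<open>sup\<close>, so \<open>enn2real\<close> loses
      nothing here.\<close>
    have "ennreal (ratio p y) \<le> (SUP p\<in>dense_part \<times> dense_part. ennreal (ratio p y))" using that by (rule SUP_upper)
    also have "\<dots> = ennreal (lip_const y)"
      unfolding lip_const_def using order.strict_trans1[OF sup ennreal_less_top] by (subst ennreal_enn2real) auto
    finally show ?thesis using lip_const_nonneg by (simp add: ennreal_le_iff)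
  qed
  have Fc: "isCont (\<lambda>u. Fx u y) x" if "x \<in> Op" for x using dFx[OF that] has_derivative_continuous by blast
  have Jc: "isCont (\<lambda>u. Jx u y) x" if "x \<in> Op" for x
  proof -
    have "continuous_on Op (\<lambda>u. jacobian (\<lambda>u. F u y) (at u))" using C1 by (simp add: C1_on_def)
    then have "continuous_on Op (\<lambda>u. Jx u y)" by (rule continuous_on_eq) (simp add: Jeq)
    then show ?thesis using that continuous_on_eq_continuous_at[OF open_Op] by blast
  qed
  have L: "norm (Fx x y - Fx x' y) + norm (Jx x y - Jx x' y) \<le> lip_const y * norm (x - x')" if x: "x \<in> Op" and x': "x' \<in> Op" for x x'
  proof -
    obtain u where u: "\<And>n. u n \<in> dense_part" "u \<longlonglongrightarrow> x" using subsetD[OF dense_part(3) x, unfolded closure_sequential] by blast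
    obtain u' where u': "\<And>n. u' n \<in> dense_part" "u' \<longlonglongrightarrow> x'" using subsetD[OF dense_part(3) x', unfolded closure_sequential] by blast
    have "norm (Fx (u n) y - Fx (u' n) y) + norm (Jx (u n) y - Jx (u' n) y) \<le> lip_const y * norm (u n - u' n)" for n
      using rc[of "(u n, u' n)"] u(1)[of n] u'(1)[of n]
      by (cases "u n = u' n") (simp_all add: ratio_def pos_divide_le_eq)
    moreover have "(\<lambda>n. norm (Fx (u n) y - Fx (u' n) y) + norm (Jx (u n) y - Jx (u' n) y)) \<longlonglongrightarrow> norm (Fx x y - Fx x' y) + norm (Jx x y - Jx x' y)"
      by (intro tendsto_add tendsto_norm tendsto_diff isCont_tendsto_compose[OF Fc[OF x] u(2)] isCont_tendsto_compose[OF Fc[OF x'] u'(2)]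
          isCont_tendsto_compose[OF Jc[OF x] u(2)] isCont_tendsto_compose[OF Jc[OF x'] u'(2)])
    moreover have "(\<lambda>n. lip_const y * norm (u n - u' n)) \<longlonglongrightarrow> lip_const y * norm (x - x')"
      by (intro tendsto_mult tendsto_const tendsto_norm tendsto_diff u u')
    ultimately show ?thesis by (intro LIMSEQ_le) auto
  qed
  have T: "norm (Fx x' y - Fx x y - Jx x y *v (x' - x)) \<le> lip_const y * (norm (x' - x))\<^sup>2"
    if x: "x \<in> Op" and d: "dist x x' < bdry_dist x" for x x'
  proof -
    \<comment> \<open>This ball lies in \<open>Op\<close> by the choice of \<open>bdry_dist\<close>,
      and on it the Jacobian moves by at most the Lipschitz constant times the radius: the remainder
      is quadratic.\<close>
    let ?B = "cball x (dist x x')"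
    have B: "u \<in> Op" if "u \<in> ?B" for u using that d bdry_dist_ball[OF x, of u] by simp
    have "norm (Fx x' y - Fx x y - Jx x y *v (x' - x)) \<le> norm (x' - x) * (lip_const y * norm (x' - x))"
    proof (rule differentiable_bound_linearization[where S="?B" and f'="\<lambda>u h. Jx u y *v h"])
      show "x + t *\<^sub>R (x' - x) \<in> ?B" if "t \<in> {0..1}" for t
        using that by (simp add: dist_norm norm_minus_commute mult_left_le_one_le)
      show "((\<lambda>u. Fx u y) has_derivative (\<lambda>h. Jx u y *v h)) (at u within ?B)" if "u \<in> ?B" for u
        using has_derivative_at_withinI[OF dFx[OF B[OF that]]] Jeq[OF B[OF that]] by simp
      show "onorm ((\<lambda>h. Jx u y *v h) - (\<lambda>h. Jx x y *v h)) \<le> lip_const y * norm (x' - x)" if "u \<in> ?B" for u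
      proof (rule onorm_bound)
        show "0 \<le> lip_const y * norm (x' - x)" using lip_const_nonneg by simp
        fix h
        have "norm (Jx u y - Jx x y) \<le> lip_const y * norm (u - x)"
          using L[OF B[OF that] x] norm_ge_zero[of "Fx u y - Fx x y"] by linarith
        also have "\<dots> \<le> lip_const y * norm (x' - x)"
          using that lip_const_nonneg[of y] by (intro mult_left_mono) (auto simp: dist_norm norm_minus_commute)
        finally have *: "norm (Jx u y - Jx x y) \<le> lip_const y * norm (x' - x)" .
        have "norm (((\<lambda>h. Jx u y *v h) - (\<lambda>h. Jx x y *v h)) h) = norm ((Jx u y - Jx x y) *v h)"
          by (simp add: matrix_vector_mult_diff_rdistrib)
        also have "\<dots> \<le> norm (Jx u y - Jx x y) * norm h" by (rule norm_matrix_vector_mult_le)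
        also have "\<dots> \<le> lip_const y * norm (x' - x) * norm h" using * by (intro mult_right_mono) auto
        finally show "norm (((\<lambda>h. Jx u y *v h) - (\<lambda>h. Jx x y *v h)) h) \<le> lip_const y * norm (x' - x) * norm h" .
      qed
    qed simp
    then show ?thesis by (simp add: power2_eq_square mult_ac)
  qed
  show "regular y" unfolding regular_def using y L T by blast
qed

text \<open>Difference quotients along an axis are bounded by the Lipschitz constant, hence so is
  their limit. This makes the entries of the Jacobian integrable.\<close>

lemma Jx_entry_bound:
  assumes y: "regular y" and x: "x \<in> Op"
  shows "\<bar>Jx x y $ i $ j\<bar> \<le> lip_const y"
proof -
  have d: "((\<lambda>u. F u y) has_derivative (\<lambda>h. Jx x y *v h)) (at x)" by (rule regular_derivative[OF y x])
  have lim: "(\<lambda>m. norm (real (Suc m) *\<^sub>R (F (x + axis j 1 /\<^sub>R real (Suc m)) y - F x y))) \<longlonglongrightarrow> norm (Jx x y *v axis j 1)"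
    by (intro tendsto_norm has_derivative_sequence[OF d])
  have "(\<lambda>m. x + axis j 1 /\<^sub>R real (Suc m)) \<longlonglongrightarrow> x + 0 *\<^sub>R axis j 1"
    by (intro tendsto_add tendsto_scaleR tendsto_const LIMSEQ_inverse_real_of_nat)
  then have "\<forall>\<^sub>F m in sequentially. x + axis j 1 /\<^sub>R real (Suc m) \<in> Op"
    using open_Op x by (intro topological_tendstoD) auto
  then have "\<forall>\<^sub>F m in sequentially. norm (real (Suc m) *\<^sub>R (F (x + axis j 1 /\<^sub>R real (Suc m)) y - F x y)) \<le> lip_const y"
  proof eventually_elim
    case (elim m)
    let ?s = "real (Suc m)"
    have "norm (Fx (x + axis j 1 /\<^sub>R ?s) y - Fx x y) \<le> lip_const y * norm ((x + axis j 1 /\<^sub>R ?s) - x)"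
      by (rule regularD(2)[OF y elim x])
    then have "norm (F (x + axis j 1 /\<^sub>R ?s) y - F x y) \<le> lip_const y * inverse ?s"
      using elim x regularD(1)[OF y] by (simp add: Fx_def norm_axis_1)
    then have "?s * norm (F (x + axis j 1 /\<^sub>R ?s) y - F x y) \<le> ?s * (lip_const y * inverse ?s)"
      by (intro mult_left_mono) auto
    also have "\<dots> = lip_const y" by simp
    finally show ?case by simp
  qed
  then have "norm (Jx x y *v axis j 1) \<le> lip_const y" using tendsto_upperbound[OF lim] by simp
  moreover have "\<bar>(Jx x y *v axis j 1) $ i\<bar> \<le> norm (Jx x y *v axis j 1)" by (rule component_le_norm_cart)
  ultimately show ?thesis by (simp add: matrix_vector_mult_basis column_def)
qed

end

section \<open>Zeros of perturbed normal maps\<close>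

text \<open>A fixed point of h \<mapsto> G (LK h - normal_map f S (z0 + h)) is a zero, since
  applying \<open>LK\<close> cancels LK h. On the ball the projection is exactly x0 plus the
  projection onto \<open>K\<close>, so the argument of \<open>G\<close> is just the error at
  \<open>x0\<close> plus a small linearisation error.\<close>

lemma normal_map_zero_near:
  fixes S :: "(real^'q) set" and f :: "real^'q \<Rightarrow> real^'q" and G LK :: "real^'q \<Rightarrow> real^'q"
  assumes z0: "z0 = x0 - b0"
    and LK: "\<And>h. LK h = L *v closest_point K h + h - closest_point K h"
    and G: "\<And>h. G (LK h) = h" "\<And>y. LK (G y) = y" "continuous_on UNIV G" "\<And>y. norm (G y) \<le> \<kappa> * norm y"
    and LKc: "continuous_on UNIV LK" and \<kappa>: "0 \<le> \<kappa>" and \<rho>: "0 < \<rho>"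
    and proj: "\<And>h. norm h \<le> \<rho> \<Longrightarrow> closest_point S (z0 + h) = x0 + closest_point K h"
    and proj_le: "\<And>h. norm (closest_point K h) \<le> norm h" and Sc: "continuous_on UNIV (closest_point S)"
    and fc: "continuous_on (cball x0 \<rho>) f"
    and f: "\<And>x. norm (x - x0) \<le> \<rho> \<Longrightarrow> norm (f x - f x0 - L *v (x - x0)) \<le> e * norm (x - x0)"
    and e: "0 \<le> e" "\<kappa> * e \<le> 1 / 2" and b: "\<kappa> * norm (f x0 - b0) \<le> \<rho> / 2"
  shows "\<exists>z\<in>cball z0 \<rho>. normal_map f S z = 0 \<and> norm (LK (z - z0) + (f x0 - b0)) \<le> e * \<rho>"
proof -
  define E where "E h = f (x0 + closest_point K h) - f x0 - L *v closest_point K h" for h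
  have E: "norm (E h) \<le> e * \<rho>" if h: "norm h \<le> \<rho>" for h
  proof -
    have k: "norm (closest_point K h) \<le> \<rho>" using proj_le[of h] h by linarith
    have "norm (E h) \<le> e * norm (closest_point K h)"
      using f[of "x0 + closest_point K h"] k by (simp add: E_def)
    also have "\<dots> \<le> e * \<rho>" using e k by (intro mult_left_mono) auto
    finally show ?thesis .
  qed
  have id: "LK h - normal_map f S (z0 + h) = - (f x0 - b0) - E h" if h: "norm h \<le> \<rho>" for h
    unfolding normal_map_def proj[OF h] LK E_def by (simp add: z0 algebra_simps)
  define T where "T h = G (LK h - normal_map f S (z0 + h))" for h
  have sub: "x0 + closest_point K h \<in> cball x0 \<rho>" if "norm h \<le> \<rho>" for h
    using proj_le[of h] that by (simp add: dist_norm)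
  have "continuous_on (cball 0 \<rho>) (\<lambda>h. f (closest_point S (z0 + h)))"
    by (rule continuous_on_compose2[OF fc continuous_on_compose2[OF Sc]])
      (use proj sub in \<open>auto intro!: continuous_intros\<close>)
  moreover have "continuous_on (cball 0 \<rho>) (\<lambda>h. closest_point S (z0 + h))"
    by (rule continuous_on_compose2[OF Sc]) (auto intro!: continuous_intros)
  ultimately have "continuous_on (cball 0 \<rho>) (\<lambda>h. LK h - normal_map f S (z0 + h))"
    unfolding normal_map_def by (intro continuous_intros continuous_on_subset[OF LKc]) auto
  then have "continuous_on (cball 0 \<rho>) T"
    unfolding T_def by (rule continuous_on_compose2[OF G(3)]) auto
  moreover have "T h \<in> cball 0 \<rho>" if "h \<in> cball 0 \<rho>" for h
  proof -
    have h: "norm h \<le> \<rho>" using that by simp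
    have "norm (T h) \<le> \<kappa> * norm (- (f x0 - b0) - E h)" unfolding T_def id[OF h] by (rule G(4))
    also have "\<dots> \<le> \<kappa> * (norm (f x0 - b0) + e * \<rho>)"
    proof (rule mult_left_mono[OF _ \<kappa>])
      have "norm (- (f x0 - b0) - E h) \<le> norm (f x0 - b0) + norm (E h)"
        using norm_triangle_ineq4[of "- (f x0 - b0)" "E h"] unfolding norm_minus_cancel .
      then show "norm (- (f x0 - b0) - E h) \<le> norm (f x0 - b0) + e * \<rho>" using E[OF h] by linarith
    qed
    also have "\<dots> = \<kappa> * norm (f x0 - b0) + (\<kappa> * e) * \<rho>" by (simp add: algebra_simps)
    \<comment> \<open>One half of the radius pays for the error at \<open>x0\<close>, the other for
      the linearisation error: \<open>T\<close> maps the ball into itself.\<close>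
    also have "\<dots> \<le> \<rho> / 2 + 1 / 2 * \<rho>" using b e(2) \<rho> by (intro add_mono mult_right_mono) auto
    finally show ?thesis by simp
  qed
  ultimately obtain h where h: "h \<in> cball 0 \<rho>" "T h = h"
    using brouwer[of "cball 0 \<rho>" T] \<rho> by auto
  have nh: "norm h \<le> \<rho>" using h(1) by simp
  have "LK h = LK h - normal_map f S (z0 + h)" using h(2) G(2) unfolding T_def by metis
  then have n0: "normal_map f S (z0 + h) = 0" by simp
  then have "LK h + (f x0 - b0) = - E h" using id[OF nh] by (simp add: algebra_simps)
  then have "norm (LK h + (f x0 - b0)) \<le> e * \<rho>" using E[OF nh] by simp
  then show ?thesis using n0 nh by (intro bexI[of _ "z0 + h"]) (auto simp: dist_norm)
qed

section \<open>The linear pieces of the normal map near \<open>z0\<close>, with \<open>b0\<close>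
  standing for f0 x0\<close>

locale vi_geometry =
  fixes S K :: "(real^'q) set" and x0 z0 b0 :: "real^'q" and L :: "real^'q^'q" and LK :: "real^'q \<Rightarrow> real^'q"
    and k :: nat and P Kc :: "nat \<Rightarrow> (real^'q) set" and A Mx :: "nat \<Rightarrow> real^'q^'q"
  assumes S: "polyhedron S" and x0: "x0 \<in> S" and b0: "- b0 \<in> normal_cone S x0"
    and z0: "z0 = x0 - b0"
    and K: "K = tangent_cone S x0 \<inter> {v. (z0 - x0) \<bullet> v = 0}"
    and LK: "\<And>h. LK h = L *v closest_point K h + h - closest_point K h"
    and LK_homeo: "\<exists>g. homeomorphism UNIV UNIV LK g"
    and P: "bij_betw P {1..k} {Q \<in> normal_manifold S. z0 \<in> Q}"
    and Kc: "\<And>i. i \<in> {1..k} \<Longrightarrow> Kc i = cone hull ((\<lambda>p. p - z0) ` P i)"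
    and A: "\<And>i y. i \<in> {1..k} \<Longrightarrow> y \<in> interior (P i) \<Longrightarrow> has_B_derivative (closest_point S) (\<lambda>h. A i *v h) y"
    and Mx: "\<And>i. i \<in> {1..k} \<Longrightarrow> Mx i = L ** A i + mat 1 - A i"
begin

abbreviation "G \<equiv> inv LK"

lemma S_facts: "S \<noteq> {}" "convex S" "closed S" "continuous_on UNIV (closest_point S)"
proof -
  show "S \<noteq> {}" "convex S" "closed S" using x0 S polyhedron_imp_convex polyhedron_imp_closed by auto
  then show "continuous_on UNIV (closest_point S)" by (intro continuous_on_closest_point)
qed

lemma closest_point_z0: "closest_point S z0 = x0"
  using closest_point_add_normal[OF S_facts(2,3) x0 b0] by (simp add: z0)

lemma K_critical: "K = critical_cone S z0"
  by (simp add: K critical_cone_def closest_point_z0)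

lemmas K_cone = closest_point_cone[OF critical_cone_props(1-3)[OF S S_facts(1)] critical_cone_props(4,5)[OF S S_facts(1)], of z0, folded K_critical]

lemma closest_point_near_z0:
  "\<exists>\<rho>>0. \<forall>h. norm h \<le> \<rho> \<longrightarrow> closest_point S (z0 + h) = x0 + closest_point K h"
  using closest_point_polyhedron_local[OF S S_facts(1), of z0] by (simp add: closest_point_z0 K_critical)

lemma G_facts: "LK (G y) = y" "G (LK h) = h" "continuous_on UNIV G" "continuous_on UNIV LK"
proof -
  obtain g where g: "homeomorphism UNIV UNIV LK g" using LK_homeo by blast
  then have gl: "\<And>h. g (LK h) = h" "\<And>y. LK (g y) = y" by (auto simp: homeomorphism_def)
  then have Gg: "G = g" by (intro inv_equality) auto
  show "LK (G y) = y" "G (LK h) = h" "continuous_on UNIV G" "continuous_on UNIV LK"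
    unfolding Gg using g gl by (auto simp: homeomorphism_def)
qed

lemma LK_scale: "0 \<le> t \<Longrightarrow> LK (t *\<^sub>R h) = t *\<^sub>R LK h"
  by (simp add: LK K_cone(5) matrix_vector_mult_scaleR algebra_simps)

lemma G_scale: "0 \<le> t \<Longrightarrow> G (t *\<^sub>R y) = t *\<^sub>R G y"
  using LK_scale[of t "G y"] G_facts(1,2) by metis

text \<open>Continuity bounds \<open>G\<close> on the unit ball, and positive homogeneity spreads
  the bound to a linear one.\<close>

lemma G_bound: "\<exists>\<kappa>>0. \<forall>y. norm (G y) \<le> \<kappa> * norm y"
proof -
  have "compact (G ` cball 0 1)"
    by (intro compact_continuous_image continuous_on_subset[OF G_facts(3)]) auto
  then obtain B where B: "B > 0" "\<And>y. y \<in> cball 0 1 \<Longrightarrow> norm (G y) \<le> B"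
    using compact_imp_bounded bounded_pos by (metis (no_types, lifting) image_eqI)
  have "norm (G y) \<le> B * norm y" for y
  proof (cases "y = 0")
    case True
    then show ?thesis using G_scale[of 0 0] by simp
  next
    case False
    have "G y = norm y *\<^sub>R G (y /\<^sub>R norm y)" using False G_scale[of "norm y" "y /\<^sub>R norm y"] by simp
    then have "norm (G y) = norm y * norm (G (y /\<^sub>R norm y))" by (metis abs_norm_cancel norm_scaleR)
    also have "\<dots> \<le> norm y * B" using False by (intro mult_left_mono B(2)) auto
    finally show ?thesis by (simp add: mult.commute)
  qed
  then show ?thesis using B(1) by blast
qed

context
  fixes i assumes i: "i \<in> {1..k}"
begin

lemma P_cell: "P i \<in> normal_manifold S" "z0 \<in> P i"
  using P i by (auto simp: bij_betw_def)

text \<open>The projection is affine on the segment from y to z, so its derivative at y along z - y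
  is the whole increment.\<close>

lemma A_affine: "y \<in> interior (P i) \<Longrightarrow> z \<in> P i \<Longrightarrow> closest_point S z = closest_point S y + A i *v (z - y)"
proof -
  assume y: "y \<in> interior (P i)" and z: "z \<in> P i"
  have "A i *v (z - y) = closest_point S z - closest_point S y"
  proof (rule has_B_derivative_ray[OF A[OF i y]])
    fix t :: real assume t: "0 \<le> t" "t \<le> 1"
    have "closest_point S ((1 - t) *\<^sub>R y + t *\<^sub>R z) = (1 - t) *\<^sub>R closest_point S y + t *\<^sub>R closest_point S z"
      by (rule normal_manifold_convex(2)[OF S P_cell(1) _ z t]) (use y interior_subset in blast)
    then show "closest_point S (y + t *\<^sub>R (z - y)) = closest_point S y + t *\<^sub>R (closest_point S z - closest_point S y)"
      by (simp add: algebra_simps)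
  qed
  then show ?thesis by simp
qed

lemma P_interior: "interior (P i) \<noteq> {}"
  by (rule normal_manifold_interior_nonempty[OF S P_cell(1)])

lemma A_affine': "y \<in> P i \<Longrightarrow> z \<in> P i \<Longrightarrow> closest_point S z = closest_point S y + A i *v (z - y)"
proof -
  assume yz: "y \<in> P i" "z \<in> P i"
  obtain u where u: "u \<in> interior (P i)" using P_interior by blast
  show ?thesis using A_affine[OF u yz(1)] A_affine[OF u yz(2)]
    by (simp add: matrix_vector_mult_diff_distrib)
qed

lemma P_polyhedron: "polyhedron (P i)"
  by (rule normal_manifold_polyhedron[OF S P_cell(1) matrix_vector_mul_linear A_affine'[OF P_cell(2)]])

text \<open>Both sets consist of the directions from \<open>z0\<close> into the cell, the zero
  multiple being covered because \<open>z0\<close> belongs to it. All facts on tangent cones of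
  polyhedra thereby apply to the cones \<open>Kc i\<close>.\<close>

lemma Kc_tangent: "Kc i = tangent_cone (P i) z0"
proof (intro equalityI subsetI)
  fix v assume "v \<in> Kc i"
  then obtain c p where c: "c \<ge> 0" "p \<in> P i" "v = c *\<^sub>R (p - z0)"
    unfolding Kc[OF i] cone_hull_expl by blast
  show "v \<in> tangent_cone (P i) z0"
  proof (cases "c = 0")
    case True
    then show ?thesis using c P_cell(2) by (auto simp: tangent_cone_def intro!: exI[of _ 1])
  next
    case False
    then have "z0 + (1 / c) *\<^sub>R v \<in> P i" using c by simp
    then show ?thesis using c False unfolding tangent_cone_def by (intro CollectI exI[of _ "1 / c"]) auto
  qed
next
  fix v assume "v \<in> tangent_cone (P i) z0"
  then obtain t where t: "t > 0" "z0 + t *\<^sub>R v \<in> P i" by (auto simp: tangent_cone_def)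
  have "v = (1 / t) *\<^sub>R ((z0 + t *\<^sub>R v) - z0)" using t by simp
  moreover have "(z0 + t *\<^sub>R v) - z0 \<in> (\<lambda>p. p - z0) ` P i" using t(2) by (rule imageI)
  moreover have "0 \<le> 1 / t" using t(1) by simp
  ultimately show "v \<in> Kc i" unfolding Kc[OF i] cone_hull_expl by blast
qed

lemmas Kc_props = tangent_cone_props[OF P_polyhedron P_cell(2), folded Kc_tangent]

lemma Kc_local: "\<exists>\<rho>>0. \<forall>v\<in>Kc i. norm v \<le> \<rho> \<longrightarrow> z0 + v \<in> P i"
proof -
  obtain B \<rho> where "finite B" "0 \<notin> B" "\<rho> > 0" "tangent_cone (P i) z0 = {v. \<forall>a\<in>B. a \<bullet> v \<le> 0}"
    "\<And>v. v \<in> tangent_cone (P i) z0 \<Longrightarrow> norm v \<le> \<rho> \<Longrightarrow> z0 + v \<in> P i"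
    by (rule polyhedron_tangent_cone[OF P_polyhedron P_cell(2)]) (rule that)
  then show ?thesis unfolding Kc_tangent by (intro exI[of _ \<rho>]) simp
qed

text \<open>A boundary point makes one of the finitely many defining inequalities tight. The
  hyperplanes pass through 0, as needed for pulling them back along a linear piece of
  \<open>G\<close>.\<close>

lemma Kc_boundary: "\<exists>B. finite B \<and> 0 \<notin> B \<and> Kc i - interior (Kc i) \<subseteq> (\<Union>a\<in>B. {h. a \<bullet> h = 0})"
proof -
  obtain B \<rho> where B: "finite B" "0 \<notin> B" "\<rho> > 0" "tangent_cone (P i) z0 = {v. \<forall>a\<in>B. a \<bullet> v \<le> 0}"
    "\<And>v. v \<in> tangent_cone (P i) z0 \<Longrightarrow> norm v \<le> \<rho> \<Longrightarrow> z0 + v \<in> P i"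
    by (rule polyhedron_tangent_cone[OF P_polyhedron P_cell(2)]) (rule that)
  have "open (\<Inter>a\<in>B. {v. a \<bullet> v < 0})" using B(1) by (intro open_INT ballI open_halfspace_lt)
  then have sub: "(\<Inter>a\<in>B. {v. a \<bullet> v < 0}) \<subseteq> interior (Kc i)"
    unfolding Kc_tangent B(4) by (intro interior_maximal) (auto simp: less_imp_le)
  have "Kc i - interior (Kc i) \<subseteq> (\<Union>a\<in>B. {h. a \<bullet> h = 0})"
  proof
    fix h assume h: "h \<in> Kc i - interior (Kc i)"
    then obtain a where a: "a \<in> B" "\<not> a \<bullet> h < 0" using sub by blast
    moreover have "a \<bullet> h \<le> 0" using h a(1) unfolding Kc_tangent B(4) by blast
    ultimately have "a \<bullet> h = 0" by linarith
    then show "h \<in> (\<Union>a\<in>B. {h. a \<bullet> h = 0})" using a(1) by blast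
  qed
  then show ?thesis using B(1,2) by blast
qed

lemma Kc_closed: "closed (Kc i)"
  using Kc_props(1) polyhedron_imp_closed polyhedron_imp_convex by auto

lemma Kc_interior_nonempty: "interior (Kc i) \<noteq> {}"
proof -
  have "(+) (- z0) ` P i \<subseteq> Kc i" using Kc_props(5) by auto
  then have "interior ((+) (- z0) ` P i) \<subseteq> interior (Kc i)" by (rule interior_mono)
  then show ?thesis unfolding interior_translation using P_interior by blast
qed

lemma Kc_interior_scale:
  assumes u: "u \<in> interior (Kc i)" and t: "0 < t"
  shows "t *\<^sub>R u \<in> interior (Kc i)"
proof -
  obtain e where e: "e > 0" "ball u e \<subseteq> Kc i" using u unfolding mem_interior by blast
  have "ball (t *\<^sub>R u) (t * e) \<subseteq> Kc i"
  proof
    fix w assume w: "w \<in> ball (t *\<^sub>R u) (t * e)"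
    have "dist u ((1 / t) *\<^sub>R w) = (1 / t) * dist (t *\<^sub>R u) w"
    proof -
      have "u - (1 / t) *\<^sub>R w = (1 / t) *\<^sub>R (t *\<^sub>R u - w)" using t by (simp add: scaleR_diff_right)
      then show ?thesis using t by (simp add: dist_norm)
    qed
    also have "\<dots> < e" using w t by (simp add: pos_divide_less_eq mult.commute)
    finally have "(1 / t) *\<^sub>R w \<in> Kc i" using e(2) by auto
    from Kc_props(3)[OF this, of t] show "w \<in> Kc i" using t by simp
  qed
  moreover have "t * e > 0" using t e by simp
  ultimately show ?thesis unfolding mem_interior by blast
qed

lemma Kc_interior_cell: "\<exists>\<rho>>0. \<forall>u\<in>interior (Kc i). norm u < \<rho> \<longrightarrow> z0 + u \<in> interior (P i)"
proof -
  obtain \<rho> where \<rho>: "\<rho> > 0" "\<And>v. v \<in> Kc i \<Longrightarrow> norm v \<le> \<rho> \<Longrightarrow> z0 + v \<in> P i" using Kc_local by blast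
  have "z0 + u \<in> interior (P i)" if u: "u \<in> interior (Kc i)" "norm u < \<rho>" for u
  proof (rule interiorI)
    show "open ((\<lambda>v. z0 + v) ` (interior (Kc i) \<inter> ball 0 \<rho>))" by (intro open_translation open_Int) auto
    show "z0 + u \<in> (\<lambda>v. z0 + v) ` (interior (Kc i) \<inter> ball 0 \<rho>)" using u by auto
    show "(\<lambda>v. z0 + v) ` (interior (Kc i) \<inter> ball 0 \<rho>) \<subseteq> P i" using \<rho>(2) interior_subset by fastforce
  qed
  then show ?thesis using \<rho>(1) by blast
qed

text \<open>Scale h down until both the cell and the local reduction contain it, read off the linear
  action there, and undo the scaling by homogeneity.\<close>

lemma closest_point_Kc: "h \<in> Kc i \<Longrightarrow> closest_point K h = A i *v h"
proof -
  assume h: "h \<in> Kc i"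
  obtain \<rho> where \<rho>: "\<rho> > 0" "\<And>v. v \<in> Kc i \<Longrightarrow> norm v \<le> \<rho> \<Longrightarrow> z0 + v \<in> P i" using Kc_local by blast
  obtain \<rho>' where \<rho>': "\<rho>' > 0" "\<And>h. norm h \<le> \<rho>' \<Longrightarrow> closest_point S (z0 + h) = x0 + closest_point K h"
    using closest_point_near_z0 by blast
  define t where "t = min \<rho> \<rho>' / (norm h + 1)"
  have n: "norm h + 1 > 0" by (simp add: add_nonneg_pos)
  have t: "t > 0" using \<rho>(1) \<rho>'(1) n by (simp add: t_def)
  have "t * norm h \<le> t * (norm h + 1)" using t by (intro mult_left_mono) auto
  also have "\<dots> = min \<rho> \<rho>'"
  proof -
    have "a / b * b = a" if "b > 0" for a b :: real using that by simp
    from this[OF n] show ?thesis unfolding t_def .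
  qed
  finally have nt: "norm (t *\<^sub>R h) \<le> \<rho>" "norm (t *\<^sub>R h) \<le> \<rho>'" using t by auto
  have "z0 + t *\<^sub>R h \<in> P i" using \<rho>(2)[OF Kc_props(3)[OF h]] nt t by simp
  from A_affine'[OF P_cell(2) this] have "closest_point K (t *\<^sub>R h) = A i *v (t *\<^sub>R h)"
    by (simp add: \<rho>'(2)[OF nt(2)] closest_point_z0)
  then have "t *\<^sub>R closest_point K h = t *\<^sub>R (A i *v h)"
    using t by (simp add: K_cone(5) matrix_vector_mult_scaleR)
  then show ?thesis using t by simp
qed

lemma LK_Kc: "h \<in> Kc i \<Longrightarrow> LK h = Mx i *v h"
  by (simp add: LK closest_point_Kc Mx[OF i] matrix_vector_mult_diff_rdistrib matrix_vector_mult_add_rdistrib matrix_vector_mul_assoc)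

text \<open>\<open>LK\<close> is the matrix \<open>Mx i\<close> on a cone with interior. A kernel
  vector would join two points of that cone with the same image, against injectivity of
  \<open>LK\<close>.\<close>

lemma Mx_det: "det (Mx i) \<noteq> 0"
proof -
  have "v = 0" if v: "Mx i *v v = 0" for v
  proof (rule ccontr)
    assume "v \<noteq> 0"
    obtain h where "h \<in> interior (Kc i)" using Kc_interior_nonempty by blast
    then obtain e where e: "e > 0" "ball h e \<subseteq> Kc i" unfolding mem_interior by blast
    define s where "s = e / (2 * norm v)"
    have s: "s > 0" "norm (s *\<^sub>R v) < e" using e \<open>v \<noteq> 0\<close> by (auto simp: s_def)
    then have "h + s *\<^sub>R v \<in> ball h e" by (simp add: dist_norm)
    then have hs: "h + s *\<^sub>R v \<in> Kc i" "h \<in> Kc i" using e by auto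
    have "LK (h + s *\<^sub>R v) = LK h"
      unfolding LK_Kc[OF hs(1)] LK_Kc[OF hs(2)] using v by (simp add: matrix_vector_right_distrib matrix_vector_mult_scaleR)
    then have "h + s *\<^sub>R v = h" using G_facts(2) by metis
    then show False using s \<open>v \<noteq> 0\<close> by simp
  qed
  then have "\<exists>B. B ** Mx i = mat 1" unfolding matrix_left_invertible_ker by blast
  then show ?thesis unfolding invertible_det_nz[symmetric] invertible_left_inverse .
qed

text \<open>The inverse of \<open>LK\<close> and the inverse matrix agree as soon as either value
  falls into the cone. This is why the two sums in the theorem are equal term by term.\<close>

lemma G_Kc_iff: "G y \<in> Kc i \<longleftrightarrow> matrix_inv (Mx i) *v y \<in> Kc i"
  and G_Kc: "G y \<in> Kc i \<Longrightarrow> G y = matrix_inv (Mx i) *v y"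
proof -
  note inv = matrix_inv_inverse[OF Mx_det]
  have 1: "G y = matrix_inv (Mx i) *v y" if h: "G y \<in> Kc i"
  proof -
    have "y = Mx i *v G y" using LK_Kc[OF h] G_facts(1) by simp
    then have "matrix_inv (Mx i) *v y = matrix_inv (Mx i) *v (Mx i *v G y)" by simp
    then show ?thesis by (simp add: matrix_vector_mul_assoc inv)
  qed
  have 2: "G y \<in> Kc i" if h: "matrix_inv (Mx i) *v y \<in> Kc i"
  proof -
    have "LK (matrix_inv (Mx i) *v y) = y"
      unfolding LK_Kc[OF h] by (simp add: matrix_vector_mul_assoc inv)
    then have "G y = matrix_inv (Mx i) *v y" using G_facts(2) by metis
    then show ?thesis using h by simp
  qed
  show "G y \<in> Kc i \<longleftrightarrow> matrix_inv (Mx i) *v y \<in> Kc i" using 1 2 by metis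
  show "G y \<in> Kc i \<Longrightarrow> G y = matrix_inv (Mx i) *v y" by (rule 1)
qed

end

text \<open>Among the points z0 + h/(m+1) infinitely many share one of the finitely many cells. That
  cell is closed, so it contains \<open>z0\<close> and is one of the \<open>P i\<close>, with h as
  one of its directions.\<close>

lemma Kc_cover: "\<exists>i\<in>{1..k}. h \<in> Kc i"
proof -
  have "\<forall>m. \<exists>Q\<in>normal_manifold S. z0 + h /\<^sub>R real (Suc m) \<in> Q"
    using normal_manifold_covers[OF S S_facts(1)] by blast
  then have "\<exists>Q\<in>normal_manifold S. infinite {m\<in>UNIV. z0 + h /\<^sub>R real (Suc m) \<in> Q}"
    by (intro pigeonhole_infinite_rel normal_manifold_finite[OF S]) auto
  then obtain Q where Q: "Q \<in> normal_manifold S" "infinite {m. z0 + h /\<^sub>R real (Suc m) \<in> Q}" by auto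
  have lim: "(\<lambda>m. z0 + h /\<^sub>R real (Suc m)) \<longlonglongrightarrow> z0 + 0 *\<^sub>R h"
    by (intro tendsto_add tendsto_scaleR tendsto_const LIMSEQ_inverse_real_of_nat)
  have "z0 \<in> Q"
  proof (rule ccontr)
    assume "z0 \<notin> Q"
    then have "\<forall>\<^sub>F m in sequentially. z0 + h /\<^sub>R real (Suc m) \<in> - Q"
      using topological_tendstoD[OF lim, of "- Q"] normal_manifold_closed[OF S Q(1)] by auto
    then obtain N where "\<And>m. m \<ge> N \<Longrightarrow> z0 + h /\<^sub>R real (Suc m) \<notin> Q" by (auto simp: eventually_sequentially)
    then have "{m. z0 + h /\<^sub>R real (Suc m) \<in> Q} \<subseteq> {..<N}" by (force simp: not_le[symmetric])
    then show False using Q(2) finite_subset by blast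
  qed
  then have "Q \<in> P ` {1..k}" using Q(1) bij_betw_imp_surj_on[OF P] by simp
  then obtain i where i: "i \<in> {1..k}" "P i = Q" by blast
  from Q(2) have "{m. z0 + h /\<^sub>R real (Suc m) \<in> Q} \<noteq> {}" by (rule infinite_imp_nonempty)
  then obtain m where "z0 + h /\<^sub>R real (Suc m) \<in> P i" using i(2) by blast
  then have "h \<in> Kc i" unfolding Kc_tangent[OF i(1)] tangent_cone_def
    by (intro CollectI exI[of _ "inverse (real (Suc m))"]) auto
  then show ?thesis using i(1) by blast
qed

text \<open>Scaled close to the apex, a common interior direction becomes a common interior point of
  two cells.\<close>

lemma Kc_interior_disjoint:
  assumes ij: "i \<in> {1..k}" "j \<in> {1..k}" and h: "h \<in> interior (Kc i)" "h \<in> interior (Kc j)"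
  shows "i = j"
proof -
  obtain \<rho> where \<rho>: "\<rho> > 0" "\<And>u. u \<in> interior (Kc i) \<Longrightarrow> norm u < \<rho> \<Longrightarrow> z0 + u \<in> interior (P i)"
    using Kc_interior_cell[OF ij(1)] by blast
  obtain \<rho>' where \<rho>': "\<rho>' > 0" "\<And>u. u \<in> interior (Kc j) \<Longrightarrow> norm u < \<rho>' \<Longrightarrow> z0 + u \<in> interior (P j)"
    using Kc_interior_cell[OF ij(2)] by blast
  define t where "t = min \<rho> \<rho>' / (2 * (norm h + 1))"
  have n: "norm h + 1 > 0" by (simp add: add_nonneg_pos)
  have t: "t > 0" using \<rho>(1) \<rho>'(1) n by (simp add: t_def)
  have "t * norm h \<le> t * (norm h + 1)" using t by (intro mult_left_mono) auto
  also have "\<dots> = min \<rho> \<rho>' / 2"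
  proof -
    have "a / (2 * b) * b = a / 2" if "b > 0" for a b :: real using that by simp
    from this[OF n] show ?thesis unfolding t_def .
  qed
  also have "\<dots> < min \<rho> \<rho>'"
  proof -
    have "0 < min \<rho> \<rho>'" using \<rho>(1) \<rho>'(1) by simp
    then show ?thesis by linarith
  qed
  finally have nt: "norm (t *\<^sub>R h) < \<rho>" "norm (t *\<^sub>R h) < \<rho>'" using t by auto
  have "z0 + t *\<^sub>R h \<in> interior (P i)" "z0 + t *\<^sub>R h \<in> interior (P j)"
    using \<rho>(2)[OF Kc_interior_scale[OF ij(1) h(1) t] nt(1)] \<rho>'(2)[OF Kc_interior_scale[OF ij(2) h(2) t] nt(2)] by auto
  then have "P i = P j" by (rule normal_manifold_interior_disjoint[OF S P_cell(1)[OF ij(1)] P_cell(1)[OF ij(2)]])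
  then show ?thesis using inj_onD[OF bij_betw_imp_inj_on[OF P]] ij by blast
qed

end

section \<open>Limits along deterministic sequences of samples\<close>

context vi_geometry
begin

text \<open>Convergence of \<open>z m\<close> is a conclusion: the zero found by Brouwer's theorem
  lies in \<open>Z\<close> with projection in \<open>Op\<close>, and \<open>uniq\<close> makes it
  equal to \<open>z m\<close>. The sample sizes are a sequence \<nu> since the lemma is applied
  along subsequences.\<close>

lemma scaled_solution_tendsto:
  fixes \<nu> :: "nat \<Rightarrow> nat" and f :: "nat \<Rightarrow> real^'q \<Rightarrow> real^'q" and J :: "nat \<Rightarrow> real^'q^'q"
  assumes \<nu>: "filterlim \<nu> at_top sequentially"
    and Op: "open Op" "x0 \<in> Op" and Z: "z0 \<in> interior Z" and \<delta>0: "0 < \<delta>0"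
    and fc: "\<And>m. continuous_on Op (f m)"
    and taylor: "\<And>m x. dist x0 x < \<delta>0 \<Longrightarrow> norm (f m x - f m x0 - J m *v (x - x0)) \<le> c m * (norm (x - x0))\<^sup>2"
    and J: "J \<longlonglongrightarrow> L" and c: "\<And>m. c m \<le> B"
    and V: "(\<lambda>m. sqrt (real (\<nu> m)) *\<^sub>R (b0 - f m x0)) \<longlonglongrightarrow> v"
    and uniq: "\<And>m y. y \<in> Z \<Longrightarrow> closest_point S y \<in> Op \<Longrightarrow> normal_map (f m) S y = 0 \<Longrightarrow> y = z m"
  shows "(\<lambda>m. sqrt (real (\<nu> m)) *\<^sub>R (z m - z0)) \<longlonglongrightarrow> G v"
proof -
  let ?s = "\<lambda>m. sqrt (real (\<nu> m))"
  let ?V = "\<lambda>m. ?s m *\<^sub>R (b0 - f m x0)"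
  obtain \<kappa> where \<kappa>: "\<kappa> > 0" "\<And>y. norm (G y) \<le> \<kappa> * norm y" using G_bound by blast
  from convergent_imp_Bseq[OF convergentI[OF V]]
  obtain R where "R > 0" "\<forall>m. norm (?V m) \<le> R" by (rule BseqE)
  then have R: "R > 0" "\<And>m. norm (?V m) \<le> R" by auto
  obtain \<rho>1 where \<rho>1: "\<rho>1 > 0" "\<And>h. norm h \<le> \<rho>1 \<Longrightarrow> closest_point S (z0 + h) = x0 + closest_point K h"
    using closest_point_near_z0 by blast
  obtain \<rho>2 where \<rho>2: "\<rho>2 > 0" "cball z0 \<rho>2 \<subseteq> Z" using Z unfolding mem_interior_cball by blast
  obtain \<rho>3 where \<rho>3: "\<rho>3 > 0" "cball x0 \<rho>3 \<subseteq> Op" using Op open_contains_cball by blast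
  \<comment> \<open>As the scaled errors are bounded by R, \<kappa> times the error at
    \<open>x0\<close> is at most half of this radius, as \<open>normal_map_zero_near\<close>
    requires.\<close>
  define \<rho> where "\<rho> m = 2 * \<kappa> * R / ?s m" for m
  \<comment> \<open>Linearisation error per unit length on the ball of radius \<rho>: the Jacobian
    error at \<open>x0\<close> plus the second-order term.\<close>
  define e where "e m = norm (J m - L) + \<bar>B\<bar> * \<rho> m" for m
  have s_lim: "filterlim ?s at_top sequentially"
    by (intro filterlim_compose[OF sqrt_at_top] filterlim_compose[OF filterlim_real_sequentially \<nu>])
  have \<rho>_lim: "\<rho> \<longlonglongrightarrow> 0" unfolding \<rho>_def by (rule tendsto_divide_0[OF tendsto_const filterlim_at_top_imp_at_infinity[OF s_lim]])
  have "(\<lambda>m. norm (J m - L) + \<bar>B\<bar> * \<rho> m) \<longlonglongrightarrow> norm (L - L) + \<bar>B\<bar> * 0"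
    by (intro tendsto_intros J \<rho>_lim)
  then have e_lim: "e \<longlonglongrightarrow> 0" unfolding e_def by simp
  have "(\<lambda>m. \<kappa> * e m) \<longlonglongrightarrow> \<kappa> * 0" by (intro tendsto_intros e_lim)
  then have ev1: "\<forall>\<^sub>F m in sequentially. \<kappa> * e m < 1 / 2" by (intro order_tendstoD) auto
  have ev2: "\<forall>\<^sub>F m in sequentially. \<rho> m < min (min \<rho>1 \<rho>2) (min \<rho>3 \<delta>0)"
    using \<rho>1(1) \<rho>2(1) \<rho>3(1) \<delta>0 by (intro order_tendstoD(2)[OF \<rho>_lim]) auto
  have ev3: "\<forall>\<^sub>F m in sequentially. 1 \<le> \<nu> m" using \<nu> unfolding filterlim_at_top by blast
  have main: "\<forall>\<^sub>F m in sequentially. norm (LK (?s m *\<^sub>R (z m - z0)) - ?V m) \<le> e m * (2 * \<kappa> * R)"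
    using ev1 ev2 ev3
  proof eventually_elim
    case (elim m)
    have sp: "?s m > 0" using elim(3) by simp
    have \<rho>p: "\<rho> m > 0" using \<kappa>(1) R(1) sp by (simp add: \<rho>_def)
    have rs: "\<rho> m < \<rho>1" "\<rho> m < \<rho>2" "\<rho> m < \<rho>3" "\<rho> m < \<delta>0" using elim(2) by auto
    have ep: "0 \<le> e m" using \<rho>p by (simp add: e_def)
    have "\<exists>y\<in>cball z0 (\<rho> m). normal_map (f m) S y = 0 \<and> norm (LK (y - z0) + (f m x0 - b0)) \<le> e m * \<rho> m"
    proof (rule normal_map_zero_near[OF z0 LK G_facts(2,1,3) \<kappa>(2) G_facts(4) less_imp_le[OF \<kappa>(1)] \<rho>p _ K_cone(4) S_facts(4) _ _ ep])
      show "closest_point S (z0 + h) = x0 + closest_point K h" if "norm h \<le> \<rho> m" for h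
        using that rs(1) by (intro \<rho>1(2)) simp
      show "continuous_on (cball x0 (\<rho> m)) (f m)"
        by (rule continuous_on_subset[OF fc]) (use \<rho>3(2) rs(3) in auto)
      show "norm (f m x - f m x0 - L *v (x - x0)) \<le> e m * norm (x - x0)" if x: "norm (x - x0) \<le> \<rho> m" for x
      proof -
        have "f m x - f m x0 - L *v (x - x0) = (f m x - f m x0 - J m *v (x - x0)) + (J m - L) *v (x - x0)"
          by (simp add: matrix_vector_mult_diff_rdistrib)
        then have "norm (f m x - f m x0 - L *v (x - x0)) \<le> norm (f m x - f m x0 - J m *v (x - x0)) + norm ((J m - L) *v (x - x0))"
          by (metis norm_triangle_ineq)
        also have "\<dots> \<le> c m * (norm (x - x0))\<^sup>2 + norm (J m - L) * norm (x - x0)"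
          using x rs(4) by (intro add_mono taylor norm_matrix_vector_mult_le) (simp add: dist_norm norm_minus_commute)
        also have "c m * (norm (x - x0))\<^sup>2 \<le> \<bar>B\<bar> * \<rho> m * norm (x - x0)"
        proof -
          have "c m * (norm (x - x0))\<^sup>2 \<le> \<bar>B\<bar> * (norm (x - x0))\<^sup>2" using c[of m] by (intro mult_right_mono) auto
          also have "\<dots> = \<bar>B\<bar> * norm (x - x0) * norm (x - x0)" by (simp add: power2_eq_square)
          also have "\<dots> \<le> \<bar>B\<bar> * \<rho> m * norm (x - x0)" using x by (intro mult_right_mono mult_left_mono) auto
          finally show ?thesis .
        qed
        finally show ?thesis by (simp add: e_def algebra_simps)
      qed
      show "\<kappa> * e m \<le> 1 / 2" using elim(1) by simp
      have "norm (?V m) = ?s m * norm (f m x0 - b0)" using sp by (simp add: norm_minus_commute)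
      then have "norm (f m x0 - b0) \<le> R / ?s m" using R(2)[of m] sp by (simp add: pos_le_divide_eq mult.commute)
      then have "\<kappa> * norm (f m x0 - b0) \<le> \<kappa> * (R / ?s m)" using \<kappa>(1) by (intro mult_left_mono) auto
      then show "\<kappa> * norm (f m x0 - b0) \<le> \<rho> m / 2" by (simp add: \<rho>_def)
    qed
    then obtain y where y: "y \<in> cball z0 (\<rho> m)" "normal_map (f m) S y = 0" "norm (LK (y - z0) + (f m x0 - b0)) \<le> e m * \<rho> m"
      by blast
    have ny: "norm (y - z0) \<le> \<rho> m" using y(1) by (simp add: dist_norm norm_minus_commute)
    have "closest_point S (z0 + (y - z0)) = x0 + closest_point K (y - z0)" using ny rs(1) by (intro \<rho>1(2)) simp
    moreover have "x0 + closest_point K (y - z0) \<in> cball x0 \<rho>3" using K_cone(4)[of "y - z0"] ny rs(3) by (simp add: dist_norm)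
    ultimately have "closest_point S y \<in> Op" using \<rho>3(2) by auto
    moreover have "y \<in> Z" using y(1) rs(2) \<rho>2(2) by auto
    ultimately have yz: "y = z m" using y(2) by (intro uniq)
    \<comment> \<open>After rescaling, the radius becomes the constant 2 \<kappa> R, so the
      vanishing factor \<open>e m\<close> alone decides.\<close>
    have "LK (?s m *\<^sub>R (z m - z0)) - ?V m = ?s m *\<^sub>R (LK (z m - z0) + (f m x0 - b0))"
      using LK_scale[of "?s m" "z m - z0"] by (simp add: algebra_simps)
    then have "norm (LK (?s m *\<^sub>R (z m - z0)) - ?V m) = ?s m * norm (LK (z m - z0) + (f m x0 - b0))" by simp
    also have "\<dots> \<le> ?s m * (e m * \<rho> m)" using y(3) yz by (intro mult_left_mono) auto
    also have "\<dots> = e m * (2 * \<kappa> * R)" using sp by (simp add: \<rho>_def)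
    finally show ?case .
  qed
  have "(\<lambda>m. e m * (2 * \<kappa> * R)) \<longlonglongrightarrow> 0 * (2 * \<kappa> * R)" by (intro tendsto_intros e_lim)
  then have "(\<lambda>m. e m * (2 * \<kappa> * R)) \<longlonglongrightarrow> 0" by simp
  from Lim_null_comparison[OF main this]
  have "(\<lambda>m. LK (?s m *\<^sub>R (z m - z0)) - ?V m) \<longlonglongrightarrow> 0" .
  from tendsto_add[OF this V] have "(\<lambda>m. LK (?s m *\<^sub>R (z m - z0))) \<longlonglongrightarrow> v" by simp
  moreover have "isCont G v" using G_facts(3) by (simp add: continuous_on_eq_continuous_at)
  ultimately have "(\<lambda>m. G (LK (?s m *\<^sub>R (z m - z0)))) \<longlonglongrightarrow> G v" by (rule isCont_tendsto_compose[rotated])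
  then show ?thesis by (simp add: G_facts(2))
qed

text \<open>The interior of a cone is invariant under positive scaling: if the scaled error has an
  interior limit, then the small unscaled error is eventually interior too, and close to the apex
  this means interior to the cell. There the projection has the matrix derivative
  \<open>A i\<close>.\<close>

lemma sd_coord_map_tendsto:
  fixes \<nu> :: "nat \<Rightarrow> nat" and f :: "nat \<Rightarrow> real^'q \<Rightarrow> real^'q" and J :: "nat \<Rightarrow> real^'q \<Rightarrow> real^'q^'q"
  assumes \<nu>: "filterlim \<nu> at_top sequentially" and i: "i \<in> {1..k}"
    and h: "(\<lambda>m. sqrt (real (\<nu> m)) *\<^sub>R (z m - z0)) \<longlonglongrightarrow> h" and hi: "h \<in> interior (Kc i)"
    and Op: "open Op" "x0 \<in> Op"
    and fd: "\<And>m x. x \<in> Op \<Longrightarrow> (f m has_derivative (\<lambda>h. J m x *v h)) (at x)"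
    and flip: "\<And>m. (c m)-lipschitz_on Op (f m)"
    and Jlip: "\<And>m x x'. x \<in> Op \<Longrightarrow> x' \<in> Op \<Longrightarrow> norm (J m x - J m x') \<le> c m * norm (x - x')"
    and J: "(\<lambda>m. J m x0) \<longlonglongrightarrow> L" and c: "\<And>m. c m \<le> B" and W: "W \<longlonglongrightarrow> W0"
  shows "z \<longlonglongrightarrow> z0"
    "(\<lambda>m. sd_coord_map (B_deriv (normal_map (f m) S) (z m)) (W m) j) \<longlonglongrightarrow> sd_coord (Mx i) W0 j"
proof -
  let ?s = "\<lambda>m. sqrt (real (\<nu> m))"
  have s_lim: "filterlim ?s at_top sequentially"
    by (intro filterlim_compose[OF sqrt_at_top] filterlim_compose[OF filterlim_real_sequentially \<nu>])
  have ev3: "\<forall>\<^sub>F m in sequentially. 1 \<le> \<nu> m" using \<nu> unfolding filterlim_at_top by blast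
  have is_lim: "(\<lambda>m. inverse (?s m)) \<longlonglongrightarrow> 0"
    by (rule tendsto_inverse_0_at_top[OF s_lim])
  have "(\<lambda>m. inverse (?s m) *\<^sub>R (?s m *\<^sub>R (z m - z0))) \<longlonglongrightarrow> 0 *\<^sub>R h" by (intro tendsto_scaleR is_lim h)
  moreover have "\<forall>\<^sub>F m in sequentially. inverse (?s m) *\<^sub>R (?s m *\<^sub>R (z m - z0)) = z m - z0"
    using ev3 by eventually_elim simp
  ultimately have "(\<lambda>m. z m - z0) \<longlonglongrightarrow> 0 *\<^sub>R h" by (rule Lim_transform_eventually)
  then have zd: "(\<lambda>m. z m - z0) \<longlonglongrightarrow> 0" by simp
  then show z: "z \<longlonglongrightarrow> z0" by (simp add: LIM_zero_iff)
  have "isCont (closest_point S) z0" using S_facts(4) by (simp add: continuous_on_eq_continuous_at)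
  from isCont_tendsto_compose[OF this z] have x: "(\<lambda>m. closest_point S (z m)) \<longlonglongrightarrow> x0" by (simp add: closest_point_z0)
  have ev1: "\<forall>\<^sub>F m in sequentially. closest_point S (z m) \<in> Op" using topological_tendstoD[OF x Op] .
  obtain \<rho> where \<rho>: "\<rho> > 0" "\<And>u. u \<in> interior (Kc i) \<Longrightarrow> norm u < \<rho> \<Longrightarrow> z0 + u \<in> interior (P i)"
    using Kc_interior_cell[OF i] by blast
  have ev2: "\<forall>\<^sub>F m in sequentially. ?s m *\<^sub>R (z m - z0) \<in> interior (Kc i)" using topological_tendstoD[OF h open_interior hi] .
  have ev4: "\<forall>\<^sub>F m in sequentially. norm (z m - z0) < \<rho>"
    using tendstoD[OF zd \<rho>(1)] by simp
  define N where "N m = J m (closest_point S (z m)) ** A i + mat 1 - A i" for m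
  have bd: "\<forall>\<^sub>F m in sequentially. B_deriv (normal_map (f m) S) (z m) = (\<lambda>h. N m *v h)"
    using ev1 ev2 ev3 ev4
  proof eventually_elim
    case (elim m)
    have sp: "?s m > 0" using elim(3) by simp
    have "inverse (?s m) *\<^sub>R (?s m *\<^sub>R (z m - z0)) \<in> interior (Kc i)"
      using sp by (intro Kc_interior_scale[OF i elim(2)]) simp
    then have "z m - z0 \<in> interior (Kc i)" using sp by simp
    from \<rho>(2)[OF this elim(4)] have "z m \<in> interior (P i)" by simp
    from has_B_derivative_unique[OF closest_point_has_B_derivative[OF S S_facts(1)] A[OF i this]]
    have cp: "closest_point (critical_cone S (z m)) = (\<lambda>h. A i *v h)" .
    have "B_deriv (normal_map (f m) S) (z m) = (\<lambda>h. J m (closest_point S (z m)) *v closest_point (critical_cone S (z m)) h + h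
        - closest_point (critical_cone S (z m)) h)"
      by (rule B_deriv_eq, rule normal_map_has_B_derivative[OF S S_facts(1) Op(1) elim(1) flip fd[OF elim(1)]])
    then show ?case unfolding cp N_def
      by (simp add: matrix_vector_mult_diff_rdistrib matrix_vector_mult_add_rdistrib matrix_vector_mul_assoc)
  qed
  have "(\<lambda>m. J m (closest_point S (z m)) - J m x0) \<longlonglongrightarrow> 0"
  proof (rule Lim_null_comparison)
    show "\<forall>\<^sub>F m in sequentially. norm (J m (closest_point S (z m)) - J m x0) \<le> \<bar>B\<bar> * norm (closest_point S (z m) - x0)"
      using ev1
    proof eventually_elim
      case (elim m)
      have "norm (J m (closest_point S (z m)) - J m x0) \<le> c m * norm (closest_point S (z m) - x0)" by (rule Jlip[OF elim Op(2)])
      also have "\<dots> \<le> \<bar>B\<bar> * norm (closest_point S (z m) - x0)" using c[of m] by (intro mult_right_mono) auto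
      finally show ?case .
    qed
    have "(\<lambda>m. \<bar>B\<bar> * norm (closest_point S (z m) - x0)) \<longlonglongrightarrow> \<bar>B\<bar> * norm (x0 - x0)" by (intro tendsto_intros x)
    then show "(\<lambda>m. \<bar>B\<bar> * norm (closest_point S (z m) - x0)) \<longlonglongrightarrow> 0" by simp
  qed
  from tendsto_add[OF this J] have Jz: "(\<lambda>m. J m (closest_point S (z m))) \<longlonglongrightarrow> L" by simp
  have "(\<lambda>m. J m (closest_point S (z m)) ** A i) \<longlonglongrightarrow> L ** A i"
    unfolding matrix_matrix_mult_def by (intro vec_tendstoI) (auto intro!: tendsto_intros Jz)
  then have N: "N \<longlonglongrightarrow> Mx i" unfolding N_def Mx[OF i] by (intro tendsto_intros)
  show "(\<lambda>m. sd_coord_map (B_deriv (normal_map (f m) S) (z m)) (W m) j) \<longlonglongrightarrow> sd_coord (Mx i) W0 j"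
  proof (rule tendstoI)
    fix \<tau> :: real assume "0 < \<tau>"
    then obtain \<epsilon> where \<epsilon>: "\<epsilon> > 0" "\<And>B V. norm (B - Mx i) < \<epsilon> \<Longrightarrow> norm (V - W0) < \<epsilon> \<Longrightarrow>
        det B \<noteq> 0 \<and> \<bar>sd_coord B V j - sd_coord (Mx i) W0 j\<bar> < \<tau>"
      using sd_coord_continuous[OF Mx_det[OF i], of \<tau> W0 j] by blast
    have "\<forall>\<^sub>F m in sequentially. norm (N m - Mx i) < \<epsilon>" "\<forall>\<^sub>F m in sequentially. norm (W m - W0) < \<epsilon>"
      using tendstoD[OF N \<epsilon>(1)] tendstoD[OF W \<epsilon>(1)] by (auto simp: dist_norm)
    with bd show "\<forall>\<^sub>F m in sequentially. dist (sd_coord_map (B_deriv (normal_map (f m) S) (z m)) (W m) j) (sd_coord (Mx i) W0 j) < \<tau>"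
    proof eventually_elim
      case (elim m)
      \<comment> \<open>Matrices near \<open>Mx i\<close> are nonsingular, so
        \<open>sd_coord_map\<close> is not at its default value 0.\<close>
      have d: "det (N m) \<noteq> 0" "\<bar>sd_coord (N m) (W m) j - sd_coord (Mx i) W0 j\<bar> < \<tau>" using \<epsilon>(2)[OF elim(2,3)] by auto
      have "bij ((*v) (N m))" using d(1) by (simp add: invertible_eq_bij[symmetric] invertible_det_nz)
      then have "sd_coord_map ((*v) (N m)) (W m) j = sd_coord (N m) (W m) j"
        by (simp add: sd_coord_map_def)
      then show ?case unfolding elim(1) using d(2) by (simp add: dist_real_def)
    qed
  qed
qed

end

text \<open>The sample is evaluated at a moving point, \<open>X\<close> against \<open>X0\<close> at
  the limit point. Each observation changes by at most its Lipschitz constant times \<delta>, and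
  bounded averages of these constants and of their squares make the change of both moments
  vanish.\<close>

lemma sample_covariance_tendsto:
  fixes \<nu> :: "nat \<Rightarrow> nat" and X X0 :: "nat \<Rightarrow> nat \<Rightarrow> real^'q" and c :: "nat \<Rightarrow> nat \<Rightarrow> real"
  assumes \<nu>: "filterlim \<nu> at_top sequentially" and \<delta>: "\<delta> \<longlonglongrightarrow> 0" "\<forall>\<^sub>F m in sequentially. 0 \<le> \<delta> m"
    and close: "\<forall>\<^sub>F m in sequentially. \<forall>l\<in>{1..\<nu> m}. norm (X m l - X0 m l) \<le> c m l * \<delta> m"
    and c1: "(\<lambda>m. (\<Sum>l=1..\<nu> m. c m l) / real (\<nu> m)) \<longlonglongrightarrow> s1"
    and c2: "(\<lambda>m. (\<Sum>l=1..\<nu> m. (c m l)\<^sup>2) / real (\<nu> m)) \<longlonglongrightarrow> s2"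
    and p: "\<And>i. (\<lambda>m. (\<Sum>l=1..\<nu> m. X0 m l $ i) / real (\<nu> m)) \<longlonglongrightarrow> p i"
    and q: "\<And>i j. (\<lambda>m. (\<Sum>l=1..\<nu> m. X0 m l $ i * X0 m l $ j) / real (\<nu> m)) \<longlonglongrightarrow> q i j"
  shows "(\<lambda>m. sample_covariance (\<nu> m) (X m)) \<longlonglongrightarrow> (\<chi> i j. q i j - p i * p j)"
proof (intro vec_tendstoI)
  fix i j
  let ?n = "\<lambda>m. real (\<nu> m)"
  let ?avg = "\<lambda>g m. (\<Sum>l=1..\<nu> m. g m l) / ?n m"
  have avg_diff: "\<bar>?avg g m - ?avg g' m\<bar> \<le> ?avg b m"
    if "\<And>l. l \<in> {1..\<nu> m} \<Longrightarrow> \<bar>g m l - g' m l\<bar> \<le> b m l" for g g' b :: "nat \<Rightarrow> nat \<Rightarrow> real" and m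
  proof -
    have "\<bar>?avg g m - ?avg g' m\<bar> = \<bar>\<Sum>l=1..\<nu> m. g m l - g' m l\<bar> / ?n m"
      by (simp add: sum_subtractf diff_divide_distrib[symmetric])
    also have "\<dots> \<le> (\<Sum>l=1..\<nu> m. \<bar>g m l - g' m l\<bar>) / ?n m" by (intro divide_right_mono sum_abs) auto
    also have "\<dots> \<le> ?avg b m" using that by (intro divide_right_mono sum_mono) auto
    finally show ?thesis .
  qed
  have mean: "(\<lambda>m. ?avg (\<lambda>m l. X m l $ i) m) \<longlonglongrightarrow> p i" for i
  proof -
    have "(\<lambda>m. ?avg (\<lambda>m l. X m l $ i) m - ?avg (\<lambda>m l. X0 m l $ i) m) \<longlonglongrightarrow> 0"
    proof (rule Lim_null_comparison)
      show "\<forall>\<^sub>F m in sequentially. norm (?avg (\<lambda>m l. X m l $ i) m - ?avg (\<lambda>m l. X0 m l $ i) m) \<le> ?avg c m * \<delta> m"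
        using close
      proof eventually_elim
        case (elim m)
        have "\<bar>X m l $ i - X0 m l $ i\<bar> \<le> c m l * \<delta> m" if "l \<in> {1..\<nu> m}" for l
          using bspec[OF elim that] component_le_norm_cart[of "X m l - X0 m l" i] by (metis order_trans vector_minus_component)
        then have "\<bar>?avg (\<lambda>m l. X m l $ i) m - ?avg (\<lambda>m l. X0 m l $ i) m\<bar> \<le> ?avg (\<lambda>m l. c m l * \<delta> m) m" by (rule avg_diff)
        then show ?case by (simp add: sum_distrib_right[symmetric])
      qed
      show "(\<lambda>m. ?avg c m * \<delta> m) \<longlonglongrightarrow> 0" using tendsto_mult[OF c1 \<delta>(1)] by simp
    qed
    from tendsto_add[OF this p[of i]] show ?thesis by simp
  qed
  define t where "t m = (\<Sum>a\<in>UNIV. ?avg (\<lambda>m l. X0 m l $ a * X0 m l $ a) m)" for m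
  have t: "t \<longlonglongrightarrow> (\<Sum>a\<in>UNIV. q a a)" unfolding t_def by (intro tendsto_sum q)
  have t_eq: "?avg (\<lambda>m l. (norm (X0 m l))\<^sup>2) m = t m" for m
  proof -
    have "(norm (X0 m l))\<^sup>2 = (\<Sum>a\<in>UNIV. X0 m l $ a * X0 m l $ a)" for l
      by (simp add: power2_norm_eq_inner inner_vec_def)
    then show ?thesis by (simp add: t_def sum.swap[of _ UNIV] sum_divide_distrib[symmetric])
  qed
  have second: "(\<lambda>m. ?avg (\<lambda>m l. X m l $ i * X m l $ j) m) \<longlonglongrightarrow> q i j"
  proof -
    \<comment> \<open>Bound on the change of a product of entries: the cross term 2 c norm(X0) is
      split by the arithmetic-geometric inequality so that only averages of squares remain.\<close>
    let ?b = "\<lambda>m l. \<delta> m * ((c m l)\<^sup>2 + (norm (X0 m l))\<^sup>2 + \<delta> m * (c m l)\<^sup>2)"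
    have "(\<lambda>m. ?avg (\<lambda>m l. X m l $ i * X m l $ j) m - ?avg (\<lambda>m l. X0 m l $ i * X0 m l $ j) m) \<longlonglongrightarrow> 0"
    proof (rule Lim_null_comparison)
      show "\<forall>\<^sub>F m in sequentially. norm (?avg (\<lambda>m l. X m l $ i * X m l $ j) m - ?avg (\<lambda>m l. X0 m l $ i * X0 m l $ j) m)
          \<le> \<delta> m * (?avg (\<lambda>m l. (c m l)\<^sup>2) m + t m + \<delta> m * ?avg (\<lambda>m l. (c m l)\<^sup>2) m)"
        using close \<delta>(2)
      proof eventually_elim
        case (elim m)
        have "\<bar>X m l $ i * X m l $ j - X0 m l $ i * X0 m l $ j\<bar> \<le> ?b m l" if l: "l \<in> {1..\<nu> m}" for l
        proof -
          define d where "d = X m l - X0 m l"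
          define N where "N = norm (X0 m l)"
          have nd: "norm d \<le> c m l * \<delta> m" using bspec[OF elim(1) l] by (simp add: d_def)
          have comp: "\<bar>u $ a\<bar> \<le> norm u" for u :: "real^'q" and a by (rule component_le_norm_cart)
          have "X m l $ i * X m l $ j - X0 m l $ i * X0 m l $ j = d $ i * X0 m l $ j + X0 m l $ i * d $ j + d $ i * d $ j"
            by (simp add: d_def algebra_simps)
          then have "\<bar>X m l $ i * X m l $ j - X0 m l $ i * X0 m l $ j\<bar> \<le> \<bar>d $ i\<bar> * \<bar>X0 m l $ j\<bar> + \<bar>X0 m l $ i\<bar> * \<bar>d $ j\<bar> + \<bar>d $ i\<bar> * \<bar>d $ j\<bar>"
            by (simp add: abs_mult[symmetric])
          also have "\<dots> \<le> norm d * N + N * norm d + norm d * norm d"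
            unfolding N_def by (intro add_mono mult_mono comp) auto
          also have "\<dots> \<le> (c m l * \<delta> m) * N + N * (c m l * \<delta> m) + (c m l * \<delta> m) * (c m l * \<delta> m)"
            using nd order_trans[OF norm_ge_zero nd] by (intro add_mono mult_mono) (auto simp: N_def)
          also have "\<dots> = \<delta> m * (2 * c m l * N + \<delta> m * (c m l)\<^sup>2)" by (simp add: power2_eq_square algebra_simps)
          also have "\<dots> \<le> \<delta> m * ((c m l)\<^sup>2 + N\<^sup>2 + \<delta> m * (c m l)\<^sup>2)"
          proof (intro mult_left_mono add_right_mono)
            show "2 * c m l * N \<le> (c m l)\<^sup>2 + N\<^sup>2" by (rule sum_squares_bound)
          qed (use elim(2) in auto)
          finally show ?thesis by (simp add: N_def)
        qed
        then have "\<bar>?avg (\<lambda>m l. X m l $ i * X m l $ j) m - ?avg (\<lambda>m l. X0 m l $ i * X0 m l $ j) m\<bar> \<le> ?avg ?b m" by (rule avg_diff)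
        also have "?avg ?b m = \<delta> m * (?avg (\<lambda>m l. (c m l)\<^sup>2) m + t m + \<delta> m * ?avg (\<lambda>m l. (c m l)\<^sup>2) m)"
          unfolding t_eq[symmetric] by (simp add: sum_distrib_left[symmetric] sum.distrib add_divide_distrib distrib_left)
        finally show ?case by simp
      qed
      have "(\<lambda>m. \<delta> m * (?avg (\<lambda>m l. (c m l)\<^sup>2) m + t m + \<delta> m * ?avg (\<lambda>m l. (c m l)\<^sup>2) m)) \<longlonglongrightarrow> 0 * (s2 + (\<Sum>a\<in>UNIV. q a a) + 0 * s2)"
        by (intro tendsto_mult tendsto_add \<delta>(1) c2 t)
      then show "(\<lambda>m. \<delta> m * (?avg (\<lambda>m l. (c m l)\<^sup>2) m + t m + \<delta> m * ?avg (\<lambda>m l. (c m l)\<^sup>2) m)) \<longlonglongrightarrow> 0" by simp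
    qed
    from tendsto_add[OF this q[of i j]] show ?thesis by simp
  qed
  \<comment> \<open>The unbiased normalisation differs from plain averaging by n/(n-1).\<close>
  have fac: "(\<lambda>m. ?n m / (?n m - 1)) \<longlonglongrightarrow> 1"
  proof -
    have "(\<lambda>n. real (Suc n) / (real (Suc n) - 1)) \<longlonglongrightarrow> 1"
      using LIMSEQ_Suc_n_over_n[where 'a=real] by simp
    then have "(\<lambda>n. real n / (real n - 1)) \<longlonglongrightarrow> 1" by (rule LIMSEQ_imp_Suc)
    from filterlim_compose[OF this \<nu>] show ?thesis .
  qed
  have "(\<lambda>m. ?n m / (?n m - 1) * (?avg (\<lambda>m l. X m l $ i * X m l $ j) m - ?avg (\<lambda>m l. X m l $ i) m * ?avg (\<lambda>m l. X m l $ j) m)) \<longlonglongrightarrow> 1 * (q i j - p i * p j)"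
    by (intro tendsto_intros fac second mean)
  moreover have "\<forall>\<^sub>F m in sequentially. ?n m / (?n m - 1) * (?avg (\<lambda>m l. X m l $ i * X m l $ j) m - ?avg (\<lambda>m l. X m l $ i) m * ?avg (\<lambda>m l. X m l $ j) m)
      = sample_covariance (\<nu> m) (X m) $ i $ j"
  proof -
    have "\<forall>\<^sub>F m in sequentially. 1 \<le> \<nu> m" using \<nu> unfolding filterlim_at_top by blast
    then show ?thesis
    proof eventually_elim
      case (elim m)
      let ?N = "?n m"
      have N: "?N \<noteq> 0" using elim by simp
      define a where "a i = (\<Sum>l=1..\<nu> m. X m l $ i)" for i
      define s where "s = (\<Sum>l=1..\<nu> m. X m l $ i * X m l $ j)"
      have "(\<Sum>l=1..\<nu> m. (X m l $ i - a i / ?N) * (X m l $ j - a j / ?N)) = s - a i / ?N * a j - a i * (a j / ?N) + ?N * (a i / ?N * (a j / ?N))"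
        by (simp add: algebra_simps sum.distrib sum_subtractf sum_distrib_left[symmetric] a_def s_def sum_distrib_right[symmetric] sum_divide_distrib[symmetric])
      also have "\<dots> = ?N * (s / ?N - a i / ?N * (a j / ?N))" using N by (simp add: field_simps)
      finally have "(\<Sum>l=1..\<nu> m. (X m l $ i - a i / ?N) * (X m l $ j - a j / ?N)) / (?N - 1) = ?N / (?N - 1) * (s / ?N - a i / ?N * (a j / ?N))"
        by simp
      moreover have "sample_covariance (\<nu> m) (X m) $ i $ j
          = (\<Sum>l=1..\<nu> m. (X m l $ i - a i / ?N) * (X m l $ j - a j / ?N)) / (?N - 1)"
        by (simp add: sample_covariance_def Let_def a_def divide_inverse_commute)
      ultimately show ?case unfolding a_def s_def by (simp only:)
    qed
  qed
  ultimately have "(\<lambda>m. sample_covariance (\<nu> m) (X m) $ i $ j) \<longlonglongrightarrow> 1 * (q i j - p i * p j)" by (rule Lim_transform_eventually)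
  then show "(\<lambda>m. sample_covariance (\<nu> m) (X m) $ i $ j) \<longlonglongrightarrow> (\<chi> i j. q i j - p i * p j) $ i $ j" by simp
qed

section \<open>Limit distribution of the normalised error\<close>

text \<open>The event itself may be nonmeasurable; off a null set D it equals the measurable E', so
  it differs from E' - D by a part of D and belongs to the completion.\<close>

lemma Prob_AE_eq:
  assumes "prob_space M" and E': "E' \<in> sets M" and ae: "AE w in M. E w \<longleftrightarrow> w \<in> E'"
  shows "Prob M E = measure M E'"
proof -
  interpret prob_space M by fact
  obtain D where D: "D \<in> null_sets M" "{w\<in>space M. \<not> (E w \<longleftrightarrow> w \<in> E')} \<subseteq> D"
    using ae by (auto simp: eventually_ae_filter)
  have eq: "{w\<in>space M. E w} = (E' - D) \<union> ({w\<in>space M. E w} \<inter> D)"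
    using D(2) sets.sets_into_space[OF E'] by blast
  have sD: "E' - D \<in> sets M" using D(1) E' by auto
  have "{w\<in>space M. E w} \<in> sets (completion M)"
    by (rule sets_completionI[OF eq _ D(1) sD]) blast
  moreover have "emeasure (completion M) {w\<in>space M. E w} = emeasure M (E' - D)"
  proof (rule antisym)
    have "emeasure (completion M) {w\<in>space M. E w} \<le> emeasure (completion M) (E' \<union> D)"
    proof (rule emeasure_mono)
      show "{w\<in>space M. E w} \<subseteq> E' \<union> D" using eq by blast
      show "E' \<union> D \<in> sets (completion M)" using E' D(1) by (intro sets_completionI_sets) auto
    qed
    also have "\<dots> = emeasure M (E' \<union> D)"
    proof -
      have "E' \<union> D \<in> sets M" using E' D(1) by auto
      then show ?thesis by simp
    qed
    also have "\<dots> = emeasure M (E' - D)"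
      using E' D(1) by (intro emeasure_eq_AE) (auto dest: AE_not_in elim!: eventually_mono)
    finally show "emeasure (completion M) {w\<in>space M. E w} \<le> emeasure M (E' - D)" .
    have "emeasure M (E' - D) = emeasure (completion M) (E' - D)" using sD by simp
    also have "\<dots> \<le> emeasure (completion M) {w\<in>space M. E w}"
      by (rule emeasure_mono) (use eq \<open>{w\<in>space M. E w} \<in> sets (completion M)\<close> in auto)
    finally show "emeasure M (E' - D) \<le> emeasure (completion M) {w\<in>space M. E w}" .
  qed
  moreover have "emeasure M (E' - D) = emeasure M E'"
    using E' D(1) by (rule emeasure_Diff_null_set[rotated])
  ultimately show ?thesis by (simp add: Prob_def measure_def)
qed

text \<open>Dominated convergence of indicators. It passes from a random index, after which the
  sample is good, to probabilities at a fixed n.\<close>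

lemma (in prob_space) eventually_not_imp_prob_tendsto_0:
  assumes A: "\<And>n. A n \<in> events" and ae: "AE w in M. \<forall>\<^sub>F n in sequentially. w \<notin> A n"
  shows "(\<lambda>n. prob (A n)) \<longlonglongrightarrow> 0"
proof -
  have "(\<lambda>n. \<integral>w. indicator (A n) w \<partial>M) \<longlonglongrightarrow> (\<integral>w. 0 \<partial>M :: real)"
  proof (rule integral_dominated_convergence[where w="\<lambda>_. 1"])
    show "AE w in M. (\<lambda>n. indicator (A n) w) \<longlonglongrightarrow> (0::real)"
      using ae
    proof eventually_elim
      case (elim w)
      then show ?case by (intro tendsto_eventually) (auto elim!: eventually_mono)
    qed
  qed (use A in auto)
  moreover have "(\<integral>w. indicator (A n) w \<partial>M) = prob (A n)" for n
    using A[of n] sets.sets_into_space by (simp add: Int_absorb2)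
  ultimately show ?thesis by simp
qed

text \<open>The points that are far out or close to \<open>B\<close> form closed sets
  \<open>D m\<close>, decreasing to \<open>B\<close>. One of them has small mass under the limit,
  the closed portmanteau inequality passes this on to \<open>V n\<close>, and its complement lies in
  the compact set \<open>C m\<close> away from \<open>B\<close>.\<close>

lemma compact_off_null_closed:
  fixes V :: "nat \<Rightarrow> 'w \<Rightarrow> 'a::euclidean_space" and Y :: "'v \<Rightarrow> 'a"
  assumes "prob_space M" "prob_space N"
    and V[measurable]: "\<And>n. V n \<in> borel_measurable M" and Y[measurable]: "Y \<in> borel_measurable N"
    and W: "\<And>(\<phi>::'a \<Rightarrow> real) B. continuous_on UNIV \<phi> \<Longrightarrow> (\<And>t. \<bar>\<phi> t\<bar> \<le> B) \<Longrightarrow>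
      (\<lambda>n. \<integral>w. \<phi> (V n w) \<partial>M) \<longlonglongrightarrow> (\<integral>v. \<phi> (Y v) \<partial>N)"
    and B: "closed B" "B \<noteq> {}" and null: "AE v in N. Y v \<notin> B" and \<tau>: "0 < \<tau>"
  shows "\<exists>C. compact C \<and> C \<inter> B = {} \<and> (\<forall>\<^sub>F n in sequentially. measure M {w\<in>space M. V n w \<notin> C} \<le> \<tau>)"
proof -
  interpret M: prob_space M by fact
  interpret N: prob_space N by fact
  define D where "D m = {y::'a. real m \<le> norm y} \<union> {y. infdist y B \<le> inverse (real (Suc m))}" for m
  define C where "C m = {y::'a. norm y \<le> real m} \<inter> {y. inverse (real (Suc m)) \<le> infdist y B}" for m
  have clD: "closed (D m)" for m
    unfolding D_def by (intro closed_Un closed_Collect_le continuous_intros)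
  have [measurable]: "D m \<in> sets borel" for m using clD by simp
  have cpC: "compact (C m)" for m
  proof -
    have "C m = cball 0 (real m) \<inter> {y. inverse (real (Suc m)) \<le> infdist y B}" by (auto simp: C_def)
    moreover have "closed {y. inverse (real (Suc m)) \<le> infdist y B}" by (intro closed_Collect_le continuous_intros)
    ultimately show ?thesis by (simp add: compact_Int_closed)
  qed
  have [measurable]: "C m \<in> sets borel" for m using compact_imp_closed[OF cpC] by simp
  have CB: "C m \<inter> B = {}" for m
  proof -
    have "infdist y B = 0" if "y \<in> B" for y using that by simp
    moreover have "0 < inverse (real (Suc m))" by simp
    ultimately show ?thesis unfolding C_def by (auto simp: not_le[symmetric])
  qed
  let ?A = "\<lambda>m. {v\<in>space N. Y v \<in> D m}"
  have "decseq ?A"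
  proof (rule decseq_SucI)
    fix m
    have "inverse (real (Suc (Suc m))) \<le> inverse (real (Suc m))" by (intro le_imp_inverse_le) auto
    then show "?A (Suc m) \<subseteq> ?A m" unfolding D_def by (auto intro: order_trans)
  qed
  then have "(\<lambda>m. measure N (?A m)) \<longlonglongrightarrow> measure N (\<Inter>m. ?A m)"
    by (intro N.finite_Lim_measure_decseq) auto
  moreover have "measure N (\<Inter>m. ?A m) = 0"
  proof -
    have "AE v in N. v \<notin> (\<Inter>m. ?A m)"
      using null
    proof eventually_elim
      case (elim v)
      have d: "infdist (Y v) B > 0" using infdist_pos_not_in_closed[OF B elim] .
      obtain m1 where m1: "norm (Y v) < real m1" using reals_Archimedean2 by blast
      obtain m2 where m2: "inverse (real (Suc m2)) < infdist (Y v) B" using reals_Archimedean[OF d] by blast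
      have "inverse (real (Suc (m1 + m2))) \<le> inverse (real (Suc m2))" by (intro le_imp_inverse_le) auto
      then have a: "inverse (real (Suc (m1 + m2))) < infdist (Y v) B" using m2 by (rule le_less_trans)
      have "norm (Y v) < real (m1 + m2)" using m1 by simp
      then have "Y v \<notin> D (m1 + m2)" using a unfolding D_def Un_iff mem_Collect_eq not_le de_Morgan_disj by blast
      then show ?case by blast
    qed
    then have "measure N (\<Inter>m. ?A m) = measure N {}" by (intro N.finite_measure_eq_AE) auto
    then show ?thesis by simp
  qed
  ultimately have "\<forall>\<^sub>F m in sequentially. measure N (?A m) < \<tau> / 2"
    using \<tau> by (intro order_tendstoD) auto
  then obtain m where m: "measure N (?A m) < \<tau> / 2" by (auto simp: eventually_sequentially)
  have "\<forall>\<^sub>F n in sequentially. measure M {w\<in>space M. V n w \<in> D m} \<le> measure N (?A m) + \<tau> / 2"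
    by (rule portmanteau_closed[OF \<open>prob_space M\<close> \<open>prob_space N\<close> V Y W clD]) (use \<tau> in auto)
  then have "\<forall>\<^sub>F n in sequentially. measure M {w\<in>space M. V n w \<notin> C m} \<le> \<tau>"
  proof eventually_elim
    case (elim n)
    have "measure M {w\<in>space M. V n w \<notin> C m} \<le> measure M {w\<in>space M. V n w \<in> D m}"
    proof (rule M.finite_measure_mono)
      show "{w\<in>space M. V n w \<notin> C m} \<subseteq> {w\<in>space M. V n w \<in> D m}"
        unfolding C_def D_def by auto
      show "{w\<in>space M. V n w \<in> D m} \<in> sets M" by measurable
    qed
    then show ?case using elim m by linarith
  qed
  then show ?thesis using cpC[of m] CB[of m] by blast
qed

lemma normal_random_vector_hyperplane:
  fixes Y :: "'v \<Rightarrow> real^'n"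
  assumes N: "prob_space N" and Y: "normal_random_vector N Y 0 V" and pos: "0 < a \<bullet> (V *v a)"
  shows "AE v in N. a \<bullet> Y v \<noteq> b"
proof -
  interpret prob_space N by fact
  have [measurable]: "Y \<in> borel_measurable N" using Y by (simp add: normal_random_vector_def)
  let ?s = "sqrt (a \<bullet> (V *v a))"
  have d: "distr N borel (\<lambda>v. (a \<bullet> Y v) / ?s) = std_normal_distribution"
    by (rule normal_random_vector_inner_distributed[OF N Y pos])
  have "measure N {v\<in>space N. (a \<bullet> Y v) / ?s \<in> {b / ?s}} = measure (distr N borel (\<lambda>v. (a \<bullet> Y v) / ?s)) {b / ?s}"
    by (subst measure_distr) (auto intro!: arg_cong[where f="measure N"])
  also have "\<dots> = 0" unfolding d by (rule std_normal_cdf(2))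
  finally have "emeasure N {v\<in>space N. (a \<bullet> Y v) / ?s \<in> {b / ?s}} = 0" by (simp add: emeasure_eq_measure)
  then have "AE v in N. (a \<bullet> Y v) / ?s \<notin> {b / ?s}" by (subst AE_iff_measurable[OF _ refl]) auto
  then show ?thesis by eventually_elim auto
qed

lemma normal_random_vector_abs_le:
  fixes Y :: "'v \<Rightarrow> real^'n"
  assumes N: "prob_space N" and Y: "normal_random_vector N Y 0 V" and pos: "0 < a \<bullet> (V *v a)"
    and \<alpha>: "\<alpha> \<in> {0<..<1}"
  shows "measure N {v\<in>space N. \<bar>(a \<bullet> Y v) / sqrt (a \<bullet> (V *v a))\<bar> \<le> sqrt (chi_square_1_quantile \<alpha>)} = 1 - \<alpha>"
proof -
  interpret prob_space N by fact
  have [measurable]: "Y \<in> borel_measurable N" using Y by (simp add: normal_random_vector_def)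
  let ?s = "sqrt (a \<bullet> (V *v a))" and ?c = "sqrt (chi_square_1_quantile \<alpha>)"
  have d: "distr N borel (\<lambda>v. (a \<bullet> Y v) / ?s) = std_normal_distribution"
    by (rule normal_random_vector_inner_distributed[OF N Y pos])
  have "measure N {v\<in>space N. \<bar>(a \<bullet> Y v) / ?s\<bar> \<le> ?c} = measure (distr N borel (\<lambda>v. (a \<bullet> Y v) / ?s)) {x. \<bar>x\<bar> \<le> ?c}"
    by (subst measure_distr) (auto intro!: arg_cong[where f="measure N"])
  then show ?thesis unfolding d using chi_square_1_quantile(2)[OF \<alpha>] by simp
qed

lemma sd_coord_pos:
  fixes B V :: "real^'n^'n"
  assumes B: "det B \<noteq> 0" and V: "\<And>a. a \<noteq> 0 \<Longrightarrow> 0 < a \<bullet> (V *v a)"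
  shows "matrix_inv B $ j \<noteq> 0" "0 < sd_coord B V j"
proof -
  have "(matrix_inv B *v (B *v axis j 1)) $ j = 1"
    using matrix_inv_inverse[OF B] by (simp add: matrix_vector_mul_assoc)
  then have "matrix_inv B $ j \<bullet> (B *v axis j 1) = 1" by (simp add: matrix_vector_mult_inner)
  then show "matrix_inv B $ j \<noteq> 0" by auto
  then show "0 < sd_coord B V j" using V by (simp add: sd_coord_inner)
qed

lemma linear_matrix_vector_left: "linear (\<lambda>A::real^'n^'m. A *v h)"
  by (rule linearI) (simp_all add: matrix_vector_mult_add_rdistrib scaleR_matrix_vector_assoc)

lemma sample_mean_matrix_vector:
  "((\<Sum>l=1..n. A l) /\<^sub>R real n) *v h = (\<Sum>l=1..n. A l *v h) /\<^sub>R real n" for A :: "nat \<Rightarrow> real^'n^'m"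
proof -
  have "(\<Sum>l=1..n. A l) *v h = (\<Sum>l=1..n. A l *v h)"
    by (rule linear_sum[OF linear_matrix_vector_left])
  then show ?thesis by (simp add: scaleR_matrix_vector_assoc[symmetric])
qed

lemma sample_mean_norm_le:
  fixes g :: "nat \<Rightarrow> 'a::real_normed_vector"
  assumes "\<And>l. l \<in> {1..n} \<Longrightarrow> norm (g l) \<le> b l"
  shows "norm ((\<Sum>l=1..n. g l) /\<^sub>R real n) \<le> (\<Sum>l=1..n. b l) / real n"
proof -
  have "norm (\<Sum>l=1..n. g l) \<le> (\<Sum>l=1..n. b l)" by (rule sum_norm_le[OF assms])
  then have "inverse (real n) * norm (\<Sum>l=1..n. g l) \<le> inverse (real n) * (\<Sum>l=1..n. b l)"
    by (intro mult_left_mono) auto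
  then show ?thesis by (simp add: divide_inverse mult.commute)
qed

lemma sample_covariance_cong:
  assumes "\<And>l. l \<in> {1..n} \<Longrightarrow> X l = X' l"
  shows "sample_covariance n X = sample_covariance n X'"
proof -
  have s: "(\<Sum>l=1..n. X l) = (\<Sum>l=1..n. X' l)" by (rule sum.cong) (use assms in auto)
  have "sample_covariance n X $ i $ j = sample_covariance n X' $ i $ j" for i j
    unfolding sample_covariance_def Let_def s vec_lambda_beta
    by (rule arg_cong[where f="\<lambda>t. t / (real n - 1)"], rule sum.cong) (use assms in auto)
  then show ?thesis by (simp add: vec_eq_iff)
qed

context random_field
begin

text \<open>The bounds in \<open>regular\<close> pass to averages, with the mean of the Lipschitz
  constants as constant.\<close>

lemma sample_mean_regular:
  assumes reg: "\<And>l. l \<in> {1..n} \<Longrightarrow> regular (y l)"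
  defines "f x \<equiv> (\<Sum>l=1..n. F x (y l)) /\<^sub>R real n" and "J x \<equiv> (\<Sum>l=1..n. Jx x (y l)) /\<^sub>R real n"
    and "c \<equiv> (\<Sum>l=1..n. lip_const (y l)) / real n"
  shows "x \<in> Op \<Longrightarrow> (f has_derivative (\<lambda>h. J x *v h)) (at x)"
    and "c-lipschitz_on Op f"
    and "x \<in> Op \<Longrightarrow> x' \<in> Op \<Longrightarrow> norm (J x - J x') \<le> c * norm (x - x')"
    and "x \<in> Op \<Longrightarrow> dist x x' < bdry_dist x \<Longrightarrow> norm (f x' - f x - J x *v (x' - x)) \<le> c * (norm (x' - x))\<^sup>2"
proof -
  have Feq: "F x (y l) = Fx x (y l)" if "x \<in> Op" "l \<in> {1..n}" for x l
    using that regularD(1)[OF reg] by (simp add: Fx_def)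
  show "(f has_derivative (\<lambda>h. J x *v h)) (at x)" if x: "x \<in> Op"
  proof -
    have "((\<lambda>x. \<Sum>l=1..n. F x (y l)) has_derivative (\<lambda>h. \<Sum>l=1..n. Jx x (y l) *v h)) (at x)"
      by (intro has_derivative_sum regular_derivative[OF reg x])
    from has_derivative_scaleR_right[OF this, of "inverse (real n)"]
    show ?thesis unfolding f_def J_def sample_mean_matrix_vector .
  qed
  show "c-lipschitz_on Op f"
  proof (rule lipschitz_onI)
    show "0 \<le> c" unfolding c_def by (intro divide_nonneg_nonneg sum_nonneg lip_const_nonneg) auto
    fix x x' assume x: "x \<in> Op" "x' \<in> Op"
    have "f x - f x' = (\<Sum>l=1..n. Fx x (y l) - Fx x' (y l)) /\<^sub>R real n"
      using x Feq by (simp add: f_def sum_subtractf scaleR_diff_right)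
    also have "norm \<dots> \<le> (\<Sum>l=1..n. lip_const (y l) * norm (x - x')) / real n"
      by (rule sample_mean_norm_le) (rule regularD(2)[OF reg x])
    finally show "dist (f x) (f x') \<le> c * dist x x'" by (simp add: c_def dist_norm sum_distrib_right[symmetric])
  qed
  show "norm (J x - J x') \<le> c * norm (x - x')" if x: "x \<in> Op" "x' \<in> Op"
  proof -
    have "J x - J x' = (\<Sum>l=1..n. Jx x (y l) - Jx x' (y l)) /\<^sub>R real n"
      by (simp add: J_def sum_subtractf scaleR_diff_right)
    also have "norm \<dots> \<le> (\<Sum>l=1..n. lip_const (y l) * norm (x - x')) / real n"
      by (rule sample_mean_norm_le) (rule regularD(3)[OF reg x])
    finally show ?thesis by (simp add: c_def sum_distrib_right[symmetric])
  qed
  show "norm (f x' - f x - J x *v (x' - x)) \<le> c * (norm (x' - x))\<^sup>2" if x: "x \<in> Op" and d: "dist x x' < bdry_dist x"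
  proof -
    have "f x' - f x - J x *v (x' - x) = (\<Sum>l=1..n. Fx x' (y l) - Fx x (y l) - Jx x (y l) *v (x' - x)) /\<^sub>R real n"
      unfolding J_def sample_mean_matrix_vector using x bdry_dist_ball[OF x d] Feq
      by (simp add: f_def sum_subtractf scaleR_diff_right)
    also have "norm \<dots> \<le> (\<Sum>l=1..n. lip_const (y l) * (norm (x' - x))\<^sup>2) / real n"
      by (rule sample_mean_norm_le) (rule regularD(4)[OF reg x d])
    finally show ?thesis by (simp add: c_def sum_distrib_right[symmetric])
  qed
qed

lemma measurable_sample_covariance:
  fixes X :: "nat \<Rightarrow> 'w \<Rightarrow> real^'q"
  assumes [measurable]: "\<And>l. l \<in> {1..n} \<Longrightarrow> X l \<in> borel_measurable M"
  shows "(\<lambda>w. sample_covariance n (\<lambda>l. X l w)) \<in> borel_measurable M"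
proof -
  have s: "(\<lambda>w. \<Sum>l=1..n. X l w) \<in> borel_measurable M" by (intro borel_measurable_sum) simp
  have m: "(\<lambda>w. ((\<Sum>l=1..n. X l w) /\<^sub>R real n) $ i) \<in> borel_measurable M" for i
    using s by (intro measurable_vec_nth borel_measurable_scaleR) auto
  show ?thesis unfolding sample_covariance_def Let_def
    by (intro measurable_vec_lambda borel_measurable_divide borel_measurable_sum borel_measurable_times
        borel_measurable_diff m measurable_vec_nth) auto
qed

text \<open>\<open>B_deriv\<close> is a definite description, so measurability cannot be read off.
  On regular samples the derivative is an explicit formula in the mean Jacobian and the projection
  onto a random critical cone; this formula is the measurable version everywhere.\<close>

lemma sd_saa_measurable:
  fixes \<xi>s :: "nat \<Rightarrow> 'w \<Rightarrow> real^'d" and z :: "'w \<Rightarrow> real^'q"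
  assumes S: "polyhedron S" "S \<noteq> {}" and z[measurable]: "z \<in> borel_measurable M"
    and \<xi>s: "\<And>l. l \<in> {1..n} \<Longrightarrow> \<xi>s l \<in> borel_measurable M"
  shows "\<exists>r'. r' \<in> borel_measurable M \<and> (\<forall>w. closest_point S (z w) \<in> Op \<longrightarrow> (\<forall>l\<in>{1..n}. regular (\<xi>s l w)) \<longrightarrow>
    sd_coord_map (B_deriv (normal_map (saa F \<xi>s n w) S) (z w)) (sample_covariance n (\<lambda>l. F (closest_point S (z w)) (\<xi>s l w))) j = r' w)"
proof -
  have cS: "convex S" "closed S" using S polyhedron_imp_convex polyhedron_imp_closed by auto
  have cont: "continuous_on UNIV (closest_point S)" by (rule continuous_on_closest_point[OF cS S(2)])
  have cpm: "(\<lambda>w. closest_point S (g w)) \<in> borel_measurable M" if "g \<in> borel_measurable M" for g :: "'w \<Rightarrow> real^'q"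
    using measurable_compose[OF that borel_measurable_continuous_onI[OF cont]] .
  define p where "p w h = closest_point (critical_cone S (z w)) h" for w h
  \<comment> \<open>The cone moves with w, but its projection is a limit of difference quotients of
    \<open>closest_point S\<close>, by local exactness even eventually constant ones.\<close>
  have pm: "(\<lambda>w. p w h) \<in> borel_measurable M" for h
  proof (rule borel_measurable_LIMSEQ_metric)
    show "(\<lambda>w. real (Suc m) *\<^sub>R (closest_point S (z w + h /\<^sub>R real (Suc m)) - closest_point S (z w))) \<in> borel_measurable M" for m
      by (intro borel_measurable_scaleR borel_measurable_diff cpm) auto
    fix w
    note KK = closest_point_cone[OF critical_cone_props(1-3)[OF S] critical_cone_props(4,5)[OF S], of "z w"]
    obtain \<rho> where \<rho>: "\<rho> > 0" "\<And>h. norm h \<le> \<rho> \<Longrightarrow> closest_point S (z w + h) = closest_point S (z w) + p w h"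
      using closest_point_polyhedron_local[OF S, of "z w"] unfolding p_def by blast
    have "(\<lambda>m. norm h * inverse (real (Suc m))) \<longlonglongrightarrow> norm h * 0"
      by (intro tendsto_mult tendsto_const LIMSEQ_inverse_real_of_nat)
    then have "\<forall>\<^sub>F m in sequentially. norm h * inverse (real (Suc m)) < \<rho>"
      using \<rho>(1) by (intro order_tendstoD) auto
    then have "\<forall>\<^sub>F m in sequentially. real (Suc m) *\<^sub>R (closest_point S (z w + h /\<^sub>R real (Suc m)) - closest_point S (z w)) = p w h"
    proof eventually_elim
      case (elim m)
      let ?s = "real (Suc m)"
      have s: "?s > 0" by simp
      have e1: "norm (h /\<^sub>R ?s) = norm h * inverse ?s" by (simp add: mult.commute)
      have "norm (h /\<^sub>R ?s) \<le> \<rho>" unfolding e1 using elim by (rule less_imp_le)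
      from \<rho>(2)[OF this] have "closest_point S (z w + h /\<^sub>R ?s) - closest_point S (z w) = p w (h /\<^sub>R ?s)" by simp
      also have "\<dots> = p w h /\<^sub>R ?s" unfolding p_def by (rule KK(5)) (use s in auto)
      finally show ?case using s by simp
    qed
    then show "(\<lambda>m. real (Suc m) *\<^sub>R (closest_point S (z w + h /\<^sub>R real (Suc m)) - closest_point S (z w))) \<longlonglongrightarrow> p w h"
      by (rule tendsto_eventually)
  qed
  have pc: "continuous_on UNIV (p w)" for w
    unfolding p_def using critical_cone_props[OF S, of "z w"]
    by (intro continuous_on_closest_point) auto
  define Jn where "Jn w = (\<Sum>l=1..n. Jx (closest_point S (z w)) (\<xi>s l w)) /\<^sub>R real n" for w
  have Jm: "Jn \<in> borel_measurable M"
    unfolding Jn_def by (intro borel_measurable_scaleR borel_measurable_const borel_measurable_sum Jx_meas cpm z \<xi>s)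
  define D where "D w h = Jn w *v p w h + h - p w h" for w h
  define r' where "r' w = sd_coord_map (D w) (sample_covariance n (\<lambda>l. Fx (closest_point S (z w)) (\<xi>s l w))) j" for w
  have "r' \<in> borel_measurable M"
    unfolding r'_def
  proof (rule sd_coord_map_measurable)
    show "(\<lambda>w. D w h) \<in> borel_measurable M" for h
      unfolding D_def by (intro borel_measurable_add borel_measurable_diff measurable_matrix_vector_mult Jm pm borel_measurable_const)
    show "continuous_on UNIV (D w)" for w
      unfolding D_def
      by (intro continuous_on_add continuous_on_diff continuous_on_id pc
          continuous_on_compose2[OF linear_continuous_on[OF matrix_vector_mul_bounded_linear] pc]) auto
    show "(\<lambda>w. sample_covariance n (\<lambda>l. Fx (closest_point S (z w)) (\<xi>s l w))) \<in> borel_measurable M"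
      by (intro measurable_sample_covariance Fx_meas cpm z \<xi>s)
  qed
  moreover have "sd_coord_map (B_deriv (normal_map (saa F \<xi>s n w) S) (z w)) (sample_covariance n (\<lambda>l. F (closest_point S (z w)) (\<xi>s l w))) j = r' w"
    if x: "closest_point S (z w) \<in> Op" and reg: "\<forall>l\<in>{1..n}. regular (\<xi>s l w)" for w
  proof -
    have reg': "regular (\<xi>s l w)" if "l \<in> {1..n}" for l using reg that by blast
    note sm = sample_mean_regular[where n=n and y="\<lambda>l. \<xi>s l w", OF reg']
    have saa: "saa F \<xi>s n w = (\<lambda>x. (\<Sum>l=1..n. F x (\<xi>s l w)) /\<^sub>R real n)" by (simp add: saa_def fun_eq_iff)
    have "B_deriv (normal_map (saa F \<xi>s n w) S) (z w) = D w"
    proof (rule B_deriv_eq)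
      show "has_B_derivative (normal_map (saa F \<xi>s n w) S) (D w) (z w)"
        unfolding D_def p_def Jn_def saa
        by (rule normal_map_has_B_derivative[OF S open_Op x sm(2) sm(1)[OF _ x]])
    qed
    moreover have "sample_covariance n (\<lambda>l. F (closest_point S (z w)) (\<xi>s l w)) = sample_covariance n (\<lambda>l. Fx (closest_point S (z w)) (\<xi>s l w))"
      by (rule sample_covariance_cong) (use x regularD(1) reg in \<open>simp add: Fx_def\<close>)
    ultimately show ?thesis by (simp add: r'_def)
  qed
  ultimately show ?thesis by blast
qed

end

locale saa_geometry = vi_geometry S K x0 z0 b0 L LK k P Kc A Mx + random_field F Op \<Xi>
  for S K :: "(real^'q) set" and x0 z0 b0 L LK k P Kc A Mx
    and F :: "real^'q \<Rightarrow> real^'d \<Rightarrow> real^'q" and Op \<Xi> +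
  assumes x0_Op: "x0 \<in> Op"
begin

text \<open>The whole sample enters only through finitely many averages and the normalised sum;
  their convergence alone yields the limits of error and width.\<close>

lemma sequence_limit:
  fixes \<nu> :: "nat \<Rightarrow> nat" and y :: "nat \<Rightarrow> nat \<Rightarrow> real^'d" and z :: "nat \<Rightarrow> real^'q"
  assumes \<nu>: "filterlim \<nu> at_top sequentially" and reg: "\<And>m l. l \<in> {1..\<nu> m} \<Longrightarrow> regular (y m l)"
    and Z: "z0 \<in> interior Z"
    and c1: "(\<lambda>m. (\<Sum>l=1..\<nu> m. lip_const (y m l)) / real (\<nu> m)) \<longlonglongrightarrow> s1"
    and c2: "(\<lambda>m. (\<Sum>l=1..\<nu> m. (lip_const (y m l))\<^sup>2) / real (\<nu> m)) \<longlonglongrightarrow> s2"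
    and J: "\<And>i j. (\<lambda>m. (\<Sum>l=1..\<nu> m. Jx x0 (y m l) $ i $ j) / real (\<nu> m)) \<longlonglongrightarrow> L $ i $ j"
    and p: "\<And>i. (\<lambda>m. (\<Sum>l=1..\<nu> m. Fx x0 (y m l) $ i) / real (\<nu> m)) \<longlonglongrightarrow> p i"
    and q: "\<And>i j. (\<lambda>m. (\<Sum>l=1..\<nu> m. Fx x0 (y m l) $ i * Fx x0 (y m l) $ j) / real (\<nu> m)) \<longlonglongrightarrow> q i j"
    and V: "(\<lambda>m. (\<Sum>l=1..\<nu> m. b0 - Fx x0 (y m l)) /\<^sub>R sqrt (real (\<nu> m))) \<longlonglongrightarrow> v"
    and uniq: "\<And>m u. u \<in> Z \<Longrightarrow> closest_point S u \<in> Op \<Longrightarrow>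
        normal_map (\<lambda>x. (\<Sum>l=1..\<nu> m. F x (y m l)) /\<^sub>R real (\<nu> m)) S u = 0 \<Longrightarrow> u = z m"
    and i: "i \<in> {1..k}" and v: "G v \<in> interior (Kc i)"
  shows "(\<lambda>m. sqrt (real (\<nu> m)) *\<^sub>R (z m - z0)) \<longlonglongrightarrow> G v"
    and "(\<lambda>m. sd_coord_map (B_deriv (normal_map (\<lambda>x. (\<Sum>l=1..\<nu> m. F x (y m l)) /\<^sub>R real (\<nu> m)) S) (z m))
        (sample_covariance (\<nu> m) (\<lambda>l. F (closest_point S (z m)) (y m l))) j)
      \<longlonglongrightarrow> sd_coord (Mx i) (\<chi> i j. q i j - p i * p j) j"
proof -
  define f where "f m x = (\<Sum>l=1..\<nu> m. F x (y m l)) /\<^sub>R real (\<nu> m)" for m x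
  define Jm where "Jm m x = (\<Sum>l=1..\<nu> m. Jx x (y m l)) /\<^sub>R real (\<nu> m)" for m x
  define c where "c m = (\<Sum>l=1..\<nu> m. lip_const (y m l)) / real (\<nu> m)" for m
  have f_eta: "(\<lambda>x. (\<Sum>l=1..\<nu> m. F x (y m l)) /\<^sub>R real (\<nu> m)) = f m" for m by (simp add: f_def fun_eq_iff)
  have sm1: "(f m has_derivative (\<lambda>h. Jm m x *v h)) (at x)" if "x \<in> Op" for m x
    using sample_mean_regular(1)[where n="\<nu> m" and y="y m", OF reg that] unfolding Jm_def f_eta by simp
  have sm2: "(c m)-lipschitz_on Op (f m)" for m
    using sample_mean_regular(2)[where n="\<nu> m" and y="y m", OF reg] unfolding c_def f_eta by simp
  have sm3: "norm (Jm m x - Jm m x') \<le> c m * norm (x - x')" if "x \<in> Op" "x' \<in> Op" for m x x'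
    using sample_mean_regular(3)[where n="\<nu> m" and y="y m", OF reg that] unfolding c_def Jm_def by simp
  have sm4: "norm (f m x' - f m x - Jm m x *v (x' - x)) \<le> c m * (norm (x' - x))\<^sup>2" if "x \<in> Op" "dist x x' < bdry_dist x" for m x x'
    using sample_mean_regular(4)[where n="\<nu> m" and y="y m", OF reg that] unfolding c_def Jm_def f_def by simp
  have Jx0: "(\<lambda>m. Jm m x0) \<longlonglongrightarrow> L"
    by (intro vec_tendstoI) (use J in \<open>simp add: Jm_def divide_inverse mult.commute\<close>)
  have c_lim: "c \<longlonglongrightarrow> s1" using c1 unfolding c_def .
  from convergent_imp_Bseq[OF convergentI[OF c_lim]]
  obtain B where "B > 0" "\<forall>m. norm (c m) \<le> B" by (rule BseqE)
  then have cB: "c m \<le> B" for m using abs_ge_self[of "c m"] by (metis order_trans real_norm_def)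
  have fc: "continuous_on Op (f m)" for m by (rule lipschitz_on_continuous_on[OF sm2])
  have ev1: "\<forall>\<^sub>F m in sequentially. 1 \<le> \<nu> m" using \<nu> unfolding filterlim_at_top by blast
  have Vf: "(\<lambda>m. sqrt (real (\<nu> m)) *\<^sub>R (b0 - f m x0)) \<longlonglongrightarrow> v"
  proof (rule Lim_transform_eventually[OF V])
    show "\<forall>\<^sub>F m in sequentially. (\<Sum>l=1..\<nu> m. b0 - Fx x0 (y m l)) /\<^sub>R sqrt (real (\<nu> m)) = sqrt (real (\<nu> m)) *\<^sub>R (b0 - f m x0)"
      using ev1
    proof eventually_elim
      case (elim m)
      let ?n = "real (\<nu> m)"
      have n: "?n > 0" using elim by simp
      have "(\<Sum>l=1..\<nu> m. Fx x0 (y m l)) = (\<Sum>l=1..\<nu> m. F x0 (y m l))"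
        by (intro sum.cong refl) (use x0_Op regularD(1)[OF reg] in \<open>simp add: Fx_def\<close>)
      also have "\<dots> = ?n *\<^sub>R f m x0" using n by (simp add: f_def)
      finally have "(\<Sum>l=1..\<nu> m. Fx x0 (y m l)) = ?n *\<^sub>R f m x0" .
      moreover have "(\<Sum>l=1..\<nu> m. b0) = ?n *\<^sub>R b0" unfolding sum_constant_scaleR by simp
      ultimately have "(\<Sum>l=1..\<nu> m. b0 - Fx x0 (y m l)) = ?n *\<^sub>R (b0 - f m x0)"
        unfolding sum_subtractf scaleR_diff_right by (simp only:)
      then show ?case using n by (simp add: real_div_sqrt[unfolded divide_inverse] mult.commute)
    qed
  qed
  show h: "(\<lambda>m. sqrt (real (\<nu> m)) *\<^sub>R (z m - z0)) \<longlonglongrightarrow> G v"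
    by (rule scaled_solution_tendsto[OF \<nu> open_Op x0_Op Z bdry_dist_pos[OF x0_Op] fc sm4[OF x0_Op] Jx0 cB Vf uniq[unfolded f_eta]])
  \<comment> \<open>A constant stands in for the covariance matrices: their limit can be found only
    once the projected solutions are known to tend to \<open>x0\<close>.\<close>
  have z: "z \<longlonglongrightarrow> z0"
    by (rule sd_coord_map_tendsto(1)[OF \<nu> i h v open_Op x0_Op sm1 sm2 sm3 Jx0 cB tendsto_const])
  have "isCont (closest_point S) z0" using S_facts(4) by (simp add: continuous_on_eq_continuous_at)
  from isCont_tendsto_compose[OF this z] have x: "(\<lambda>m. closest_point S (z m)) \<longlonglongrightarrow> x0" by (simp add: closest_point_z0)
  have ev2: "\<forall>\<^sub>F m in sequentially. closest_point S (z m) \<in> Op" using topological_tendstoD[OF x open_Op x0_Op] .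
  have "(\<lambda>m. norm (closest_point S (z m) - x0)) \<longlonglongrightarrow> norm (x0 - x0)" by (intro tendsto_intros x)
  then have \<delta>: "(\<lambda>m. norm (closest_point S (z m) - x0)) \<longlonglongrightarrow> 0" by simp
  have "(\<lambda>m. sample_covariance (\<nu> m) (\<lambda>l. F (closest_point S (z m)) (y m l))) \<longlonglongrightarrow> (\<chi> i j. q i j - p i * p j)"
  proof (rule sample_covariance_tendsto[OF \<nu> \<delta> _ _ c1 c2 p q])
    show "\<forall>\<^sub>F m in sequentially. \<forall>l\<in>{1..\<nu> m}. norm (F (closest_point S (z m)) (y m l) - Fx x0 (y m l)) \<le> lip_const (y m l) * norm (closest_point S (z m) - x0)"
      using ev2
    proof eventually_elim
      case (elim m)
      show ?case
      proof
        fix l assume l: "l \<in> {1..\<nu> m}"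
        show "norm (F (closest_point S (z m)) (y m l) - Fx x0 (y m l)) \<le> lip_const (y m l) * norm (closest_point S (z m) - x0)"
          using regularD(2)[OF reg[OF l] elim x0_Op] elim regularD(1)[OF reg[OF l]] by (simp add: Fx_def)
      qed
    qed
  qed simp
  from sd_coord_map_tendsto(2)[OF \<nu> i h v open_Op x0_Op sm1 sm2 sm3 Jx0 cB this]
  show "(\<lambda>m. sd_coord_map (B_deriv (normal_map (\<lambda>x. (\<Sum>l=1..\<nu> m. F x (y m l)) /\<^sub>R real (\<nu> m)) S) (z m))
        (sample_covariance (\<nu> m) (\<lambda>l. F (closest_point S (z m)) (y m l))) j)
      \<longlonglongrightarrow> sd_coord (Mx i) (\<chi> i j. q i j - p i * p j) j" unfolding f_eta .
qed

end

section \<open>From deterministic limits to probabilities\<close>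

context saa_geometry
begin

text \<open>The limiting event as a set of values of the normalised sum. Interiors make the pieces
  disjoint, so that each piece carries its own threshold c r_i.\<close>

definition limit_event :: "'q \<Rightarrow> real \<Rightarrow> (nat \<Rightarrow> real) \<Rightarrow> (real^'q) set" where
  "limit_event j c r = (\<Union>i\<in>{1..k}. {y. G y \<in> interior (Kc i) \<and> \<bar>G y $ j\<bar> \<le> c * r i})"

text \<open>Values at which the limit does not decide the event: no cone interior is reached, or a
  threshold is met exactly. The point 0 only makes the set nonempty, as distances to it are
  taken.\<close>

definition exceptional :: "'q \<Rightarrow> real \<Rightarrow> (nat \<Rightarrow> real) \<Rightarrow> (real^'q) set" where
  "exceptional j c r = insert 0 (- (\<Union>i\<in>{1..k}. {y. G y \<in> interior (Kc i)}) \<union> (\<Union>i\<in>{1..k}. {y. \<bar>G y $ j\<bar> = c * r i}))"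

lemma open_G_interior: "open {y. G y \<in> interior (Kc i)}"
  using open_vimage[OF open_interior G_facts(3), of "Kc i"] by (simp add: vimage_def)

lemma G_coord_cont: "continuous_on UNIV (\<lambda>y. \<bar>G y $ j\<bar>)"
  by (intro continuous_intros G_facts(3))

lemma closed_exceptional: "closed (exceptional j c r)"
  unfolding exceptional_def
  by (intro closed_insert closed_Un closed_Compl open_UN ballI open_G_interior closed_UN closed_Collect_eq G_coord_cont continuous_on_const) auto

lemma limit_event_borel: "limit_event j c r \<in> sets borel"
proof -
  have "{y. G y \<in> interior (Kc i) \<and> \<bar>G y $ j\<bar> \<le> c * r i} = {y. G y \<in> interior (Kc i)} \<inter> {y. \<bar>G y $ j\<bar> \<le> c * r i}" for i
    by auto
  moreover have "closed {y. \<bar>G y $ j\<bar> \<le> c * r i}" for i by (intro closed_Collect_le G_coord_cont continuous_on_const)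
  ultimately show ?thesis unfolding limit_event_def using open_G_interior
    by (auto intro!: sets.finite_UN sets.Int)
qed

text \<open>Off the exceptional set a point has a neighbourhood that lies in one cone interior,
  meets no other, and on which the threshold inequality keeps its strict sign; so membership is
  locally constant.\<close>

lemma frontier_limit_event: "frontier (limit_event j c r) \<subseteq> exceptional j c r"
proof
  fix y assume y: "y \<in> frontier (limit_event j c r)"
  show "y \<in> exceptional j c r"
  proof (rule ccontr)
    assume "y \<notin> exceptional j c r"
    then obtain i where i: "i \<in> {1..k}" "G y \<in> interior (Kc i)" "\<bar>G y $ j\<bar> \<noteq> c * r i"
      unfolding exceptional_def by blast
    show False
    proof (cases "\<bar>G y $ j\<bar> < c * r i")
      case True
      have "open ({y. G y \<in> interior (Kc i)} \<inter> {y. \<bar>G y $ j\<bar> < c * r i})"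
        by (intro open_Int open_G_interior open_Collect_less G_coord_cont continuous_on_const)
      moreover have "{y. G y \<in> interior (Kc i)} \<inter> {y. \<bar>G y $ j\<bar> < c * r i} \<subseteq> limit_event j c r"
        unfolding limit_event_def using i(1) by force
      ultimately have "y \<in> interior (limit_event j c r)" using i(2) True by (intro interiorI) auto
      then show False using y by (simp add: frontier_def)
    next
      case False
      have op: "open ({y. G y \<in> interior (Kc i)} \<inter> {y. c * r i < \<bar>G y $ j\<bar>})"
        by (intro open_Int open_G_interior open_Collect_less G_coord_cont continuous_on_const)
      have "{y. G y \<in> interior (Kc i)} \<inter> {y. c * r i < \<bar>G y $ j\<bar>} \<inter> limit_event j c r = {}"
      proof -
        have "l = i" if "l \<in> {1..k}" "G u \<in> interior (Kc l)" "G u \<in> interior (Kc i)" for l u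
          by (rule Kc_interior_disjoint[OF that(1) i(1) that(2,3)])
        then show ?thesis unfolding limit_event_def by fastforce
      qed
      then have "{y. G y \<in> interior (Kc i)} \<inter> {y. c * r i < \<bar>G y $ j\<bar>} \<inter> closure (limit_event j c r) = {}"
        using open_Int_closure_eq_empty[OF op] by blast
      moreover have "y \<in> {y. G y \<in> interior (Kc i)} \<inter> {y. c * r i < \<bar>G y $ j\<bar>}" using i False by auto
      ultimately show False using y by (auto simp: frontier_def)
    qed
  qed
qed

text \<open>For regular samples this is sqrt n times b0 minus the sample average at
  \<open>x0\<close>, written with \<open>Fx\<close> to be measurable. The sign is that of
  \<open>LK\<close> applied to the scaled solution error.\<close>

definition scaled_error :: "(nat \<Rightarrow> 'w \<Rightarrow> real^'d) \<Rightarrow> nat \<Rightarrow> 'w \<Rightarrow> real^'q" where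
  "scaled_error \<xi>s n w = (\<Sum>l=1..n. b0 - Fx x0 (\<xi>s l w)) /\<^sub>R sqrt (real n)"

definition width :: "(nat \<Rightarrow> 'w \<Rightarrow> real^'d) \<Rightarrow> (nat \<Rightarrow> 'w \<Rightarrow> real^'q) \<Rightarrow> 'q \<Rightarrow> nat \<Rightarrow> 'w \<Rightarrow> real" where
  "width \<xi>s z j n w = sd_coord_map (B_deriv (normal_map (saa F \<xi>s n w) S) (z n w))
     (sample_covariance n (\<lambda>l. F (closest_point S (z n w)) (\<xi>s l w))) j"

definition good_sample :: "(nat \<Rightarrow> 'w \<Rightarrow> real^'d) \<Rightarrow> (nat \<Rightarrow> 'w \<Rightarrow> real^'q) \<Rightarrow> (real^'q) set \<Rightarrow> nat \<Rightarrow> 'w \<Rightarrow> bool" where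
  "good_sample \<xi>s z Z n w \<longleftrightarrow> (\<forall>l\<in>{1..n}. regular (\<xi>s l w)) \<and>
     (\<forall>u. u \<in> Z \<longrightarrow> closest_point S u \<in> Op \<longrightarrow> normal_map (saa F \<xi>s n w) S u = 0 \<longrightarrow> u = z n w)"

text \<open>By compactness, bad indices would have scaled errors accumulating at a point of \<open>C\<close>, where the
  deterministic limit of error and width decides the event.\<close>
lemma uniform_equivalence:
  fixes \<xi>s :: "nat \<Rightarrow> 'w \<Rightarrow> real^'d" and z :: "nat \<Rightarrow> 'w \<Rightarrow> real^'q" and e :: "(real^'d \<Rightarrow> real) \<Rightarrow> real"
  assumes Z: "z0 \<in> interior Z"
    and H: "lip_const \<in> H" "(\<lambda>y. (lip_const y)\<^sup>2) \<in> H" "\<And>i j. (\<lambda>y. Jx x0 y $ i $ j) \<in> H" "\<And>i. (\<lambda>y. Fx x0 y $ i) \<in> H"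
      "\<And>i j. (\<lambda>y. Fx x0 y $ i * Fx x0 y $ j) \<in> H"
    and eL: "\<And>i j. e (\<lambda>y. Jx x0 y $ i $ j) = L $ i $ j"
    and V: "V = (\<chi> i j. e (\<lambda>y. Fx x0 y $ i * Fx x0 y $ j) - e (\<lambda>y. Fx x0 y $ i) * e (\<lambda>y. Fx x0 y $ j))"
    and pd: "\<And>a. a \<noteq> 0 \<Longrightarrow> 0 < a \<bullet> (V *v a)" and r: "\<And>i. i \<in> {1..k} \<Longrightarrow> r i = sd_coord (Mx i) V j"
    and C: "compact C" "C \<inter> exceptional j c r = {}"
  shows "\<exists>\<epsilon>>0. \<exists>n1. \<forall>n\<ge>n1. \<forall>w. good_sample \<xi>s z Z n w \<longrightarrow>
     (\<forall>h\<in>H. \<bar>(\<Sum>l=1..n. h (\<xi>s l w)) / real n - e h\<bar> < \<epsilon>) \<longrightarrow> scaled_error \<xi>s n w \<in> C \<longrightarrow>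
     0 < width \<xi>s z j n w \<and>
     (sqrt (real n) * \<bar>(z n w - z0) $ j\<bar> \<le> c * width \<xi>s z j n w \<longleftrightarrow> scaled_error \<xi>s n w \<in> limit_event j c r)"
proof (rule ccontr)
  let ?good = "good_sample \<xi>s z Z" and ?V = "scaled_error \<xi>s" and ?r = "width \<xi>s z j" and ?D = "limit_event j c r"
  let ?avg = "\<lambda>h n w. (\<Sum>l=1..n. h (\<xi>s l w)) / real n"
  let ?ok = "\<lambda>n w. 0 < ?r n w \<and> (sqrt (real n) * \<bar>(z n w - z0) $ j\<bar> \<le> c * ?r n w \<longleftrightarrow> ?V n w \<in> ?D)"
  assume neg: "\<not> ?thesis"
  \<comment> \<open>The failure is used with tolerance 1/(m+1) and threshold m + 1, so sample sizes
    tend to infinity and all averages to their expectations. The samples for different m may come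
    from different points of the probability space.\<close>
  have "\<forall>m. \<exists>n w. Suc m \<le> n \<and> ?good n w \<and> (\<forall>h\<in>H. \<bar>?avg h n w - e h\<bar> < inverse (real (Suc m))) \<and> ?V n w \<in> C \<and> \<not> ?ok n w"
  proof
    fix m
    have "0 < inverse (real (Suc m))" by simp
    with neg show "\<exists>n w. Suc m \<le> n \<and> ?good n w \<and> (\<forall>h\<in>H. \<bar>?avg h n w - e h\<bar> < inverse (real (Suc m))) \<and> ?V n w \<in> C \<and> \<not> ?ok n w"
      by meson
  qed
  then obtain \<nu> \<omega> where *: "\<And>m. Suc m \<le> \<nu> m" "\<And>m. ?good (\<nu> m) (\<omega> m)"
    "\<And>m h. h \<in> H \<Longrightarrow> \<bar>?avg h (\<nu> m) (\<omega> m) - e h\<bar> < inverse (real (Suc m))"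
    "\<And>m. ?V (\<nu> m) (\<omega> m) \<in> C" "\<And>m. \<not> ?ok (\<nu> m) (\<omega> m)"
    by metis
  have "seq_compact C" using C(1) by (rule compact_imp_seq_compact)
  moreover have "\<forall>m. ?V (\<nu> m) (\<omega> m) \<in> C" using *(4) by blast
  ultimately obtain v \<sigma> where \<sigma>: "v \<in> C" "strict_mono (\<sigma> :: nat \<Rightarrow> nat)" "((\<lambda>m. ?V (\<nu> m) (\<omega> m)) \<circ> \<sigma>) \<longlonglongrightarrow> v"
    by (rule seq_compactE)
  define \<nu>' where "\<nu>' m = \<nu> (\<sigma> m)" for m
  define \<omega>' where "\<omega>' m = \<omega> (\<sigma> m)" for m
  have V_lim: "(\<lambda>m. ?V (\<nu>' m) (\<omega>' m)) \<longlonglongrightarrow> v" using \<sigma>(3) by (simp add: o_def \<nu>'_def \<omega>'_def)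
  have \<nu>ge: "m \<le> \<nu>' m" for m using *(1)[of "\<sigma> m"] seq_suble[OF \<sigma>(2), of m] by (simp add: \<nu>'_def)
  have \<nu>': "filterlim \<nu>' at_top sequentially"
    by (rule filterlim_at_top_mono[OF filterlim_ident]) (simp add: \<nu>ge)
  have avg: "(\<lambda>m. ?avg h (\<nu>' m) (\<omega>' m)) \<longlonglongrightarrow> e h" if h: "h \<in> H" for h
  proof -
    have "(\<lambda>m. ?avg h (\<nu>' m) (\<omega>' m) - e h) \<longlonglongrightarrow> 0"
    proof (rule Lim_null_comparison[OF _ LIMSEQ_inverse_real_of_nat])
      have "norm (?avg h (\<nu>' m) (\<omega>' m) - e h) \<le> inverse (real (Suc m))" for m
      proof -
        have "\<bar>?avg h (\<nu>' m) (\<omega>' m) - e h\<bar> < inverse (real (Suc (\<sigma> m)))" unfolding \<nu>'_def \<omega>'_def by (rule *(3)[OF h])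
        also have "\<dots> \<le> inverse (real (Suc m))" using seq_suble[OF \<sigma>(2), of m] by (intro le_imp_inverse_le) auto
        finally show ?thesis by simp
      qed
      then show "\<forall>\<^sub>F m in sequentially. norm (?avg h (\<nu>' m) (\<omega>' m) - e h) \<le> inverse (real (Suc m))" by simp
    qed
    then show ?thesis by (simp add: LIM_zero_iff)
  qed
  \<comment> \<open>This yields a cone whose interior contains \<open>G v\<close>, with a strict
    inequality between coordinate and threshold.\<close>
  have "v \<notin> exceptional j c r" using C(2) \<sigma>(1) by blast
  then obtain i where i: "i \<in> {1..k}" "G v \<in> interior (Kc i)" "\<bar>G v $ j\<bar> \<noteq> c * r i"
    unfolding exceptional_def by blast
  have reg: "regular (\<xi>s l (\<omega>' m))" if "l \<in> {1..\<nu>' m}" for m l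
    using *(2)[of "\<sigma> m"] that unfolding good_sample_def \<nu>'_def \<omega>'_def by blast
  have saa: "(\<lambda>x. (\<Sum>l=1..n. F x (\<xi>s l w)) /\<^sub>R real n) = saa F \<xi>s n w" for n w by (simp add: saa_def fun_eq_iff)
  have uniq: "u = z (\<nu>' m) (\<omega>' m)" if "u \<in> Z" "closest_point S u \<in> Op"
    "normal_map (\<lambda>x. (\<Sum>l=1..\<nu>' m. F x (\<xi>s l (\<omega>' m))) /\<^sub>R real (\<nu>' m)) S u = 0" for m u
    using *(2)[of "\<sigma> m"] that unfolding saa good_sample_def \<nu>'_def \<omega>'_def by blast
  note lim = sequence_limit[where y="\<lambda>m l. \<xi>s l (\<omega>' m)" and z="\<lambda>m. z (\<nu>' m) (\<omega>' m)", OF \<nu>' reg Z avg[OF H(1)] avg[OF H(2)]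
      avg[OF H(3), unfolded eL] avg[OF H(4)] avg[OF H(5)] V_lim[unfolded scaled_error_def] uniq i(1,2)]
  have h_lim: "(\<lambda>m. \<bar>(sqrt (real (\<nu>' m)) *\<^sub>R (z (\<nu>' m) (\<omega>' m) - z0)) $ j\<bar>) \<longlonglongrightarrow> \<bar>G v $ j\<bar>"
    by (intro tendsto_intros lim(1))
  have r_lim: "(\<lambda>m. ?r (\<nu>' m) (\<omega>' m)) \<longlonglongrightarrow> r i"
    using lim(2)[of j] unfolding width_def saa r[OF i(1)] V .
  have cr_lim: "(\<lambda>m. c * ?r (\<nu>' m) (\<omega>' m)) \<longlonglongrightarrow> c * r i" by (intro tendsto_intros r_lim)
  have "r i > 0" unfolding r[OF i(1)] by (rule sd_coord_pos(2)[OF Mx_det[OF i(1)] pd])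
  then have ev_r: "\<forall>\<^sub>F m in sequentially. 0 < ?r (\<nu>' m) (\<omega>' m)" by (rule order_tendstoD[OF r_lim])
  have "isCont G v" using G_facts(3) by (simp add: continuous_on_eq_continuous_at)
  from isCont_tendsto_compose[OF this V_lim] have GV: "(\<lambda>m. G (?V (\<nu>' m) (\<omega>' m))) \<longlonglongrightarrow> G v" .
  then have GVj: "(\<lambda>m. \<bar>G (?V (\<nu>' m) (\<omega>' m)) $ j\<bar>) \<longlonglongrightarrow> \<bar>G v $ j\<bar>" by (intro tendsto_intros)
  have ev_K: "\<forall>\<^sub>F m in sequentially. G (?V (\<nu>' m) (\<omega>' m)) \<in> interior (Kc i)" using topological_tendstoD[OF GV open_interior i(2)] .
  have D_iff: "u \<in> ?D \<longleftrightarrow> \<bar>G u $ j\<bar> \<le> c * r i" if u: "G u \<in> interior (Kc i)" for u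
  proof
    assume "u \<in> ?D"
    then obtain l where l: "l \<in> {1..k}" "G u \<in> interior (Kc l)" "\<bar>G u $ j\<bar> \<le> c * r l" unfolding limit_event_def by blast
    then show "\<bar>G u $ j\<bar> \<le> c * r i" using Kc_interior_disjoint[OF l(1) i(1) l(2) u] by simp
  next
    assume "\<bar>G u $ j\<bar> \<le> c * r i"
    then show "u \<in> ?D" unfolding limit_event_def using i(1) u by blast
  qed
  \<comment> \<open>Both comparisons have the same limits on either side, and these limits differ,
    so eventually both comparisons come out alike.\<close>
  have "\<forall>\<^sub>F m in sequentially. (\<bar>(sqrt (real (\<nu>' m)) *\<^sub>R (z (\<nu>' m) (\<omega>' m) - z0)) $ j\<bar> \<le> c * ?r (\<nu>' m) (\<omega>' m)) = (\<bar>G (?V (\<nu>' m) (\<omega>' m)) $ j\<bar> \<le> c * r i)"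
  proof (cases "\<bar>G v $ j\<bar> < c * r i")
    case True
    have "(\<lambda>m. c * ?r (\<nu>' m) (\<omega>' m) - \<bar>(sqrt (real (\<nu>' m)) *\<^sub>R (z (\<nu>' m) (\<omega>' m) - z0)) $ j\<bar>) \<longlonglongrightarrow> c * r i - \<bar>G v $ j\<bar>"
      by (intro tendsto_diff cr_lim h_lim)
    then have "\<forall>\<^sub>F m in sequentially. 0 < c * ?r (\<nu>' m) (\<omega>' m) - \<bar>(sqrt (real (\<nu>' m)) *\<^sub>R (z (\<nu>' m) (\<omega>' m) - z0)) $ j\<bar>"
      using True by (intro order_tendstoD) auto
    moreover have "\<forall>\<^sub>F m in sequentially. \<bar>G (?V (\<nu>' m) (\<omega>' m)) $ j\<bar> < c * r i" using True by (rule order_tendstoD[OF GVj])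
    ultimately show ?thesis by eventually_elim linarith
  next
    case False
    then have F: "c * r i < \<bar>G v $ j\<bar>" using i(3) by simp
    have "(\<lambda>m. c * ?r (\<nu>' m) (\<omega>' m) - \<bar>(sqrt (real (\<nu>' m)) *\<^sub>R (z (\<nu>' m) (\<omega>' m) - z0)) $ j\<bar>) \<longlonglongrightarrow> c * r i - \<bar>G v $ j\<bar>"
      by (intro tendsto_diff cr_lim h_lim)
    then have "\<forall>\<^sub>F m in sequentially. c * ?r (\<nu>' m) (\<omega>' m) - \<bar>(sqrt (real (\<nu>' m)) *\<^sub>R (z (\<nu>' m) (\<omega>' m) - z0)) $ j\<bar> < 0"
      using F by (intro order_tendstoD) auto
    moreover have "\<forall>\<^sub>F m in sequentially. c * r i < \<bar>G (?V (\<nu>' m) (\<omega>' m)) $ j\<bar>" using F by (rule order_tendstoD[OF GVj])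
    ultimately show ?thesis by eventually_elim linarith
  qed
  with ev_r ev_K have "\<forall>\<^sub>F m in sequentially. ?ok (\<nu>' m) (\<omega>' m)"
  proof eventually_elim
    case (elim m)
    have "\<bar>(sqrt (real (\<nu>' m)) *\<^sub>R (z (\<nu>' m) (\<omega>' m) - z0)) $ j\<bar> = sqrt (real (\<nu>' m)) * \<bar>(z (\<nu>' m) (\<omega>' m) - z0) $ j\<bar>"
      by (simp add: abs_mult)
    then show ?case using elim D_iff by simp
  qed
  from eventually_happens'[OF sequentially_bot this]
  obtain m where "?ok (\<nu>' m) (\<omega>' m)" by blast
  moreover have "\<not> ?ok (\<nu>' m) (\<omega>' m)" unfolding \<nu>'_def \<omega>'_def by (rule *(5))
  ultimately show False by blast
qed

text \<open>The event and the event that the scaled error is in \<open>limit_event\<close> differ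
  only if the scaled error leaves the compact set, or some average deviates, or the sample is not
  yet good. Each exception is bounded by \<tau>/4 for large n. The condition on \<open>E\<close>
  concerns positive widths only, so the convention at width 0 is immaterial.\<close>

lemma Prob_tendsto_limit_event:
  fixes \<xi>s :: "nat \<Rightarrow> 'w \<Rightarrow> real^'d" and z :: "nat \<Rightarrow> 'w \<Rightarrow> real^'q" and e :: "(real^'d \<Rightarrow> real) \<Rightarrow> real"
    and Y :: "'v \<Rightarrow> real^'q" and E :: "nat \<Rightarrow> 'w \<Rightarrow> bool"
  assumes M: "prob_space M" and N: "prob_space N" and Z: "z0 \<in> interior Z"
    and \<xi>s: "\<And>l. 1 \<le> l \<Longrightarrow> \<xi>s l \<in> borel_measurable M"
    and good: "AE w in M. \<forall>\<^sub>F n in sequentially. good_sample \<xi>s z Z n w"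
    and H: "finite H" "\<And>h. h \<in> H \<Longrightarrow> h \<in> borel_measurable borel"
      "lip_const \<in> H" "(\<lambda>y. (lip_const y)\<^sup>2) \<in> H" "\<And>i j. (\<lambda>y. Jx x0 y $ i $ j) \<in> H" "\<And>i. (\<lambda>y. Fx x0 y $ i) \<in> H"
      "\<And>i j. (\<lambda>y. Fx x0 y $ i * Fx x0 y $ j) \<in> H"
    and wlln: "\<And>h \<epsilon>. h \<in> H \<Longrightarrow> 0 < \<epsilon> \<Longrightarrow>
      (\<lambda>n. measure M {w \<in> space M. \<epsilon> \<le> \<bar>(\<Sum>l=1..n. h (\<xi>s l w)) / real n - e h\<bar>}) \<longlonglongrightarrow> 0"
    and eL: "\<And>i j. e (\<lambda>y. Jx x0 y $ i $ j) = L $ i $ j"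
    and V: "V = (\<chi> i j. e (\<lambda>y. Fx x0 y $ i * Fx x0 y $ j) - e (\<lambda>y. Fx x0 y $ i) * e (\<lambda>y. Fx x0 y $ j))"
    and pd: "\<And>a. a \<noteq> 0 \<Longrightarrow> 0 < a \<bullet> (V *v a)" and r: "\<And>i. i \<in> {1..k} \<Longrightarrow> r i = sd_coord (Mx i) V j"
    and Y: "Y \<in> borel_measurable N" and null: "AE v in N. Y v \<notin> exceptional j c r"
    and W: "\<And>(\<phi>::real^'q \<Rightarrow> real) B. continuous_on UNIV \<phi> \<Longrightarrow> (\<And>t. \<bar>\<phi> t\<bar> \<le> B) \<Longrightarrow>
      (\<lambda>n. \<integral>w. \<phi> (scaled_error \<xi>s n w) \<partial>M) \<longlonglongrightarrow> (\<integral>v. \<phi> (Y v) \<partial>N)"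
    and E': "\<And>n. 1 \<le> n \<Longrightarrow> E' n \<in> sets M" "\<And>n. 1 \<le> n \<Longrightarrow> AE w in M. E n w \<longleftrightarrow> w \<in> E' n"
    and E: "\<And>n w. 1 \<le> n \<Longrightarrow> 0 < width \<xi>s z j n w \<Longrightarrow> E n w \<longleftrightarrow> sqrt (real n) * \<bar>(z n w - z0) $ j\<bar> \<le> c * width \<xi>s z j n w"
  shows "(\<lambda>n. Prob M (E n)) \<longlonglongrightarrow> measure N {v\<in>space N. Y v \<in> limit_event j c r}"
proof -
  interpret M: prob_space M by fact
  let ?V = "scaled_error \<xi>s" and ?D = "limit_event j c r"
  have Dm[measurable]: "?D \<in> sets borel" by (rule limit_event_borel)
  have Vm[measurable]: "?V n \<in> borel_measurable M" for n
  proof -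
    have "(\<lambda>w. (\<Sum>l=1..n. b0 - Fx x0 (\<xi>s l w)) /\<^sub>R sqrt (real n)) \<in> borel_measurable M"
      by (intro borel_measurable_scaleR borel_measurable_const borel_measurable_sum borel_measurable_diff Fx_meas \<xi>s) auto
    then show ?thesis by (simp add: scaled_error_def[abs_def])
  qed
  have avgm: "(\<lambda>w. (\<Sum>l=1..n. h (\<xi>s l w)) / real n) \<in> borel_measurable M" if "h \<in> H" for h n
    by (intro borel_measurable_divide borel_measurable_const borel_measurable_sum measurable_compose[OF \<xi>s H(2)[OF that]]) auto
  have limD: "(\<lambda>n. measure M {w\<in>space M. ?V n w \<in> ?D}) \<longlonglongrightarrow> measure N {v\<in>space N. Y v \<in> ?D}"
    by (rule portmanteau_frontier[OF M N Vm Y W Dm])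
      (use null frontier_limit_event in \<open>auto elim!: eventually_mono\<close>)
  have "(\<lambda>n. Prob M (E n) - measure M {w\<in>space M. ?V n w \<in> ?D}) \<longlonglongrightarrow> 0"
  proof (rule LIMSEQ_I)
    fix \<tau> :: real assume \<tau>: "0 < \<tau>"
    have "\<exists>C. compact C \<and> C \<inter> exceptional j c r = {} \<and> (\<forall>\<^sub>F n in sequentially. measure M {w\<in>space M. ?V n w \<notin> C} \<le> \<tau> / 4)"
    proof (rule compact_off_null_closed[OF M N Vm Y W closed_exceptional _ null])
      show "exceptional j c r \<noteq> {}" by (simp add: exceptional_def)
      show "0 < \<tau> / 4" using \<tau> by simp
    qed
    then obtain C where C: "compact C" "C \<inter> exceptional j c r = {}"
      "\<forall>\<^sub>F n in sequentially. measure M {w\<in>space M. ?V n w \<notin> C} \<le> \<tau> / 4" by blast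
    have Cm[measurable]: "C \<in> sets borel" using compact_imp_closed[OF C(1)] by simp
    obtain \<epsilon> n1 where \<epsilon>: "\<epsilon> > 0" and eqv: "\<And>n w. n1 \<le> n \<Longrightarrow> good_sample \<xi>s z Z n w \<Longrightarrow>
      (\<forall>h\<in>H. \<bar>(\<Sum>l=1..n. h (\<xi>s l w)) / real n - e h\<bar> < \<epsilon>) \<Longrightarrow> ?V n w \<in> C \<Longrightarrow>
      0 < width \<xi>s z j n w \<and> (sqrt (real n) * \<bar>(z n w - z0) $ j\<bar> \<le> c * width \<xi>s z j n w \<longleftrightarrow> ?V n w \<in> ?D)"
      using uniform_equivalence[where \<xi>s=\<xi>s and z=z and e=e, OF Z H(3-7) eL V pd r C(1,2)] by blast
    define X where "X n = (\<Union>h\<in>H. {w \<in> space M. \<epsilon> \<le> \<bar>(\<Sum>l=1..n. h (\<xi>s l w)) / real n - e h\<bar>})" for n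
    have Xm[measurable]: "X n \<in> sets M" for n
      unfolding X_def using H(1) avgm by (intro sets.finite_UN) auto
    have X0: "(\<lambda>n. measure M (X n)) \<longlonglongrightarrow> 0"
    proof (rule tendsto_sandwich[OF _ _ tendsto_const])
      show "\<forall>\<^sub>F n in sequentially. measure M (X n) \<le> (\<Sum>h\<in>H. measure M {w \<in> space M. \<epsilon> \<le> \<bar>(\<Sum>l=1..n. h (\<xi>s l w)) / real n - e h\<bar>})"
        unfolding X_def using H(1) avgm by (intro always_eventually allI M.finite_measure_subadditive_finite) auto
      show "(\<lambda>n. \<Sum>h\<in>H. measure M {w \<in> space M. \<epsilon> \<le> \<bar>(\<Sum>l=1..n. h (\<xi>s l w)) / real n - e h\<bar>}) \<longlonglongrightarrow> 0"
        by (rule tendsto_null_sum) (rule wlln[OF _ \<epsilon>])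
    qed simp
    \<comment> \<open>The disagreements that \<open>eqv\<close> forbids for good samples; almost
      every w leaves these sets for good. The index 0 is cut out since \<open>E'\<close> is
      measurable from 1 on.\<close>
    define A where "A n = (if n = 0 then {} else {w\<in>space M. ?V n w \<in> C \<and> (w \<in> E' n) \<noteq> (?V n w \<in> ?D)} - X n)" for n
    have Bm: "{w\<in>space M. ?V n w \<in> C \<and> (w \<in> E' n) \<noteq> (?V n w \<in> ?D)} \<in> sets M" if "1 \<le> n" for n
    proof -
      have [measurable]: "E' n \<in> sets M" by (rule E'(1)[OF that])
      show ?thesis by measurable
    qed
    have Am: "A n \<in> sets M" for n using Bm[of n] Xm[of n] by (auto simp: A_def)
    have "AE w in M. \<forall>n\<ge>1. E n w \<longleftrightarrow> w \<in> E' n"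
      using E'(2) by (simp add: AE_all_countable AE_conj_iff)
    with good have "AE w in M. \<forall>\<^sub>F n in sequentially. w \<notin> A n"
    proof eventually_elim
      case (elim w)
      from elim(1) eventually_ge_at_top[of n1] eventually_ge_at_top[of 1] show ?case
      proof eventually_elim
        case (elim n)
        show ?case
        proof
          assume w: "w \<in> A n"
          then have w': "w \<in> space M" "?V n w \<in> C" "(w \<in> E' n) \<noteq> (?V n w \<in> ?D)" "w \<notin> X n"
            using elim(3) by (auto simp: A_def)
          have "\<forall>h\<in>H. \<bar>(\<Sum>l=1..n. h (\<xi>s l w)) / real n - e h\<bar> < \<epsilon>"
            using w'(1,4) unfolding X_def by (auto simp: not_le)
          from eqv[OF elim(2,1) this w'(2)] have "E n w \<longleftrightarrow> ?V n w \<in> ?D" using E[OF elim(3)] by blast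
          then show False using w'(3) \<open>\<forall>n\<ge>1. E n w \<longleftrightarrow> w \<in> E' n\<close> elim(3) by blast
        qed
      qed
    qed
    then have A0: "(\<lambda>n. measure M (A n)) \<longlonglongrightarrow> 0" by (intro M.eventually_not_imp_prob_tendsto_0 Am)
    have "\<forall>\<^sub>F n in sequentially. measure M (A n) < \<tau> / 4" "\<forall>\<^sub>F n in sequentially. measure M (X n) < \<tau> / 4"
      using order_tendstoD(2)[OF A0, of "\<tau> / 4"] order_tendstoD(2)[OF X0, of "\<tau> / 4"] \<tau> by auto
    with C(3) eventually_ge_at_top[of 1]
    have "\<forall>\<^sub>F n in sequentially. norm (Prob M (E n) - measure M {w\<in>space M. ?V n w \<in> ?D} - 0) < \<tau>"
    proof eventually_elim
      case (elim n)
      let ?B = "{w\<in>space M. ?V n w \<in> ?D}" and ?U = "A n \<union> X n \<union> {w\<in>space M. ?V n w \<notin> C}"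
      have Em: "E' n \<in> sets M" by (rule E'(1)[OF elim(2)])
      have Um: "?U \<in> sets M" using Am Xm by measurable
      have sub: "E' n \<subseteq> ?B \<union> ?U" "?B \<subseteq> E' n \<union> ?U"
        using sets.sets_into_space[OF Em] elim(2) by (auto simp: A_def)
      have "measure M ?U \<le> measure M (A n \<union> X n) + measure M {w\<in>space M. ?V n w \<notin> C}"
        using Am Xm by (intro measure_Un_le) auto
      moreover have "measure M (A n \<union> X n) \<le> measure M (A n) + measure M (X n)" using Am Xm by (intro measure_Un_le) auto
      ultimately have U: "measure M ?U < \<tau>" using elim \<tau> by linarith
      have "measure M (E' n) \<le> measure M (?B \<union> ?U)" using sub Um by (intro M.finite_measure_mono) auto
      moreover have "measure M (?B \<union> ?U) \<le> measure M ?B + measure M ?U" using Um by (intro measure_Un_le) auto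
      moreover have "measure M ?B \<le> measure M (E' n \<union> ?U)" using sub Um Em by (intro M.finite_measure_mono) auto
      moreover have "measure M (E' n \<union> ?U) \<le> measure M (E' n) + measure M ?U" using Um Em by (intro measure_Un_le) auto
      ultimately show ?case unfolding Prob_AE_eq[OF M Em E'(2)[OF elim(2)]] using U by (simp add: abs_less_iff)
    qed
    then show "\<exists>n0. \<forall>n\<ge>n0. norm (Prob M (E n) - measure M {w\<in>space M. ?V n w \<in> ?D} - 0) < \<tau>"
      by (simp add: eventually_sequentially)
  qed
  from tendsto_add[OF this limD] show ?thesis by simp
qed

end

section \<open>Expectation of the Jacobian\<close>

lemma norm_matrix_le: "norm A \<le> (\<Sum>i\<in>UNIV. \<Sum>j\<in>UNIV. \<bar>A $ i $ j\<bar>)" for A :: "real^'n^'m"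
proof -
  have "norm A \<le> (\<Sum>i\<in>UNIV. norm (A $ i))" unfolding norm_vec_def by (rule L2_set_le_sum) simp
  also have "\<dots> \<le> (\<Sum>i\<in>UNIV. \<Sum>j\<in>UNIV. \<bar>A $ i $ j\<bar>)" by (intro sum_mono norm_le_l1_cart)
  finally show ?thesis .
qed

context random_field
begin

lemma integrable_Jx:
  assumes [measurable]: "\<xi> \<in> borel_measurable M" and reg: "AE w in M. regular (\<xi> w)"
    and lip_const: "integrable M (\<lambda>w. lip_const (\<xi> w))" and x0: "x0 \<in> Op"
  shows "integrable M (\<lambda>w. Jx x0 (\<xi> w))"
proof (rule Bochner_Integration.integrable_bound)
  show "integrable M (\<lambda>w. (\<Sum>i\<in>(UNIV::'q set). \<Sum>j\<in>(UNIV::'q set). lip_const (\<xi> w)))"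
    by (intro Bochner_Integration.integrable_sum lip_const)
  show "(\<lambda>w. Jx x0 (\<xi> w)) \<in> borel_measurable M" by measurable
  show "AE w in M. norm (Jx x0 (\<xi> w)) \<le> norm (\<Sum>i\<in>(UNIV::'q set). \<Sum>j\<in>(UNIV::'q set). lip_const (\<xi> w))"
    using reg
  proof eventually_elim
    case (elim w)
    have "norm (Jx x0 (\<xi> w)) \<le> (\<Sum>i\<in>UNIV. \<Sum>j\<in>UNIV. \<bar>Jx x0 (\<xi> w) $ i $ j\<bar>)" by (rule norm_matrix_le)
    also have "\<dots> \<le> (\<Sum>i\<in>(UNIV::'q set). \<Sum>j\<in>(UNIV::'q set). lip_const (\<xi> w))"
      by (intro sum_mono Jx_entry_bound elim x0)
    also have "\<dots> \<le> norm (\<Sum>i\<in>(UNIV::'q set). \<Sum>j\<in>(UNIV::'q set). lip_const (\<xi> w))" unfolding real_norm_def by (rule abs_ge_self)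
    finally show ?case .
  qed
qed

text \<open>Differentiation under the integral: integrating the pathwise Taylor bound gives a Taylor
  bound for the expectation, with the expected Lipschitz constant.\<close>

lemma jacobian_mean:
  assumes [measurable]: "\<xi> \<in> borel_measurable M" and reg: "AE w in M. regular (\<xi> w)"
    and lip_const: "integrable M (\<lambda>w. lip_const (\<xi> w))" and x0: "x0 \<in> Op"
    and F: "\<And>x. x \<in> Op \<Longrightarrow> integrable M (\<lambda>w. F x (\<xi> w))"
  shows "jacobian (\<lambda>x. \<integral>w. F x (\<xi> w) \<partial>M) (at x0) $ i $ j = (\<integral>w. Jx x0 (\<xi> w) $ i $ j \<partial>M)"
proof -
  define f0 where "f0 x = (\<integral>w. F x (\<xi> w) \<partial>M)" for x
  define EJ where "EJ = (\<integral>w. Jx x0 (\<xi> w) \<partial>M)"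
  have iJ: "integrable M (\<lambda>w. Jx x0 (\<xi> w))" by (rule integrable_Jx[OF _ reg lip_const x0]) measurable
  have Feq: "AE w in M. F x (\<xi> w) = Fx x (\<xi> w)" if "x \<in> Op" for x
    using reg by eventually_elim (use that regularD(1) in \<open>simp add: Fx_def\<close>)
  have iF: "integrable M (\<lambda>w. Fx x (\<xi> w))" if "x \<in> Op" for x
    using Feq[OF that] F[OF that] by (subst integrable_cong_AE[symmetric]) (auto intro: borel_measurable_integrable)
  have f0: "f0 x = (\<integral>w. Fx x (\<xi> w) \<partial>M)" if "x \<in> Op" for x
    unfolding f0_def using F[OF that] iF[OF that] Feq[OF that]
    by (intro integral_cong_AE) (auto intro: borel_measurable_integrable)
  have bl: "bounded_linear (\<lambda>B::real^'q^'q. B *v h)" for h :: "real^'q"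
    using linear_conv_bounded_linear linear_matrix_vector_left by blast
  have "(f0 has_derivative (\<lambda>h. EJ *v h)) (at x0)"
  proof (rule has_derivative_of_quadratic_bound[OF matrix_vector_mul_bounded_linear bdry_dist_pos[OF x0]])
    show "0 \<le> (\<integral>w. lip_const (\<xi> w) \<partial>M)" by (intro integral_nonneg_AE AE_I2 lip_const_nonneg)
    fix u assume "norm (u - x0) < bdry_dist x0"
    then have d: "dist x0 u < bdry_dist x0" by (simp add: dist_norm norm_minus_commute)
    have u: "u \<in> Op" by (rule bdry_dist_ball[OF x0 d])
    have iJh: "integrable M (\<lambda>w. Jx x0 (\<xi> w) *v (u - x0))" by (rule integrable_bounded_linear[OF bl iJ])
    have EJh: "(\<integral>w. Jx x0 (\<xi> w) *v (u - x0) \<partial>M) = EJ *v (u - x0)"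
      unfolding EJ_def by (rule integral_bounded_linear[OF bl iJ])
    have eq: "f0 u - f0 x0 - EJ *v (u - x0) = (\<integral>w. Fx u (\<xi> w) - Fx x0 (\<xi> w) - Jx x0 (\<xi> w) *v (u - x0) \<partial>M)"
      using iF[OF u] iF[OF x0] iJh by (simp add: f0[OF u] f0[OF x0] EJh)
    have "norm (f0 u - f0 x0 - EJ *v (u - x0)) \<le> (\<integral>w. norm (Fx u (\<xi> w) - Fx x0 (\<xi> w) - Jx x0 (\<xi> w) *v (u - x0)) \<partial>M)"
      unfolding eq by (rule integral_norm_bound)
    also have "\<dots> \<le> (\<integral>w. lip_const (\<xi> w) * (norm (u - x0))\<^sup>2 \<partial>M)"
    proof (rule integral_mono_AE)
      show "AE w in M. norm (Fx u (\<xi> w) - Fx x0 (\<xi> w) - Jx x0 (\<xi> w) *v (u - x0)) \<le> lip_const (\<xi> w) * (norm (u - x0))\<^sup>2"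
        using reg by eventually_elim (rule regularD(4)[OF _ x0 d])
    qed (use iF[OF u] iF[OF x0] iJh lip_const in auto)
    finally show "norm (f0 u - f0 x0 - EJ *v (u - x0)) \<le> (\<integral>w. lip_const (\<xi> w) \<partial>M) * (norm (u - x0))\<^sup>2" by simp
  qed
  then have "frechet_derivative f0 (at x0) = (\<lambda>h. EJ *v h)" by (rule frechet_derivative_at[symmetric])
  then have "jacobian f0 (at x0) = EJ" by (simp add: jacobian_def)
  moreover have "EJ $ i $ j = (\<integral>w. Jx x0 (\<xi> w) $ i $ j \<partial>M)"
  proof -
    have "bounded_linear (\<lambda>B::real^'q^'q. B $ i $ j)"
      using bounded_linear_compose[OF bounded_linear_vec_nth bounded_linear_vec_nth] by blast
    from integral_bounded_linear[OF this iJ] show ?thesis by (simp add: EJ_def)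
  qed
  ultimately show ?thesis by (simp add: f0_def[abs_def])
qed

end

section \<open>The limit law on the cones\<close>

context saa_geometry
begin

text \<open>\<open>G\<close> is not linear, but where its value lies in \<open>Kc i\<close> it is
  the inverse of \<open>Mx i\<close>. Hence every exceptional coincidence puts \<open>Y v\<close> on
  one of finitely many hyperplanes with nonzero normal, all null since the covariance is positive
  definite.\<close>

lemma null_exceptional:
  fixes Y :: "'v \<Rightarrow> real^'q"
  assumes N: "prob_space N" and Y: "normal_random_vector N Y 0 V"
    and pd: "\<And>a. a \<noteq> 0 \<Longrightarrow> 0 < a \<bullet> (V *v a)"
  shows "AE v in N. \<forall>i\<in>{1..k}. G (Y v) \<in> Kc i \<longrightarrow> G (Y v) \<in> interior (Kc i)"
    and "AE v in N. Y v \<notin> exceptional j c r"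
proof -
  have hyp: "AE v in N. a \<bullet> Y v \<noteq> b" if "a \<noteq> 0" for a b
    by (rule normal_random_vector_hyperplane[OF N Y pd[OF that]])
  have "AE v in N. G (Y v) \<in> Kc i \<longrightarrow> G (Y v) \<in> interior (Kc i)" if i: "i \<in> {1..k}" for i
  proof -
    obtain B where B: "finite B" "0 \<notin> B" "Kc i - interior (Kc i) \<subseteq> (\<Union>a\<in>B. {h. a \<bullet> h = 0})"
      using Kc_boundary[OF i] by blast
    let ?Mi = "matrix_inv (Mx i)"
    have nz: "a v* ?Mi \<noteq> 0" if "a \<in> B" for a
    proof
      assume "a v* ?Mi = 0"
      then have "a \<bullet> (?Mi *v (Mx i *v a)) = 0" by (simp add: dot_lmul_matrix[symmetric])
      then have "a = 0" using matrix_inv_inverse[OF Mx_det[OF i]] by (simp add: matrix_vector_mul_assoc)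
      then show False using that B(2) by blast
    qed
    have "AE v in N. \<forall>a\<in>B. (a v* ?Mi) \<bullet> Y v \<noteq> 0" by (intro AE_finite_allI B(1) hyp nz)
    then show ?thesis
    proof eventually_elim
      case (elim v)
      show ?case
      proof (rule impI, rule ccontr)
        assume g: "G (Y v) \<in> Kc i" "G (Y v) \<notin> interior (Kc i)"
        then obtain a where a: "a \<in> B" "a \<bullet> G (Y v) = 0" using B(3) by blast
        then have "(a v* ?Mi) \<bullet> Y v = 0" by (simp add: G_Kc[OF i g(1)] dot_lmul_matrix)
        then show False using elim a(1) by blast
      qed
    qed
  qed
  then show 1: "AE v in N. \<forall>i\<in>{1..k}. G (Y v) \<in> Kc i \<longrightarrow> G (Y v) \<in> interior (Kc i)"
    by (intro AE_finite_allI) auto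
  have nz: "matrix_inv (Mx l) $ j \<noteq> 0" if "l \<in> {1..k}" for l
    by (rule sd_coord_pos(1)[OF Mx_det[OF that] pd])
  \<comment> \<open>The cone l that holds \<open>G (Y v)\<close> need not be the one whose threshold
    \<open>r i\<close> is met, so all pairs are excluded, with both signs of the coordinate.\<close>
  have 2: "AE v in N. \<forall>i\<in>{1..k}. \<forall>l\<in>{1..k}. matrix_inv (Mx l) $ j \<bullet> Y v \<noteq> c * r i \<and> matrix_inv (Mx l) $ j \<bullet> Y v \<noteq> - (c * r i)"
    by (intro AE_finite_allI AE_conjI hyp nz) auto
  \<comment> \<open>Any coordinate hyperplane serves to exclude the artificial point 0.\<close>
  have "axis j 1 \<noteq> (0::real^'q)" by (simp add: axis_eq_0_iff)
  from hyp[OF this, of 0] 1 2 show "AE v in N. Y v \<notin> exceptional j c r"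
  proof eventually_elim
    case (elim v)
    obtain l where l: "l \<in> {1..k}" "G (Y v) \<in> Kc l" using Kc_cover by blast
    have g: "G (Y v) $ j = matrix_inv (Mx l) $ j \<bullet> Y v" by (simp add: G_Kc[OF l] matrix_vector_mult_inner)
    have "\<bar>G (Y v) $ j\<bar> \<noteq> c * r i" if "i \<in> {1..k}" for i
    proof
      assume "\<bar>G (Y v) $ j\<bar> = c * r i"
      then have "matrix_inv (Mx l) $ j \<bullet> Y v = c * r i \<or> matrix_inv (Mx l) $ j \<bullet> Y v = - (c * r i)"
        unfolding g by linarith
      then show False using elim(3) that l(1) by blast
    qed
    moreover have "Y v \<noteq> 0" using elim(1) by auto
    moreover have "G (Y v) \<in> interior (Kc l)" using elim(2) l by blast
    ultimately show ?case using l(1) unfolding exceptional_def by blast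
  qed
qed

text \<open>Disjoint interiors make the probability additive, and almost surely the closed cones may
  replace them. Without the coordinate condition the same count gives total mass 1, because the
  cones cover.\<close>

lemma measure_limit_event:
  fixes Y :: "'v \<Rightarrow> real^'q"
  assumes N: "prob_space N" and Y[measurable]: "Y \<in> borel_measurable N"
    and ae: "AE v in N. \<forall>i\<in>{1..k}. G (Y v) \<in> Kc i \<longrightarrow> G (Y v) \<in> interior (Kc i)"
  shows "measure N {v\<in>space N. Y v \<in> limit_event j c r} = (\<Sum>i=1..k. measure N {v\<in>space N. \<bar>G (Y v) $ j\<bar> \<le> c * r i \<and> G (Y v) \<in> Kc i})"
    and "(\<Sum>i=1..k. measure N {v\<in>space N. G (Y v) \<in> Kc i}) = 1"
proof -
  interpret N: prob_space N by fact
  have [measurable]: "interior (Kc i) \<in> sets borel" for i by simp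
  have GY[measurable]: "(\<lambda>v. G (Y v)) \<in> borel_measurable N"
    using measurable_compose[OF Y borel_measurable_continuous_onI[OF G_facts(3)]] .
  have Kcl: "closed (Kc i)" if "i \<in> {1..k}" for i by (rule Kc_closed[OF that])
  have part: "measure N (\<Union>i\<in>{1..k}. {v\<in>space N. Q i v \<and> G (Y v) \<in> interior (Kc i)}) = (\<Sum>i=1..k. measure N {v\<in>space N. Q i v \<and> G (Y v) \<in> Kc i})"
    if Q: "\<And>i. Measurable.pred N (Q i)" for Q :: "nat \<Rightarrow> 'v \<Rightarrow> bool"
  proof -
    have im: "{v\<in>space N. Q i v \<and> G (Y v) \<in> interior (Kc i)} \<in> sets N" for i
      using Q[of i] by measurable
    have "measure N (\<Union>i\<in>{1..k}. {v\<in>space N. Q i v \<and> G (Y v) \<in> interior (Kc i)}) = (\<Sum>i\<in>{1..k}. measure N {v\<in>space N. Q i v \<and> G (Y v) \<in> interior (Kc i)})"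
    proof (rule N.finite_measure_finite_Union)
      show "disjoint_family_on (\<lambda>i. {v\<in>space N. Q i v \<and> G (Y v) \<in> interior (Kc i)}) {1..k}"
        unfolding disjoint_family_on_def using Kc_interior_disjoint by blast
    qed (use im in auto)
    also have "\<dots> = (\<Sum>i=1..k. measure N {v\<in>space N. Q i v \<and> G (Y v) \<in> Kc i})"
    proof (rule sum.cong[OF refl])
      fix i assume i: "i \<in> {1..k}"
      have [measurable]: "Kc i \<in> sets borel" using Kcl[OF i] by simp
      show "measure N {v\<in>space N. Q i v \<and> G (Y v) \<in> interior (Kc i)} = measure N {v\<in>space N. Q i v \<and> G (Y v) \<in> Kc i}"
      proof (rule N.finite_measure_eq_AE)
        show "AE v in N. (v \<in> {v\<in>space N. Q i v \<and> G (Y v) \<in> interior (Kc i)}) = (v \<in> {v\<in>space N. Q i v \<and> G (Y v) \<in> Kc i})"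
          using ae by eventually_elim (use i interior_subset in blast)
        show "{v\<in>space N. Q i v \<and> G (Y v) \<in> Kc i} \<in> sets N" using Q[of i] GY by measurable
      qed (rule im)
    qed
    finally show ?thesis .
  qed
  have c: "(\<lambda>v. G (Y v) $ j) \<in> borel_measurable N" using GY by measurable
  have "{v\<in>space N. Y v \<in> limit_event j c r} = (\<Union>i\<in>{1..k}. {v\<in>space N. \<bar>G (Y v) $ j\<bar> \<le> c * r i \<and> G (Y v) \<in> interior (Kc i)})"
    unfolding limit_event_def by auto
  moreover have "Measurable.pred N (\<lambda>v. \<bar>G (Y v) $ j\<bar> \<le> c * r i)" for i using c by measurable
  ultimately show "measure N {v\<in>space N. Y v \<in> limit_event j c r} = (\<Sum>i=1..k. measure N {v\<in>space N. \<bar>G (Y v) $ j\<bar> \<le> c * r i \<and> G (Y v) \<in> Kc i})"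
    using part[of "\<lambda>i v. \<bar>G (Y v) $ j\<bar> \<le> c * r i"] by simp
  have "measure N (\<Union>i\<in>{1..k}. {v\<in>space N. True \<and> G (Y v) \<in> interior (Kc i)}) = measure N (space N)"
  proof (rule N.finite_measure_eq_AE)
    show "AE v in N. (v \<in> (\<Union>i\<in>{1..k}. {v\<in>space N. True \<and> G (Y v) \<in> interior (Kc i)})) = (v \<in> space N)"
      using ae AE_space
    proof eventually_elim
      case (elim v)
      obtain l where "l \<in> {1..k}" "G (Y v) \<in> Kc l" using Kc_cover by blast
      then show ?case using elim by blast
    qed
    show "(\<Union>i\<in>{1..k}. {v\<in>space N. True \<and> G (Y v) \<in> interior (Kc i)}) \<in> sets N" using GY by measurable
  qed simp
  then show "(\<Sum>i=1..k. measure N {v\<in>space N. G (Y v) \<in> Kc i}) = 1"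
    using part[of "\<lambda>i v. True"] N.prob_space by simp
qed

lemma cell_event_iff:
  assumes i: "i \<in> {1..k}" and \<rho>: "0 < \<rho>"
  shows "\<bar>(matrix_inv (Mx i) *v y) $ j / \<rho>\<bar> \<le> c \<and> matrix_inv (Mx i) *v y \<in> Kc i \<longleftrightarrow> \<bar>G y $ j\<bar> \<le> c * \<rho> \<and> G y \<in> Kc i"
    and "\<bar>G y $ j / \<rho>\<bar> \<le> c \<and> G y \<in> Kc i \<longleftrightarrow> \<bar>G y $ j\<bar> \<le> c * \<rho> \<and> G y \<in> Kc i"
proof -
  have d: "\<bar>t / \<rho>\<bar> \<le> c \<longleftrightarrow> \<bar>t\<bar> \<le> c * \<rho>" for t using \<rho> by (simp add: abs_divide pos_divide_le_eq)
  show "\<bar>G y $ j / \<rho>\<bar> \<le> c \<and> G y \<in> Kc i \<longleftrightarrow> \<bar>G y $ j\<bar> \<le> c * \<rho> \<and> G y \<in> Kc i" unfolding d ..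
  show "\<bar>(matrix_inv (Mx i) *v y) $ j / \<rho>\<bar> \<le> c \<and> matrix_inv (Mx i) *v y \<in> Kc i \<longleftrightarrow> \<bar>G y $ j\<bar> \<le> c * \<rho> \<and> G y \<in> Kc i"
    unfolding d using G_Kc_iff[OF i, of y] G_Kc[OF i, of y] by auto
qed

end

section \<open>Assembly of the limit law and the coverage probability\<close>

lemma Prob_eq_measure:
  assumes "prob_space M" "Measurable.pred M E"
  shows "Prob M E = measure M {w\<in>space M. E w}"
  by (rule Prob_AE_eq[OF assms(1)]) (use assms(2) in \<open>auto simp: pred_def intro!: AE_I2\<close>)

theorem theorem5p1:
  fixes M :: "'w measure" and N :: "'v measure"
    and \<xi> :: "'w \<Rightarrow> real^'d" and \<xi>s :: "nat \<Rightarrow> 'w \<Rightarrow> real^'d" and \<Xi> :: "(real^'d) set"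
    and Op S X0 Z K :: "(real^'q) set"
    and F :: "real^'q \<Rightarrow> real^'d \<Rightarrow> real^'q" and f0 :: "real^'q \<Rightarrow> real^'q"
    and x0 z0 :: "real^'q" and L \<Sigma>0 :: "real^'q^'q" and LK :: "real^'q \<Rightarrow> real^'q"
    and z x :: "nat \<Rightarrow> 'w \<Rightarrow> real^'q" and \<Sigma> :: "nat \<Rightarrow> 'w \<Rightarrow> real^'q^'q"
    and r :: "nat \<Rightarrow> 'q \<Rightarrow> 'w \<Rightarrow> real"
    and k :: nat and P Kc :: "nat \<Rightarrow> (real^'q) set" and A Mx :: "nat \<Rightarrow> real^'q^'q"
    and Y0 \<Gamma> :: "'v \<Rightarrow> real^'q" and \<Gamma>c :: "nat \<Rightarrow> 'v \<Rightarrow> real^'q" and rc :: "nat \<Rightarrow> 'q \<Rightarrow> real"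
  assumes M: "prob_space M"
    and xi: "\<xi> \<in> borel_measurable M" and Xi: "closed \<Xi>" and supp: "AE w in M. \<xi> w \<in> \<Xi>"
    and Op: "open Op"
    and F_meas: "(\<lambda>(x, y). F x y) \<in> borel_measurable (restrict_space borel (Op \<times> \<Xi>))"
    and f0_wd: "\<forall>x\<in>Op. integrable M (\<lambda>w. F x (\<xi> w))"
    and f0: "f0 = (\<lambda>x. \<integral>w. F x (\<xi> w) \<partial>M)"
    and S: "polyhedron S"
    and indep: "prob_space.indep_vars M (\<lambda>_. borel) \<xi>s {1..}"
    and ident: "\<forall>i\<ge>1. distr M borel (\<xi>s i) = distr M borel \<xi>"
    and a: "\<forall>x\<in>Op. (\<integral>\<^sup>+w. ennreal ((norm (F x (\<xi> w)))\<^sup>2) \<partial>M) < \<infinity>"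
    and b1: "AE w in M. C1_on Op (\<lambda>x. F x (\<xi> w))"
    and b2: "\<forall>x\<in>Op. (\<integral>\<^sup>+w. ennreal ((norm (jacobian (\<lambda>x. F x (\<xi> w)) (at x)))\<^sup>2) \<partial>M) < \<infinity>"
    and c: "\<exists>C. C \<in> borel_measurable M \<and> integrable M (\<lambda>w. (C w)\<^sup>2) \<and>
              (AE w in M. \<forall>x\<in>Op. \<forall>x'\<in>Op.
                 norm (F x (\<xi> w) - F x' (\<xi> w)) +
                 norm (jacobian (\<lambda>u. F u (\<xi> w)) (at x) - jacobian (\<lambda>u. F u (\<xi> w)) (at x'))
                 \<le> C w * norm (x - x'))"
    and x0: "x0 \<in> S \<inter> Op" "solves_VI f0 S x0"
    and z0: "z0 = x0 - f0 x0"
    and L: "L = jacobian f0 (at x0)"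
    and K: "K = tangent_cone S x0 \<inter> {v. (z0 - x0) \<bullet> v = 0}"
    and LK: "LK = (\<lambda>h. L *v closest_point K h + h - closest_point K h)"
    and LK_homeo: "\<exists>g. homeomorphism UNIV UNIV LK g"
    and X0: "x0 \<in> interior X0" "X0 \<subseteq> Op" and Z: "z0 \<in> interior Z"
    and z_meas: "\<forall>n\<ge>1. z n \<in> borel_measurable M"
    and z_dom: "\<forall>n\<ge>1. \<forall>w\<in>space M. closest_point S (z n w) \<in> Op"
    and x: "x = (\<lambda>n w. closest_point S (z n w))"
    and sol: "AE w in M. \<exists>n0. \<forall>n\<ge>n0.
        (\<forall>y. y \<in> Z \<and> closest_point S y \<in> Op \<and> normal_map (saa F \<xi>s n w) S y = 0 \<longleftrightarrow> y = z n w) \<and>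
        (\<forall>u. u \<in> X0 \<and> solves_VI (saa F \<xi>s n w) S u \<longleftrightarrow> u = x n w)"
    and Sigma0: "\<Sigma>0 = covariance_matrix M (\<lambda>w. F x0 (\<xi> w))"
    and Sigma: "\<Sigma> = (\<lambda>n w. sample_covariance n (\<lambda>i. F (x n w) (\<xi>s i w)))"
    and N: "prob_space N" and Y0: "normal_random_vector N Y0 0 \<Sigma>0"
    and det_pos: "det \<Sigma>0 > 0"
    and P: "bij_betw P {1..k} {Q \<in> normal_manifold S. z0 \<in> Q}"
    and Kc: "\<forall>i\<in>{1..k}. Kc i = cone hull ((\<lambda>p. p - z0) ` P i)"
    and A: "\<forall>i\<in>{1..k}. \<forall>y\<in>interior (P i). has_B_derivative (closest_point S) (\<lambda>h. A i *v h) y"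
    and Mx: "\<forall>i\<in>{1..k}. Mx i = L ** A i + mat 1 - A i"
    and Gamma: "\<Gamma> = (\<lambda>v. inv LK (Y0 v))"
    and Gammac: "\<forall>i\<in>{1..k}. \<Gamma>c i = (\<lambda>v. matrix_inv (Mx i) *v Y0 v)"
    and rc: "\<forall>i\<in>{1..k}. \<forall>j. rc i j = sd_coord (Mx i) \<Sigma>0 j"
    and r: "r = (\<lambda>n j w. sd_coord_map (B_deriv (normal_map (saa F \<xi>s n w) S) (z n w)) (\<Sigma> n w) j)"
  shows "(\<forall>\<alpha>\<in>{0<..<1}. \<forall>j.
            (\<lambda>n. Prob M (\<lambda>w. sqrt (real n) * \<bar>(z n w - z0) $ j\<bar> / r n j w
                             \<le> sqrt (chi_square_1_quantile \<alpha>)))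
              \<longlonglongrightarrow> (\<Sum>i=1..k. Prob N (\<lambda>v. \<bar>\<Gamma>c i v $ j / rc i j\<bar> \<le> sqrt (chi_square_1_quantile \<alpha>) \<and>
                                       \<Gamma>c i v \<in> Kc i))
            \<and> (\<Sum>i=1..k. Prob N (\<lambda>v. \<bar>\<Gamma>c i v $ j / rc i j\<bar> \<le> sqrt (chi_square_1_quantile \<alpha>) \<and>
                                      \<Gamma>c i v \<in> Kc i))
              = (\<Sum>i=1..k. Prob N (\<lambda>v. \<bar>\<Gamma> v $ j / rc i j\<bar> \<le> sqrt (chi_square_1_quantile \<alpha>) \<and>
                                      \<Gamma> v \<in> Kc i)))
       \<and> (\<forall>\<alpha>\<in>{0<..<1}. \<forall>j.
            (\<forall>i\<in>{1..k}.
               Prob N (\<lambda>v. \<bar>\<Gamma>c i v $ j / rc i j\<bar> \<le> sqrt (chi_square_1_quantile \<alpha>) \<and> \<Gamma>c i v \<in> Kc i)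
               = Prob N (\<lambda>v. \<bar>\<Gamma>c i v $ j / rc i j\<bar> \<le> sqrt (chi_square_1_quantile \<alpha>))
                 * Prob N (\<lambda>v. \<Gamma>c i v \<in> Kc i))
            \<longrightarrow> (\<lambda>n. Prob M (\<lambda>w. \<bar>(z n w - z0) $ j\<bar>
                                 \<le> sqrt (chi_square_1_quantile \<alpha>) * r n j w / sqrt (real n)))
                  \<longlonglongrightarrow> 1 - \<alpha>)"
proof -
  interpret M: prob_space M by fact
  interpret N: prob_space N by fact
  obtain C where C: "C \<in> borel_measurable M" "integrable M (\<lambda>w. (C w)\<^sup>2)"
    "AE w in M. \<forall>x\<in>Op. \<forall>x'\<in>Op. norm (F x (\<xi> w) - F x' (\<xi> w)) +
       norm (jacobian (\<lambda>u. F u (\<xi> w)) (at x) - jacobian (\<lambda>u. F u (\<xi> w)) (at x')) \<le> C w * norm (x - x')"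
    using c by blast
  have x0Op: "x0 \<in> Op" and x0S: "x0 \<in> S" using x0 by auto
  have \<xi>m[measurable]: "\<xi> \<in> borel_measurable M" by fact
  have \<xi>sm: "\<xi>s l \<in> borel_measurable M" if "1 \<le> l" for l
    using indep that unfolding M.indep_vars_def by auto
  interpret rf: random_field F Op \<Xi> by (rule random_field.intro[OF Op Xi F_meas])
  \<comment> \<open>The absolute value serves because \<open>regularI\<close> asks for a nonnegative
    constant, a sign that the hypothesis on \<open>C\<close> does not state.\<close>
  have regC: "AE w in M. rf.regular (\<xi> w) \<and> rf.lip_const (\<xi> w) \<le> \<bar>C w\<bar>"
    using supp b1 C(3)
  proof eventually_elim
    case (elim w)
    have "norm (F x (\<xi> w) - F x' (\<xi> w)) + norm (jacobian (\<lambda>u. F u (\<xi> w)) (at x) - jacobian (\<lambda>u. F u (\<xi> w)) (at x'))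
        \<le> \<bar>C w\<bar> * norm (x - x')" if "x \<in> Op" "x' \<in> Op" for x x'
    proof -
      have "C w * norm (x - x') \<le> \<bar>C w\<bar> * norm (x - x')" by (intro mult_right_mono) auto
      then show ?thesis using elim(3) that by (meson order_trans)
    qed
    from rf.regularI[OF elim(1,2) abs_ge_zero this] show ?case by blast
  qed
  then have reg: "AE w in M. rf.regular (\<xi> w)" by eventually_elim simp
  have cx2: "integrable M (\<lambda>w. (rf.lip_const (\<xi> w))\<^sup>2)"
  proof (rule Bochner_Integration.integrable_bound[OF C(2)])
    show "AE w in M. norm ((rf.lip_const (\<xi> w))\<^sup>2) \<le> norm ((C w)\<^sup>2)"
      using regC
    proof eventually_elim
      case (elim w)
      then have "\<bar>rf.lip_const (\<xi> w)\<bar> \<le> \<bar>C w\<bar>" using rf.lip_const_nonneg[of "\<xi> w"] by simp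
      then have "(rf.lip_const (\<xi> w))\<^sup>2 \<le> (C w)\<^sup>2" by (simp add: abs_le_square_iff)
      then show ?case by simp
    qed
  qed measurable
  have cx1: "integrable M (\<lambda>w. rf.lip_const (\<xi> w))"
    by (rule M.square_integrable_imp_integrable[OF _ cx2]) measurable
  \<comment> \<open>Regularity is rewritten as "no pair of points is irregular", a statement about a
    projection of a Borel set, and is then carried from \<open>\<xi>\<close> to each sample
    point.\<close>
  have regs: "AE w in M. \<forall>l\<ge>1. rf.regular (\<xi>s l w)"
  proof -
    have "AE w in M. rf.regular (\<xi>s l w)" if l: "1 \<le> l" for l
    proof -
      have "AE w in M. \<forall>q. (q, \<xi> w) \<notin> rf.irregular_pairs" using reg by eventually_elim (simp add: rf.regular_iff)
      from AE_all_transfer[OF M xi \<xi>sm[OF l] _ rf.irregular_pairs_borel this]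
      have "AE w in M. \<forall>q. (q, \<xi>s l w) \<notin> rf.irregular_pairs" using ident l by blast
      then show ?thesis by eventually_elim (simp add: rf.regular_iff)
    qed
    then have "AE w in M. 1 \<le> l \<longrightarrow> rf.regular (\<xi>s l w)" for l by (cases "1 \<le> l") auto
    then show ?thesis by (simp add: AE_all_countable)
  qed
  have vi: "vi_geometry S K x0 z0 (f0 x0) L LK k P Kc A Mx"
  proof (rule vi_geometry.intro)
    obtain v where v: "v \<in> normal_cone S x0" "0 = f0 x0 + v" using x0(2) unfolding solves_VI_def by blast
    then have "v = - f0 x0" by (simp add: eq_neg_iff_add_eq_0 add.commute)
    then show "- f0 x0 \<in> normal_cone S x0" using v(1) by simp
    show "LK h = L *v closest_point K h + h - closest_point K h" for h by (simp add: LK)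
    show "Kc i = cone hull ((\<lambda>p. p - z0) ` P i)" if "i \<in> {1..k}" for i using Kc that by blast
    show "has_B_derivative (closest_point S) ((*v) (A i)) y" if "i \<in> {1..k}" "y \<in> interior (P i)" for i y
      using A that by blast
    show "Mx i = L ** A i + mat 1 - A i" if "i \<in> {1..k}" for i using Mx that by blast
  qed (fact S x0S z0 K LK_homeo P)+
  interpret sg: saa_geometry S K x0 z0 "f0 x0" L LK k P Kc A Mx F Op \<Xi>
    by (rule saa_geometry.intro[OF vi rf.random_field_axioms]) (unfold_locales, fact x0Op)
  have Fint: "integrable M (\<lambda>w. F x0 (\<xi> w))" using f0_wd x0Op by blast
  have Feq: "AE w in M. F x0 (\<xi> w) = rf.Fx x0 (\<xi> w)"
    using reg by eventually_elim (use x0Op rf.regularD(1) in \<open>simp add: rf.Fx_def\<close>)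
  have Fxm[measurable]: "(\<lambda>w. rf.Fx x0 (\<xi> w)) \<in> borel_measurable M" by measurable
  have Fx1: "integrable M (\<lambda>w. rf.Fx x0 (\<xi> w))"
    using Fint Feq by (subst integrable_cong_AE[symmetric]) (auto intro: borel_measurable_integrable)
  have Fx_mean: "(\<integral>w. rf.Fx x0 (\<xi> w) \<partial>M) = f0 x0"
    unfolding f0 using Fint Feq by (intro integral_cong_AE) (auto intro: borel_measurable_integrable)
  have Fx2: "integrable M (\<lambda>w. (norm (rf.Fx x0 (\<xi> w)))\<^sup>2)"
  proof (rule integrableI_bounded)
    have "(\<integral>\<^sup>+ w. ennreal (norm ((norm (rf.Fx x0 (\<xi> w)))\<^sup>2)) \<partial>M) = (\<integral>\<^sup>+ w. ennreal ((norm (F x0 (\<xi> w)))\<^sup>2) \<partial>M)"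
      using Feq by (intro nn_integral_cong_AE) (auto elim!: eventually_mono)
    then show "(\<integral>\<^sup>+ w. ennreal (norm ((norm (rf.Fx x0 (\<xi> w)))\<^sup>2)) \<partial>M) < \<infinity>" using a x0Op by simp
  qed measurable
  have Fxi: "integrable M (\<lambda>w. rf.Fx x0 (\<xi> w) $ i)" for i
    by (rule integrable_bounded_linear[OF bounded_linear_vec_nth Fx1])
  have Fxi_mean: "(\<integral>w. rf.Fx x0 (\<xi> w) $ i \<partial>M) = f0 x0 $ i" for i
    unfolding integral_bounded_linear[OF bounded_linear_vec_nth Fx1] Fx_mean ..
  have Fxij: "integrable M (\<lambda>w. rf.Fx x0 (\<xi> w) $ i * rf.Fx x0 (\<xi> w) $ j)" for i j
  proof (rule Bochner_Integration.integrable_bound[OF Fx2])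
    show "AE w in M. norm (rf.Fx x0 (\<xi> w) $ i * rf.Fx x0 (\<xi> w) $ j) \<le> norm ((norm (rf.Fx x0 (\<xi> w)))\<^sup>2)"
      by (intro AE_I2) (simp add: abs_mult power2_eq_square mult_mono component_le_norm_cart)
  qed measurable
  define e where "e h = (\<integral>w. h (\<xi> w) \<partial>M)" for h :: "real^'d \<Rightarrow> real"
  define m where "m = f0 x0"
  \<comment> \<open>From here on \<open>X0\<close> is the centred summand of the limit theorem, no
    longer the neighbourhood of \<open>x0\<close>.\<close>
  define X0 where "X0 w = f0 x0 - rf.Fx x0 (\<xi> w)" for w
  have X0m[measurable]: "X0 \<in> borel_measurable M" unfolding X0_def by measurable
  have X0ij: "X0 w $ i * X0 w $ j = rf.Fx x0 (\<xi> w) $ i * rf.Fx x0 (\<xi> w) $ j - m $ i * rf.Fx x0 (\<xi> w) $ j - m $ j * rf.Fx x0 (\<xi> w) $ i + m $ i * m $ j" for w i j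
    by (simp add: X0_def m_def algebra_simps)
  have X0int: "integrable M (\<lambda>w. X0 w $ i * X0 w $ j)" for i j
    unfolding X0ij by (intro Bochner_Integration.integrable_add Bochner_Integration.integrable_diff Fxij integrable_mult_right Fxi M.integrable_const)
  have X0_e: "(\<integral>w. X0 w $ i * X0 w $ j \<partial>M) = e (\<lambda>y. rf.Fx x0 y $ i * rf.Fx x0 y $ j) - e (\<lambda>y. rf.Fx x0 y $ i) * e (\<lambda>y. rf.Fx x0 y $ j)" for i j
    unfolding X0ij e_def
    by (simp add: Fxij Fxi Fxi_mean m_def M.prob_space)
  have Sig: "\<Sigma>0 $ i $ j = (\<integral>w. X0 w $ i * X0 w $ j \<partial>M)" for i j
  proof -
    have \<mu>: "(\<integral>w. F x0 (\<xi> w) \<partial>M) = f0 x0" by (simp add: f0)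
    have "\<Sigma>0 $ i $ j = (\<integral>w. (F x0 (\<xi> w) $ i - f0 x0 $ i) * (F x0 (\<xi> w) $ j - f0 x0 $ j) \<partial>M)"
      unfolding Sigma0 covariance_matrix_def Let_def \<mu> by simp
    also have "\<dots> = (\<integral>w. X0 w $ i * X0 w $ j \<partial>M)"
    proof (rule integral_cong_AE)
      have [measurable]: "(\<lambda>w. F x0 (\<xi> w)) \<in> borel_measurable M" using Fint by simp
      show "(\<lambda>w. (F x0 (\<xi> w) $ i - f0 x0 $ i) * (F x0 (\<xi> w) $ j - f0 x0 $ j)) \<in> borel_measurable M" by measurable
      show "(\<lambda>w. X0 w $ i * X0 w $ j) \<in> borel_measurable M" by measurable
      show "AE w in M. (F x0 (\<xi> w) $ i - f0 x0 $ i) * (F x0 (\<xi> w) $ j - f0 x0 $ j) = X0 w $ i * X0 w $ j"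
        using Feq by eventually_elim (simp add: X0_def algebra_simps)
    qed
    finally show ?thesis .
  qed
  have Sig_e: "\<Sigma>0 = (\<chi> i j. e (\<lambda>y. rf.Fx x0 y $ i * rf.Fx x0 y $ j) - e (\<lambda>y. rf.Fx x0 y $ i) * e (\<lambda>y. rf.Fx x0 y $ j))"
    by (simp add: vec_eq_iff Sig X0_e)
  have bil: "(u \<bullet> X0 w) * (v \<bullet> X0 w) = (\<Sum>i\<in>UNIV. \<Sum>j\<in>UNIV. (u $ i * v $ j) * (X0 w $ i * X0 w $ j))" for u v w
    by (simp add: inner_vec_def sum_product mult_ac)
  have quad: "integrable M (\<lambda>w. (u \<bullet> X0 w) * (v \<bullet> X0 w))" "(\<integral>w. (u \<bullet> X0 w) * (v \<bullet> X0 w) \<partial>M) = u \<bullet> (\<Sigma>0 *v v)" for u v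
  proof -
    show "integrable M (\<lambda>w. (u \<bullet> X0 w) * (v \<bullet> X0 w))"
      unfolding bil by (intro Bochner_Integration.integrable_sum integrable_mult_right X0int)
    have "(\<integral>w. (u \<bullet> X0 w) * (v \<bullet> X0 w) \<partial>M) = (\<Sum>i\<in>UNIV. \<Sum>j\<in>UNIV. (u $ i * v $ j) * \<Sigma>0 $ i $ j)"
      unfolding bil Sig by (simp add: Bochner_Integration.integral_sum X0int)
    also have "\<dots> = u \<bullet> (\<Sigma>0 *v v)"
      by (simp add: inner_vec_def matrix_vector_mult_def sum_distrib_left mult_ac)
    finally show "(\<integral>w. (u \<bullet> X0 w) * (v \<bullet> X0 w) \<partial>M) = u \<bullet> (\<Sigma>0 *v v)" .
  qed
  \<comment> \<open>As a second-moment matrix \<open>\<Sigma>0\<close> is symmetric and positive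
    semidefinite; the positive determinant upgrades this to positive definiteness.\<close>
  have pd: "0 < u \<bullet> (\<Sigma>0 *v u)" if "u \<noteq> 0" for u
  proof (rule positive_definite_of_det[OF _ _ _ that])
    show "u \<bullet> (\<Sigma>0 *v v) = v \<bullet> (\<Sigma>0 *v u)" for u v unfolding quad(2)[symmetric] by (simp add: mult.commute)
    show "0 \<le> u \<bullet> (\<Sigma>0 *v u)" for u unfolding quad(2)[symmetric] by (intro integral_nonneg_AE AE_I2) simp
    show "det \<Sigma>0 \<noteq> 0" using det_pos by simp
  qed
  have Ym[measurable]: "Y0 \<in> borel_measurable N" using Y0 by (simp add: normal_random_vector_def)
  have distr_comp: "distr M borel (\<lambda>w. g (\<xi>s l w)) = distr M borel (\<lambda>w. g (\<xi> w))"
    if "1 \<le> l" and [measurable]: "g \<in> borel_measurable borel" for l and g :: "real^'d \<Rightarrow> 'z::topological_space"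
  proof -
    have [measurable]: "\<xi>s l \<in> borel_measurable M" by (rule \<xi>sm[OF that(1)])
    have "distr M borel (\<lambda>w. g (\<xi>s l w)) = distr (distr M borel (\<xi>s l)) borel g"
      by (subst distr_distr) (auto simp: o_def)
    also have "distr M borel (\<xi>s l) = distr M borel \<xi>" using ident that(1) by blast
    also have "distr (distr M borel \<xi>) borel g = distr M borel (\<lambda>w. g (\<xi> w))"
      by (subst distr_distr) (auto simp: o_def)
    finally show ?thesis .
  qed
  have Vm: "sg.scaled_error \<xi>s n \<in> borel_measurable M" for n
  proof -
    have "(\<lambda>w. (\<Sum>l=1..n. f0 x0 - rf.Fx x0 (\<xi>s l w)) /\<^sub>R sqrt (real n)) \<in> borel_measurable M"
      by (intro borel_measurable_scaleR borel_measurable_const borel_measurable_sum borel_measurable_diff rf.Fx_meas \<xi>sm) auto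
    then show ?thesis by (simp add: sg.scaled_error_def[abs_def])
  qed
  have X0lin: "(\<integral>w. u \<bullet> X0 w \<partial>M) = 0" for u
  proof -
    have "integrable M X0" unfolding X0_def[abs_def] by (intro Bochner_Integration.integrable_diff M.integrable_const Fx1)
    moreover have "(\<integral>w. X0 w \<partial>M) = 0"
      unfolding X0_def using Fx1 by (simp add: Fx_mean M.prob_space)
    ultimately show ?thesis by simp
  qed
  have W1: "(\<lambda>n. \<integral>w. \<psi> (u \<bullet> sg.scaled_error \<xi>s n w) \<partial>M) \<longlonglongrightarrow> (\<integral>v. \<psi> (u \<bullet> Y0 v) \<partial>N)"
    if \<psi>: "continuous_on UNIV \<psi>" "\<And>t. \<bar>\<psi> t\<bar> \<le> B" for u and \<psi> :: "real \<Rightarrow> real" and B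
    unfolding sg.scaled_error_def
  proof (rule multivariate_clt[OF M N _ _ X0m _ X0lin _ pd Y0 \<psi>])
    have gm: "(\<lambda>y. f0 x0 - rf.Fx x0 y) \<in> borel_measurable borel" by measurable
    show "M.indep_vars (\<lambda>_. borel) (\<lambda>l w. f0 x0 - rf.Fx x0 (\<xi>s l w)) {1..}"
      by (rule M.indep_vars_compose2[OF indep gm])
    show "distr M borel (\<lambda>w. f0 x0 - rf.Fx x0 (\<xi>s l w)) = distr M borel X0" if "1 \<le> l" for l
      unfolding X0_def[abs_def] by (rule distr_comp[OF that gm])
    show "integrable M (\<lambda>w. (u \<bullet> X0 w)\<^sup>2)" "(\<integral>w. (u \<bullet> X0 w)\<^sup>2 \<partial>M) = u \<bullet> (\<Sigma>0 *v u)" for u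
      using quad[of u u] by (simp_all add: power2_eq_square)
  qed
  have W: "(\<lambda>n. \<integral>w. \<phi> (sg.scaled_error \<xi>s n w) \<partial>M) \<longlonglongrightarrow> (\<integral>v. \<phi> (Y0 v) \<partial>N)"
    if "continuous_on UNIV \<phi>" "\<And>t. \<bar>\<phi> t\<bar> \<le> B" for \<phi> :: "real^'q \<Rightarrow> real" and B
    by (rule cramer_wold[OF M N Vm Ym W1 that])
  \<comment> \<open>Everything that the deterministic argument asks of a sample besides the
    normalised sum: moments of the Lipschitz constant, the mean Jacobian at \<open>x0\<close>, and
    the first and second moments of the field there.\<close>
  define H where "H = {rf.lip_const, \<lambda>y. (rf.lip_const y)\<^sup>2} \<union> (\<Union>i. \<Union>j. {\<lambda>y. rf.Jx x0 y $ i $ j}) \<union> (\<Union>i. {\<lambda>y. rf.Fx x0 y $ i})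
      \<union> (\<Union>i. \<Union>j. {\<lambda>y. rf.Fx x0 y $ i * rf.Fx x0 y $ j})"
  have H_mem: "rf.lip_const \<in> H" "(\<lambda>y. (rf.lip_const y)\<^sup>2) \<in> H" "\<And>i j. (\<lambda>y. rf.Jx x0 y $ i $ j) \<in> H" "\<And>i. (\<lambda>y. rf.Fx x0 y $ i) \<in> H"
      "\<And>i j. (\<lambda>y. rf.Fx x0 y $ i * rf.Fx x0 y $ j) \<in> H"
    unfolding H_def by blast+
  have H_fin: "finite H" unfolding H_def by simp
  have Jm: "(\<lambda>y. rf.Jx x0 y) \<in> borel_measurable borel" "(\<lambda>y. rf.Fx x0 y) \<in> borel_measurable borel" by measurable
  have H_borel: "h \<in> borel_measurable borel" if "h \<in> H" for h
    using that Jm unfolding H_def by (auto intro!: measurable_vec_nth)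
  have Jint: "integrable M (\<lambda>w. rf.Jx x0 (\<xi> w) $ i $ j)" for i j
  proof (rule Bochner_Integration.integrable_bound[OF cx1])
    show "AE w in M. norm (rf.Jx x0 (\<xi> w) $ i $ j) \<le> norm (rf.lip_const (\<xi> w))"
      using reg by eventually_elim (use rf.Jx_entry_bound[OF _ x0Op] rf.lip_const_nonneg in \<open>simp add: abs_of_nonneg\<close>)
  qed measurable
  have H_int: "integrable M (\<lambda>w. h (\<xi> w))" if "h \<in> H" for h
    using that cx1 cx2 Jint Fxi Fxij unfolding H_def by blast
  have wlln: "(\<lambda>n. measure M {w \<in> space M. \<epsilon> \<le> \<bar>(\<Sum>l=1..n. h (\<xi>s l w)) / real n - e h\<bar>}) \<longlonglongrightarrow> 0"
    if h: "h \<in> H" and \<epsilon>: "0 < \<epsilon>" for h \<epsilon>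
    unfolding e_def
  proof (rule M.weak_law_large_numbers[OF _ _ _ H_int[OF h] \<epsilon>])
    show "M.indep_vars (\<lambda>_. borel) (\<lambda>l w. h (\<xi>s l w)) {1..}"
      by (rule M.indep_vars_compose2[OF indep H_borel[OF h]])
    show "distr M borel (\<lambda>w. h (\<xi>s l w)) = distr M borel (\<lambda>w. h (\<xi> w))" if "1 \<le> l" for l
      by (rule distr_comp[OF that H_borel[OF h]])
    show "(\<lambda>w. h (\<xi> w)) \<in> borel_measurable M" using H_int[OF h] by simp
  qed
  have eL: "e (\<lambda>y. rf.Jx x0 y $ i $ j) = L $ i $ j" for i j
    unfolding e_def L f0 by (rule rf.jacobian_mean[OF \<xi>m reg cx1 x0Op, symmetric]) (use f0_wd in blast)
  have good: "AE w in M. \<forall>\<^sub>F n in sequentially. sg.good_sample \<xi>s z Z n w"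
    using sol regs
  proof eventually_elim
    case (elim w)
    then obtain n0 where n0: "\<And>n y. n0 \<le> n \<Longrightarrow> y \<in> Z \<and> closest_point S y \<in> Op \<and> normal_map (saa F \<xi>s n w) S y = 0 \<longleftrightarrow> y = z n w"
      by blast
    have "sg.good_sample \<xi>s z Z n w" if "n0 \<le> n" for n
      unfolding sg.good_sample_def using n0[OF that] elim(2) by auto
    then show ?case unfolding eventually_sequentially by blast
  qed
  have width: "r n j w = sg.width \<xi>s z j n w" for n j w
    unfolding r Sigma x sg.width_def ..
  \<comment> \<open>Measurable versions of the widths, so that the events in the theorem are
    measurable up to null sets.\<close>
  have "\<forall>n j. \<exists>r'. 1 \<le> n \<longrightarrow> r' \<in> borel_measurable M \<and> (AE w in M. r n j w = r' w)"
  proof (intro allI)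
    fix n j
    show "\<exists>r'. 1 \<le> n \<longrightarrow> r' \<in> borel_measurable M \<and> (AE w in M. r n j w = r' w)"
    proof (cases "1 \<le> n")
      case True
      have zn: "z n \<in> borel_measurable M" using z_meas True by blast
      have \<xi>sn: "\<And>l. l \<in> {1..n} \<Longrightarrow> \<xi>s l \<in> borel_measurable M" using \<xi>sm by auto
      have "\<exists>r'. r' \<in> borel_measurable M \<and> (\<forall>w. closest_point S (z n w) \<in> Op \<longrightarrow> (\<forall>l\<in>{1..n}. rf.regular (\<xi>s l w)) \<longrightarrow>
          sd_coord_map (B_deriv (normal_map (saa F \<xi>s n w) S) (z n w)) (sample_covariance n (\<lambda>l. F (closest_point S (z n w)) (\<xi>s l w))) j = r' w)"
        by (rule rf.sd_saa_measurable[OF S sg.S_facts(1) zn]) (rule \<xi>sn)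
      then obtain r' where r': "r' \<in> borel_measurable M" "\<And>w. closest_point S (z n w) \<in> Op \<Longrightarrow> (\<forall>l\<in>{1..n}. rf.regular (\<xi>s l w)) \<Longrightarrow>
          sd_coord_map (B_deriv (normal_map (saa F \<xi>s n w) S) (z n w)) (sample_covariance n (\<lambda>l. F (closest_point S (z n w)) (\<xi>s l w))) j = r' w"
        by metis
      have "AE w in M. r n j w = r' w"
        using regs AE_space
      proof eventually_elim
        case (elim w)
        then show ?case unfolding width sg.width_def using z_dom True by (intro r'(2)) auto
      qed
      then show ?thesis using r'(1) by blast
    qed simp
  qed
  then obtain r' where r': "\<And>n j. 1 \<le> n \<Longrightarrow> r' n j \<in> borel_measurable M" "\<And>n j. 1 \<le> n \<Longrightarrow> AE w in M. r n j w = r' n j w"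
    by metis
  have rcpos: "0 < rc i j" if "i \<in> {1..k}" for i j
    using sd_coord_pos(2)[OF sg.Mx_det[OF that] pd] rc that by simp
  \<comment> \<open>Stated for any events that reduce to the product form when the width is
    positive. The two events of the theorem may disagree at width 0, where the quotient is 0 by
    convention, but both are instances.\<close>
  have limit: "(\<lambda>n. Prob M (E n)) \<longlonglongrightarrow> (\<Sum>i=1..k. measure N {v\<in>space N. \<bar>sg.G (Y0 v) $ j\<bar> \<le> cc * rc i j \<and> sg.G (Y0 v) \<in> Kc i})"
    if E': "\<And>n. 1 \<le> n \<Longrightarrow> E' n \<in> sets M" "\<And>n. 1 \<le> n \<Longrightarrow> AE w in M. E n w \<longleftrightarrow> w \<in> E' n"
      and E: "\<And>n w. 1 \<le> n \<Longrightarrow> 0 < r n j w \<Longrightarrow> E n w \<longleftrightarrow> sqrt (real n) * \<bar>(z n w - z0) $ j\<bar> \<le> cc * r n j w"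
    for E E' j cc
  proof -
    have rcj: "rc i j = sd_coord (Mx i) \<Sigma>0 j" if "i \<in> {1..k}" for i using rc that by blast
    have "(\<lambda>n. Prob M (E n)) \<longlonglongrightarrow> measure N {v\<in>space N. Y0 v \<in> sg.limit_event j cc (\<lambda>i. rc i j)}"
      by (rule sg.Prob_tendsto_limit_event[OF M N Z \<xi>sm good H_fin H_borel H_mem wlln eL Sig_e pd rcj Ym
            sg.null_exceptional(2)[OF N Y0 pd] W E' E[unfolded width]])
    also have "measure N {v\<in>space N. Y0 v \<in> sg.limit_event j cc (\<lambda>i. rc i j)} =
        (\<Sum>i=1..k. measure N {v\<in>space N. \<bar>sg.G (Y0 v) $ j\<bar> \<le> cc * rc i j \<and> sg.G (Y0 v) \<in> Kc i})"
      by (rule sg.measure_limit_event(1)[OF N Ym sg.null_exceptional(1)[OF N Y0 pd]])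
    finally show ?thesis .
  qed
  have GY[measurable]: "(\<lambda>v. sg.G (Y0 v)) \<in> borel_measurable N"
    using measurable_compose[OF Ym borel_measurable_continuous_onI[OF sg.G_facts(3)]] .
  have Kc_meas: "Kc i \<in> sets borel" if "i \<in> {1..k}" for i using sg.Kc_closed[OF that] by simp
  have ev_c: "Prob N (\<lambda>v. \<bar>\<Gamma>c i v $ j / rc i j\<bar> \<le> cc \<and> \<Gamma>c i v \<in> Kc i)
      = measure N {v\<in>space N. \<bar>sg.G (Y0 v) $ j\<bar> \<le> cc * rc i j \<and> sg.G (Y0 v) \<in> Kc i}"
    and ev_G: "Prob N (\<lambda>v. \<bar>\<Gamma> v $ j / rc i j\<bar> \<le> cc \<and> \<Gamma> v \<in> Kc i)
      = measure N {v\<in>space N. \<bar>sg.G (Y0 v) $ j\<bar> \<le> cc * rc i j \<and> sg.G (Y0 v) \<in> Kc i}"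
    and ev_K: "Prob N (\<lambda>v. \<Gamma>c i v \<in> Kc i) = measure N {v\<in>space N. sg.G (Y0 v) \<in> Kc i}"
    if i: "i \<in> {1..k}" for i j cc
  proof -
    have [measurable]: "Kc i \<in> sets borel" by (rule Kc_meas[OF i])
    have gc: "\<Gamma>c i = (\<lambda>v. matrix_inv (Mx i) *v Y0 v)" using Gammac i by blast
    have "Measurable.pred N (\<lambda>v. \<bar>sg.G (Y0 v) $ j\<bar> \<le> cc * rc i j \<and> sg.G (Y0 v) \<in> Kc i)" by measurable
    then show "Prob N (\<lambda>v. \<bar>\<Gamma>c i v $ j / rc i j\<bar> \<le> cc \<and> \<Gamma>c i v \<in> Kc i)
      = measure N {v\<in>space N. \<bar>sg.G (Y0 v) $ j\<bar> \<le> cc * rc i j \<and> sg.G (Y0 v) \<in> Kc i}"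
      "Prob N (\<lambda>v. \<bar>\<Gamma> v $ j / rc i j\<bar> \<le> cc \<and> \<Gamma> v \<in> Kc i)
      = measure N {v\<in>space N. \<bar>sg.G (Y0 v) $ j\<bar> \<le> cc * rc i j \<and> sg.G (Y0 v) \<in> Kc i}"
      unfolding gc Gamma sg.cell_event_iff[OF i rcpos[OF i]] by (rule Prob_eq_measure[OF N])+
    have "Measurable.pred N (\<lambda>v. sg.G (Y0 v) \<in> Kc i)" by measurable
    then show "Prob N (\<lambda>v. \<Gamma>c i v \<in> Kc i) = measure N {v\<in>space N. sg.G (Y0 v) \<in> Kc i}"
      unfolding gc sg.G_Kc_iff[OF i, symmetric] by (rule Prob_eq_measure[OF N])
  qed
  have coord_meas: "(\<lambda>w. \<bar>(z n w - z0) $ j\<bar>) \<in> borel_measurable M" if "1 \<le> n" for n j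
  proof -
    have [measurable]: "z n \<in> borel_measurable M" using z_meas that by blast
    show ?thesis by measurable
  qed
  show ?thesis
  proof (intro conjI ballI allI impI)
    fix \<alpha> :: real and j :: 'q assume \<alpha>: "\<alpha> \<in> {0<..<1}"
    let ?c = "sqrt (chi_square_1_quantile \<alpha>)"
    have "(\<lambda>n. Prob M (\<lambda>w. sqrt (real n) * \<bar>(z n w - z0) $ j\<bar> / r n j w \<le> ?c)) \<longlonglongrightarrow>
        (\<Sum>i=1..k. measure N {v\<in>space N. \<bar>sg.G (Y0 v) $ j\<bar> \<le> ?c * rc i j \<and> sg.G (Y0 v) \<in> Kc i})"
    proof (rule limit)
      fix n :: nat assume n: "1 \<le> n"
      have [measurable]: "r' n j \<in> borel_measurable M" "(\<lambda>w. \<bar>(z n w - z0) $ j\<bar>) \<in> borel_measurable M"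
        by (rule r'(1)[OF n], rule coord_meas[OF n])
      show "{w\<in>space M. sqrt (real n) * \<bar>(z n w - z0) $ j\<bar> / r' n j w \<le> ?c} \<in> sets M" by measurable
      show "AE w in M. (sqrt (real n) * \<bar>(z n w - z0) $ j\<bar> / r n j w \<le> ?c) = (w \<in> {w\<in>space M. sqrt (real n) * \<bar>(z n w - z0) $ j\<bar> / r' n j w \<le> ?c})"
        using r'(2)[OF n, of j] AE_space by eventually_elim simp
      show "sqrt (real n) * \<bar>(z n w - z0) $ j\<bar> / r n j w \<le> ?c \<longleftrightarrow> sqrt (real n) * \<bar>(z n w - z0) $ j\<bar> \<le> ?c * r n j w"
        if "0 < r n j w" for w using that by (rule pos_divide_le_eq)
    qed
    moreover have "(\<Sum>i=1..k. Prob N (\<lambda>v. \<bar>\<Gamma>c i v $ j / rc i j\<bar> \<le> ?c \<and> \<Gamma>c i v \<in> Kc i))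
        = (\<Sum>i=1..k. measure N {v\<in>space N. \<bar>sg.G (Y0 v) $ j\<bar> \<le> ?c * rc i j \<and> sg.G (Y0 v) \<in> Kc i})"
      by (rule sum.cong[OF refl ev_c])
    ultimately show "(\<lambda>n. Prob M (\<lambda>w. sqrt (real n) * \<bar>(z n w - z0) $ j\<bar> / r n j w \<le> ?c)) \<longlonglongrightarrow>
        (\<Sum>i=1..k. Prob N (\<lambda>v. \<bar>\<Gamma>c i v $ j / rc i j\<bar> \<le> ?c \<and> \<Gamma>c i v \<in> Kc i))" by simp
    show "(\<Sum>i=1..k. Prob N (\<lambda>v. \<bar>\<Gamma>c i v $ j / rc i j\<bar> \<le> ?c \<and> \<Gamma>c i v \<in> Kc i))
        = (\<Sum>i=1..k. Prob N (\<lambda>v. \<bar>\<Gamma> v $ j / rc i j\<bar> \<le> ?c \<and> \<Gamma> v \<in> Kc i))"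
      by (rule sum.cong[OF refl]) (simp only: ev_c ev_G)
  next
    fix \<alpha> :: real and j :: 'q assume \<alpha>: "\<alpha> \<in> {0<..<1}"
    let ?c = "sqrt (chi_square_1_quantile \<alpha>)"
    assume ind: "\<forall>i\<in>{1..k}. Prob N (\<lambda>v. \<bar>\<Gamma>c i v $ j / rc i j\<bar> \<le> ?c \<and> \<Gamma>c i v \<in> Kc i)
        = Prob N (\<lambda>v. \<bar>\<Gamma>c i v $ j / rc i j\<bar> \<le> ?c) * Prob N (\<lambda>v. \<Gamma>c i v \<in> Kc i)"
    have "(\<lambda>n. Prob M (\<lambda>w. \<bar>(z n w - z0) $ j\<bar> \<le> ?c * r n j w / sqrt (real n))) \<longlonglongrightarrow>
        (\<Sum>i=1..k. measure N {v\<in>space N. \<bar>sg.G (Y0 v) $ j\<bar> \<le> ?c * rc i j \<and> sg.G (Y0 v) \<in> Kc i})"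
    proof (rule limit)
      fix n :: nat assume n: "1 \<le> n"
      have [measurable]: "r' n j \<in> borel_measurable M" "(\<lambda>w. \<bar>(z n w - z0) $ j\<bar>) \<in> borel_measurable M"
        by (rule r'(1)[OF n], rule coord_meas[OF n])
      show "{w\<in>space M. \<bar>(z n w - z0) $ j\<bar> \<le> ?c * r' n j w / sqrt (real n)} \<in> sets M" by measurable
      show "AE w in M. (\<bar>(z n w - z0) $ j\<bar> \<le> ?c * r n j w / sqrt (real n)) = (w \<in> {w\<in>space M. \<bar>(z n w - z0) $ j\<bar> \<le> ?c * r' n j w / sqrt (real n)})"
        using r'(2)[OF n, of j] AE_space by eventually_elim simp
      have "0 < sqrt (real n)" using n by simp
      then show "\<bar>(z n w - z0) $ j\<bar> \<le> ?c * r n j w / sqrt (real n) \<longleftrightarrow> sqrt (real n) * \<bar>(z n w - z0) $ j\<bar> \<le> ?c * r n j w" for w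
        by (simp add: pos_le_divide_eq mult.commute)
    qed
    \<comment> \<open>The jth coordinate of \<open>\<Gamma>c i\<close> is centred normal with
      standard deviation \<open>rc i j\<close>, so its standardised absolute value stays below the
      quantile with probability 1 - \<alpha>, the same for every i; the assumed independence pulls
      out this factor.\<close>
    moreover have "(\<Sum>i=1..k. measure N {v\<in>space N. \<bar>sg.G (Y0 v) $ j\<bar> \<le> ?c * rc i j \<and> sg.G (Y0 v) \<in> Kc i})
        = (\<Sum>i=1..k. (1 - \<alpha>) * measure N {v\<in>space N. sg.G (Y0 v) \<in> Kc i})"
    proof (rule sum.cong[OF refl])
      fix i assume i: "i \<in> {1..k}"
      let ?a = "matrix_inv (Mx i) $ j"
      have a0: "0 < ?a \<bullet> (\<Sigma>0 *v ?a)" by (rule pd[OF sd_coord_pos(1)[OF sg.Mx_det[OF i] pd]])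
      have gc: "\<Gamma>c i v $ j / rc i j = (?a \<bullet> Y0 v) / sqrt (?a \<bullet> (\<Sigma>0 *v ?a))" for v
        using Gammac rc i by (simp add: matrix_vector_mult_inner sd_coord_inner)
      have "Measurable.pred N (\<lambda>v. \<bar>(?a \<bullet> Y0 v) / sqrt (?a \<bullet> (\<Sigma>0 *v ?a))\<bar> \<le> ?c)" by measurable
      from Prob_eq_measure[OF N this] have "Prob N (\<lambda>v. \<bar>\<Gamma>c i v $ j / rc i j\<bar> \<le> ?c) = 1 - \<alpha>"
        unfolding gc normal_random_vector_abs_le[OF N Y0 a0 \<alpha>] .
      then show "measure N {v\<in>space N. \<bar>sg.G (Y0 v) $ j\<bar> \<le> ?c * rc i j \<and> sg.G (Y0 v) \<in> Kc i}
          = (1 - \<alpha>) * measure N {v\<in>space N. sg.G (Y0 v) \<in> Kc i}"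
        using bspec[OF ind i] unfolding ev_c[OF i] ev_K[OF i] by simp
    qed
    \<comment> \<open>Almost surely exactly one cone contains the limit, so the cone probabilities
      add up to 1.\<close>
    moreover have "(\<Sum>i=1..k. (1 - \<alpha>) * measure N {v\<in>space N. sg.G (Y0 v) \<in> Kc i}) = 1 - \<alpha>"
    proof -
      have "(\<Sum>i=1..k. measure N {v\<in>space N. sg.G (Y0 v) \<in> Kc i}) = 1"
        by (rule sg.measure_limit_event(2)[OF N Ym sg.null_exceptional(1)[OF N Y0 pd]])
      then show ?thesis unfolding sum_distrib_left[symmetric] by (simp only: mult_1_right)
    qed
    ultimately show "(\<lambda>n. Prob M (\<lambda>w. \<bar>(z n w - z0) $ j\<bar> \<le> ?c * r n j w / sqrt (real n))) \<longlonglongrightarrow> 1 - \<alpha>"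
      by simp
  qed
qed

end
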